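(* In the setting described in the context, suppose $\bar u\in\mathcal U$ is a strict global minimizer of $\mathcal J$ over $\mathcal U$ (i.e. $\mathcal J(\bar u)<\mathcal J(u)$ for all $u\in\mathcal U\setminus\{\bar u\}$). Then the following are equivalent: (i) there exist $\delta>0$, $c>0$ such that $\mathcal J'(\bar u)v+\frac12\mathcal J''(\bar u)v^2\ge c\|z_v\|_{L^2(\Omega)}^2$ for all $v\in\mathcal U-\bar u$ with $\|z_v\|_{L^2(\Omega)}\le\delta$; (ii) there exists $\kappa>0$ such that for every $\eta\in L^2(\Omega)$ and every minimizer $u_\eta\in\mathcal U$ of the problem $(\mathcal P_\eta)$: $\min_{u\in\mathcal U}\frac12\int_\Omega|y_u-(y_d+\eta)|^2dx$, one has $\|y_{u_\eta}-y_{\bar u}\|_{L^2(\Omega)}\le\kappa\|\eta\|_{L^2(\Omega)}$.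
   Context: Let $d\in\{2,3\}$, $\Omega\subset\mathbb R^d$ a bounded Lipschitz domain, $\alpha<\beta$ reals, and $\mathcal U:=\{u\in L^1(\Omega): u(x)\in[\alpha,\beta]\text{ a.e.}\}$. For $u\in\mathcal U$, $y_u\in H^1_0(\Omega)\cap C(\bar\Omega)$ is the unique weak solution of $-\Delta y+y^3=u$ in $\Omega$, $y=0$ on $\partial\Omega$. Given $y_d\in L^2(\Omega)$, $\mathcal J(u):=\frac12\int_\Omega|y_u-y_d|^2dx$. The adjoint state $p_u\in H^1_0(\Omega)\cap C(\bar\Omega)$ is the weak solution of $-\Delta p+3y_u^2p=y_u-y_d$, $p=0$ on $\partial\Omega$, and $\mathcal J'(\bar u)v=\int_\Omega p_{\bar u}v\,dx$. For $v\in L^2(\Omega)$, $z_v\in H^1_0(\Omega)\cap C(\bar\Omega)$ is the weak solution of $-\Delta z+3y_{\bar u}^2z=v$, $z=0$ on $\partial\Omega$, and $\mathcal J''(\bar u)v^2=\int_\Omega(1-6y_{\bar u}p_{\bar u})z_v^2\,dx$. *)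

theory Defs
  imports "HOL-Analysis.Analysis"
begin

text \<open>Bounded Lipschitz domain: bounded, open, connected, and near every boundary point
  the set is (in suitable rotated coordinates with last axis e) the region strictly below
  the graph of a Lipschitz function defined on the hyperplane orthogonal to e.\<close>
definition lipschitz_domain :: "'a::euclidean_space set \<Rightarrow> bool" where
  "lipschitz_domain \<Omega> \<longleftrightarrow> bounded \<Omega> \<and> open \<Omega> \<and> connected \<Omega> \<and> \<Omega> \<noteq> {} \<and>
     (\<forall>x\<in>frontier \<Omega>. \<exists>r>0. \<exists>e::'a. \<exists>\<gamma>::'a \<Rightarrow> real. \<exists>L.
        norm e = 1 \<and> L-lipschitz_on {q. q \<bullet> e = 0} \<gamma> \<and>
        \<Omega> \<inter> ball x r = {p \<in> ball x r. p \<bullet> e < \<gamma> (p - (p \<bullet> e) *\<^sub>R e)})"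

definition pd :: "('a::euclidean_space \<Rightarrow> real) \<Rightarrow> 'a \<Rightarrow> 'a \<Rightarrow> real" where
  "pd f b x = frechet_derivative f (at x) b"

coinductive smooth :: "('a::euclidean_space \<Rightarrow> real) \<Rightarrow> bool" where
  "f differentiable_on UNIV \<Longrightarrow> (\<forall>b\<in>Basis. smooth (pd f b)) \<Longrightarrow> smooth f"

definition test_fun :: "'a::euclidean_space set \<Rightarrow> ('a \<Rightarrow> real) \<Rightarrow> bool" where
  "test_fun \<Omega> \<phi> \<longleftrightarrow> smooth \<phi> \<and> compact (closure {x. \<phi> x \<noteq> 0}) \<and> closure {x. \<phi> x \<noteq> 0} \<subseteq> \<Omega>"

definition weak_grad :: "'a::euclidean_space set \<Rightarrow> ('a \<Rightarrow> real) \<Rightarrow> ('a \<Rightarrow> 'a) \<Rightarrow> bool" where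
  "weak_grad \<Omega> y G \<longleftrightarrow> (\<forall>\<phi>. test_fun \<Omega> \<phi> \<longrightarrow> (\<forall>b\<in>Basis.
      (LINT x:\<Omega>|lebesgue. y x * pd \<phi> b x) = - (LINT x:\<Omega>|lebesgue. (G x \<bullet> b) * \<phi> x)))"

definition L2fun :: "'a::euclidean_space set \<Rightarrow> ('a \<Rightarrow> real) \<Rightarrow> bool" where
  "L2fun \<Omega> f \<longleftrightarrow> f \<in> borel_measurable lebesgue \<and> set_integrable lebesgue \<Omega> (\<lambda>x. (f x)\<^sup>2)"

definition L2norm :: "'a::euclidean_space set \<Rightarrow> ('a \<Rightarrow> real) \<Rightarrow> real" where
  "L2norm \<Omega> f = sqrt (LINT x:\<Omega>|lebesgue. (f x)\<^sup>2)"

definition Uad :: "'a::euclidean_space set \<Rightarrow> real \<Rightarrow> real \<Rightarrow> ('a \<Rightarrow> real) set" where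
  "Uad \<Omega> \<alpha> \<beta> = {u. u \<in> borel_measurable lebesgue \<and> set_integrable lebesgue \<Omega> u \<and>
                     (AE x in lebesgue. x \<in> \<Omega> \<longrightarrow> u x \<in> {\<alpha>..\<beta>})}"

text \<open>y in H^1_0 \<inter> C(closure Omega), represented by its extension by zero outside Omega
  (hence continuous on the whole space), with weak gradient G in L2, satisfying the weak
  formulation against all test functions.\<close>
definition weak_dirichlet ::
  "'a::euclidean_space set \<Rightarrow> ('a \<Rightarrow> real \<Rightarrow> real) \<Rightarrow> ('a \<Rightarrow> real) \<Rightarrow> ('a \<Rightarrow> real) \<Rightarrow> bool" where
  "weak_dirichlet \<Omega> N f y \<longleftrightarrow> continuous_on UNIV y \<and> (\<forall>x. x \<notin> \<Omega> \<longrightarrow> y x = 0) \<and>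
     (\<exists>G. G \<in> borel_measurable lebesgue \<and> set_integrable lebesgue \<Omega> (\<lambda>x. (norm (G x))\<^sup>2) \<and>
          weak_grad \<Omega> y G \<and>
          (\<forall>\<phi>. test_fun \<Omega> \<phi> \<longrightarrow>
             (LINT x:\<Omega>|lebesgue. (\<Sum>b\<in>Basis. (G x \<bullet> b) * pd \<phi> b x) + N x (y x) * \<phi> x)
             = (LINT x:\<Omega>|lebesgue. f x * \<phi> x)))"

definition sol :: "'a::euclidean_space set \<Rightarrow> ('a \<Rightarrow> real \<Rightarrow> real) \<Rightarrow> ('a \<Rightarrow> real) \<Rightarrow> 'a \<Rightarrow> real" where
  "sol \<Omega> N f = (THE y. weak_dirichlet \<Omega> N f y)"

definition state :: "'a::euclidean_space set \<Rightarrow> ('a \<Rightarrow> real) \<Rightarrow> 'a \<Rightarrow> real" where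
  "state \<Omega> u = sol \<Omega> (\<lambda>x t. t ^ 3) u"

definition adjoint :: "'a::euclidean_space set \<Rightarrow> ('a \<Rightarrow> real) \<Rightarrow> ('a \<Rightarrow> real) \<Rightarrow> 'a \<Rightarrow> real" where
  "adjoint \<Omega> yd u = sol \<Omega> (\<lambda>x t. 3 * (state \<Omega> u x)\<^sup>2 * t) (\<lambda>x. state \<Omega> u x - yd x)"

definition lin_state :: "'a::euclidean_space set \<Rightarrow> ('a \<Rightarrow> real) \<Rightarrow> ('a \<Rightarrow> real) \<Rightarrow> 'a \<Rightarrow> real" where
  "lin_state \<Omega> ubar v = sol \<Omega> (\<lambda>x t. 3 * (state \<Omega> ubar x)\<^sup>2 * t) v"

definition Jfun :: "'a::euclidean_space set \<Rightarrow> ('a \<Rightarrow> real) \<Rightarrow> ('a \<Rightarrow> real) \<Rightarrow> real" where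
  "Jfun \<Omega> yd u = 1/2 * (LINT x:\<Omega>|lebesgue. (state \<Omega> u x - yd x)\<^sup>2)"

definition J1 :: "'a::euclidean_space set \<Rightarrow> ('a \<Rightarrow> real) \<Rightarrow> ('a \<Rightarrow> real) \<Rightarrow> ('a \<Rightarrow> real) \<Rightarrow> real" where
  "J1 \<Omega> yd ubar v = (LINT x:\<Omega>|lebesgue. adjoint \<Omega> yd ubar x * v x)"

definition J2 :: "'a::euclidean_space set \<Rightarrow> ('a \<Rightarrow> real) \<Rightarrow> ('a \<Rightarrow> real) \<Rightarrow> ('a \<Rightarrow> real) \<Rightarrow> real" where
  "J2 \<Omega> yd ubar v = (LINT x:\<Omega>|lebesgue.
       (1 - 6 * state \<Omega> ubar x * adjoint \<Omega> yd ubar x) * (lin_state \<Omega> ubar v x)\<^sup>2)"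

end

theory Submission
  imports Defs "HOL-Probability.Distributions" "HOL-Complex_Analysis.Great_Picard"
begin

text \<open>Both conditions are equivalent to quadratic growth of the objective in the state,
  \<open>J(u) - J(ubar) \<ge> c \<parallel>y\<^sub>u - y\<^sub>b\<parallel>\<^sup>2\<close> for all admissible \<open>u\<close>. Growth gives stability by comparing a perturbed
  minimiser with \<open>ubar\<close>; conversely the perturbation \<open>(y\<^sub>u - y\<^sub>b) / (2 \<kappa>)\<close> has a minimiser, and stability
  applied to it gives growth. A Taylor expansion whose remainder is \<open>o(1) \<parallel>y\<^sub>u - y\<^sub>b\<parallel>\<^sup>2\<close> as
  \<open>y\<^sub>u \<rightarrow> y\<^sub>b\<close> uniformly identifies the second-order condition with growth near \<open>ubar\<close>; away from \<open>ubar\<close>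
  growth follows from strict minimality and the compactness of the set of states.

  The equations are solved in \<open>C\<^sub>0(\<Omega>)\<close> without Sobolev spaces: solutions are limits of whole-space
  problems with a penalty outside \<open>\<Omega>\<close>, built from the resolvent kernel, and the boundary values are
  controlled by barriers in the exterior balls of the Lipschitz domain. Below dimension four the kernel is
  square integrable, so that the sup norm of a state is bounded by the L2 norm of its source. The weak
  gradient is recovered from an energy estimate and the Riesz representation theorem.\<close>

section \<open>Smooth functions and the maximum principle\<close>

abbreviation cont :: "('a::topological_space \<Rightarrow> 'b::topological_space) \<Rightarrow> bool" where
  "cont f \<equiv> continuous_on UNIV f"

(* the unqualified names denote the Henstock--Kurzweil versions *)
lemmas bochner_integral_sum = Bochner_Integration.integral_sum
  and bochner_integrable_sum = Bochner_Integration.integrable_sum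
  and bochner_integrable_bound = Bochner_Integration.integrable_bound
  and bochner_integral_cong = Bochner_Integration.integral_cong
  and bochner_integrable_add = Bochner_Integration.integrable_add
  and bochner_integrable_diff = Bochner_Integration.integrable_diff
  and bochner_integral_diff = Bochner_Integration.integral_diff

definition lap :: "('a::euclidean_space \<Rightarrow> real) \<Rightarrow> 'a \<Rightarrow> real" where
  "lap f x = (\<Sum>b\<in>Basis. pd (pd f b) b x)"

definition flat_exp :: "nat \<Rightarrow> real \<Rightarrow> real" where
  "flat_exp m t = (if t > 0 then exp (- 1 / t) / t ^ m else 0)"

lemma flat_exp_tendsto_0: "(flat_exp m \<longlongrightarrow> 0) (at 0)"
proof (rule filterlim_split_at)
  show "(flat_exp m \<longlongrightarrow> 0) (at_left 0)"
    by (rule tendsto_eventually, unfold eventually_at_filter) (auto simp: flat_exp_def)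
  have "((\<lambda>h::real. inverse h ^ m / exp (inverse h)) \<longlongrightarrow> 0) (at_right 0)"
    using filterlim_compose[OF tendsto_power_div_exp_0 filterlim_inverse_at_top_right] .
  then show "(flat_exp m \<longlongrightarrow> 0) (at_right 0)"
    by (rule Lim_transform_eventually, unfold eventually_at_filter)
      (auto simp: flat_exp_def exp_minus field_simps)
qed

lemma DERIV_flat_exp:
  "(flat_exp m has_real_derivative (flat_exp (m + 2) t - real m * flat_exp (m + 1) t)) (at t)"
  (is "(_ has_real_derivative ?D) _")
proof -
  consider "t > 0" | "t < 0" | "t = 0" by linarith
  then show ?thesis
  proof cases
    assume t: "t > 0"
    have "((\<lambda>t. exp (- 1 / t) / t ^ m) has_real_derivative ?D) (at t)"
      using t by (auto intro!: derivative_eq_intros simp: flat_exp_def field_simps power2_eq_square)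
        (cases m; simp add: field_simps)
    then show ?thesis
      by (rule has_field_derivative_transform_within_open[OF _ open_greaterThan])
        (use t in \<open>auto simp: flat_exp_def\<close>)
  next
    assume t: "t < 0"
    then have "((\<lambda>t. 0) has_real_derivative ?D) (at t)" by (simp add: flat_exp_def)
    then show ?thesis
      by (rule has_field_derivative_transform_within_open[OF _ open_lessThan])
        (use t in \<open>auto simp: flat_exp_def\<close>)
  next
    assume t: "t = 0"
    have "((\<lambda>h. flat_exp m h / h) \<longlongrightarrow> 0) (at 0)"
      by (rule Lim_transform_eventually[OF flat_exp_tendsto_0[of "m+1"]])
        (auto simp: flat_exp_def eventually_at_filter field_simps)
    then show ?thesis by (simp add: DERIV_def t flat_exp_def)
  qed
qed

text \<open>A class of functions closed under taking directional derivatives; it provides both the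
  mollifier and all the barriers.\<close>
inductive elementary :: "('a::euclidean_space \<Rightarrow> real) \<Rightarrow> bool" where
  const: "elementary (\<lambda>x. c)"
| coord: "elementary (\<lambda>x. x \<bullet> v)"
| add: "elementary f \<Longrightarrow> elementary g \<Longrightarrow> elementary (\<lambda>x. f x + g x)"
| mult: "elementary f \<Longrightarrow> elementary g \<Longrightarrow> elementary (\<lambda>x. f x * g x)"
| exp: "elementary f \<Longrightarrow> elementary (\<lambda>x. exp (f x))"
| flat: "elementary f \<Longrightarrow> elementary (\<lambda>x. flat_exp m (f x))"

lemma elementary_derivative:
  "elementary f \<Longrightarrow> \<exists>D. (\<forall>x. (f has_derivative (\<lambda>h. D h x)) (at x)) \<and> (\<forall>h. elementary (D h))"
proof (induction rule: elementary.induct)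
  case const
  show ?case by (rule exI[of _ "\<lambda>h x. 0"]) (auto intro: elementary.const)
next
  case (coord v)
  show ?case
    by (rule exI[of _ "\<lambda>h x. h \<bullet> v"]) (auto intro: elementary.const intro!: derivative_eq_intros)
next
  case (add f g)
  then obtain D E where D: "\<And>x. (f has_derivative (\<lambda>h. D h x)) (at x)" "\<And>h. elementary (D h)"
    "\<And>x. (g has_derivative (\<lambda>h. E h x)) (at x)" "\<And>h. elementary (E h)" by blast
  show ?case
    by (rule exI[of _ "\<lambda>h x. D h x + E h x"])
      (use D in \<open>auto intro: elementary.add intro!: derivative_eq_intros\<close>)
next
  case (mult f g)
  then obtain D E where D: "\<And>x. (f has_derivative (\<lambda>h. D h x)) (at x)" "\<And>h. elementary (D h)"
    "\<And>x. (g has_derivative (\<lambda>h. E h x)) (at x)" "\<And>h. elementary (E h)" by blast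
  show ?case
    by (rule exI[of _ "\<lambda>h x. f x * E h x + D h x * g x"])
      (use D mult.hyps in \<open>auto intro!: has_derivative_mult elementary.add elementary.mult\<close>)
next
  case (exp f)
  then obtain D where D: "\<And>x. (f has_derivative (\<lambda>h. D h x)) (at x)" "\<And>h. elementary (D h)" by blast
  show ?case
    by (rule exI[of _ "\<lambda>h x. D h x * exp (f x)"])
      (use D exp.hyps in \<open>auto intro: elementary.exp elementary.mult intro!: derivative_eq_intros\<close>)
next
next
  case (flat f m)
  then obtain D where D: "\<And>x. (f has_derivative (\<lambda>h. D h x)) (at x)" "\<And>h. elementary (D h)" by blast
  define E where "E h x = (flat_exp (m + 2) (f x) + (- real m) * flat_exp (m + 1) (f x)) * D h x" for h x
  have "elementary (E h)" for h unfolding E_def[abs_def]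
    by (intro elementary.add elementary.mult elementary.flat elementary.const D flat.hyps)
  moreover have "((\<lambda>x. flat_exp m (f x)) has_derivative (\<lambda>h. E h x)) (at x)" for x
    using has_derivative_compose[OF D(1)[of x] DERIV_flat_exp[of m "f x", unfolded has_field_derivative_def]]
    by (simp add: E_def algebra_simps)
  ultimately show ?case by (intro exI[of _ E]) simp
qed

lemma pd_eq: "(f has_derivative D) (at x) \<Longrightarrow> pd f b x = D b"
  unfolding pd_def using frechet_derivative_at by metis

lemma differentiable_has_derivative_pd:
  "f differentiable (at x) \<Longrightarrow> (f has_derivative (\<lambda>h. pd f h x)) (at x)"
  unfolding pd_def using frechet_derivative_works by blast

lemma differentiable_imp_cont: "(\<And>x. f differentiable (at x)) \<Longrightarrow> cont f"
  by (simp add: continuous_at_imp_continuous_on differentiable_imp_continuous_within)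

lemma smooth_coinduct:
  assumes "P f" "\<And>f x. P f \<Longrightarrow> f differentiable (at x)" "\<And>f b. P f \<Longrightarrow> b \<in> Basis \<Longrightarrow> P (pd f b)"
  shows "smooth f"
  using assms(1)
proof (coinduct rule: smooth.coinduct)
  case (smooth f)
  then have "f differentiable_on UNIV" using assms(2) by (simp add: differentiable_on_def)
  then show ?case using assms(3)[OF smooth] by blast
qed

lemma elementary_smooth:
  assumes "elementary f" shows "smooth f"
  using assms
proof (rule smooth_coinduct[where P = elementary])
  fix f :: "'a \<Rightarrow> real" and x b :: 'a assume "elementary f"
  then obtain D where D: "\<And>x. (f has_derivative (\<lambda>h. D h x)) (at x)" "\<And>h. elementary (D h)"
    using elementary_derivative by blast
  then show "f differentiable (at x)" by (auto simp: differentiable_def)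
  have "pd f b = D b" using pd_eq[OF D(1)] by auto
  with D show "elementary (pd f b)" by simp
qed

lemma smooth_differentiable: "smooth f \<Longrightarrow> f differentiable (at x)"
  by (erule smooth.cases) (simp add: differentiable_on_def)

lemma smooth_pd_Basis: "smooth f \<Longrightarrow> b \<in> Basis \<Longrightarrow> smooth (pd f b)"
  by (erule smooth.cases) simp

lemma smooth_has_derivative: "smooth f \<Longrightarrow> (f has_derivative (\<lambda>h. pd f h x)) (at x)"
  by (intro differentiable_has_derivative_pd smooth_differentiable)

lemma smooth_continuous: "smooth f \<Longrightarrow> continuous_on S f"
  by (meson smooth_has_derivative continuous_at_imp_continuous_on has_derivative_continuous)

lemma pd_scaleR:
  assumes "f differentiable (at x)" shows "pd f (c *\<^sub>R h) x = c * pd f h x"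
  using linear_scale[OF has_derivative_linear[OF differentiable_has_derivative_pd[OF assms]], of c h]
  by simp

lemma pd_basis_sum:
  assumes "f differentiable (at x)" shows "pd f h x = (\<Sum>b\<in>Basis. (h \<bullet> b) * pd f b x)"
proof -
  note lin = has_derivative_linear[OF differentiable_has_derivative_pd[OF assms]]
  have "pd f (\<Sum>b\<in>Basis. (h \<bullet> b) *\<^sub>R b) x = (\<Sum>b\<in>Basis. (h \<bullet> b) * pd f b x)"
    by (simp add: linear_sum[OF lin] pd_scaleR[OF assms])
  then show ?thesis by (simp add: euclidean_representation)
qed

lemma pd_add: "smooth f \<Longrightarrow> smooth g \<Longrightarrow> pd (\<lambda>x. f x + g x) b = (\<lambda>x. pd f b x + pd g b x)"
  by (rule ext, rule pd_eq[OF has_derivative_add]) (auto intro: smooth_has_derivative)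

lemma smooth_add:
  assumes "smooth f" "smooth g" shows "smooth (\<lambda>x. f x + g x)"
proof (rule smooth_coinduct[where P = "\<lambda>F. \<exists>f g. F = (\<lambda>x. f x + g x) \<and> smooth f \<and> smooth g"])
  show "\<exists>f' g'. (\<lambda>x. f x + g x) = (\<lambda>x. f' x + g' x) \<and> smooth f' \<and> smooth g'"
    by (rule exI[of _ f], rule exI[of _ g]) (simp add: assms)
next
  fix F :: "'a \<Rightarrow> real" and x b :: 'a assume "\<exists>f g. F = (\<lambda>x. f x + g x) \<and> smooth f \<and> smooth g"
  then obtain f g where F: "F = (\<lambda>x. f x + g x)" "smooth f" "smooth g" by (elim exE conjE)
  show "F differentiable (at x)"
    unfolding F(1) by (intro differentiable_add smooth_differentiable F)
  assume "b \<in> Basis"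
  then show "\<exists>f g. pd F b = (\<lambda>x. f x + g x) \<and> smooth f \<and> smooth g"
    by (intro exI[of _ "pd f b"] exI[of _ "pd g b"]) (simp add: F(1) pd_add[OF F(2,3)] smooth_pd_Basis F(2,3))
qed

lemma has_derivative_affine:
  assumes "smooth f"
  shows "((\<lambda>x. k * f (c *\<^sub>R x + v)) has_derivative (\<lambda>h. (k * c) * pd f h (c *\<^sub>R x + v))) (at x)"
proof -
  have "((\<lambda>x. k * f (c *\<^sub>R x + v)) has_derivative (\<lambda>h. k * pd f (c *\<^sub>R h) (c *\<^sub>R x + v))) (at x)"
    by (intro has_derivative_mult_right has_derivative_compose[OF _ smooth_has_derivative[OF assms]])
      (auto intro!: derivative_eq_intros)
  then show ?thesis by (simp add: pd_scaleR[OF smooth_differentiable[OF assms]] mult.assoc)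
qed

lemma pd_affine: "smooth f \<Longrightarrow> pd (\<lambda>x. k * f (c *\<^sub>R x + v)) b = (\<lambda>x. (k * c) * pd f b (c *\<^sub>R x + v))"
  by (rule ext, rule pd_eq) (rule has_derivative_affine)

lemma smooth_affine:
  assumes "smooth f" shows "smooth (\<lambda>x. k * f (c *\<^sub>R x + v))"
proof (rule smooth_coinduct[where P = "\<lambda>F. \<exists>k f. F = (\<lambda>x. k * f (c *\<^sub>R x + v)) \<and> smooth f"])
  show "\<exists>k' f'. (\<lambda>x. k * f (c *\<^sub>R x + v)) = (\<lambda>x. k' * f' (c *\<^sub>R x + v)) \<and> smooth f'"
    by (rule exI[of _ k], rule exI[of _ f]) (simp add: assms)
next
  fix F :: "'a \<Rightarrow> real" and x b :: 'a assume "\<exists>k f. F = (\<lambda>x. k * f (c *\<^sub>R x + v)) \<and> smooth f"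
  then obtain k f where F: "F = (\<lambda>x. k * f (c *\<^sub>R x + v))" "smooth f" by (elim exE conjE)
  show "F differentiable (at x)"
    unfolding F(1) differentiable_def by (rule exI, rule has_derivative_affine[OF F(2)])
  assume "b \<in> Basis"
  then show "\<exists>k f. pd F b = (\<lambda>x. k * f (c *\<^sub>R x + v)) \<and> smooth f"
    by (intro exI[of _ "k * c"] exI[of _ "pd f b"]) (simp add: F(1) pd_affine[OF F(2)] smooth_pd_Basis F(2))
qed

lemma smooth_cmult: "smooth f \<Longrightarrow> smooth (\<lambda>x. k * f x)"
  using smooth_affine[of f k 1 0] by simp

lemma smooth_reflect: "smooth f \<Longrightarrow> smooth (\<lambda>z. f (x - z))"
  using smooth_affine[of f 1 "-1" x] by simp

lemma smooth_sum: "finite A \<Longrightarrow> (\<And>i. i \<in> A \<Longrightarrow> smooth (f i)) \<Longrightarrow> smooth (\<lambda>x. \<Sum>i\<in>A. f i x)"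
  by (induction A rule: finite_induct) (auto intro: smooth_add elementary_smooth elementary.const)

lemma smooth_pd:
  assumes "smooth f" shows "smooth (pd f h)"
proof -
  have "smooth (\<lambda>x. \<Sum>b\<in>Basis. (h \<bullet> b) * pd f b x)"
    by (intro smooth_sum smooth_cmult smooth_pd_Basis assms) auto
  then show ?thesis by (simp add: pd_basis_sum[OF smooth_differentiable[OF assms], symmetric])
qed

lemma pd_cmult: "smooth f \<Longrightarrow> pd (\<lambda>x. k * f x) b = (\<lambda>x. k * pd f b x)"
  using pd_affine[of f k 1 0 b] by simp

lemma smooth_lap: "smooth f \<Longrightarrow> smooth (lap f)"
  unfolding lap_def[abs_def] by (intro smooth_sum smooth_pd) auto

lemma lap_affine: "smooth f \<Longrightarrow> lap (\<lambda>x. k * f (c *\<^sub>R x + v)) = (\<lambda>x. k * c\<^sup>2 * lap f (c *\<^sub>R x + v))"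
  by (rule ext, simp only: lap_def sum_distrib_left, rule sum.cong)
    (simp_all add: pd_affine smooth_pd power2_eq_square)

lemma lap_reflect: "smooth f \<Longrightarrow> lap (\<lambda>z. f (x - z)) = (\<lambda>z. lap f (x - z))"
  using lap_affine[of f 1 "-1" x] by simp

lemma lap_add: "smooth f \<Longrightarrow> smooth g \<Longrightarrow> lap (\<lambda>x. f x + g x) = (\<lambda>x. lap f x + lap g x)"
  by (rule ext, simp only: lap_def sum.distrib[symmetric], rule sum.cong) (simp_all add: pd_add smooth_pd)

lemma lap_cmult: "smooth f \<Longrightarrow> lap (\<lambda>x. k * f x) = (\<lambda>x. k * lap f x)"
  using lap_affine[of f k 1 0] by simp

lemma pd_zero_outside:
  assumes "closed K" "\<And>x. x \<notin> K \<Longrightarrow> f x = 0" "x \<notin> K" shows "pd f b x = 0"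
proof -
  have "(f has_derivative (\<lambda>h. 0)) (at x)"
    by (rule has_derivative_transform_within_open[OF has_derivative_const[of 0] open_Compl[OF assms(1)]])
      (use assms in auto)
  from pd_eq[OF this] show ?thesis .
qed

lemma test_funI:
  assumes "smooth \<phi>" "compact K" "K \<subseteq> D" "\<And>x. x \<notin> K \<Longrightarrow> \<phi> x = 0"
  shows "test_fun D \<phi>"
proof -
  have "closure {x. \<phi> x \<noteq> 0} \<subseteq> K"
    using assms by (intro closure_minimal) (auto intro: compact_imp_closed)
  moreover from this have "compact (closure {x. \<phi> x \<noteq> 0})"
    using compact_Int_closed[OF assms(2) closed_closure] by (metis inf.absorb2)
  ultimately show ?thesis using assms by (auto simp: test_fun_def)
qed

lemma test_fun_support:
  assumes "test_fun D \<phi>" shows "\<exists>K. compact K \<and> K \<subseteq> D \<and> (\<forall>x. x \<notin> K \<longrightarrow> \<phi> x = 0)"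
proof (intro exI conjI allI impI)
  show "\<phi> x = 0" if "x \<notin> closure {x. \<phi> x \<noteq> 0}" for x
    using that closure_subset[of "{x. \<phi> x \<noteq> 0}"] by auto
qed (use assms in \<open>simp_all add: test_fun_def\<close>)

lemma test_fun_smooth: "test_fun D \<phi> \<Longrightarrow> smooth \<phi>"
  by (simp add: test_fun_def)

lemma test_fun_continuous: "test_fun D \<phi> \<Longrightarrow> continuous_on S \<phi>"
  by (intro smooth_continuous test_fun_smooth)

lemma test_fun_mono: "test_fun D \<phi> \<Longrightarrow> D \<subseteq> D' \<Longrightarrow> test_fun D' \<phi>"
  by (auto simp: test_fun_def)

lemma test_fun_outside: "test_fun D \<phi> \<Longrightarrow> x \<notin> D \<Longrightarrow> \<phi> x = 0"
  using test_fun_support by blast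

lemma test_fun_pd:
  assumes "test_fun D \<phi>" shows "test_fun D (pd \<phi> h)"
proof -
  obtain K where K: "compact K" "K \<subseteq> D" "\<And>x. x \<notin> K \<Longrightarrow> \<phi> x = 0"
    using test_fun_support[OF assms] by blast
  show ?thesis
    by (rule test_funI[OF smooth_pd[OF test_fun_smooth[OF assms]] K(1,2)])
      (use pd_zero_outside[OF compact_imp_closed[OF K(1)]] K(3) in auto)
qed

lemma test_fun_add:
  assumes "test_fun D \<phi>" "test_fun D \<psi>" shows "test_fun D (\<lambda>x. \<phi> x + \<psi> x)"
proof -
  obtain K where "compact K" "K \<subseteq> D" "\<And>x. x \<notin> K \<Longrightarrow> \<phi> x = 0"
    using test_fun_support[OF assms(1)] by blast
  moreover obtain L where "compact L" "L \<subseteq> D" "\<And>x. x \<notin> L \<Longrightarrow> \<psi> x = 0"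
    using test_fun_support[OF assms(2)] by blast
  ultimately show ?thesis
    by (intro test_funI[of _ "K \<union> L"] smooth_add compact_Un test_fun_smooth[OF assms(1)]
        test_fun_smooth[OF assms(2)]) simp_all
qed

lemma test_fun_lap:
  assumes "test_fun D \<phi>" shows "test_fun D (lap \<phi>)"
proof -
  obtain K where K: "compact K" "K \<subseteq> D" "\<And>x. x \<notin> K \<Longrightarrow> \<phi> x = 0"
    using test_fun_support[OF assms] by blast
  have "lap \<phi> x = 0" if "x \<notin> K" for x unfolding lap_def
    by (rule sum.neutral) (use K(3) compact_imp_closed[OF K(1)] that in \<open>auto intro!: pd_zero_outside[of K]\<close>)
  then show ?thesis using K test_fun_smooth[OF assms] by (intro test_funI[of _ K] smooth_lap)
qed

lemma test_fun_affine:
  fixes \<phi> :: "'a::euclidean_space \<Rightarrow> real"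
  assumes "test_fun UNIV \<phi>" "c \<noteq> 0" shows "test_fun UNIV (\<lambda>x. k * \<phi> (c *\<^sub>R x + v))"
proof -
  obtain K where K: "compact K" "\<And>x. x \<notin> K \<Longrightarrow> \<phi> x = 0"
    using test_fun_support[OF assms(1)] by blast
  show ?thesis
  proof (rule test_funI[OF smooth_affine[OF test_fun_smooth[OF assms(1)]]])
    show "compact ((\<lambda>x. inverse c *\<^sub>R (x - v)) ` K)" by (intro compact_continuous_image continuous_intros K)
    show "k * \<phi> (c *\<^sub>R x + v) = 0" if "x \<notin> (\<lambda>x. inverse c *\<^sub>R (x - v)) ` K" for x
    proof -
      have "x = inverse c *\<^sub>R ((c *\<^sub>R x + v) - v)" using assms(2) by simp
      then show ?thesis using that K(2) by (metis (lifting) imageI mult_zero_right)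
    qed
  qed simp
qed

lemma test_fun_cmult:
  assumes "test_fun D \<phi>" shows "test_fun D (\<lambda>x. c * \<phi> x)"
proof -
  obtain K where "compact K" "K \<subseteq> D" "\<And>x. x \<notin> K \<Longrightarrow> \<phi> x = 0"
    using test_fun_support[OF assms] by blast
  then show ?thesis using test_fun_smooth[OF assms] by (intro test_funI[of _ K] smooth_cmult) simp_all
qed

lemma compact_support_bounded:
  fixes f :: "'a::euclidean_space \<Rightarrow> real"
  assumes "cont f" "compact K" "\<And>x. x \<notin> K \<Longrightarrow> f x = 0" shows "\<exists>C\<ge>0. \<forall>x. \<bar>f x\<bar> \<le> C"
proof -
  have "bounded (f ` K)"
    using assms by (intro compact_imp_bounded compact_continuous_image continuous_on_subset[OF assms(1)]) auto
  then obtain C where "0 < C" "\<And>x. x \<in> K \<Longrightarrow> \<bar>f x\<bar> \<le> C" unfolding bounded_pos by auto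
  then have "\<bar>f x\<bar> \<le> C" for x using assms(3)[of x] by (cases "x \<in> K") auto
  then show ?thesis using \<open>0 < C\<close> by (intro exI[of _ C]) simp
qed

lemma test_fun_bounded:
  assumes "test_fun D \<phi>" shows "\<exists>C\<ge>0. \<forall>x. \<bar>\<phi> x\<bar> \<le> C"
  using test_fun_support[OF assms] compact_support_bounded[OF test_fun_continuous[OF assms]] by blast

lemma test_fun_pd_bounded:
  fixes \<phi> :: "'a::euclidean_space \<Rightarrow> real"
  assumes "test_fun D \<phi>" shows "\<exists>C\<ge>0. \<forall>x h. \<bar>pd \<phi> h x\<bar> \<le> C * norm h"
proof -
  obtain C where C: "\<And>b x. \<bar>pd \<phi> b x\<bar> \<le> C b" using test_fun_bounded[OF test_fun_pd[OF assms]] by metis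
  have "\<bar>pd \<phi> h x\<bar> \<le> (\<Sum>b\<in>Basis. C b) * norm h" for x h
  proof -
    have "\<bar>pd \<phi> h x\<bar> \<le> (\<Sum>b\<in>Basis. norm h * C b)"
      unfolding pd_basis_sum[OF smooth_differentiable[OF test_fun_smooth[OF assms]], of h x]
      by (rule order_trans[OF sum_abs], rule sum_mono, unfold abs_mult, rule mult_mono)
        (auto simp: C Basis_le_norm)
    then show ?thesis by (simp add: sum_distrib_left mult.commute)
  qed
  moreover have "0 \<le> (\<Sum>b\<in>Basis. C b)"
    by (rule sum_nonneg) (rule order_trans[OF abs_ge_zero C[of _ 0]])
  ultimately show ?thesis by blast
qed

lemma integrable_compact_support:
  fixes f :: "'a::euclidean_space \<Rightarrow> real"
  assumes "cont f" "compact K" "\<And>x. x \<notin> K \<Longrightarrow> f x = 0"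
  shows "integrable lborel f"
proof -
  have "integrable lborel (\<lambda>x. indicator K x *\<^sub>R f x)"
    using assms by (intro borel_integrable_compact) (auto intro: continuous_on_subset)
  moreover have "(\<lambda>x. indicator K x *\<^sub>R f x) = f"
    using assms by (auto simp: indicator_def fun_eq_iff)
  ultimately show ?thesis by simp
qed

lemma integrable_times_test_fun:
  fixes q :: "'a::euclidean_space \<Rightarrow> real"
  assumes "cont q" "test_fun D \<phi>" shows "integrable lborel (\<lambda>x. q x * \<phi> x)"
proof -
  obtain K where "compact K" "\<And>x. x \<notin> K \<Longrightarrow> \<phi> x = 0"
    using test_fun_support[OF assms(2)] by blast
  then show ?thesis
    by (intro integrable_compact_support[of _ K] continuous_on_mult assms(1) test_fun_continuous[OF assms(2)])
        simp_all
qed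

lemma integrable_test_fun: "test_fun D \<phi> \<Longrightarrow> integrable lborel (\<phi> :: 'a::euclidean_space \<Rightarrow> real)"
  using integrable_times_test_fun[of "\<lambda>_. 1"] by simp

lemma line_derivative:
  assumes "\<And>x. f differentiable (at x)"
  shows "((\<lambda>t. f (x + t *\<^sub>R v)) has_real_derivative pd f v (x + t *\<^sub>R v)) (at t)"
proof -
  have "((\<lambda>t. f (x + t *\<^sub>R v)) has_derivative (\<lambda>s. pd f (s *\<^sub>R v) (x + t *\<^sub>R v))) (at t)"
    by (rule has_derivative_compose[OF _ differentiable_has_derivative_pd[OF assms]])
      (auto intro!: derivative_eq_intros)
  then show ?thesis by (rule has_derivative_imp_has_field_derivative) (simp add: pd_scaleR[OF assms])
qed

lemma derivative_remainder_le:
  fixes g :: "'a::real_normed_vector \<Rightarrow> real"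
  assumes deriv: "\<And>x. norm (x - x0) < 1 \<Longrightarrow> (g has_derivative g' x) (at x)"
    and bound: "\<And>x h. norm (x - x0) < 1 \<Longrightarrow> \<bar>g' x h\<bar> \<le> C * norm h" and x: "norm (x - x0) < 1" "x \<noteq> x0"
  shows "\<bar>g x - g x0 - g' x0 (x - x0)\<bar> \<le> 2 * C * norm (x - x0)"
proof -
  have "norm (g x - g x0) \<le> C * norm (x - x0)"
  proof (rule differentiable_bound[OF convex_ball, of x0 1 g g'])
    fix y assume "y \<in> ball x0 1"
    then have y: "norm (y - x0) < 1" by (simp add: dist_norm norm_minus_commute)
    show "(g has_derivative g' y) (at y within ball x0 1)" using deriv[OF y]
      by (rule has_derivative_at_withinI)
    have "0 \<le> C * norm (x - x0)" by (rule order_trans[OF abs_ge_zero bound[OF y]])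
    then have "0 \<le> C" using x(2) by (simp add: zero_le_mult_iff)
    then show "onorm (g' y) \<le> C" using bound[OF y] by (intro onorm_bound) (simp_all add: mult.commute)
  qed (use x in \<open>auto simp: dist_norm norm_minus_commute\<close>)
  moreover have "\<bar>g' x0 (x - x0)\<bar> \<le> C * norm (x - x0)" by (rule bound) simp
  ultimately show ?thesis by simp
qed

lemma dominated_convergence_at:
  fixes r :: "'a::real_normed_vector \<Rightarrow> 'b \<Rightarrow> real"
  assumes r: "\<And>x. integrable M (r x)" and lim: "\<And>z. ((\<lambda>x. r x z) \<longlongrightarrow> 0) (at x0)"
    and bound: "\<And>x z. norm (x - x0) < 1 \<Longrightarrow> x \<noteq> x0 \<Longrightarrow> \<bar>r x z\<bar> \<le> w z" and w: "integrable M w"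
  shows "((\<lambda>x. \<integral>z. r x z \<partial>M) \<longlongrightarrow> 0) (at x0)"
  unfolding tendsto_at_iff_sequentially o_def
proof (intro allI impI)
  fix X assume X: "\<forall>n. X n \<in> UNIV - {x0}" "X \<longlonglongrightarrow> x0"
  then obtain N where N: "\<And>n. n \<ge> N \<Longrightarrow> norm (X n - x0) < 1" using LIMSEQ_D[of X x0 1] by auto
  have "(\<lambda>n. \<integral>z. r (X (n + N)) z \<partial>M) \<longlonglongrightarrow> (\<integral>z. 0 \<partial>M)"
  proof (rule integral_dominated_convergence[where w = w])
    have "(\<lambda>n. r (X n) z) \<longlonglongrightarrow> 0" for z
      using lim[of z] X unfolding tendsto_at_iff_sequentially o_def by blast
    then show "AE z in M. (\<lambda>n. r (X (n + N)) z) \<longlonglongrightarrow> 0" by (intro AE_I2 LIMSEQ_ignore_initial_segment)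
    show "AE z in M. norm (r (X (n + N)) z) \<le> w z" for n using bound[OF N] X(1) by (intro AE_I2) simp
  qed (use r w in auto)
  then show "(\<lambda>n. \<integral>z. r (X n) z \<partial>M) \<longlonglongrightarrow> 0" by (simp add: LIMSEQ_offset)
qed

lemma has_derivative_integral:
  fixes f :: "'a::real_normed_vector \<Rightarrow> 'b \<Rightarrow> real"
  assumes f: "\<And>x. integrable M (f x)" and f': "\<And>h. integrable M (\<lambda>z. f' x0 z h)"
    and deriv: "\<And>x z. norm (x - x0) < 1 \<Longrightarrow> ((\<lambda>x. f x z) has_derivative f' x z) (at x)"
    and bound: "\<And>x z h. norm (x - x0) < 1 \<Longrightarrow> \<bar>f' x z h\<bar> \<le> w z * norm h" and w: "integrable M w"
  shows "((\<lambda>x. \<integral>z. f x z \<partial>M) has_derivative (\<lambda>h. \<integral>z. f' x0 z h \<partial>M)) (at x0)"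
  unfolding has_derivative_at_within
proof
  interpret D: bounded_linear "f' x0 z" for z
    by (rule has_derivative_bounded_linear[OF deriv]) simp
  show "bounded_linear (\<lambda>h. \<integral>z. f' x0 z h \<partial>M)"
  proof (rule bounded_linear_intro)
    fix h k :: 'a and c :: real
    show "(\<integral>z. f' x0 z (h + k) \<partial>M) = (\<integral>z. f' x0 z h \<partial>M) + (\<integral>z. f' x0 z k \<partial>M)"
      "(\<integral>z. f' x0 z (c *\<^sub>R h) \<partial>M) = c *\<^sub>R (\<integral>z. f' x0 z h \<partial>M)"
      by (simp_all add: D.add D.scaleR f')
    have "\<bar>\<integral>z. f' x0 z h \<partial>M\<bar> \<le> (\<integral>z. w z * norm h \<partial>M)"
      by (rule order_trans[OF integral_abs_bound integral_mono]) (use f' w bound[of x0] in auto)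
    then show "norm (\<integral>z. f' x0 z h \<partial>M) \<le> norm h * (\<integral>z. w z \<partial>M)" by (simp add: mult.commute)
  qed
  define r where "r x z = (f x z - f x0 z - f' x0 z (x - x0)) /\<^sub>R norm (x - x0)" for x z
  have "((\<lambda>x. \<integral>z. r x z \<partial>M) \<longlongrightarrow> 0) (at x0)"
  proof (rule dominated_convergence_at[where w = "\<lambda>z. 2 * w z"])
    show "((\<lambda>x. r x z) \<longlongrightarrow> 0) (at x0)" for z
      using deriv[of x0 z] by (simp add: has_derivative_at_within r_def)
    show "\<bar>r x z\<bar> \<le> 2 * w z" if "norm (x - x0) < 1" "x \<noteq> x0" for x z
      using derivative_remainder_le[of x0 "\<lambda>x. f x z" "\<lambda>x. f' x z", OF deriv bound that] that(2)
      by (simp add: r_def divide_simps abs_mult)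
  qed (use f f' w in \<open>simp_all add: r_def\<close>)
  moreover have "(\<integral>z. r x z \<partial>M) = ((\<integral>z. f x z \<partial>M) - (\<integral>z. f x0 z \<partial>M) - (\<integral>z. f' x0 z (x - x0) \<partial>M)) /\<^sub>R norm
      (x - x0)"
    for x unfolding r_def using f f' by simp
  ultimately show "((\<lambda>x. ((\<integral>z. f x z \<partial>M) - (\<integral>z. f x0 z \<partial>M) - (\<integral>z. f' x0 z (x - x0) \<partial>M)) /\<^sub>R norm (x - x0))
      \<longlongrightarrow> 0) (at x0)" by simp
qed

lemma DERIV_integral:
  fixes f :: "real \<Rightarrow> 'b \<Rightarrow> real"
  assumes "\<And>s. integrable M (f s)" "integrable M (f' s0)"
    and "\<And>s z. \<bar>s - s0\<bar> < 1 \<Longrightarrow> ((\<lambda>s. f s z) has_real_derivative f' s z) (at s)"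
    and "\<And>s z. \<bar>s - s0\<bar> < 1 \<Longrightarrow> \<bar>f' s z\<bar> \<le> w z" and "integrable M w"
  shows "((\<lambda>s. \<integral>z. f s z \<partial>M) has_real_derivative (\<integral>z. f' s0 z \<partial>M)) (at s0)"
  using has_derivative_integral[where f = f and f' = "\<lambda>s z. (*) (f' s z)" and w = w and M = M and ?x0.0 =
      s0] assms
  by (simp add: has_field_derivative_def abs_mult mult_right_mono)

lemma lborel_integral_affine:
  fixes f :: "'a::euclidean_space \<Rightarrow> real"
  assumes [measurable]: "f \<in> borel_measurable borel" and c: "c \<noteq> 0"
  shows "(LBINT x. f x) = \<bar>c\<bar> ^ DIM('a) * (LBINT x. f (t + c *\<^sub>R x))"
  by (subst lborel_affine[OF c, of t]) (simp add: integral_density integral_distr)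

lemma lborel_integrable_affine:
  fixes f :: "'a::euclidean_space \<Rightarrow> real"
  assumes f: "integrable lborel f" and c: "c \<noteq> 0"
  shows "integrable lborel (\<lambda>x. f (t + c *\<^sub>R x))"
proof -
  have [measurable]: "f \<in> borel_measurable borel" using f by auto
  have "integrable (density (distr lborel borel (\<lambda>x. t + c *\<^sub>R x)) (\<lambda>_. ennreal (\<bar>c\<bar> ^ DIM('a)))) f"
    using f lborel_affine[OF c, of t] by simp
  then have "integrable lborel (\<lambda>x. \<bar>c\<bar> ^ DIM('a) *\<^sub>R f (t + c *\<^sub>R x))"
    by (subst (asm) integrable_density) (simp_all add: integrable_distr_eq)
  then show ?thesis using c by simp
qed

lemma lborel_integral_shift:
  fixes f :: "'a::euclidean_space \<Rightarrow> real"
  assumes "f \<in> borel_measurable borel"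
  shows "(LBINT x. f (x + v)) = (LBINT x. f x)"
  using lborel_integral_affine[OF assms, of 1 v] by (simp add: add.commute)

lemma lborel_integral_reflect:
  fixes f :: "'a::euclidean_space \<Rightarrow> real"
  assumes "f \<in> borel_measurable borel"
  shows "(LBINT x. f (v - x)) = (LBINT x. f x)"
  using lborel_integral_affine[OF assms, of "-1" v] by simp

lemma borel_measurable_UNIV: "cont f \<Longrightarrow> f \<in> borel_measurable borel"
  by (rule borel_measurable_continuous_onI)

lemma integrable_shift:
  "integrable lborel f \<Longrightarrow> integrable lborel (\<lambda>x. f (x + v :: 'a::euclidean_space) :: real)"
  using lborel_integrable_affine[of f 1 v] by (simp add: add.commute)

lemma integrable_reflect:
  "integrable lborel f \<Longrightarrow> integrable lborel (\<lambda>x. f (v - x :: 'a::euclidean_space) :: real)"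
  using lborel_integrable_affine[of f "-1" v] by simp

lemma integrable_indicator_bounded:
  "bounded S \<Longrightarrow> S \<in> sets borel \<Longrightarrow> integrable lborel (indicator S :: 'a::euclidean_space \<Rightarrow> real)"
  using emeasure_bounded_finite by (intro integrable_real_indicator) auto

lemma integral_pd_zero:
  fixes F :: "'a::euclidean_space \<Rightarrow> real"
  assumes F: "\<And>x. F differentiable (at x)" and pd: "cont (pd F b)"
    and K: "compact K" "\<And>x. x \<notin> K \<Longrightarrow> F x = 0"
  shows "(LBINT x. pd F b x) = 0"
proof -
  have [measurable]: "F \<in> borel_measurable borel"
    by (intro borel_measurable_UNIV differentiable_imp_cont F)
  have pd_outside: "pd F b x = 0" if "x \<notin> K" for x
    using K(2) that by (rule pd_zero_outside[OF compact_imp_closed[OF K(1)]])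
  obtain C where C: "\<And>x. \<bar>pd F b x\<bar> \<le> C" "0 \<le> C"
    using compact_support_bounded[OF pd K(1) pd_outside] by blast
  obtain R where R: "\<And>x. x \<in> K \<Longrightarrow> norm x \<le> R"
    using compact_imp_bounded[OF K(1)] bounded_iff by blast
  have "((\<lambda>s. \<integral>x. F (x + s *\<^sub>R b) \<partial>lborel) has_real_derivative (LBINT x. pd F b (x + 0 *\<^sub>R b))) (at 0)"
  proof (rule DERIV_integral[where w = "\<lambda>x. C * indicator (cball 0 (R + norm b)) x"])
    show "integrable lborel (\<lambda>x. F (x + s *\<^sub>R b))" for s
      by (intro integrable_shift integrable_compact_support[OF _ K] differentiable_imp_cont F)
    show "integrable lborel (\<lambda>x. pd F b (x + 0 *\<^sub>R b))"
      using integrable_compact_support[OF pd K(1) pd_outside] by simp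
    show "((\<lambda>s. F (x + s *\<^sub>R b)) has_real_derivative pd F b (x + s *\<^sub>R b)) (at s)" for s x
      by (rule line_derivative[OF F])
    show "\<bar>pd F b (x + s *\<^sub>R b)\<bar> \<le> C * indicator (cball 0 (R + norm b)) x" if "\<bar>s - 0\<bar> < 1" for s x
    proof (cases "x + s *\<^sub>R b \<in> K")
      case True
      have "norm x \<le> norm (x + s *\<^sub>R b) + norm (s *\<^sub>R b)" by (metis add_diff_cancel norm_triangle_ineq4)
      also have "\<dots> \<le> R + norm b"
        using R[OF True] that mult_right_mono[of "\<bar>s\<bar>" 1 "norm b"] by (simp add: norm_scaleR)
      finally show ?thesis using C by simp
    qed (use pd_outside C in simp)
    show "integrable lborel (\<lambda>x. C * indicator (cball 0 (R + norm b)) x)"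
      by (intro integrable_mult_right integrable_indicator_bounded) auto
  qed
  moreover have "(LBINT x. F (x + s *\<^sub>R b)) = (LBINT x. F x)" for s
    by (rule lborel_integral_shift) measurable
  ultimately have "((\<lambda>s::real. (LBINT x. F x)) has_real_derivative (LBINT x. pd F b x)) (at 0)"
    by simp
  from DERIV_unique[OF this DERIV_const] show ?thesis .
qed

lemma pd_mult:
  assumes "f differentiable (at x)" "g differentiable (at x)"
  shows "pd (\<lambda>x. f x * g x) b x = f x * pd g b x + pd f b x * g x"
  using pd_eq[OF has_derivative_mult[OF assms[THEN differentiable_has_derivative_pd]]] .

lemma integration_by_parts:
  fixes f g :: "'a::euclidean_space \<Rightarrow> real"
  assumes f: "\<And>x. f differentiable (at x)" "cont (pd f b)"
    and g: "\<And>x. g differentiable (at x)" "cont (pd g b)"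
    and K: "compact K" "\<And>x. x \<notin> K \<Longrightarrow> f x = 0 \<or> g x = 0"
  shows "(LBINT x. f x * pd g b x) = - (LBINT x. pd f b x * g x)" (is ?parts)
    and "integrable lborel (\<lambda>x. f x * pd g b x)" (is ?left)
    and "integrable lborel (\<lambda>x. pd f b x * g x)" (is ?right)
proof -
  have fg: "f x * g x = 0" if "x \<notin> K" for x using K(2)[OF that] by auto
  have outside: "f x * pd g b x = 0 \<and> pd f b x * g x = 0" if x: "x \<notin> K" for x
  proof -
    have "pd (\<lambda>x. f x * g x) b x = 0" by (rule pd_zero_outside[OF compact_imp_closed[OF K(1)] fg x])
    then show ?thesis using K(2)[OF x] by (auto simp: pd_mult[OF f(1) g(1)])
  qed
  note cont = differentiable_imp_cont[OF f(1)] differentiable_imp_cont[OF g(1)] f(2) g(2)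
  show ?left ?right
    by (intro integrable_compact_support[OF _ K(1)] continuous_intros cont; use outside in auto)+
  have "(LBINT x. pd (\<lambda>x. f x * g x) b x) = 0"
  proof (rule integral_pd_zero[OF differentiable_mult[OF f(1) g(1)] _ K(1) fg])
    show "cont (pd (\<lambda>x. f x * g x) b)"
      unfolding pd_mult[OF f(1) g(1), abs_def] by (intro continuous_intros cont)
  qed
  then have "(LBINT x. f x * pd g b x + pd f b x * g x) = 0" by (simp add: pd_mult[OF f(1) g(1)])
  with \<open>?left\<close> \<open>?right\<close> show ?parts by simp
qed

lemma integration_by_parts_test_fun:
  assumes \<psi>: "smooth \<psi>" and \<phi>: "test_fun D \<phi>"
  shows "(LBINT x. \<psi> x * pd \<phi> b x) = - (LBINT x. pd \<psi> b x * \<phi> x)"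
proof -
  obtain K where "compact K" "\<And>x. x \<notin> K \<Longrightarrow> \<phi> x = 0" using test_fun_support[OF \<phi>] by blast
  then show ?thesis
    using \<psi> test_fun_smooth[OF \<phi>]
    by (intro integration_by_parts[of _ _ _ K] smooth_differentiable smooth_continuous smooth_pd) auto
qed

lemma integral_lap_swap:
  assumes \<psi>: "smooth \<psi>" and \<phi>: "test_fun D \<phi>"
  shows "(LBINT x. \<psi> x * lap \<phi> x) = (LBINT x. lap \<psi> x * \<phi> x)"
proof -
  have "(LBINT x. \<psi> x * lap \<phi> x) = (\<Sum>b\<in>Basis. \<integral>x. \<psi> x * pd (pd \<phi> b) b x \<partial>lborel)"
    unfolding lap_def sum_distrib_left
    by (intro bochner_integral_sum integrable_times_test_fun[of _ D] smooth_continuous test_fun_pd \<psi> \<phi>)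
  also have "\<dots> = (\<Sum>b\<in>Basis. \<integral>x. pd (pd \<psi> b) b x * \<phi> x \<partial>lborel)"
    by (simp add: integration_by_parts_test_fun[OF \<psi> test_fun_pd[OF \<phi>]]
        integration_by_parts_test_fun[OF smooth_pd[OF \<psi>] \<phi>])
  also have "\<dots> = (LBINT x. lap \<psi> x * \<phi> x)"
    unfolding lap_def sum_distrib_right
    by (intro bochner_integral_sum[symmetric] integrable_times_test_fun[OF _ \<phi>] smooth_continuous smooth_pd \<psi>)
  finally show ?thesis .
qed

lemma elementary_sum: "finite A \<Longrightarrow> (\<And>i. i \<in> A \<Longrightarrow> elementary (f i)) \<Longrightarrow> elementary (\<lambda>x. \<Sum>i\<in>A. f i x)"
  by (induction A rule: finite_induct) (auto intro: elementary.const elementary.add)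

lemma elementary_sqdist: "elementary (\<lambda>x. (x - a) \<bullet> (x - a))"
proof -
  have "elementary (\<lambda>x. (\<Sum>b\<in>Basis. (x \<bullet> b) * (x \<bullet> b)) + (- 2 * (x \<bullet> a) + a \<bullet> a))"
    by (intro elementary.add elementary.mult elementary_sum elementary.const elementary.coord) auto
  moreover have "(\<Sum>b\<in>Basis. (x \<bullet> b) * (x \<bullet> b)) + (- 2 * (x \<bullet> a) + a \<bullet> a) = (x - a) \<bullet> (x - a)" for x
    using euclidean_inner[of x x] by (simp add: inner_diff_left inner_diff_right inner_commute)
  ultimately show ?thesis by simp
qed

lemma lap_sqdist: "lap (\<lambda>x::'a. (x - a) \<bullet> (x - a)) x = 2 * DIM('a::euclidean_space)"
proof -
  have "((\<lambda>x::'a. (x - a) \<bullet> (x - a)) has_derivative (\<lambda>h. 2 * ((x - a) \<bullet> h))) (at x)" for x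
    by (auto intro!: derivative_eq_intros simp: inner_commute)
  then have pd: "pd (\<lambda>x::'a. (x - a) \<bullet> (x - a)) b = (\<lambda>x. 2 * ((x - a) \<bullet> b))" for b
    by (auto dest: pd_eq)
  have "((\<lambda>x. 2 * ((x - a) \<bullet> b)) has_derivative (\<lambda>h. 2 * (h \<bullet> b))) (at x)" for b x
    by (auto intro!: derivative_eq_intros)
  from pd_eq[OF this] have "pd (\<lambda>x. 2 * ((x - a) \<bullet> b)) b x = 2" if "b \<in> Basis" for b
    using that by simp
  then show ?thesis by (simp add: lap_def pd)
qed

lemma integral_pos_if_pos_at:
  fixes f :: "'a::euclidean_space \<Rightarrow> real"
  assumes f: "integrable lborel f" "\<And>x. 0 \<le> f x" and "isCont f a" "0 < f a"
  shows "0 < (LBINT x. f x)"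
proof -
  obtain r where r: "r > 0" "\<And>x. dist x a < r \<Longrightarrow> dist (f x) (f a) < f a / 2"
    using assms(3,4) unfolding continuous_at_eps_delta by (meson half_gt_zero)
  have "0 < f a / 2 * measure lborel (ball a r)"
    using assms(4) r(1) content_ball_pos[of r a] by simp
  also have "\<dots> = (LBINT x. f a / 2 * indicator (ball a r) x)" by simp
  also have "\<dots> \<le> (LBINT x. f x)"
  proof (rule integral_mono)
    show "f a / 2 * indicator (ball a r) x \<le> f x" for x
      using r(2)[of x] f(2)[of x] by (auto simp: indicator_def dist_commute dist_real_def abs_if split:
          if_splits)
  qed (intro integrable_mult_right integrable_indicator_bounded f; simp)+
  finally show ?thesis .
qed

definition bump :: "('a::euclidean_space \<Rightarrow> real) \<Rightarrow> bool" where
  "bump \<rho> \<longleftrightarrow> smooth \<rho> \<and> (\<forall>x. 0 \<le> \<rho> x) \<and> (\<forall>x. 1 \<le> norm x \<longrightarrow> \<rho> x = 0) \<and> (LBINT x. \<rho> x) = 1"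

lemma bump_exists: "\<exists>\<rho> :: 'a::euclidean_space \<Rightarrow> real. bump \<rho>"
proof -
  define \<rho> :: "'a \<Rightarrow> real" where "\<rho> x = flat_exp 0 (1 + (-1) * ((x - 0) \<bullet> (x - 0)))" for x
  have smooth: "smooth \<rho>" unfolding \<rho>_def[abs_def]
    by (intro elementary_smooth elementary.flat elementary.add elementary.const elementary.mult
        elementary_sqdist)
  have nonneg: "0 \<le> \<rho> x" for x by (simp add: \<rho>_def flat_exp_def)
  have outside: "\<rho> x = 0" if "1 \<le> norm x" for x
    using one_le_power[OF that, of 2] by (simp add: \<rho>_def flat_exp_def dot_square_norm)
  have "integrable lborel \<rho>"
    by (rule integrable_compact_support[OF smooth_continuous[OF smooth] compact_cball[of 0 1]])
        (use outside in auto)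
  moreover have "isCont \<rho> 0" using smooth_continuous[OF smooth, of UNIV]
    by (simp add: continuous_on_eq_continuous_at)
  ultimately have "0 < (LBINT x. \<rho> x)"
    by (rule integral_pos_if_pos_at[OF _ nonneg]) (simp add: \<rho>_def flat_exp_def)
  then have "bump (\<lambda>x. inverse (LBINT x. \<rho> x) * \<rho> x)"
    unfolding bump_def using smooth_cmult[OF smooth] nonneg outside by simp
  then show ?thesis by (rule exI[of bump])
qed

definition mollifier :: "real \<Rightarrow> 'a::euclidean_space \<Rightarrow> real" where
  "mollifier \<epsilon> x = inverse (\<epsilon> ^ DIM('a)) * (SOME \<rho> :: 'a \<Rightarrow> real. bump \<rho>) (inverse \<epsilon> *\<^sub>R x)"

lemma
  assumes "\<epsilon> > 0"
  shows mollifier_smooth: "smooth (mollifier \<epsilon> :: 'a::euclidean_space \<Rightarrow> real)"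
    and mollifier_nonneg: "0 \<le> mollifier \<epsilon> (x::'a)"
    and mollifier_outside: "\<epsilon> \<le> norm x \<Longrightarrow> mollifier \<epsilon> x = 0"
    and mollifier_integral: "(LBINT x. mollifier \<epsilon> (x::'a)) = 1"
proof -
  define \<rho> :: "'a \<Rightarrow> real" where "\<rho> = (SOME \<rho>. bump \<rho>)"
  have \<rho>: "smooth \<rho>" "\<And>x. 0 \<le> \<rho> x" "\<And>x. 1 \<le> norm x \<Longrightarrow> \<rho> x = 0" "(LBINT x. \<rho> x) = 1"
    using someI_ex[OF bump_exists[where 'a = 'a], folded \<rho>_def] by (simp_all add: bump_def)
  have mollifier: "mollifier \<epsilon> = (\<lambda>x. inverse (\<epsilon> ^ DIM('a)) * \<rho> (inverse \<epsilon> *\<^sub>R x))"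
    by (simp add: mollifier_def[abs_def] \<rho>_def)
  show "smooth (mollifier \<epsilon> :: 'a \<Rightarrow> real)"
    unfolding mollifier using smooth_affine[OF \<rho>(1), of _ _ 0] by simp
  show "0 \<le> mollifier \<epsilon> x" using \<rho>(2) assms by (simp add: mollifier)
  show "mollifier \<epsilon> x = 0" if "\<epsilon> \<le> norm x"
    using \<rho>(3)[of "inverse \<epsilon> *\<^sub>R x"] that assms by (simp add: mollifier field_simps)
  show "(LBINT x. mollifier \<epsilon> (x::'a)) = 1"
    using lborel_integral_affine[of \<rho> "inverse \<epsilon>" 0] borel_measurable_UNIV[OF smooth_continuous[OF \<rho>(1)]]
        assms \<rho>(4)
    by (simp add: mollifier power_inverse)
qed

lemma mollifier_reflect_integral:
  "\<epsilon> > 0 \<Longrightarrow> (LBINT z. mollifier \<epsilon> (x - z)) = 1"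
  using lborel_integral_reflect[OF borel_measurable_UNIV[OF smooth_continuous[OF mollifier_smooth]]]
  by (simp add: mollifier_integral)

lemma test_fun_mollifier:
  assumes "\<epsilon> > 0" "cball x \<epsilon> \<subseteq> D" shows "test_fun D (\<lambda>z. mollifier \<epsilon> (x - z))"
proof (rule test_funI[OF smooth_reflect[OF mollifier_smooth[OF assms(1)]] compact_cball assms(2)])
  show "mollifier \<epsilon> (x - z) = 0" if "z \<notin> cball x \<epsilon>" for z
    using mollifier_outside[OF assms(1), of "x - z"] that by (simp add: dist_norm)
qed

lemma test_fun_mollifier_UNIV: "\<epsilon> > 0 \<Longrightarrow> test_fun UNIV (mollifier \<epsilon>)"
  by (rule test_funI[OF mollifier_smooth compact_cball[of 0 \<epsilon>]]) (auto intro: mollifier_outside)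

definition conv :: "('a::euclidean_space \<Rightarrow> real) \<Rightarrow> ('a \<Rightarrow> real) \<Rightarrow> 'a \<Rightarrow> real" where
  "conv y \<rho> x = (LBINT z. y z * \<rho> (x - z))"

lemma conv_integrable:
  fixes y :: "'a::euclidean_space \<Rightarrow> real"
  assumes "cont y" "test_fun UNIV \<rho>" shows "integrable lborel (\<lambda>z. y z * \<rho> (x - z))"
  using integrable_times_test_fun[OF assms(1) test_fun_affine[OF assms(2), of "-1" 1 x]] by simp

lemma conv_has_derivative:
  fixes y :: "'a::euclidean_space \<Rightarrow> real"
  assumes y: "cont y" and \<rho>: "test_fun UNIV \<rho>"
  shows "(conv y \<rho> has_derivative (\<lambda>h. conv y (pd \<rho> h) x)) (at x)"
  unfolding conv_def[abs_def]
proof -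
  obtain K where K: "compact K" "\<And>x. x \<notin> K \<Longrightarrow> \<rho> x = 0" using test_fun_support[OF \<rho>] by blast
  obtain R where R: "\<And>x. x \<in> K \<Longrightarrow> norm x \<le> R" using compact_imp_bounded[OF K(1)] bounded_iff by blast
  obtain C where C: "\<And>x h. \<bar>pd \<rho> h x\<bar> \<le> C * norm h" "0 \<le> C"
    using test_fun_pd_bounded[OF \<rho>] by blast
  show "((\<lambda>x. \<integral>z. y z * \<rho> (x - z) \<partial>lborel) has_derivative (\<lambda>h. \<integral>z. y z * pd \<rho> h (x - z) \<partial>lborel)) (at x)"
  proof (rule has_derivative_integral[where w = "\<lambda>z. C * (indicator (cball x (R + 1)) z * \<bar>y z\<bar>)"])
    fix x' z h :: 'a assume x': "norm (x' - x) < 1"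
    show "((\<lambda>x. y z * \<rho> (x - z)) has_derivative (\<lambda>h. y z * pd \<rho> h (x' - z))) (at x')"
      by (intro has_derivative_mult_right has_derivative_compose[OF _ smooth_has_derivative[OF
          test_fun_smooth[OF \<rho>]]])
        (auto intro!: derivative_eq_intros)
    show "\<bar>y z * pd \<rho> h (x' - z)\<bar> \<le> C * (indicator (cball x (R + 1)) z * \<bar>y z\<bar>) * norm h"
    proof (cases "x' - z \<in> K")
      case True
      have "norm (x - z) \<le> norm (x' - z) + norm (x' - x)" using norm_triangle_ineq4[of "x' - z" "x' - x"]
        by simp
      then have "z \<in> cball x (R + 1)" using R[OF True] x' by (simp add: dist_norm)
      then show ?thesis using mult_left_mono[OF C(1), of "\<bar>y z\<bar>"] by (simp add: abs_mult mult_ac)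
    next
      case False
      then have "pd \<rho> h (x' - z) = 0" using K(2) by (intro pd_zero_outside[OF compact_imp_closed[OF K(1)]])
      then show ?thesis using C(2) by simp
    qed
  next
    show "integrable lborel (\<lambda>z. y z * \<rho> (x - z))" "integrable lborel (\<lambda>z. y z * pd \<rho> h (x - z))" for x h
      by (intro conv_integrable y \<rho> test_fun_pd)+
    show "integrable lborel (\<lambda>z. C * (indicator (cball x (R + 1)) z * \<bar>y z\<bar>))"
      using borel_integrable_compact[OF compact_cball[of x "R + 1"], of "\<lambda>z. \<bar>y z\<bar>"] y
      by (auto intro!: continuous_intros intro: continuous_on_subset)
  qed
qed

lemma pd_conv: "cont y \<Longrightarrow> test_fun UNIV \<rho> \<Longrightarrow> pd (conv y \<rho>) h = conv y (pd \<rho> h)"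
  by (rule ext) (rule pd_eq[OF conv_has_derivative])

lemma smooth_conv:
  assumes y: "cont y" and \<rho>: "test_fun UNIV \<rho>" shows "smooth (conv y \<rho>)"
proof (rule smooth_coinduct[where P = "\<lambda>F. \<exists>\<rho>. F = conv y \<rho> \<and> test_fun UNIV \<rho>"])
  show "\<exists>\<rho>'. conv y \<rho> = conv y \<rho>' \<and> test_fun UNIV \<rho>'" using \<rho> by (intro exI[of _ \<rho>]) simp
next
  fix F x b assume "\<exists>\<rho>. F = conv y \<rho> \<and> test_fun UNIV \<rho>"
  then obtain \<rho> where F: "F = conv y \<rho>" "test_fun UNIV \<rho>" by (elim exE conjE)
  show "F differentiable (at x)"
    unfolding F(1) differentiable_def by (rule exI, rule conv_has_derivative[OF y F(2)])
  show "\<exists>\<rho>. pd F b = conv y \<rho> \<and> test_fun UNIV \<rho>"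
    unfolding F(1) pd_conv[OF y F(2)] using test_fun_pd[OF F(2)] by (intro exI[of _ "pd \<rho> b"]) simp
qed

lemma lap_conv:
  assumes y: "cont y" and \<rho>: "test_fun UNIV \<rho>" shows "lap (conv y \<rho>) = conv y (lap \<rho>)"
proof
  fix x
  have "lap (conv y \<rho>) x = (\<Sum>b\<in>Basis. LBINT z. y z * pd (pd \<rho> b) b (x - z))"
    by (simp add: lap_def pd_conv[OF y \<rho>] pd_conv[OF y test_fun_pd[OF \<rho>]] conv_def)
  also have "\<dots> = conv y (lap \<rho>) x" unfolding conv_def lap_def sum_distrib_left
    by (intro bochner_integral_sum[symmetric] conv_integrable y test_fun_pd \<rho>)
  finally show "lap (conv y \<rho>) x = conv y (lap \<rho>) x" .
qed

lemma conv_mollifier_close: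
  fixes y :: "'a::euclidean_space \<Rightarrow> real"
  assumes y: "cont y" and \<epsilon>: "\<epsilon> > 0" and close: "\<And>z. norm (x - z) \<le> \<epsilon> \<Longrightarrow> \<bar>y z - c\<bar> \<le> k"
  shows "\<bar>conv y (mollifier \<epsilon>) x - c\<bar> \<le> k"
proof -
  let ?\<rho> = "\<lambda>z. mollifier \<epsilon> (x - z)"
  have int: "integrable lborel (\<lambda>z. y z * ?\<rho> z)" "integrable lborel ?\<rho>"
    using conv_integrable[OF y test_fun_mollifier_UNIV[OF \<epsilon>], of x]
      conv_integrable[of "\<lambda>_. 1", OF _ test_fun_mollifier_UNIV[OF \<epsilon>], of x] by simp_all
  have "conv y (mollifier \<epsilon>) x - c = (LBINT z. (y z - c) * ?\<rho> z)"
    using int mollifier_reflect_integral[OF \<epsilon>, of x] by (simp add: conv_def left_diff_distrib)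
  also have "\<bar>\<dots>\<bar> \<le> (LBINT z. k * ?\<rho> z)"
  proof (rule order_trans[OF integral_abs_bound], rule integral_mono)
    show "integrable lborel (\<lambda>z. \<bar>(y z - c) * ?\<rho> z\<bar>)" using int by (simp add: left_diff_distrib)
    show "\<bar>(y z - c) * ?\<rho> z\<bar> \<le> k * ?\<rho> z" for z
      using close[of z] mollifier_nonneg[OF \<epsilon>, of "x - z"] mollifier_outside[OF \<epsilon>, of "x - z"]
      by (cases "norm (x - z) \<le> \<epsilon>") (auto simp: abs_mult intro: mult_right_mono)
  qed (use int in simp)
  finally show ?thesis by (simp add: mollifier_reflect_integral[OF \<epsilon>])
qed

lemma uniformly_continuous_near_bounded:
  fixes y :: "'a::euclidean_space \<Rightarrow> real"
  assumes y: "cont y" and S: "bounded S" and e: "e > 0"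
  obtains d where "d > 0" "\<And>x z. x \<in> S \<Longrightarrow> norm (x - z) < d \<Longrightarrow> \<bar>y x - y z\<bar> < e"
proof -
  obtain R where R: "\<And>x. x \<in> S \<Longrightarrow> norm x \<le> R" using S bounded_iff by blast
  have "uniformly_continuous_on (cball 0 (R + 1)) y"
    using y by (intro compact_uniformly_continuous) (auto intro: continuous_on_subset)
  then obtain d where d: "d > 0"
      "\<And>x z. norm x \<le> R + 1 \<Longrightarrow> norm z \<le> R + 1 \<Longrightarrow> dist x z < d \<Longrightarrow> \<bar>y x - y z\<bar> < e"
    unfolding uniformly_continuous_on_def dist_real_def using e by (metis mem_cball_0)
  show ?thesis
  proof (rule that[of "min d 1"])
    fix x z assume xz: "x \<in> S" "norm (x - z) < min d 1"
    then have "norm z \<le> R + 1" using norm_triangle_ineq2[of z x] R[of x] by (simp add: norm_minus_commute)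
    then show "\<bar>y x - y z\<bar> < e" using d(2)[of x z] xz R[of x] by (simp add: dist_norm)
  qed (use d in simp)
qed

lemma second_derivative_nonpos_at_max:
  fixes f :: "'a::euclidean_space \<Rightarrow> real"
  assumes f: "smooth f" and r: "r > 0" and max_at_x: "\<And>z. norm (z - x) < r \<Longrightarrow> f z \<le> f x" and b: "b \<in> Basis"
  shows "pd (pd f b) b x \<le> 0"
proof (rule ccontr)
  assume "\<not> ?thesis"
  then have pos: "pd (pd f b) b x > 0" by simp
  define g where "g t = f (x + t *\<^sub>R b)" for t
  define g' where "g' t = pd f b (x + t *\<^sub>R b)" for t
  have g: "(g has_real_derivative g' t) (at t)" for t
    unfolding g_def[abs_def] g'_def by (rule line_derivative[OF smooth_differentiable[OF f]])
  have "(g' has_real_derivative pd (pd f b) b (x + 0 *\<^sub>R b)) (at 0)"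
    unfolding g'_def[abs_def] by (rule line_derivative[OF smooth_differentiable[OF smooth_pd[OF f]]])
  then have "(g' has_real_derivative pd (pd f b) b x) (at 0)" by simp
  from DERIV_pos_inc_right[OF this pos] obtain d where d: "d > 0" "\<And>h. 0 < h \<Longrightarrow> h < d \<Longrightarrow> g' 0 < g' h" by auto
  have max_at_0: "g t \<le> g 0" if "\<bar>t\<bar> < r" for t using max_at_x[of "x + t *\<^sub>R b"] that b by (simp add: g_def)
  have "g' 0 = 0" by (rule DERIV_local_max[OF g r]) (use max_at_0 in auto)
  define h where "h = min d r / 2"
  have h: "0 < h" "h < d" "h < r" using d r by (auto simp: h_def)
  obtain t where "0 < t" "t < h" "g h - g 0 = (h - 0) * g' t"
    using MVT2[of 0 h g g'] g h by auto
  then have "g h > g 0" using d(2)[of t] h \<open>g' 0 = 0\<close> by (smt (verit) mult_pos_pos)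
  with max_at_0[of h] h show False by simp
qed

lemma lap_nonpos_at_max:
  assumes "smooth f" "r > 0" "\<And>z. norm (z - x) < r \<Longrightarrow> f z \<le> f x" shows "lap f x \<le> 0"
  unfolding lap_def using second_derivative_nonpos_at_max[OF assms] by (rule sum_nonpos)

lemma mollifier_close_on_compact:
  fixes w :: "'a::euclidean_space \<Rightarrow> real"
  assumes w: "cont w" and A: "compact A" and U: "open U" "A \<subseteq> U" and e: "e > 0"
  obtains \<epsilon> where "\<epsilon> > 0" "\<And>z. z \<in> A \<Longrightarrow> cball z \<epsilon> \<subseteq> U" "\<And>z. z \<in> A \<Longrightarrow> \<bar>conv w (mollifier \<epsilon>) z - w z\<bar> \<le> e"
proof -
  obtain r where r: "r > 0" "(\<Union>z\<in>A. ball z r) \<subseteq> U"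
    using compact_subset_open_imp_ball_epsilon_subset[OF A U] by blast
  obtain d where d: "d > 0" "\<And>z z'. z \<in> A \<Longrightarrow> norm (z - z') < d \<Longrightarrow> \<bar>w z - w z'\<bar> < e"
    using uniformly_continuous_near_bounded[OF w compact_imp_bounded[OF A] e] by auto
  define \<epsilon> where "\<epsilon> = min r d / 2"
  have \<epsilon>: "\<epsilon> > 0" "\<epsilon> < r" "\<epsilon> < d" using r d by (auto simp: \<epsilon>_def)
  show ?thesis
  proof (rule that[OF \<epsilon>(1)])
    fix z assume z: "z \<in> A"
    have "cball z \<epsilon> \<subseteq> ball z r" using \<epsilon>(2) by auto
    then show "cball z \<epsilon> \<subseteq> U" using r(2) z by blast
    show "\<bar>conv w (mollifier \<epsilon>) z - w z\<bar> \<le> e"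
    proof (rule conv_mollifier_close[OF w \<epsilon>(1)])
      show "\<bar>w z' - w z\<bar> \<le> e" if "norm (z - z') \<le> \<epsilon>" for z'
        using d(2)[OF z, of z'] \<epsilon>(3) that by (simp add: abs_minus_commute)
    qed
  qed
qed

lemma lap_conv_mollifier_nonneg:
  assumes w: "cont w" and \<epsilon>: "\<epsilon> > 0" "cball z \<epsilon> \<subseteq> U"
    and subharmonic: "\<And>\<phi>. test_fun U \<phi> \<Longrightarrow> (\<And>x. 0 \<le> \<phi> x) \<Longrightarrow> 0 \<le> (LBINT x. w x * lap \<phi> x)"
  shows "0 \<le> lap (conv w (mollifier \<epsilon>)) z"
  using subharmonic[OF test_fun_mollifier[OF \<epsilon>]]
  unfolding lap_conv[OF w test_fun_mollifier_UNIV[OF \<epsilon>(1)]] conv_def lap_reflect[OF mollifier_smooth[OF \<epsilon>(1)]]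
  by (simp add: mollifier_nonneg[OF \<epsilon>(1)])

lemma
  fixes g :: "'a::euclidean_space \<Rightarrow> real"
  assumes g: "smooth g"
  shows smooth_add_sqdist: "smooth (\<lambda>z. g z + k * ((z - x) \<bullet> (z - x)))"
    and lap_add_sqdist: "lap (\<lambda>z. g z + k * ((z - x) \<bullet> (z - x))) z = lap g z + k * (2 * DIM('a))"
proof -
  have sqdist: "smooth (\<lambda>z. (z - x) \<bullet> (z - x))" by (intro elementary_smooth elementary_sqdist)
  show "smooth (\<lambda>z. g z + k * ((z - x) \<bullet> (z - x)))" by (intro smooth_add g smooth_cmult sqdist)
  show "lap (\<lambda>z. g z + k * ((z - x) \<bullet> (z - x))) z = lap g z + k * (2 * DIM('a))"
    unfolding lap_add[OF g smooth_cmult[OF sqdist]] lap_cmult[OF sqdist] lap_sqdist ..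
qed

(* If w(x) = m > 0, mollify w near the compact set where w \<ge> m/2 and add a small multiple of
      |z - x|^2: the maximum over that set is interior, yet the Laplacian there is positive. *)
lemma maximum_principle:
  fixes w :: "'a::euclidean_space \<Rightarrow> real"
  assumes D: "open D" "bounded D" and w: "cont w"
    and boundary: "\<And>x. x \<in> frontier D \<Longrightarrow> w x \<le> 0"
    and subharmonic: "\<And>\<phi>. test_fun (D \<inter> {x. 0 < w x}) \<phi> \<Longrightarrow> (\<And>x. 0 \<le> \<phi> x) \<Longrightarrow> 0 \<le> (LBINT x. w x * lap \<phi> x)"
    and x: "x \<in> D"
  shows "w x \<le> 0"
proof (rule ccontr)
  define m where "m = w x"
  assume "\<not> w x \<le> 0"
  then have m: "m > 0" by (simp add: m_def)
  define A where "A = closure D \<inter> {z. m / 2 \<le> w z}"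
  have A: "compact A" unfolding A_def
    using D w by (intro compact_Int_closed closed_Collect_le) (auto simp: compact_closure)
  have "z \<in> D" if "z \<in> A" for z
    using that boundary[of z] m D(1) by (auto simp: A_def frontier_def interior_open)
  then have A_sub: "A \<subseteq> D \<inter> {x. 0 < w x}" using m by (auto simp: A_def)
  have above: "open (D \<inter> {x. s < w x})" for s using D(1) w
    by (intro open_Int open_Collect_less continuous_on_const)
  have "bounded ((\<lambda>z. (z - x) \<bullet> (z - x)) ` A)"
    by (intro compact_imp_bounded compact_continuous_image continuous_intros A)
  then obtain R where R: "R > 0" "\<And>z. z \<in> A \<Longrightarrow> (z - x) \<bullet> (z - x) \<le> R" unfolding bounded_pos by fastforce
  obtain \<epsilon> where \<epsilon>: "\<epsilon> > 0" "\<And>z. z \<in> A \<Longrightarrow> cball z \<epsilon> \<subseteq> D \<inter> {x. 0 < w x}"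
    and close: "\<And>z. z \<in> A \<Longrightarrow> \<bar>conv w (mollifier \<epsilon>) z - w z\<bar> \<le> m / 8"
    using mollifier_close_on_compact[OF w A above A_sub, of "m / 8"] m by auto
  define F where "F z = conv w (mollifier \<epsilon>) z + m / (8 * R) * ((z - x) \<bullet> (z - x))" for z
  have smooth: "smooth (conv w (mollifier \<epsilon>))" by (intro smooth_conv w test_fun_mollifier_UNIV \<epsilon>)
  have F: "smooth F" unfolding F_def[abs_def] by (rule smooth_add_sqdist[OF smooth])
  have x_in_A: "x \<in> A" using x m closure_subset[of D] by (auto simp: A_def m_def)
  obtain z where z: "z \<in> A" "\<And>z'. z' \<in> A \<Longrightarrow> F z' \<le> F z"
    using continuous_attains_sup[OF A _ smooth_continuous[OF F]] x_in_A by blast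
  have "m / (8 * R) * ((z - x) \<bullet> (z - x)) \<le> m / 8"
    using mult_left_mono[OF R(2)[OF z(1)], of "m / (8 * R)"] m R(1) by simp
  then have "F z \<le> w z + m / 4" using close[OF z(1)] unfolding F_def by linarith
  moreover have "F x = conv w (mollifier \<epsilon>) x" by (simp add: F_def)
  then have "m - m / 8 \<le> F x" using close[OF x_in_A] unfolding m_def by linarith
  ultimately have "z \<in> D \<inter> {z. m / 2 < w z}" using z(2)[OF x_in_A] m A_sub z(1) by auto
  then obtain s where s: "s > 0" "ball z s \<subseteq> D \<inter> {z. m / 2 < w z}" using above by (metis open_contains_ball)
  have "lap F z \<le> 0"
  proof (rule lap_nonpos_at_max[OF F s(1)])
    fix z' assume "norm (z' - z) < s"
    then have "z' \<in> D \<inter> {z. m / 2 < w z}" by (intro subsetD[OF s(2)]) (simp add: dist_norm norm_minus_commute)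
    then show "F z' \<le> F z" using closure_subset[of D] by (intro z(2)) (auto simp: A_def)
  qed
  moreover have "0 \<le> lap (conv w (mollifier \<epsilon>)) z"
    by (rule lap_conv_mollifier_nonneg[OF w \<epsilon>(1) \<epsilon>(2)[OF z(1)] subharmonic])
  moreover have "lap F z = lap (conv w (mollifier \<epsilon>)) z + m / (8 * R) * (2 * DIM('a))"
    unfolding F_def[abs_def] by (rule lap_add_sqdist[OF smooth])
  moreover have "0 < m / (8 * R) * (2 * DIM('a))" using m R(1) by simp
  ultimately show False by linarith
qed

section \<open>Square integrable functions\<close>

definition square_integrable :: "'b measure \<Rightarrow> ('b \<Rightarrow> real) \<Rightarrow> bool" where
  "square_integrable M f \<longleftrightarrow> f \<in> borel_measurable M \<and> integrable M (\<lambda>x. (f x)\<^sup>2)"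

definition L2_inner :: "'b measure \<Rightarrow> ('b \<Rightarrow> real) \<Rightarrow> ('b \<Rightarrow> real) \<Rightarrow> real" where
  "L2_inner M f g = (\<integral>x. f x * g x \<partial>M)"

definition L2_sqnorm :: "'b measure \<Rightarrow> ('b \<Rightarrow> real) \<Rightarrow> real" where
  "L2_sqnorm M f = (\<integral>x. (f x)\<^sup>2 \<partial>M)"

definition L2_Cauchy :: "'b measure \<Rightarrow> (nat \<Rightarrow> 'b \<Rightarrow> real) \<Rightarrow> bool" where
  "L2_Cauchy M v \<longleftrightarrow> (\<forall>e>0. \<exists>N. \<forall>j\<ge>N. \<forall>k\<ge>N. L2_sqnorm M (\<lambda>x. v j x - v k x) \<le> e)"

lemma square_integrable_measurable: "square_integrable M f \<Longrightarrow> f \<in> borel_measurable M"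
  by (simp add: square_integrable_def)

lemma square_integrable_square: "square_integrable M f \<Longrightarrow> integrable M (\<lambda>x. (f x)\<^sup>2)"
  by (simp add: square_integrable_def)

lemma L2_sqnorm_nonneg [simp]: "0 \<le> L2_sqnorm M f"
  by (simp add: L2_sqnorm_def)

lemma L2_inner_commute: "L2_inner M f g = L2_inner M g f"
  by (simp add: L2_inner_def mult.commute)

lemma L2_inner_self: "L2_inner M f f = L2_sqnorm M f"
  by (simp add: L2_inner_def L2_sqnorm_def power2_eq_square)

lemma L2_sqnorm_minus_commute: "L2_sqnorm M (\<lambda>x. f x - g x) = L2_sqnorm M (\<lambda>x. g x - f x)"
  by (simp add: L2_sqnorm_def power2_commute)

lemma L2_inner_cmult: "L2_inner M (\<lambda>x. c * f x) g = c * L2_inner M f g"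
  by (simp add: L2_inner_def mult.assoc)

lemma L2_sqnorm_cmult: "L2_sqnorm M (\<lambda>x. c * f x) = c\<^sup>2 * L2_sqnorm M f"
  by (simp add: L2_sqnorm_def power_mult_distrib)

lemma square_integrable_bound:
  assumes "f \<in> borel_measurable M" "integrable M g" "\<And>x. (f x)\<^sup>2 \<le> g x"
  shows "square_integrable M f" and "L2_sqnorm M f \<le> (\<integral>x. g x \<partial>M)"
proof -
  show f: "square_integrable M f" unfolding square_integrable_def
    using bochner_integrable_bound[OF assms(2), of "\<lambda>x. (f x)\<^sup>2"] assms(1,3)
        order_trans[OF assms(3) abs_ge_self]
    by (auto intro!: AE_I2)
  show "L2_sqnorm M f \<le> (\<integral>x. g x \<partial>M)" unfolding L2_sqnorm_def
    by (rule integral_mono[OF square_integrable_square[OF f] assms(2,3)])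
qed

lemma square_integrable_imp_integrable_mult:
  assumes "square_integrable M f" "square_integrable M g" shows "integrable M (\<lambda>x. f x * g x)"
proof (rule bochner_integrable_bound[OF bochner_integrable_add[OF assms[THEN square_integrable_square]]])
  have "\<bar>a * b\<bar> \<le> a\<^sup>2 + b\<^sup>2" for a b :: real
    using sum_squares_bound[of a b] sum_squares_bound[of a "-b"] zero_le_power2[of a] zero_le_power2[of b]
    by (simp add: abs_le_iff)
  then show "AE x in M. norm (f x * g x) \<le> norm ((f x)\<^sup>2 + (g x)\<^sup>2)" by (auto intro!: AE_I2)
qed (use assms in \<open>auto simp: square_integrable_def\<close>)

lemma
  assumes f: "square_integrable M f" and g: "square_integrable M g"
  shows square_integrable_lincomb: "square_integrable M (\<lambda>x. a * f x + b * g x)"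
    and L2_sqnorm_lincomb: "L2_sqnorm M (\<lambda>x. a * f x + b * g x) =
      a\<^sup>2 * L2_sqnorm M f + 2 * a * b * L2_inner M f g + b\<^sup>2 * L2_sqnorm M g"
proof -
  note int = f[THEN square_integrable_square] g[THEN square_integrable_square]
    square_integrable_imp_integrable_mult[OF f g]
  have square: "(\<lambda>x. (a * f x + b * g x)\<^sup>2) = (\<lambda>x. a\<^sup>2 * (f x)\<^sup>2 + 2 * a * b * (f x * g x) + b\<^sup>2 * (g x)\<^sup>2)"
    by (auto simp: power2_eq_square algebra_simps)
  show "square_integrable M (\<lambda>x. a * f x + b * g x)" unfolding square_integrable_def square
    using int f g by (simp add: square_integrable_def)
  show "L2_sqnorm M (\<lambda>x. a * f x + b * g x) =
      a\<^sup>2 * L2_sqnorm M f + 2 * a * b * L2_inner M f g + b\<^sup>2 * L2_sqnorm M g"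
    unfolding L2_sqnorm_def square L2_inner_def using int by simp
qed

lemma square_integrable_cmult: "square_integrable M f \<Longrightarrow> square_integrable M (\<lambda>x. c * f x)"
  using square_integrable_lincomb[of M f f c 0] by simp

lemma square_integrable_diff:
  "square_integrable M f \<Longrightarrow> square_integrable M g \<Longrightarrow> square_integrable M (\<lambda>x. f x - g x)"
  using square_integrable_lincomb[of M f g 1 "-1"] by simp

lemma L2_sqnorm_diff:
  "square_integrable M f \<Longrightarrow> square_integrable M g \<Longrightarrow>
    L2_sqnorm M (\<lambda>x. f x - g x) = L2_sqnorm M f - 2 * L2_inner M f g + L2_sqnorm M g"
  using L2_sqnorm_lincomb[of M f g 1 "-1"] by simp

lemma L2_inner_diff_left:
  "square_integrable M f \<Longrightarrow> square_integrable M g \<Longrightarrow> square_integrable M h \<Longrightarrow>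
    L2_inner M (\<lambda>x. f x - g x) h = L2_inner M f h - L2_inner M g h"
  unfolding L2_inner_def left_diff_distrib
  by (intro bochner_integral_diff square_integrable_imp_integrable_mult)

lemma L2_inner_lincomb_right:
  "square_integrable M f \<Longrightarrow> square_integrable M g \<Longrightarrow> square_integrable M h \<Longrightarrow>
    L2_inner M f (\<lambda>x. a * g x + b * h x) = a * L2_inner M f g + b * L2_inner M f h"
  using square_integrable_imp_integrable_mult[of M f g] square_integrable_imp_integrable_mult[of M f h]
  by (simp add: L2_inner_def distrib_left mult.left_commute)

lemma L2_inner_diff_right:
  "square_integrable M f \<Longrightarrow> square_integrable M g \<Longrightarrow> square_integrable M h \<Longrightarrow>
    L2_inner M f (\<lambda>x. g x - h x) = L2_inner M f g - L2_inner M f h"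
  using L2_inner_lincomb_right[of M f g h 1 "-1"] by simp

lemma L2_sqnorm_sum_le:
  assumes "square_integrable M g" "square_integrable M h"
  shows "L2_sqnorm M (\<lambda>x. g x + h x) \<le> 2 * L2_sqnorm M g + 2 * L2_sqnorm M h"
  using L2_sqnorm_lincomb[OF assms, of 1 1] L2_sqnorm_diff[OF assms] L2_sqnorm_nonneg[of M "\<lambda>x. g x - h x"]
  by simp

lemma parallelogram_L2:
  assumes "square_integrable M f" "square_integrable M g"
  shows "L2_sqnorm M (\<lambda>x. f x - g x) =
    2 * L2_sqnorm M f + 2 * L2_sqnorm M g - 4 * L2_sqnorm M (\<lambda>x. 1/2 * f x + 1/2 * g x)"
  unfolding L2_sqnorm_diff[OF assms] L2_sqnorm_lincomb[OF assms] by (simp add: power2_eq_square)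

lemma discriminant_nonpos:
  fixes a b c :: real
  assumes nonneg: "\<And>t. 0 \<le> a + 2 * t * b + t\<^sup>2 * c" and c: "0 \<le> c" shows "b\<^sup>2 \<le> a * c"
proof (cases "c = 0")
  case True
  then have "b = 0" using nonneg[of "- (a + 1) / (2 * b)"] by (cases "b = 0") (auto simp: field_simps)
  then show ?thesis using True by simp
next
  case False
  have "0 \<le> a + 2 * (- b / c) * b + (- b / c)\<^sup>2 * c" by (rule nonneg)
  also have "\<dots> = a - b\<^sup>2 / c" using False by (simp add: power2_eq_square field_simps)
  finally show ?thesis using False c by (simp add: field_simps)
qed

lemma Cauchy_Schwarz_L2:
  assumes "square_integrable M f" "square_integrable M g"
  shows "\<bar>L2_inner M f g\<bar> \<le> sqrt (L2_sqnorm M f) * sqrt (L2_sqnorm M g)"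
proof -
  have "0 \<le> L2_sqnorm M f + 2 * t * L2_inner M f g + t\<^sup>2 * L2_sqnorm M g" for t
    using L2_sqnorm_lincomb[OF assms, of 1 t] L2_sqnorm_nonneg[of M "\<lambda>x. 1 * f x + t * g x"] by simp
  then have "(L2_inner M f g)\<^sup>2 \<le> L2_sqnorm M f * L2_sqnorm M g" by (rule discriminant_nonpos) simp
  then show ?thesis by (metis real_sqrt_abs real_sqrt_le_mono real_sqrt_mult)
qed

lemma L2_inner_tendsto:
  assumes f: "\<And>k. square_integrable M (F k)" "square_integrable M f" "(\<lambda>k. L2_sqnorm M (\<lambda>x. F k x - f x)) \<longlonglongrightarrow> 0"
    and g: "\<And>k. square_integrable M (G k)" "square_integrable M g" "(\<lambda>k. L2_sqnorm M (\<lambda>x. G k x - g x)) \<longlonglongrightarrow> 0"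
  shows "(\<lambda>k. L2_inner M (F k) (G k)) \<longlonglongrightarrow> L2_inner M f g"
proof -
  define nf ng where "nf k = sqrt (L2_sqnorm M (\<lambda>x. F k x - f x))"
    and "ng k = sqrt (L2_sqnorm M (\<lambda>x. G k x - g x))" for k
  define A B where "A = sqrt (L2_sqnorm M f)" and "B = sqrt (L2_sqnorm M g)"
  have bound: "\<bar>L2_inner M (F k) (G k) - L2_inner M f g\<bar> \<le> nf k * ng k + nf k * B + A * ng k" for k
  proof -
    note df = square_integrable_diff[OF f(1,2), of k] and dg = square_integrable_diff[OF g(1,2), of k]
    have "L2_inner M (F k) (G k) - L2_inner M f g = L2_inner M (\<lambda>x. F k x - f x) (\<lambda>x. G k x - g x) +
        L2_inner M (\<lambda>x. F k x - f x) g + L2_inner M f (\<lambda>x. G k x - g x)"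
      using f(1)[of k] f(2) g(1)[of k] g(2) df dg
      by (simp add: L2_inner_diff_left L2_inner_diff_right)
    also have "\<bar>\<dots>\<bar> \<le> nf k * ng k + nf k * B + A * ng k"
      unfolding nf_def ng_def A_def B_def
      by (intro order_trans[OF abs_triangle_ineq] add_mono Cauchy_Schwarz_L2 df dg f(2) g(2))
    finally show ?thesis .
  qed
  have "nf \<longlonglongrightarrow> 0" "ng \<longlonglongrightarrow> 0"
    unfolding nf_def[abs_def] ng_def[abs_def] using tendsto_real_sqrt[OF f(3)] tendsto_real_sqrt[OF g(3)]
    by simp_all
  then have "(\<lambda>k. nf k * ng k + nf k * B + A * ng k) \<longlonglongrightarrow> 0 * 0 + 0 * B + A * 0" by (intro tendsto_intros)
  then have "(\<lambda>k. nf k * ng k + nf k * B + A * ng k) \<longlonglongrightarrow> 0" by simp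
  then have "(\<lambda>k. L2_inner M (F k) (G k) - L2_inner M f g) \<longlonglongrightarrow> 0"
    by (rule Lim_null_comparison[rotated]) (simp add: bound)
  then show ?thesis by (simp add: LIM_zero_iff)
qed

lemma L2_CauchyI:
  assumes "\<And>e. e > 0 \<Longrightarrow> \<forall>\<^sub>F j in sequentially. \<forall>k\<ge>j. L2_sqnorm M (\<lambda>x. v j x - v k x) \<le> e"
  shows "L2_Cauchy M v"
  unfolding L2_Cauchy_def
proof (intro allI impI)
  fix e :: real assume "e > 0"
  then obtain N where N: "\<And>j k. j \<ge> N \<Longrightarrow> k \<ge> j \<Longrightarrow> L2_sqnorm M (\<lambda>x. v j x - v k x) \<le> e"
    using assms[of e] by (auto simp: eventually_sequentially)
  have "L2_sqnorm M (\<lambda>x. v j x - v k x) \<le> e" if "j \<ge> N" "k \<ge> N" for j k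
    using N[of j k] N[of k j] that L2_sqnorm_minus_commute[of M "v j" "v k"] by (cases "j \<le> k") auto
  then show "\<exists>N. \<forall>j\<ge>N. \<forall>k\<ge>N. L2_sqnorm M (\<lambda>x. v j x - v k x) \<le> e" by blast
qed

lemma AE_convergent_if_L2_increments_small:
  assumes v: "\<And>k. square_integrable M (v k)"
    and small: "\<And>k. L2_sqnorm M (\<lambda>x. v (Suc k) x - v k x) \<le> (1/4) ^ k"
  shows "AE x in M. convergent (\<lambda>k. v k x)"
proof -
  define D where "D k x = v (Suc k) x - v k x" for k x
  have D: "square_integrable M (D k)" for k unfolding D_def[abs_def] by (rule square_integrable_diff[OF v v])
  note [measurable] = square_integrable_measurable[OF D]
  have increment: "(\<integral>\<^sup>+x. ennreal (2 ^ k * (D k x)\<^sup>2) \<partial>M) \<le> ennreal ((1/2)^k)" for k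
  proof -
    have "(\<integral>\<^sup>+x. ennreal (2 ^ k * (D k x)\<^sup>2) \<partial>M) = ennreal (2 ^ k * L2_sqnorm M (D k))"
      using square_integrable_square[OF D[of k]] by (subst nn_integral_eq_integral) (auto simp: L2_sqnorm_def)
    also have "2 ^ k * L2_sqnorm M (D k) \<le> 2 ^ k * (1/4)^k" using small[of k] by (simp add: D_def[abs_def])
    also have "2 ^ k * (1/4)^k = (1/2 :: real)^k" by (simp flip: power_mult_distrib)
    finally show ?thesis by (simp add: ennreal_leI)
  qed
  have "(\<integral>\<^sup>+x. (\<Sum>k. ennreal (2 ^ k * (D k x)\<^sup>2)) \<partial>M) = (\<Sum>k. \<integral>\<^sup>+x. ennreal (2 ^ k * (D k x)\<^sup>2) \<partial>M)"
    by (rule nn_integral_suminf) measurable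
  also have "\<dots> \<le> (\<Sum>k. ennreal ((1/2)^k))" by (rule suminf_le[OF increment]) auto
  also have "\<dots> = ennreal (\<Sum>k. (1/2)^k)" by (rule suminf_ennreal2) (auto intro: summable_geometric)
  also have "\<dots> < \<infinity>" by simp
  finally have "(\<integral>\<^sup>+x. (\<Sum>k. ennreal (2 ^ k * (D k x)\<^sup>2)) \<partial>M) \<noteq> \<infinity>" by simp
  then have "AE x in M. (\<Sum>k. ennreal (2 ^ k * (D k x)\<^sup>2)) \<noteq> \<infinity>" by (intro nn_integral_PInf_AE) measurable
  then show ?thesis
  proof eventually_elim
    case (elim x)
    then have "summable (\<lambda>k. 2 ^ k * (D k x)\<^sup>2)" by (intro summable_suminf_not_top) auto
    then have sum: "summable (\<lambda>k. 2 ^ k * (D k x)\<^sup>2 + (1/2) ^ k)"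
      by (intro summable_add summable_geometric) auto
    have "norm (D k x) \<le> 2 ^ k * (D k x)\<^sup>2 + (1/2) ^ k" for k
    proof -
      have "0 \<le> 2 ^ k * (\<bar>D k x\<bar> - (1/2) ^ k)\<^sup>2" by simp
      also have "\<dots> = 2 ^ k * (D k x)\<^sup>2 - 2 * \<bar>D k x\<bar> + (1/2) ^ k"
        by (simp add: power2_eq_square algebra_simps flip: power_mult_distrib)
      finally show ?thesis by simp
    qed
    from summable_comparison_test'[OF sum this] have "convergent (\<lambda>n. \<Sum>k<n. D k x)"
      by (simp add: summable_iff_convergent)
    then have "convergent (\<lambda>n. v n x - v 0 x)" unfolding D_def sum_lessThan_telescope[of "\<lambda>k. v k x"] .
    from convergent_add[OF this convergent_const[of "v 0 x"]] show ?case by simp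
  qed
qed

lemma L2_Fatou:
  assumes w: "\<And>k. square_integrable M (w k)" and h [measurable]: "h \<in> borel_measurable M"
    and lim: "AE x in M. (\<lambda>k. w k x) \<longlonglongrightarrow> h x" and bound: "\<And>k. N \<le> k \<Longrightarrow> L2_sqnorm M (w k) \<le> e"
  shows "square_integrable M h" and "L2_sqnorm M h \<le> e"
proof -
  note [measurable] = square_integrable_measurable[OF w]
  have "0 \<le> e" using order_trans[OF L2_sqnorm_nonneg bound[OF order_refl]] .
  have "(\<integral>\<^sup>+x. ennreal ((h x)\<^sup>2) \<partial>M) = (\<integral>\<^sup>+x. liminf (\<lambda>k. ennreal ((w k x)\<^sup>2)) \<partial>M)"
  proof (rule nn_integral_cong_AE)
    show "AE x in M. ennreal ((h x)\<^sup>2) = liminf (\<lambda>k. ennreal ((w k x)\<^sup>2))"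
      using lim
    proof eventually_elim
      case (elim x)
      then have "(\<lambda>k. ennreal ((w k x)\<^sup>2)) \<longlonglongrightarrow> ennreal ((h x)\<^sup>2)" by (intro tendsto_ennrealI tendsto_intros)
      from lim_imp_Liminf[OF _ this] show ?case by simp
    qed
  qed
  also have "\<dots> \<le> liminf (\<lambda>k. \<integral>\<^sup>+x. ennreal ((w k x)\<^sup>2) \<partial>M)" by (rule nn_integral_liminf) measurable
  also have "\<dots> \<le> ennreal e"
  proof (rule Liminf_le)
    have "(\<integral>\<^sup>+x. ennreal ((w k x)\<^sup>2) \<partial>M) = ennreal (L2_sqnorm M (w k))" for k
      unfolding L2_sqnorm_def by (rule nn_integral_eq_integral[OF square_integrable_square[OF w]]) simp
    then show "\<forall>\<^sub>F k in sequentially. (\<integral>\<^sup>+x. ennreal ((w k x)\<^sup>2) \<partial>M) \<le> ennreal e"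
      using bound by (intro eventually_sequentiallyI[of N]) (simp add: ennreal_leI)
  qed simp
  finally have le: "(\<integral>\<^sup>+x. ennreal ((h x)\<^sup>2) \<partial>M) \<le> ennreal e" .
  have int: "integrable M (\<lambda>x. (h x)\<^sup>2)" by (rule integrableI_bounded) (use le in \<open>auto intro: le_less_trans\<close>)
  then show "square_integrable M h" by (simp add: square_integrable_def)
  show "L2_sqnorm M h \<le> e" using le nn_integral_eq_integral[OF int] \<open>0 \<le> e\<close> by (simp add: L2_sqnorm_def)
qed

lemma L2_complete:
  assumes v: "\<And>k. square_integrable M (v k)" and Cauchy: "L2_Cauchy M v"
  obtains g r where "square_integrable M g" "(\<lambda>k. L2_sqnorm M (\<lambda>x. v k x - g x)) \<longlonglongrightarrow> 0"
    "AE x in M. (\<lambda>k. v (r k) x) \<longlonglongrightarrow> g x"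
proof -
  note [measurable] = square_integrable_measurable[OF v]
  have "\<forall>k::nat. \<exists>N. \<forall>i\<ge>N. \<forall>j\<ge>N. L2_sqnorm M (\<lambda>x. v i x - v j x) \<le> (1/4)^k"
    using Cauchy by (simp add: L2_Cauchy_def)
  then obtain N where N: "\<And>k i j. i \<ge> N k \<Longrightarrow> j \<ge> N k \<Longrightarrow> L2_sqnorm M (\<lambda>x. v i x - v j x) \<le> (1/4)^k" by metis
  define r where "r k = k + (\<Sum>i\<le>k. N i)" for k
  have r: "N k \<le> r k" "N k \<le> r (Suc k)" "k \<le> r k" for k
    using member_le_sum[of k "{..k}" N] by (auto simp: r_def)
  have "AE x in M. convergent (\<lambda>k. v (r k) x)"
    by (rule AE_convergent_if_L2_increments_small[OF v N]) (rule r)+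
  define g where "g x = lim (\<lambda>k. v (r k) x)" for x
  have g [measurable]: "g \<in> borel_measurable M" unfolding g_def[abs_def] by measurable
  have lim: "AE x in M. (\<lambda>k. v (r k) x) \<longlonglongrightarrow> g x"
    using \<open>AE x in M. convergent (\<lambda>k. v (r k) x)\<close> by eventually_elim (simp add: g_def convergent_LIMSEQ_iff)
  have close: "square_integrable M (\<lambda>x. v j x - g x)" "L2_sqnorm M (\<lambda>x. v j x - g x) \<le> e"
    if K: "\<And>k. k \<ge> K \<Longrightarrow> L2_sqnorm M (\<lambda>x. v j x - v k x) \<le> e" for j K e
  proof -
    have "AE x in M. (\<lambda>k. v j x - v (r k) x) \<longlonglongrightarrow> v j x - g x"
      using lim by eventually_elim (intro tendsto_intros)
    moreover have "L2_sqnorm M (\<lambda>x. v j x - v (r k) x) \<le> e" if "K \<le> k" for k using K[of "r k"] r(3)[of k] that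
      by simp
    ultimately show "square_integrable M (\<lambda>x. v j x - g x)" "L2_sqnorm M (\<lambda>x. v j x - g x) \<le> e"
      using L2_Fatou[of M "\<lambda>k x. v j x - v (r k) x" "\<lambda>x. v j x - g x" K e] square_integrable_diff[OF v v]
      by auto
  qed
  have "(\<lambda>k. L2_sqnorm M (\<lambda>x. v k x - g x)) \<longlonglongrightarrow> 0"
  proof (rule LIMSEQ_I)
    fix e :: real assume "e > 0"
    then obtain K where "\<And>j k. j \<ge> K \<Longrightarrow> k \<ge> K \<Longrightarrow> L2_sqnorm M (\<lambda>x. v j x - v k x) \<le> e / 2"
      using Cauchy unfolding L2_Cauchy_def by (meson half_gt_zero)
    then show "\<exists>K. \<forall>j\<ge>K. norm (L2_sqnorm M (\<lambda>x. v j x - g x) - 0) < e"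
      using close(2)[of K _ "e / 2"] \<open>e > 0\<close> by (intro exI[of _ K]) force
  qed
  moreover have "square_integrable M g"
  proof -
    obtain K where "\<And>j k. j \<ge> K \<Longrightarrow> k \<ge> K \<Longrightarrow> L2_sqnorm M (\<lambda>x. v j x - v k x) \<le> 1"
      using Cauchy unfolding L2_Cauchy_def by (meson zero_less_one)
    then have "square_integrable M (\<lambda>x. v K x - g x)" by (intro close(1)) auto
    from square_integrable_diff[OF v[of K] this] show ?thesis by simp
  qed
  ultimately show ?thesis using that lim by blast
qed

(* by the parallelogram law *)
lemma almost_minimal_L2_Cauchy:
  fixes K :: "nat \<Rightarrow> ('b \<Rightarrow> real) set"
  assumes K: "\<And>n u. u \<in> K n \<Longrightarrow> square_integrable M u" and antimono: "\<And>n. K (Suc n) \<subseteq> K n"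
    and bounded: "\<And>n. \<exists>u\<in>K n. L2_sqnorm M u \<le> B"
    and midpoint: "\<And>n u w. u \<in> K n \<Longrightarrow> w \<in> K n \<Longrightarrow> (\<lambda>x. 1/2 * u x + 1/2 * w x) \<in> K n"
  obtains v where "\<And>n. v n \<in> K n" "\<And>n u. u \<in> K n \<Longrightarrow> L2_sqnorm M (v n) \<le> L2_sqnorm M u + 1 / real (Suc n)"
    "L2_Cauchy M v"
proof -
  define d where "d n = (INF u\<in>K n. L2_sqnorm M u)" for n
  have bdd: "bdd_below (L2_sqnorm M ` K n)" for n by (rule bdd_belowI[of _ 0]) auto
  have nonempty: "K n \<noteq> {}" for n using bounded[of n] by auto
  have d_le: "d n \<le> L2_sqnorm M u" if "u \<in> K n" for n u unfolding d_def by (rule cINF_lower[OF bdd that])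
  have "\<exists>u\<in>K n. L2_sqnorm M u < d n + 1 / real (Suc n)" for n
    using cINF_less_iff[OF nonempty bdd, of n "d n + 1 / real (Suc n)"] unfolding d_def by simp
  then obtain v where v: "\<And>n. v n \<in> K n" "\<And>n. L2_sqnorm M (v n) < d n + 1 / real (Suc n)" by metis
  have K_mono: "K k \<subseteq> K n" if "n \<le> k" for n k
    by (rule lift_Suc_antimono_le[where f = K, OF antimono that])
  have "incseq d" unfolding incseq_def d_def
    using K_mono by (intro allI impI cINF_superset_mono[OF nonempty bdd]) auto
  moreover have "d n \<le> B" for n using bounded[of n] d_le by (meson order_trans)
  ultimately obtain L where L: "d \<longlonglongrightarrow> L" "\<And>n. d n \<le> L" using incseq_convergent by metis
  have dist: "L2_sqnorm M (\<lambda>x. v n x - v k x) \<le> 2 * (L - d n) + 4 * (1 / real (Suc n))" if le: "n \<le> k" for n k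
  proof -
    have "v k \<in> K n" using v(1) K_mono[OF le] by blast
    then have "d n \<le> L2_sqnorm M (\<lambda>x. 1/2 * v n x + 1/2 * v k x)" by (intro d_le midpoint v(1))
    moreover have "1 / real (Suc k) \<le> 1 / real (Suc n)" using le by (simp add: frac_le)
    ultimately show ?thesis
      using parallelogram_L2[OF K[OF v(1)] K[OF v(1)], of n k] v(2)[of n] v(2)[of k] L(2)[of k] by argo
  qed
  have "L2_Cauchy M v"
  proof (rule L2_CauchyI)
    fix e :: real assume e: "e > 0"
    have "(\<lambda>n. 2 * (L - d n) + 4 * (1 / real (Suc n))) \<longlonglongrightarrow> 2 * (L - L) + 4 * 0"
      by (intro tendsto_intros L lim_1_over_n[THEN LIMSEQ_Suc])
    then have "\<forall>\<^sub>F n in sequentially. 2 * (L - d n) + 4 * (1 / real (Suc n)) < e"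
      by (rule order_tendstoD) (use e in simp)
    then show "\<forall>\<^sub>F n in sequentially. \<forall>k\<ge>n. L2_sqnorm M (\<lambda>x. v n x - v k x) \<le> e"
      by eventually_elim (use dist in \<open>force intro: order_trans less_imp_le\<close>)
  qed
  moreover have "L2_sqnorm M (v n) \<le> L2_sqnorm M u + 1 / real (Suc n)" if "u \<in> K n" for n u
    using v(2)[of n] d_le[OF that] by simp
  ultimately show ?thesis using that v(1) by blast
qed

lemma almost_minimal_limit_orthogonal:
  assumes v: "\<And>n. square_integrable M (v n)" and g: "square_integrable M g" and u: "square_integrable M u"
    and lim: "(\<lambda>n. L2_sqnorm M (\<lambda>x. v n x - g x)) \<longlonglongrightarrow> 0"
    and minimal: "\<And>n t. L2_sqnorm M (v n) \<le> L2_sqnorm M (\<lambda>x. 1 * v n x + t * u x) + 1 / real (Suc n)"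
  shows "L2_inner M g u = 0"
proof -
  have "(L2_inner M g u)\<^sup>2 \<le> 0 * L2_sqnorm M u"
  proof (rule discriminant_nonpos)
    fix t
    have "(\<lambda>n. L2_inner M (v n) u) \<longlonglongrightarrow> L2_inner M g u"
      by (rule L2_inner_tendsto[OF v g lim u u]) (simp add: L2_sqnorm_def)
    then have "(\<lambda>n. 1 / real (Suc n) + 2 * t * L2_inner M (v n) u + t\<^sup>2 * L2_sqnorm M u)
        \<longlonglongrightarrow> 0 + 2 * t * L2_inner M g u + t\<^sup>2 * L2_sqnorm M u"
      by (intro tendsto_intros lim_1_over_n[THEN LIMSEQ_Suc])
    then show "0 \<le> 0 + 2 * t * L2_inner M g u + t\<^sup>2 * L2_sqnorm M u"
    proof (rule LIMSEQ_le_const)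
      show "\<exists>N. \<forall>n\<ge>N. 0 \<le> 1 / real (Suc n) + 2 * t * L2_inner M (v n) u + t\<^sup>2 * L2_sqnorm M u"
        using minimal[of _ t] L2_sqnorm_lincomb[OF v u, of 1 _ t] by (simp add: add_ac)
    qed
  qed simp
  then show ?thesis by simp
qed

lemma minimising_sequence_in_hyperplane:
  assumes V: "\<And>u. u \<in> V \<Longrightarrow> square_integrable M u"
    and lin: "\<And>u w a b. u \<in> V \<Longrightarrow> w \<in> V \<Longrightarrow> (\<lambda>x. a * u x + b * w x) \<in> V"
    and l: "\<And>u w a b. u \<in> V \<Longrightarrow> w \<in> V \<Longrightarrow> l (\<lambda>x. a * u x + b * w x) = a * l u + b * l w"
    and w: "w \<in> V" "l w = (1::real)"
  obtains v g where "\<And>n. v n \<in> V" "\<And>n. l (v n) = 1"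
    "\<And>n u. u \<in> V \<Longrightarrow> l u = 1 \<Longrightarrow> L2_sqnorm M (v n) \<le> L2_sqnorm M u + 1 / real (Suc n)"
    "square_integrable M g" "(\<lambda>n. L2_sqnorm M (\<lambda>x. v n x - g x)) \<longlonglongrightarrow> 0"
proof -
  define K where "K = {u \<in> V. l u = 1}"
  obtain v where v: "\<And>n. v n \<in> K" "\<And>n u. u \<in> K \<Longrightarrow> L2_sqnorm M (v n) \<le> L2_sqnorm M u + 1 / real (Suc n)"
    "L2_Cauchy M v"
  proof (rule almost_minimal_L2_Cauchy[of "\<lambda>n. K" M "L2_sqnorm M w"])
    show "\<exists>u\<in>K. L2_sqnorm M u \<le> L2_sqnorm M w" for n :: nat using w by (auto simp: K_def)
    show "(\<lambda>x. 1/2 * u x + 1/2 * w x) \<in> K" if "u \<in> K" "w \<in> K" for n :: nat and u w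
      using that lin[of u w "1/2" "1/2"] l[of u w "1/2" "1/2"] by (simp add: K_def)
  qed (auto simp: K_def V that)
  have K: "v n \<in> V" "l (v n) = 1" for n using v(1)[of n] by (auto simp: K_def)
  obtain g where g: "square_integrable M g" "(\<lambda>n. L2_sqnorm M (\<lambda>x. v n x - g x)) \<longlonglongrightarrow> 0"
    using L2_complete[OF V[OF K(1)] v(3)] by blast
  show ?thesis by (rule that[OF K v(2) g]) (simp add: K_def)
qed

(* The minimal element of the hyperplane l = 1 is orthogonal to the kernel of l. *)
lemma riesz_representation_L2:
  assumes V: "\<And>u. u \<in> V \<Longrightarrow> square_integrable M u"
    and lin: "\<And>u w a b. u \<in> V \<Longrightarrow> w \<in> V \<Longrightarrow> (\<lambda>x. a * u x + b * w x) \<in> V"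
    and l: "\<And>u w a b. u \<in> V \<Longrightarrow> w \<in> V \<Longrightarrow> l (\<lambda>x. a * u x + b * w x) = a * l u + b * l w"
    and bound: "\<And>u. u \<in> V \<Longrightarrow> \<bar>l u\<bar> \<le> C * sqrt (L2_sqnorm M u)"
  shows "\<exists>g. square_integrable M g \<and> (\<forall>u\<in>V. L2_inner M g u = l u)"
proof (cases "\<forall>u\<in>V. l u = 0")
  case True
  then show ?thesis by (intro exI[of _ "\<lambda>x. 0"]) (auto simp: L2_inner_def square_integrable_def)
next
  case False
  then obtain u0 where u0: "u0 \<in> V" "l u0 \<noteq> 0" by blast
  define w where "w = (\<lambda>x. (1 / l u0) * u0 x + 0 * u0 x)"
  have w: "w \<in> V" "l w = 1" unfolding w_def
    using lin[OF u0(1) u0(1), of "1 / l u0" 0] l[OF u0(1) u0(1), of "1 / l u0" 0] u0(2) by simp_all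
  obtain v g where v: "\<And>n. v n \<in> V" "\<And>n. l (v n) = 1"
    and minimal: "\<And>n u. u \<in> V \<Longrightarrow> l u = 1 \<Longrightarrow> L2_sqnorm M (v n) \<le> L2_sqnorm M u + 1 / real (Suc n)"
    and g: "square_integrable M g" "(\<lambda>n. L2_sqnorm M (\<lambda>x. v n x - g x)) \<longlonglongrightarrow> 0"
    using minimising_sequence_in_hyperplane[where V = V and M = M and l = l, OF V lin l w] by blast
  have orthogonal: "L2_inner M g u = 0" if u: "u \<in> V" "l u = 0" for u
  proof (rule almost_minimal_limit_orthogonal[OF V[OF v(1)] g(1) V[OF u(1)] g(2)])
    show "L2_sqnorm M (v n) \<le> L2_sqnorm M (\<lambda>x. 1 * v n x + t * u x) + 1 / real (Suc n)" for n t
      by (rule minimal) (use lin[OF v(1) u(1), of 1 n t] l[OF v(1) u(1), of 1 n t] v(2) u(2) in \<open>simp_all\<close>)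
  qed
  define \<beta> where "\<beta> = L2_inner M g w"
  have multiple: "L2_inner M g u = l u * \<beta>" if u: "u \<in> V" for u
    using orthogonal[OF lin[OF u w(1), of 1 "- l u"]] l[OF u w(1), of 1 "- l u"] w(2)
      L2_inner_lincomb_right[OF g(1) V[OF u] V[OF w(1)], of 1 "- l u"] by (simp add: \<beta>_def)
  have "\<beta> \<noteq> 0"
  proof
    assume "\<beta> = 0"
    then have "L2_sqnorm M (v n) \<le> L2_sqnorm M (\<lambda>x. v n x - g x)" for n
      using multiple[OF v(1), of n] L2_sqnorm_diff[OF V[OF v(1)] g(1), of n] by (simp add: L2_inner_commute)
    then have "(\<lambda>n. L2_sqnorm M (v n)) \<longlonglongrightarrow> 0"
      by (intro tendsto_sandwich[OF _ _ tendsto_const g(2)] always_eventually) auto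
    then have "(\<lambda>n. C * sqrt (L2_sqnorm M (v n))) \<longlonglongrightarrow> C * sqrt 0" by (intro tendsto_intros)
    moreover have "1 \<le> C * sqrt (L2_sqnorm M (v n))" for n using bound[OF v(1), of n] v(2)[of n] by simp
    ultimately have "1 \<le> C * sqrt 0" by (intro LIMSEQ_le_const) auto
    then show False by simp
  qed
  then show ?thesis using square_integrable_cmult[OF g(1), of "inverse \<beta>"] multiple
    by (intro exI[of _ "\<lambda>x. inverse \<beta> * g x"]) (simp add: L2_inner_cmult)
qed

section \<open>The resolvent kernel of the Laplacian\<close>

definition gauss :: "'a::euclidean_space \<Rightarrow> real" where
  "gauss x = (\<Prod>b\<in>Basis. normal_density 0 (sqrt 2) (x \<bullet> b))"

lemma gauss_eq:
  fixes x :: "'a::euclidean_space"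
  shows "gauss x = gauss (0::'a) * exp (- (1/4) * ((x - 0) \<bullet> (x - 0)))"
proof -
  have "gauss x = (\<Prod>b\<in>Basis. normal_density 0 (sqrt 2) 0 * exp (- (1/4) * ((x \<bullet> b) * (x \<bullet> b))))"
    by (simp add: gauss_def normal_density_def power2_eq_square)
  also have "\<dots> = gauss (0::'a) * exp (\<Sum>b\<in>Basis. - (1/4) * ((x \<bullet> b) * (x \<bullet> b)))"
    by (simp add: prod.distrib gauss_def exp_sum)
  also have "(\<Sum>b\<in>Basis. - (1/4) * ((x \<bullet> b) * (x \<bullet> b))) = - (1/4) * ((x - 0) \<bullet> (x - 0))"
    unfolding sum_distrib_left[symmetric] by (simp add: euclidean_inner[of x x])
  finally show ?thesis .
qed

lemma gauss_0_pos: "0 < gauss (0::'a::euclidean_space)"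
  unfolding gauss_def by (intro prod_pos normal_density_pos) simp

lemma gauss_nonneg [simp]: "0 \<le> gauss x"
  unfolding gauss_def by (intro prod_nonneg) simp

lemma gauss_le: "gauss (x::'a::euclidean_space) \<le> gauss (0::'a)"
  using mult_left_le[of "exp (- (1/4) * (x \<bullet> x))" "gauss (0::'a)"] by (subst gauss_eq) simp

lemma gauss_minus: "gauss (- x) = gauss x"
  by (subst (1 2) gauss_eq) simp

lemma gauss_smooth: "smooth (gauss :: 'a::euclidean_space \<Rightarrow> real)"
  by (subst gauss_eq[abs_def])
    (intro smooth_cmult elementary_smooth elementary.exp elementary.mult elementary.const elementary_sqdist)

lemma gauss_measurable[measurable]: "gauss \<in> borel_measurable borel"
  by (intro borel_measurable_UNIV smooth_continuous gauss_smooth)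

lemma
  shows gauss_integrable: "integrable lborel (gauss :: 'a::euclidean_space \<Rightarrow> real)"
    and gauss_integral: "(LBINT z. gauss (z::'a)) = 1"
proof -
  have "(\<integral>\<^sup>+t. ennreal (normal_density 0 (sqrt 2) t) \<partial>lborel) = 1"
    by (subst nn_integral_eq_integral) auto
  then have "(\<integral>\<^sup>+z. (\<Prod>b\<in>Basis. ennreal (normal_density 0 (sqrt 2) ((z::'a) \<bullet> b))) \<partial>lborel) = 1"
    by (subst nn_integral_lborel_prod) auto
  then have "(\<integral>\<^sup>+z. ennreal (gauss (z::'a)) \<partial>lborel) = 1" by (simp add: gauss_def prod_ennreal)
  then have "has_bochner_integral lborel (gauss :: 'a \<Rightarrow> real) 1"
    by (intro has_bochner_integral_nn_integral) (auto simp: gauss_nonneg)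
  then show "integrable lborel (gauss :: 'a \<Rightarrow> real)" "(LBINT z. gauss (z::'a)) = 1"
    by (auto simp: has_bochner_integral_iff)
qed

lemma pd_gauss: "pd gauss b x = - ((x \<bullet> b) / 2) * gauss x"
proof -
  have "((\<lambda>x::'a. gauss (0::'a) * exp (- (1/4) * ((x - 0) \<bullet> (x - 0)))) has_derivative
      (\<lambda>h. - ((x \<bullet> h) / 2) * gauss x)) (at x)"
    by (subst gauss_eq[of x]) (auto intro!: derivative_eq_intros simp: inner_commute)
  then show ?thesis unfolding gauss_eq[abs_def, symmetric] by (rule pd_eq)
qed

lemma integrable_gaussian:
  assumes "a > 0" shows "integrable lborel (\<lambda>x::'a::euclidean_space. exp (- a * (x \<bullet> x)))"
proof -
  have "integrable lborel (\<lambda>x::'a. gauss (0 + (2 * sqrt a) *\<^sub>R x))"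
    by (rule lborel_integrable_affine[OF gauss_integrable]) (use assms in simp)
  moreover have "gauss (0 + (2 * sqrt a) *\<^sub>R x) = gauss (0::'a) * exp (- a * (x \<bullet> x))" for x :: 'a
    using assms by (subst gauss_eq) (simp flip: mult.assoc)
  ultimately show ?thesis using gauss_0_pos[where 'a = 'a] by simp
qed

lemma norm_times_gaussian_le: "t * exp (- (1/4) * t\<^sup>2) \<le> 2 * exp (- (1/8) * t\<^sup>2)" for t :: real
proof -
  have "0 \<le> (t / 2 - 1)\<^sup>2" by simp
  then have "t \<le> 2 * (1 + (1/8) * t\<^sup>2)" by (simp add: power2_eq_square algebra_simps)
  also have "\<dots> \<le> 2 * exp ((1/8) * t\<^sup>2)" by (intro mult_left_mono exp_ge_add_one_self) simp
  finally have "t * exp (- (1/4) * t\<^sup>2) \<le> 2 * exp ((1/8) * t\<^sup>2) * exp (- (1/4) * t\<^sup>2)"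
    by (intro mult_right_mono) auto
  then show ?thesis by (simp add: mult.assoc flip: exp_add)
qed

lemma gauss_moment: "integrable lborel (\<lambda>z::'a::euclidean_space. norm z * gauss z)"
proof (rule bochner_integrable_bound)
  show "integrable lborel (\<lambda>z::'a. (2 * gauss (0::'a)) * exp (- (1/8) * (z \<bullet> z)))"
    by (intro integrable_mult_right integrable_gaussian) simp
  show "AE z::'a in lborel. norm (norm z * gauss z) \<le> norm ((2 * gauss (0::'a)) * exp (- (1/8) * (z \<bullet> z)))"
  proof (rule AE_I2)
    fix z :: 'a
    show "norm (norm z * gauss z) \<le> norm ((2 * gauss (0::'a)) * exp (- (1/8) * (z \<bullet> z)))"
      using mult_left_mono[OF norm_times_gaussian_le[of "norm z"] less_imp_le[OF gauss_0_pos[where 'a = 'a]]]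
      by (subst gauss_eq) (simp add: dot_square_norm abs_mult mult_ac)
  qed
qed measurable

lemma gaussian_diff_le:
  fixes s t :: real
  assumes "0 \<le> s" "0 \<le> t"
  shows "\<bar>exp (- (1/4) * s\<^sup>2) - exp (- (1/4) * t\<^sup>2)\<bar> \<le> \<bar>s - t\<bar> * (exp (- (1/8) * s\<^sup>2) + exp (- (1/8) * t\<^sup>2))"
  using assms
proof (induction s t rule: linorder_wlog)
  case (le s t)
  show ?case
  proof (cases "s = t")
    case False
    have "((\<lambda>u. exp (- (1/4) * u\<^sup>2)) has_real_derivative - (u / 2) * exp (- (1/4) * u\<^sup>2)) (at u)"
      for u :: real
      by (auto intro!: derivative_eq_intros)
    then have "\<exists>u. s < u \<and> u < t \<and>
        exp (- (1/4) * t\<^sup>2) - exp (- (1/4) * s\<^sup>2) = (t - s) * (- (u / 2) * exp (- (1/4) * u\<^sup>2))"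
      using le(1) False by (intro MVT2) auto
    then obtain u where u: "s < u" "u < t"
        "exp (- (1/4) * t\<^sup>2) - exp (- (1/4) * s\<^sup>2) = (t - s) * (- (u / 2) * exp (- (1/4) * u\<^sup>2))" by blast
    have "u / 2 * exp (- (1/4) * u\<^sup>2) \<le> exp (- (1/8) * u\<^sup>2)" using norm_times_gaussian_le[of u] by simp
    also have "\<dots> \<le> exp (- (1/8) * s\<^sup>2)" using u(1) le(2) by (simp add: power_mono)
    also have "\<dots> \<le> exp (- (1/8) * s\<^sup>2) + exp (- (1/8) * t\<^sup>2)" by simp
    finally have "(t - s) * (u / 2 * exp (- (1/4) * u\<^sup>2)) \<le>
        (t - s) * (exp (- (1/8) * s\<^sup>2) + exp (- (1/8) * t\<^sup>2))"
      using le(1) by (intro mult_left_mono) auto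
    moreover have "0 \<le> (t - s) * (u / 2 * exp (- (1/4) * u\<^sup>2))" using le u(1)
      by (intro mult_nonneg_nonneg) auto
    ultimately show ?thesis using u(3) le(1) by (simp add: abs_le_iff)
  qed simp
qed (simp add: abs_minus_commute add.commute)

definition gauss_variation :: "'a::euclidean_space itself \<Rightarrow> real" where
  "gauss_variation _ = 2 * gauss (0::'a) * (LBINT z. exp (- (1/8) * (z \<bullet> (z::'a))))"

lemma gauss_variation_nonneg: "0 \<le> gauss_variation TYPE('a::euclidean_space)"
  by (simp add: gauss_variation_def gauss_nonneg)

lemma gauss_translation_L1:
  fixes h :: "'a::euclidean_space"
  shows "(LBINT z. \<bar>gauss z - gauss (z + h)\<bar>) \<le> gauss_variation TYPE('a) * norm h"
proof -
  define E where "E z = exp (- (1/8) * (z \<bullet> z))" for z :: 'a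
  have E: "integrable lborel E" unfolding E_def[abs_def] by (rule integrable_gaussian) simp
  have "\<bar>gauss z - gauss (z + h)\<bar> \<le> gauss (0::'a) * norm h * (E z + E (z + h))" for z
  proof -
    have "\<bar>gauss z - gauss (z + h)\<bar> = gauss (0::'a) * \<bar>exp (- (1/4) * (norm z)\<^sup>2) -
        exp (- (1/4) * (norm (z + h))\<^sup>2)\<bar>"
      by (subst (1 2) gauss_eq) (simp add: dot_square_norm abs_mult flip: right_diff_distrib')
    also have "\<dots> \<le> gauss (0::'a) * (\<bar>norm z - norm (z + h)\<bar> * (E z + E (z + h)))"
      unfolding E_def dot_square_norm by (intro mult_left_mono gaussian_diff_le gauss_nonneg) auto
    also have "\<dots> \<le> gauss (0::'a) * (norm h * (E z + E (z + h)))"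
      using norm_triangle_ineq3[of z "z + h"] by (intro mult_left_mono mult_right_mono gauss_nonneg)
          (auto simp: E_def)
    finally show ?thesis by (simp add: mult.assoc)
  qed
  then have "(LBINT z. \<bar>gauss z - gauss (z + h)\<bar>) \<le> (LBINT z. gauss (0::'a) * norm h * (E z + E (z + h)))"
    by (intro integral_mono integrable_abs bochner_integrable_diff integrable_mult_right
        bochner_integrable_add integrable_shift gauss_integrable E)
  also have "\<dots> = gauss (0::'a) * norm h * ((LBINT z. E z) + (LBINT z. E (z + h)))"
    using E integrable_shift[OF E] by simp
  also have "(LBINT z. E (z + h)) = (LBINT z. E z)"
    by (rule lborel_integral_shift) (use E in auto)
  finally show ?thesis by (simp add: gauss_variation_def E_def mult_ac)
qed

definition gauss_avg :: "('a::euclidean_space \<Rightarrow> real) \<Rightarrow> real \<Rightarrow> real" where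
  "gauss_avg \<psi> s = (LBINT z. gauss z * \<psi> (s *\<^sub>R z))"

lemma gauss_mult_integrable:
  fixes f :: "'a::euclidean_space \<Rightarrow> real"
  assumes "f \<in> borel_measurable borel" "\<And>x. \<bar>f x\<bar> \<le> C" shows "integrable lborel (\<lambda>z. gauss z * f z)"
  by (rule bochner_integrable_bound[OF integrable_mult_left[OF gauss_integrable, of C]])
    (use assms gauss_nonneg in
        \<open>auto simp: abs_mult intro!: mult_left_mono order_trans[OF _ abs_ge_self[of C]]\<close>)

lemma gauss_avg_integrable:
  fixes \<psi> :: "'a::euclidean_space \<Rightarrow> real"
  assumes [measurable]: "\<psi> \<in> borel_measurable borel" and "\<And>x. \<bar>\<psi> x\<bar> \<le> C"
  shows "integrable lborel (\<lambda>z. gauss z * \<psi> (s *\<^sub>R z))"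
  by (rule gauss_mult_integrable[where C = C]) (use assms in auto)

lemma gauss_avg_bound:
  fixes \<psi> :: "'a::euclidean_space \<Rightarrow> real"
  assumes "\<psi> \<in> borel_measurable borel" "\<And>x. \<bar>\<psi> x\<bar> \<le> C" shows "\<bar>gauss_avg \<psi> s\<bar> \<le> C"
proof -
  have "\<bar>gauss_avg \<psi> s\<bar> \<le> (LBINT z. gauss (z::'a) * C)" unfolding gauss_avg_def
    by (rule order_trans[OF integral_abs_bound
        integral_mono[OF integrable_abs[OF gauss_avg_integrable[OF assms]]]])
      (use assms(2) gauss_integrable in \<open>auto simp: abs_mult gauss_nonneg intro!: mult_left_mono\<close>)
  then show ?thesis by (simp add: gauss_integral)
qed

lemma isCont_gauss_avg:
  fixes \<psi> :: "'a::euclidean_space \<Rightarrow> real"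
  assumes \<psi>: "cont \<psi>" and C: "\<And>x. \<bar>\<psi> x\<bar> \<le> C" shows "isCont (gauss_avg \<psi>) s"
  unfolding continuous_at_sequentially o_def gauss_avg_def
proof (intro allI impI)
  fix X assume X: "X \<longlonglongrightarrow> s"
  note [measurable] = borel_measurable_UNIV[OF \<psi>]
  show "(\<lambda>n. LBINT z. gauss z * \<psi> (X n *\<^sub>R z)) \<longlonglongrightarrow> (LBINT z. gauss z * \<psi> (s *\<^sub>R z))"
  proof (rule integral_dominated_convergence[where w = "\<lambda>z. gauss z * C"])
    have "(\<lambda>n. \<psi> (X n *\<^sub>R z)) \<longlonglongrightarrow> \<psi> (s *\<^sub>R z)" for z
      using \<psi> by (intro isCont_tendsto_compose[of _ \<psi>] tendsto_intros X)
          (simp add: continuous_on_eq_continuous_at)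
    then show "AE z in lborel. (\<lambda>n. gauss z * \<psi> (X n *\<^sub>R z)) \<longlonglongrightarrow> gauss z * \<psi> (s *\<^sub>R z)"
      by (intro AE_I2 tendsto_mult_left)
  qed (use C gauss_integrable in \<open>auto simp: abs_mult gauss_nonneg intro!: mult_left_mono\<close>)
qed

lemma gauss_integration_by_parts:
  fixes \<psi> :: "'a::euclidean_space \<Rightarrow> real"
  assumes \<psi>: "test_fun UNIV \<psi>" and b: "b \<in> Basis"
  shows "(LBINT z. gauss z * ((z \<bullet> b) * \<psi> z)) = 2 * (LBINT z. gauss z * pd \<psi> b z)"
proof -
  have "(LBINT z. gauss z * pd \<psi> b z) = - (LBINT z. pd gauss b z * \<psi> z)"
    by (rule integration_by_parts_test_fun[OF gauss_smooth \<psi>])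
  also have "\<dots> = (LBINT z. gauss z * ((z \<bullet> b) * \<psi> z)) / 2"
    by (simp add: pd_gauss mult_ac flip: Bochner_Integration.integral_minus integral_divide_zero)
  finally show ?thesis by simp
qed

lemma gauss_avg_test_fun_integrable:
  fixes \<phi> :: "'a::euclidean_space \<Rightarrow> real"
  assumes "test_fun UNIV \<phi>" shows "integrable lborel (\<lambda>z. gauss z * \<phi> (s *\<^sub>R z))"
  using test_fun_bounded[OF assms] borel_measurable_UNIV[OF test_fun_continuous[OF assms]]
  by (blast intro: gauss_avg_integrable)

(* The heat equation in integrated form; Gaussian integration by parts replaces the time
      derivative of the kernel by the Laplacian of the test function. *)
lemma DERIV_gauss_avg:
  fixes \<phi> :: "'a::euclidean_space \<Rightarrow> real"
  assumes \<phi>: "test_fun UNIV \<phi>" and s: "s > 0"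
  shows "(gauss_avg \<phi> has_real_derivative 2 * s * gauss_avg (lap \<phi>) s) (at s)"
proof -
  note smooth = test_fun_smooth[OF \<phi>]
  obtain C where C: "\<And>x h. \<bar>pd \<phi> h x\<bar> \<le> C * norm h" using test_fun_pd_bounded[OF \<phi>] by blast
  have scaled: "test_fun UNIV (\<lambda>z. pd \<phi> b (s *\<^sub>R z))" for b
    using test_fun_affine[OF test_fun_pd[OF \<phi>], of s 1 b 0] s by simp
  have int: "integrable lborel (\<lambda>z. gauss z * ((z \<bullet> b) * pd \<phi> b (s *\<^sub>R z)))" for b
    using integrable_times_test_fun[OF _ scaled, of "\<lambda>z. gauss z * (z \<bullet> b)" b]
      continuous_on_mult[OF smooth_continuous[OF gauss_smooth], of UNIV "\<lambda>z. z \<bullet> b"]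
    by (simp add: continuous_on_inner mult.assoc)
  have radial: "gauss z * pd \<phi> z (s *\<^sub>R z) = (\<Sum>b\<in>Basis. gauss z * ((z \<bullet> b) * pd \<phi> b (s *\<^sub>R z)))" for z
    by (simp add: pd_basis_sum[OF smooth_differentiable[OF smooth], of z] sum_distrib_left)
  have "(gauss_avg \<phi> has_real_derivative (LBINT z. gauss z * pd \<phi> z (s *\<^sub>R z))) (at s)"
    unfolding gauss_avg_def[abs_def]
  proof (rule DERIV_integral[where w = "\<lambda>z. C * (norm z * gauss z)"])
    show "integrable lborel (\<lambda>z. gauss z * \<phi> (t *\<^sub>R z))" for t
      by (rule gauss_avg_test_fun_integrable[OF \<phi>])
    show "integrable lborel (\<lambda>z. gauss z * pd \<phi> z (s *\<^sub>R z))"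
      unfolding radial by (intro bochner_integrable_sum int)
    show "((\<lambda>t. gauss z * \<phi> (t *\<^sub>R z)) has_real_derivative gauss z * pd \<phi> z (t *\<^sub>R z)) (at t)" for t z
      using line_derivative[OF smooth_differentiable[OF smooth], of 0 z t] by (intro DERIV_cmult) simp
    show "\<bar>gauss z * pd \<phi> z (t *\<^sub>R z)\<bar> \<le> C * (norm z * gauss z)" for t z
      using mult_left_mono[OF C[of z "t *\<^sub>R z"] gauss_nonneg[of z]]
      by (simp add: abs_mult gauss_nonneg mult_ac)
    show "integrable lborel (\<lambda>z::'a. C * (norm z * gauss z))" by (intro integrable_mult_right gauss_moment)
  qed
  also have "(LBINT z. gauss z * pd \<phi> z (s *\<^sub>R z)) =
      (\<Sum>b\<in>Basis. LBINT z. gauss z * ((z \<bullet> b) * pd \<phi> b (s *\<^sub>R z)))"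
    unfolding radial by (rule bochner_integral_sum[OF int])
  also have "\<dots> = (\<Sum>b\<in>Basis. 2 * (LBINT z. gauss z * (s * pd (pd \<phi> b) b (s *\<^sub>R z))))"
    using gauss_integration_by_parts[OF scaled] pd_affine[OF smooth_pd[OF smooth], of 1 _ s 0] by simp
  also have "\<dots> = 2 * s * (\<Sum>b\<in>Basis. LBINT z. gauss z * pd (pd \<phi> b) b (s *\<^sub>R z))"
    by (simp add: sum_distrib_left mult.left_commute[of _ s] mult.assoc)
  also have "(\<Sum>b\<in>Basis. LBINT z. gauss z * pd (pd \<phi> b) b (s *\<^sub>R z)) = gauss_avg (lap \<phi>) s"
    unfolding gauss_avg_def lap_def sum_distrib_left
    by (intro bochner_integral_sum[symmetric] gauss_avg_test_fun_integrable test_fun_pd \<phi>)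
  finally show ?thesis .
qed

(* The heat kernel at time s^2; it vanishes at the junk value s = 0. *)
definition heat :: "real \<Rightarrow> 'a::euclidean_space \<Rightarrow> real" where
  "heat s x = inverse (s ^ DIM('a)) * gauss (inverse s *\<^sub>R x)"

lemma heat_nonneg: "0 \<le> s \<Longrightarrow> 0 \<le> heat s x" by (simp add: heat_def gauss_nonneg)

lemma heat_measurable[measurable]: "(\<lambda>(s, x). heat s x) \<in> borel_measurable (borel \<Otimes>\<^sub>M borel)"
  unfolding heat_def by measurable

lemma heat_measurable'[measurable]: "heat s \<in> borel_measurable borel"
  unfolding heat_def[abs_def] by measurable

lemma heat_minus: "heat s (- x) = heat s x" by (simp add: heat_def gauss_minus)

lemma heat_le: "s > 0 \<Longrightarrow> heat s (x::'a::euclidean_space) \<le> inverse (s ^ DIM('a)) * gauss (0::'a)"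
  unfolding heat_def by (intro mult_left_mono gauss_le) auto

lemma heat_integral:
  fixes \<psi> :: "'a::euclidean_space \<Rightarrow> real"
  assumes s: "s > 0" and [measurable]: "\<psi> \<in> borel_measurable borel"
  shows "(LBINT x. heat s x * \<psi> x) = gauss_avg \<psi> s"
proof -
  have "(LBINT x. heat s x * \<psi> x) = \<bar>s\<bar> ^ DIM('a) * (LBINT x. heat s (0 + s *\<^sub>R x) * \<psi> (0 + s *\<^sub>R x))"
    by (rule lborel_integral_affine) (use s in auto)
  also have "\<dots> = (LBINT x. \<bar>s\<bar> ^ DIM('a) * (heat s (s *\<^sub>R x) * \<psi> (s *\<^sub>R x)))" by simp
  also have "\<dots> = gauss_avg \<psi> s"
    unfolding gauss_avg_def using s by (intro bochner_integral_cong) (simp_all add: heat_def mult.assoc)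
  finally show ?thesis .
qed

lemma heat_integrable: "s > 0 \<Longrightarrow> integrable lborel (heat s)"
  unfolding heat_def[abs_def]
  using lborel_integrable_affine[OF gauss_integrable, of "inverse s" 0] by (intro integrable_mult_right) simp

lemma heat_integral_1: "s > 0 \<Longrightarrow> (LBINT x. heat s x) = 1"
  using heat_integral[of s "\<lambda>_. 1"] by (simp add: gauss_avg_def gauss_integral)

(* The substitution t = s^2 turns exp (- \<mu> t) dt into this weight. *)
definition laplace_weight :: "real \<Rightarrow> real \<Rightarrow> real" where
  "laplace_weight \<mu> s = 2 * s * exp (- \<mu> * s\<^sup>2) * indicator {0..} s"

lemma laplace_weight_nonneg: "0 \<le> laplace_weight \<mu> s"
  by (simp add: laplace_weight_def indicator_def)

lemma laplace_weight_eq_0: "s \<le> 0 \<Longrightarrow> laplace_weight \<mu> s = 0"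
  by (auto simp: laplace_weight_def indicator_def)

lemma laplace_weight_heat_nonneg: "0 \<le> laplace_weight \<mu> s * heat s x"
  using laplace_weight_eq_0[of s \<mu>] laplace_weight_nonneg[of \<mu> s] heat_nonneg[of s x]
  by (cases "s \<le> 0") simp_all

lemma abs_laplace_weight_heat: "\<bar>laplace_weight \<mu> s * heat s x * c\<bar> = laplace_weight \<mu> s * heat s x * \<bar>c\<bar>"
  by (simp only: abs_mult[of "_ * _"] abs_of_nonneg[OF laplace_weight_heat_nonneg])

lemma laplace_weight_measurable[measurable]: "laplace_weight \<mu> \<in> borel_measurable borel"
  unfolding laplace_weight_def[abs_def] by measurable

lemma exp_square_at_top: assumes "\<mu> > 0" shows "((\<lambda>s::real. exp (- \<mu> * s\<^sup>2)) \<longlongrightarrow> 0) at_top"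
proof -
  have "LIM s at_top. - \<mu> * s\<^sup>2 :> at_bot"
    by (intro filterlim_tendsto_neg_mult_at_bot[OF tendsto_const] filterlim_pow_at_top filterlim_ident)
        (use assms in auto)
  then show ?thesis by (rule filterlim_compose[OF exp_at_bot])
qed

lemma
  assumes "\<mu> > 0"
  shows laplace_weight_integrable: "integrable lborel (laplace_weight \<mu>)"
    and laplace_weight_integral: "(LBINT s. laplace_weight \<mu> s) = 1 / \<mu>"
proof -
  have "(\<integral>\<^sup>+s. ennreal (2 * s * exp (- \<mu> * s\<^sup>2)) * indicator {0..} s \<partial>lborel) =
      ennreal (- 0 / \<mu> - (- exp (- \<mu> * 0\<^sup>2) / \<mu>))"
  proof (rule nn_integral_FTC_atLeast)
    show "((\<lambda>s. - exp (- \<mu> * s\<^sup>2) / \<mu>) has_real_derivative 2 * s * exp (- \<mu> * s\<^sup>2)) (at s)" for s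
      using assms by (auto intro!: derivative_eq_intros)
    show "((\<lambda>s. - exp (- \<mu> * s\<^sup>2) / \<mu>) \<longlongrightarrow> - 0 / \<mu>) at_top"
      using assms by (intro tendsto_intros exp_square_at_top) auto
  qed auto
  moreover have "ennreal (2 * s * exp (- \<mu> * s\<^sup>2)) * indicator {0..} s = ennreal (laplace_weight \<mu> s)" for s
    by (auto simp: laplace_weight_def indicator_def)
  ultimately have "has_bochner_integral lborel (laplace_weight \<mu>) (1 / \<mu>)"
    using assms by (intro has_bochner_integral_nn_integral) (auto simp: laplace_weight_nonneg)
  then show "integrable lborel (laplace_weight \<mu>)" "(LBINT s. laplace_weight \<mu> s) = 1 / \<mu>"
    by (auto simp: has_bochner_integral_iff)
qed

lemma laplace_heat_pair_integrable:
  fixes \<psi> :: "'a::euclidean_space \<Rightarrow> real"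
  assumes \<mu>: "\<mu> > 0" and [measurable]: "\<psi> \<in> borel_measurable borel" and C: "\<And>x. \<bar>\<psi> x\<bar> \<le> C"
  shows "integrable (lborel \<Otimes>\<^sub>M lborel) (\<lambda>(s, x). laplace_weight \<mu> s * heat s x * \<psi> x)"
proof (rule lborel_pair.Fubini_integrable)
  let ?f = "\<lambda>s x. laplace_weight \<mu> s * heat s x * \<psi> x"
  have C0: "0 \<le> C" by (rule order_trans[OF abs_ge_zero C])
  have bound: "\<bar>?f s x\<bar> \<le> laplace_weight \<mu> s * C * heat s x" for s x
    using mult_left_mono[OF C[of x] laplace_weight_heat_nonneg[of \<mu> s x]]
    unfolding abs_laplace_weight_heat by (simp only: mult_ac)
  have int: "integrable lborel (?f s)" "integrable lborel (\<lambda>x::'a. laplace_weight \<mu> s * C * heat s x)" for s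
  proof -
    show heat: "integrable lborel (\<lambda>x::'a. laplace_weight \<mu> s * C * heat s x)"
      using heat_integrable[of s, where 'a = 'a] laplace_weight_eq_0[of s \<mu>] by (cases "s \<le> 0") simp_all
    show "integrable lborel (?f s)"
      by (rule bochner_integrable_bound[OF heat])
          (use bound in \<open>auto intro!: AE_I2 order_trans[OF _ abs_ge_self]\<close>)
  qed
  show "(\<lambda>(s, x). ?f s x) \<in> borel_measurable (lborel \<Otimes>\<^sub>M lborel)" by measurable
  show "AE s in lborel. integrable lborel (\<lambda>x. case (s, x) of (s, x) \<Rightarrow> ?f s x)" using int(1) by simp
  show "integrable lborel (\<lambda>s. \<integral>x. norm (case (s, x) of (s, x) \<Rightarrow> ?f s x) \<partial>lborel)"
  proof (rule bochner_integrable_bound[OF integrable_mult_right[OF laplace_weight_integrable[OF \<mu>], of C]])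
    have "(LBINT x. \<bar>?f s x\<bar>) \<le> C * laplace_weight \<mu> s" for s
    proof -
      have "(LBINT x. \<bar>?f s x\<bar>) \<le> (LBINT x::'a. laplace_weight \<mu> s * C * heat s x)"
        by (rule integral_mono[OF integrable_abs[OF int(1)] int(2) bound])
      also have "\<dots> \<le> C * laplace_weight \<mu> s"
        using heat_integral_1[of s, where 'a = 'a] laplace_weight_eq_0[of s \<mu>]
        by (cases "s \<le> 0") (simp_all add: mult.commute)
      finally show ?thesis .
    qed
    then show "AE s in lborel. norm (LBINT x. norm (case (s, x) of (s, x) \<Rightarrow> ?f s x)) \<le>
        norm (C * laplace_weight \<mu> s)"
      using C0 laplace_weight_nonneg[of \<mu>] by (intro AE_I2) simp
  qed measurable
qed

(* The kernel of 1 / (\<mu> - \<Delta>), as the Laplace transform of the heat kernel. *)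
definition resolvent :: "real \<Rightarrow> 'a::euclidean_space \<Rightarrow> real" where
  "resolvent \<mu> x = (LBINT s. laplace_weight \<mu> s * heat s x)"

lemma resolvent_nonneg: "0 \<le> resolvent \<mu> x"
  unfolding resolvent_def by (intro integral_nonneg_AE AE_I2 laplace_weight_heat_nonneg)

lemma resolvent_minus: "resolvent \<mu> (- x) = resolvent \<mu> x"
  by (simp add: resolvent_def heat_minus)

lemma resolvent_minus_commute: "resolvent \<mu> (x - z) = resolvent \<mu> (z - x)"
  using resolvent_minus[of \<mu> "z - x"] by simp

lemma resolvent_measurable[measurable]: "resolvent \<mu> \<in> borel_measurable borel"
proof -
  have "(\<lambda>x. \<integral>s. laplace_weight \<mu> s * heat s x \<partial>lborel) \<in> borel_measurable (borel :: 'a measure)"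
    by (rule lborel.borel_measurable_lebesgue_integral) measurable
  then show ?thesis by (simp add: resolvent_def[abs_def])
qed

lemma
  fixes \<psi> :: "'a::euclidean_space \<Rightarrow> real"
  assumes \<mu>: "\<mu> > 0" and [measurable]: "\<psi> \<in> borel_measurable borel" and C: "\<And>x. \<bar>\<psi> x\<bar> \<le> C"
  shows resolvent_integral_bounded:
    "(LBINT x. resolvent \<mu> x * \<psi> x) = (LBINT s. laplace_weight \<mu> s * gauss_avg \<psi> s)"
    and resolvent_mult_integrable: "integrable lborel (\<lambda>x. resolvent \<mu> x * \<psi> x)"
    and laplace_weight_gauss_avg_integrable: "integrable lborel (\<lambda>s. laplace_weight \<mu> s * gauss_avg \<psi> s)"
proof -
  have pair: "integrable (lborel \<Otimes>\<^sub>M lborel) (\<lambda>(s, x). laplace_weight \<mu> s * heat s x * \<psi> x)"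
    by (rule laplace_heat_pair_integrable[OF \<mu>]) (use C in auto)
  have over_s: "(LBINT s. laplace_weight \<mu> s * heat s x * \<psi> x) = resolvent \<mu> x * \<psi> x" for x
    by (simp add: resolvent_def)
  have over_x: "(LBINT x. laplace_weight \<mu> s * heat s x * \<psi> x) = laplace_weight \<mu> s * gauss_avg \<psi> s" for s
    using heat_integral[of s \<psi>] laplace_weight_eq_0[of s \<mu>] by (cases "s \<le> 0") (simp_all add: mult.assoc)
  show "(LBINT x. resolvent \<mu> x * \<psi> x) = (LBINT s. laplace_weight \<mu> s * gauss_avg \<psi> s)"
    using lborel_pair.integral_snd[OF pair] lborel_pair.integral_fst[OF pair] by (simp only: over_s over_x)
  show "integrable lborel (\<lambda>x. resolvent \<mu> x * \<psi> x)"
    using lborel_pair.integrable_snd[OF pair] by (simp only: over_s)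
  show "integrable lborel (\<lambda>s. laplace_weight \<mu> s * gauss_avg \<psi> s)"
    using lborel_pair.integrable_fst[OF pair] by (simp only: over_x)
qed

lemma resolvent_integrable: "\<mu> > 0 \<Longrightarrow> integrable lborel (resolvent \<mu>)"
  using resolvent_mult_integrable[of \<mu> "\<lambda>_. 1" 1] by simp

lemma resolvent_integral: "\<mu> > 0 \<Longrightarrow> (LBINT x. resolvent \<mu> (x::'a::euclidean_space)) = 1 / \<mu>"
  using resolvent_integral_bounded[of \<mu> "\<lambda>_::'a. 1" 1]
  by (simp add: gauss_avg_def gauss_integral laplace_weight_integral)

lemma gauss_avg_resolvent_FTC:
  fixes \<phi> :: "'a::euclidean_space \<Rightarrow> real"
  assumes \<mu>: "\<mu> > 0" and \<phi>: "test_fun UNIV \<phi>"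
    and int: "integrable lborel (\<lambda>s. laplace_weight \<mu> s * (\<mu> * gauss_avg \<phi> s - gauss_avg (lap \<phi>) s))"
  shows "(LBINT s. laplace_weight \<mu> s * (\<mu> * gauss_avg \<phi> s - gauss_avg (lap \<phi>) s)) = \<phi> 0"
proof -
  define f where "f s = 2 * s * exp (- \<mu> * s\<^sup>2) * (\<mu> * gauss_avg \<phi> s - gauss_avg (lap \<phi>) s)" for s
  define F where "F s = - exp (- \<mu> * s\<^sup>2) * gauss_avg \<phi> s" for s
  have weight: "laplace_weight \<mu> s * (\<mu> * gauss_avg \<phi> s - gauss_avg (lap \<phi>) s) =
      indicator {0<..} s *\<^sub>R f s" for s
    by (cases "s = 0") (auto simp: laplace_weight_def f_def indicator_def)
  obtain C where C: "\<And>x. \<bar>\<phi> x\<bar> \<le> C" using test_fun_bounded[OF \<phi>] by blast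
  have isCont: "isCont (gauss_avg \<phi>) s" "isCont (gauss_avg (lap \<phi>)) s" for s
    using test_fun_bounded[OF \<phi>] test_fun_bounded[OF test_fun_lap[OF \<phi>]]
      test_fun_continuous[OF \<phi>] test_fun_continuous[OF test_fun_lap[OF \<phi>]] by (blast intro: isCont_gauss_avg)+
  have "(LBINT s=0..\<infinity>. f s) = 0 - (- \<phi> 0)"
  proof (rule interval_integral_FTC_integrable[where F = F])
    fix s assume "0 < ereal s"
    then have s: "s > 0" by simp
    have "(F has_real_derivative f s) (at s)"
      unfolding F_def[abs_def] f_def
      by (rule derivative_eq_intros DERIV_gauss_avg[OF \<phi> s] refl)+ (simp add: algebra_simps)
    then show "(F has_vector_derivative f s) (at s)"
      by (simp add: has_real_derivative_iff_has_vector_derivative)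
    show "isCont f s" unfolding f_def[abs_def] by (intro continuous_intros isCont)
  next
    show "set_integrable lborel (einterval 0 \<infinity>) f"
      using int unfolding weight set_integrable_def zero_ereal_def by simp
    have "isCont F 0" unfolding F_def[abs_def] by (intro continuous_intros isCont)
    then have "(F \<longlongrightarrow> - \<phi> 0) (at_right 0)"
      by (simp add: F_def gauss_avg_def gauss_integral isCont_def filterlim_at_split)
    then show "((F \<circ> real_of_ereal) \<longlongrightarrow> - \<phi> 0) (at_right 0)" by (simp add: zero_ereal_def ereal_tendsto_simps)
    have "(F \<longlongrightarrow> 0) at_top"
    proof (rule Lim_null_comparison)
      show "\<forall>\<^sub>F s in at_top. norm (F s) \<le> exp (- \<mu> * s\<^sup>2) * C"
        using gauss_avg_bound[OF borel_measurable_UNIV[OF test_fun_continuous[OF \<phi>]] C]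
        by (auto simp: F_def abs_mult intro!: always_eventually)
      show "((\<lambda>s. exp (- \<mu> * s\<^sup>2) * C) \<longlongrightarrow> 0) at_top"
        using tendsto_mult_right[OF exp_square_at_top[OF \<mu>], of C] by simp
    qed
    then show "((F \<circ> real_of_ereal) \<longlongrightarrow> 0) (at_left \<infinity>)" by (simp add: ereal_tendsto_simps)
  qed simp
  then show ?thesis unfolding weight interval_lebesgue_integral_0_infty set_lebesgue_integral_def by simp
qed

lemma resolvent_fundamental_solution:
  fixes \<phi> :: "'a::euclidean_space \<Rightarrow> real"
  assumes \<mu>: "\<mu> > 0" and \<phi>: "test_fun UNIV \<phi>"
  shows "(LBINT x. resolvent \<mu> x * (\<mu> * \<phi> x - lap \<phi> x)) = \<phi> 0"
proof -
  have test: "test_fun UNIV (\<lambda>x. \<mu> * \<phi> x + - 1 * lap \<phi> x)"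
    by (intro test_fun_add test_fun_cmult \<phi> test_fun_lap)
  note meas = borel_measurable_UNIV[OF test_fun_continuous]
  obtain C where C: "\<And>x. \<bar>\<mu> * \<phi> x - lap \<phi> x\<bar> \<le> C" using test_fun_bounded[OF test] by auto
  have m: "(\<lambda>x. \<mu> * \<phi> x - lap \<phi> x) \<in> borel_measurable borel" using meas[OF test] by simp
  have int: "integrable lborel (\<lambda>z. gauss z * \<phi> (s *\<^sub>R z))"
    "integrable lborel (\<lambda>z. gauss z * lap \<phi> (s *\<^sub>R z))" for s
    using test_fun_bounded[OF \<phi>] test_fun_bounded[OF test_fun_lap[OF \<phi>]] meas[OF \<phi>]
        meas[OF test_fun_lap[OF \<phi>]]
    by (blast intro: gauss_avg_integrable)+
  have avg: "gauss_avg (\<lambda>x. \<mu> * \<phi> x - lap \<phi> x) s = \<mu> * gauss_avg \<phi> s - gauss_avg (lap \<phi>) s" for s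
    using int[of s] by (simp add: gauss_avg_def right_diff_distrib mult.left_commute[of _ \<mu>])
  show ?thesis
    using gauss_avg_resolvent_FTC[OF \<mu> \<phi>] resolvent_integral_bounded[OF \<mu> m C]
      laplace_weight_gauss_avg_integrable[OF \<mu> m C] by (simp only: avg)
qed

lemma laplace_weight_powr_finite:
  assumes \<mu>: "\<mu> > 0" and a: "0 \<le> a" "a < 4"
  shows "(\<integral>\<^sup>+s. ennreal (laplace_weight \<mu> s * s powr (- a / 2)) \<partial>lborel) < \<infinity>"
proof -
  have "ennreal (laplace_weight \<mu> s * s powr (- a / 2)) \<le>
      2 * (ennreal (s powr (1 - a / 2)) * indicator {0..1} s) + ennreal (laplace_weight \<mu> s)" for s
  proof -
    consider "s \<le> 0" | "0 < s" "s \<le> 1" | "s > 1" by linarith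
    then show ?thesis
    proof cases
      assume s: "0 < s" "s \<le> 1"
      have "laplace_weight \<mu> s \<le> 2 * s" using s \<mu> by (simp add: laplace_weight_def mult_left_le)
      then have "laplace_weight \<mu> s * s powr (- a / 2) \<le> 2 * s * s powr (- a / 2)"
        by (intro mult_right_mono) auto
      also have "\<dots> = 2 * s powr (1 - a / 2)" using s by (simp add: powr_mult_base)
      finally have "ennreal (laplace_weight \<mu> s * s powr (- a / 2)) \<le> ennreal (2 * s powr (1 - a / 2))"
        by (rule ennreal_leI)
      also have "\<dots> = 2 * ennreal (s powr (1 - a / 2))" by (simp add: ennreal_mult)
      finally have "ennreal (laplace_weight \<mu> s * s powr (- a / 2)) \<le> 2 * ennreal (s powr (1 - a / 2))" .
      then show ?thesis using s by (simp add: add_increasing2)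
    next
      assume s: "s > 1"
      have "s powr (- a / 2) \<le> s powr 0" using s a by (intro powr_mono) auto
      then have "laplace_weight \<mu> s * s powr (- a / 2) \<le> laplace_weight \<mu> s"
        using laplace_weight_nonneg s by (intro mult_left_le) auto
      then show ?thesis by (simp add: add_increasing ennreal_leI)
    qed (simp add: laplace_weight_eq_0)
  qed
  then have "(\<integral>\<^sup>+s. ennreal (laplace_weight \<mu> s * s powr (- a / 2)) \<partial>lborel) \<le>
      (\<integral>\<^sup>+s. 2 * (ennreal (s powr (1 - a / 2)) * indicator {0..1} s) + ennreal (laplace_weight \<mu> s) \<partial>lborel)"
    by (rule nn_integral_mono)
  also have "\<dots> = 2 * (\<integral>\<^sup>+s. ennreal (s powr (1 - a / 2)) * indicator {0..1} s \<partial>lborel) +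
      (\<integral>\<^sup>+s. ennreal (laplace_weight \<mu> s) \<partial>lborel)"
    by (simp add: nn_integral_add nn_integral_cmult)
  also have "(\<integral>\<^sup>+s. ennreal (s powr (1 - a / 2)) * indicator {0..1} s \<partial>lborel) =
      ennreal (1 powr (1 - a / 2 + 1) / (1 - a / 2 + 1))"
    by (rule nn_integral_has_integral_lebesgue'[OF _ has_integral_powr_from_0]) (use a in auto)
  also have "(\<integral>\<^sup>+s. ennreal (laplace_weight \<mu> s) \<partial>lborel) = ennreal (1 / \<mu>)"
    using nn_integral_eq_integral[OF laplace_weight_integrable[OF \<mu>]] laplace_weight_integral[OF \<mu>]
    by (simp add: laplace_weight_nonneg)
  finally show ?thesis by (auto simp: ennreal_mult_less_top intro: le_less_trans)
qed

lemma laplace_weight_heat_le: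
  fixes x :: "'a::euclidean_space" and \<mu> :: real
  defines "m s \<equiv> laplace_weight \<mu> s * s powr (- real DIM('a) / 2)"
  shows "laplace_weight \<mu> s * heat s x \<le> sqrt (m s) * sqrt (gauss (0::'a) * (m s * heat s x))"
proof (cases "s > 0")
  case True
  have "(s powr (- real DIM('a) / 2))\<^sup>2 = s powr (- real DIM('a))"
    by (simp add: power2_eq_square flip: powr_add)
  then have "heat s x \<le> gauss (0::'a) * (s powr (- real DIM('a) / 2))\<^sup>2"
    using heat_le[OF True, of x] by (simp add: powr_minus powr_realpow[OF True] mult.commute)
  then have "(heat s x)\<^sup>2 \<le> gauss (0::'a) * (s powr (- real DIM('a) / 2))\<^sup>2 * heat s x"
    using heat_nonneg[of s x] True by (simp add: power2_eq_square mult_right_mono)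
  then have "(laplace_weight \<mu> s)\<^sup>2 * (heat s x)\<^sup>2 \<le>
      (laplace_weight \<mu> s)\<^sup>2 * (gauss (0::'a) * (s powr (- real DIM('a) / 2))\<^sup>2 * heat s x)"
    by (intro mult_left_mono) auto
  then have "(laplace_weight \<mu> s * heat s x)\<^sup>2 \<le> m s * (gauss (0::'a) * (m s * heat s x))"
    by (simp add: m_def power2_eq_square mult_ac)
  then show ?thesis by (simp add: real_le_rsqrt flip: real_sqrt_mult)
qed (simp add: laplace_weight_eq_0 m_def)

lemma resolvent_power2_le:
  fixes x :: "'a::euclidean_space" and \<mu> :: real
  defines "m s \<equiv> laplace_weight \<mu> s * s powr (- real DIM('a) / 2)"
  shows "ennreal ((resolvent \<mu> x)\<^sup>2) \<le>
    (\<integral>\<^sup>+s. ennreal (m s) \<partial>lborel) * (\<integral>\<^sup>+s. ennreal (gauss (0::'a) * (m s * heat s x)) \<partial>lborel)"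
proof -
  have [measurable]: "m \<in> borel_measurable borel" unfolding m_def[abs_def] by measurable
  have m: "0 \<le> m s" "0 \<le> m s * heat s x" for s
    using heat_nonneg[of s x] laplace_weight_nonneg[of \<mu> s] laplace_weight_eq_0[of s \<mu>]
    by (cases "s \<le> 0"; simp add: m_def)+
  have "ennreal (resolvent \<mu> x) \<le> (\<integral>\<^sup>+s. ennreal (laplace_weight \<mu> s * heat s x) \<partial>lborel)"
    unfolding resolvent_def
    by (cases "integrable lborel (\<lambda>s. laplace_weight \<mu> s * heat s x)")
      (simp_all add: nn_integral_eq_integral[OF _ AE_I2] laplace_weight_heat_nonneg
          not_integrable_integral_eq)
  also have "\<dots> \<le> (\<integral>\<^sup>+s. ennreal (sqrt (m s)) * ennreal (sqrt (gauss (0::'a) * (m s * heat s x))) \<partial>lborel)"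
    using laplace_weight_heat_le[of \<mu> _ x] m unfolding m_def
    by (intro nn_integral_mono) (simp add: ennreal_leI flip: ennreal_mult)
  finally have "(ennreal (resolvent \<mu> x))\<^sup>2 \<le>
      (\<integral>\<^sup>+s. ennreal (sqrt (m s)) * ennreal (sqrt (gauss (0::'a) * (m s * heat s x))) \<partial>lborel)\<^sup>2"
    by (rule power_mono) simp
  also have "\<dots> \<le> (\<integral>\<^sup>+s. (ennreal (sqrt (m s)))\<^sup>2 \<partial>lborel) *
      (\<integral>\<^sup>+s. (ennreal (sqrt (gauss (0::'a) * (m s * heat s x))))\<^sup>2 \<partial>lborel)"
    by (rule Cauchy_Schwarz_nn_integral) measurable
  finally show ?thesis using m by (simp add: ennreal_power resolvent_nonneg)
qed

(* The weight s powr (- DIM / 2) is the square root of the singularity of the heat kernel; it is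
      integrable against laplace_weight only below dimension four. *)
lemma resolvent_square_integrable:
  assumes \<mu>: "\<mu> > 0" and dim: "DIM('a::euclidean_space) \<le> 3"
  shows "square_integrable lborel (resolvent \<mu> :: 'a \<Rightarrow> real)"
proof -
  define G where "G = gauss (0::'a)"
  define m where "m s = laplace_weight \<mu> s * s powr (- real DIM('a) / 2)" for s
  have G: "0 \<le> G" by (simp add: G_def)
  define M where "M = (\<integral>\<^sup>+s. ennreal (m s) \<partial>lborel)"
  have M: "M < \<infinity>" unfolding M_def m_def by (rule laplace_weight_powr_finite[OF \<mu>]) (use dim in auto)
  have [measurable]: "m \<in> borel_measurable borel" unfolding m_def[abs_def] by measurable
  have "ennreal ((resolvent \<mu> x)\<^sup>2) \<le> M * (\<integral>\<^sup>+s. ennreal (G * (m s * heat s (x::'a))) \<partial>lborel)" for x :: 'a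
    unfolding M_def G_def m_def by (rule resolvent_power2_le)
  then have "(\<integral>\<^sup>+x. ennreal ((resolvent \<mu> (x::'a))\<^sup>2) \<partial>lborel) \<le>
      (\<integral>\<^sup>+x. M * (\<integral>\<^sup>+s. ennreal (G * (m s * heat s (x::'a))) \<partial>lborel) \<partial>lborel)"
    by (rule nn_integral_mono)
  also have "\<dots> = M * (\<integral>\<^sup>+x. (\<integral>\<^sup>+s. ennreal (G * (m s * heat s (x::'a))) \<partial>lborel) \<partial>lborel)"
    by (rule nn_integral_cmult) measurable
  also have "(\<integral>\<^sup>+x. (\<integral>\<^sup>+s. ennreal (G * (m s * heat s (x::'a))) \<partial>lborel) \<partial>lborel) =
      (\<integral>\<^sup>+s. (\<integral>\<^sup>+x. ennreal (G * (m s * heat s (x::'a))) \<partial>lborel) \<partial>lborel)"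
    by (rule lborel_pair.Fubini') measurable
  also have "\<dots> = (\<integral>\<^sup>+s. ennreal G * ennreal (m s) \<partial>lborel)"
  proof (rule nn_integral_cong)
    fix s
    have "(\<integral>\<^sup>+x. ennreal (heat s (x::'a)) \<partial>lborel) = 1" if "s > 0"
      using nn_integral_eq_integral[OF heat_integrable[OF that, where 'a = 'a]] heat_integral_1[OF that,
      where 'a = 'a] that
      by (simp add: heat_nonneg)
    then show "(\<integral>\<^sup>+x. ennreal (G * (m s * heat s (x::'a))) \<partial>lborel) = ennreal G * ennreal (m s)"
      using G laplace_weight_nonneg[of \<mu> s] by (cases "s > 0")
        (simp_all add: ennreal_mult heat_nonneg nn_integral_cmult m_def laplace_weight_eq_0)
  qed
  also have "\<dots> = ennreal G * M" unfolding M_def by (rule nn_integral_cmult) measurable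
  also have "M * (ennreal G * M) < \<infinity>" using M by (auto simp: ennreal_mult_less_top)
  finally have "integrable lborel (\<lambda>x::'a. (resolvent \<mu> x)\<^sup>2)" by (intro integrableI_bounded) auto
  then show ?thesis by (simp add: square_integrable_def)
qed

section \<open>Helmholtz equations\<close>

lemma gauss_avg_translation_le:
  fixes f :: "'a::euclidean_space \<Rightarrow> real"
  assumes [measurable]: "f \<in> borel_measurable borel" and M: "\<And>x. \<bar>f x\<bar> \<le> M" and s: "s > 0"
  shows "\<bar>gauss_avg (\<lambda>w. f (x - w)) s - gauss_avg (\<lambda>w. f (y - w)) s\<bar> \<le>
      M * gauss_variation TYPE('a) * norm (x - y) / s"
proof -
  define h where "h = inverse s *\<^sub>R (y - x)"
  have M0: "0 \<le> M" by (rule order_trans[OF abs_ge_zero M])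
  have "s *\<^sub>R h = y - x" using s by (simp add: h_def)
  then have shift: "y - s *\<^sub>R (w + h) = x - s *\<^sub>R w" for w by (simp add: scaleR_add_right)
  have avg: "integrable lborel (\<lambda>w. gauss w * f (z - s *\<^sub>R w))" for z
    by (rule gauss_mult_integrable[where C = M]) (use M in auto)
  have "(LBINT w. gauss (w + h) * f (x - s *\<^sub>R w)) = (LBINT w. gauss w * f (y - s *\<^sub>R w))"
    using lborel_integral_shift[of "\<lambda>w. gauss w * f (y - s *\<^sub>R w)" h] by (simp add: shift)
  moreover have shifted: "integrable lborel (\<lambda>w. gauss (w + h) * f (x - s *\<^sub>R w))"
    using integrable_shift[OF avg[of y], of h] by (simp add: shift)
  ultimately have "gauss_avg (\<lambda>w. f (x - w)) s - gauss_avg (\<lambda>w. f (y - w)) s =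
      (LBINT w. gauss w * f (x - s *\<^sub>R w) - gauss (w + h) * f (x - s *\<^sub>R w))"
    using avg[of x] by (simp add: gauss_avg_def)
  also have "\<bar>\<dots>\<bar> \<le> (LBINT w. \<bar>gauss w - gauss (w + h)\<bar> * M)"
  proof (rule order_trans[OF integral_abs_bound], rule integral_mono)
    show "\<bar>gauss w * f (x - s *\<^sub>R w) - gauss (w + h) * f (x - s *\<^sub>R w)\<bar> \<le> \<bar>gauss w - gauss (w + h)\<bar> * M" for w
      using M by (simp add: abs_mult mult_left_mono flip: left_diff_distrib)
  qed (intro integrable_abs integrable_mult_left bochner_integrable_diff avg shifted integrable_shift
      gauss_integrable)+
  also have "\<dots> \<le> gauss_variation TYPE('a) * norm h * M"
    using mult_right_mono[OF gauss_translation_L1[of h] M0] by simp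
  finally show ?thesis using s by (simp add: h_def norm_minus_commute divide_inverse mult_ac)
qed

definition potential :: "real \<Rightarrow> ('a::euclidean_space \<Rightarrow> real) \<Rightarrow> 'a \<Rightarrow> real" where
  "potential \<mu> f x = (LBINT z. resolvent \<mu> (x - z) * f z)"

definition potential_lipschitz_const :: "'a::euclidean_space itself \<Rightarrow> real \<Rightarrow> real" where
  "potential_lipschitz_const T \<mu> = gauss_variation T * (LBINT s. 2 * exp (- \<mu> * (s \<bullet> (s::real))))"

lemma potential_lipschitz:
  fixes f :: "'a::euclidean_space \<Rightarrow> real"
  assumes \<mu>: "\<mu> > 0" and [measurable]: "f \<in> borel_measurable borel" and M: "\<And>x. \<bar>f x\<bar> \<le> M"
  shows "\<bar>potential \<mu> f x - potential \<mu> f y\<bar> \<le> M * potential_lipschitz_const TYPE('a) \<mu> * norm (x - y)"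
proof -
  define avg where "avg x s = gauss_avg (\<lambda>w. f (x - w)) s" for x s
  define D where "D = M * gauss_variation TYPE('a) * norm (x - y)"
  have D: "0 \<le> D" unfolding D_def
    using order_trans[OF abs_ge_zero M] gauss_variation_nonneg[where 'a = 'a] by simp
  have potential: "potential \<mu> f x = (LBINT s. laplace_weight \<mu> s * avg x s)" for x
    using lborel_integral_reflect[of "\<lambda>z. resolvent \<mu> (x - z) * f z" x]
    by (simp add: potential_def avg_def resolvent_integral_bounded[OF \<mu> _ M])
  have int: "integrable lborel (\<lambda>s. laplace_weight \<mu> s * avg x s)" for x
    unfolding avg_def by (rule laplace_weight_gauss_avg_integrable[OF \<mu> _ M]) measurable
  have "potential \<mu> f x - potential \<mu> f y =
      (LBINT s. laplace_weight \<mu> s * avg x s - laplace_weight \<mu> s * avg y s)"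
    using int by (simp add: potential)
  also have "\<bar>\<dots>\<bar> \<le> (LBINT s. D * (2 * exp (- \<mu> * (s \<bullet> (s::real)))))"
  proof (rule order_trans[OF integral_abs_bound], rule integral_mono)
    show "integrable lborel (\<lambda>s. D * (2 * exp (- \<mu> * (s \<bullet> (s::real)))))"
      using integrable_gaussian[OF \<mu>, where 'a = real] by (intro integrable_mult_right)
    fix s :: real
    show "\<bar>laplace_weight \<mu> s * avg x s - laplace_weight \<mu> s * avg y s\<bar> \<le> D * (2 * exp (- \<mu> * (s \<bullet> s)))"
    proof (cases "s > 0")
      case True
      have "laplace_weight \<mu> s * \<bar>avg x s - avg y s\<bar> \<le> laplace_weight \<mu> s * (D / s)"
        unfolding avg_def D_def by (intro mult_left_mono laplace_weight_nonneg gauss_avg_translation_le True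
            M) measurable
      also have "\<dots> = D * (2 * exp (- \<mu> * (s \<bullet> s)))" using True
        by (simp add: laplace_weight_def power2_eq_square)
      finally show ?thesis by (simp add: abs_mult abs_of_nonneg[OF laplace_weight_nonneg] flip:
          right_diff_distrib)
    qed (use D in \<open>simp add: laplace_weight_eq_0\<close>)
  qed (intro integrable_abs bochner_integrable_diff int)
  also have "\<dots> = M * potential_lipschitz_const TYPE('a) \<mu> * norm (x - y)"
    by (simp add: D_def potential_lipschitz_const_def)
  finally show ?thesis .
qed

abbreviation sqnorm :: "('a::euclidean_space \<Rightarrow> real) \<Rightarrow> real" where
  "sqnorm f \<equiv> L2_sqnorm lborel f"

abbreviation ip :: "('a::euclidean_space \<Rightarrow> real) \<Rightarrow> ('a \<Rightarrow> real) \<Rightarrow> real" where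
  "ip f g \<equiv> L2_inner lborel f g"

(* (\<mu> - \<Delta>) y = f on D in the sense of distributions. *)
definition helmholtz :: "real \<Rightarrow> 'a::euclidean_space set \<Rightarrow> ('a \<Rightarrow> real) \<Rightarrow> ('a \<Rightarrow> real) \<Rightarrow> bool" where
  "helmholtz \<mu> D f y \<longleftrightarrow> cont y \<and> (\<forall>\<phi>. test_fun D \<phi> \<longrightarrow>
    integrable lborel (\<lambda>x. f x * \<phi> x) \<and> (LBINT x. y x * (\<mu> * \<phi> x - lap \<phi> x)) = (LBINT x. f x * \<phi> x))"

lemma helmholtz_continuous: "helmholtz \<mu> D f y \<Longrightarrow> cont y"
  by (simp add: helmholtz_def)

lemma helmholtz_integrable: "helmholtz \<mu> D f y \<Longrightarrow> test_fun D \<phi> \<Longrightarrow> integrable lborel (\<lambda>x. f x * \<phi> x)"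
  by (simp add: helmholtz_def)

lemma helmholtz_weak:
  "helmholtz \<mu> D f y \<Longrightarrow> test_fun D \<phi> \<Longrightarrow> (LBINT x. y x * (\<mu> * \<phi> x - lap \<phi> x)) = (LBINT x. f x * \<phi> x)"
  by (simp add: helmholtz_def)

lemma test_fun_helmholtz: "test_fun D \<phi> \<Longrightarrow> test_fun D (\<lambda>x. \<mu> * \<phi> x - lap \<phi> x)"
  using test_fun_add[OF test_fun_cmult test_fun_cmult[OF test_fun_lap], of D \<phi> \<phi> \<mu> "-1"] by simp

lemma helmholtz_mono: "helmholtz \<mu> D f y \<Longrightarrow> D' \<subseteq> D \<Longrightarrow> helmholtz \<mu> D' f y"
  unfolding helmholtz_def using test_fun_mono by blast

lemma helmholtz_cong:
  assumes "helmholtz \<mu> D f y" "\<And>x. x \<in> D \<Longrightarrow> f x = g x" shows "helmholtz \<mu> D g y"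
proof -
  have "(\<lambda>x. f x * \<phi> x) = (\<lambda>x. g x * \<phi> x)" if "test_fun D \<phi>" for \<phi>
  proof
    show "f x * \<phi> x = g x * \<phi> x" for x using assms(2)[of x] test_fun_outside[OF that, of x]
      by (cases "x \<in> D") auto
  qed
  then show ?thesis using assms(1) unfolding helmholtz_def by metis
qed

lemma helmholtz_lincomb:
  assumes "helmholtz \<mu> D f y" "helmholtz \<mu> D g z"
  shows "helmholtz \<mu> D (\<lambda>x. a * f x + b * g x) (\<lambda>x. a * y x + b * z x)"
  unfolding helmholtz_def
proof (intro conjI allI impI)
  note cont = assms[THEN helmholtz_continuous]
  show "cont (\<lambda>x. a * y x + b * z x)" by (intro continuous_intros cont)
  fix \<phi> assume \<phi>: "test_fun D \<phi>"
  note int = assms[THEN helmholtz_integrable, OF \<phi>] integrable_times_test_fun[OF _ test_fun_helmholtz[OF \<phi>]]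
  note weak = assms[THEN helmholtz_weak, OF \<phi>]
  show "integrable lborel (\<lambda>x. (a * f x + b * g x) * \<phi> x)" using int(1,2)
    by (simp add: distrib_right mult.assoc)
  show "(LBINT x. (a * y x + b * z x) * (\<mu> * \<phi> x - lap \<phi> x)) = (LBINT x. (a * f x + b * g x) * \<phi> x)"
    using int(1,2) int(3)[OF cont(1)] int(3)[OF cont(2)] weak by (simp add: distrib_right mult.assoc)
qed

lemma helmholtz_diff:
  "helmholtz \<mu> D f y \<Longrightarrow> helmholtz \<mu> D g z \<Longrightarrow> helmholtz \<mu> D (\<lambda>x. f x - g x) (\<lambda>x. y x - z x)"
  using helmholtz_lincomb[of \<mu> D f y g z 1 "-1"] by simp

lemma helmholtz_uminus: "helmholtz \<mu> D f y \<Longrightarrow> helmholtz \<mu> D (\<lambda>x. - f x) (\<lambda>x. - y x)"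
  using helmholtz_lincomb[of \<mu> D f y f y "-1" 0] by simp

lemma helmholtz_change_coefficient:
  assumes "helmholtz \<mu> D f y" shows "helmholtz \<mu>' D (\<lambda>x. f x + (\<mu>' - \<mu>) * y x) y"
  unfolding helmholtz_def
proof (intro conjI allI impI)
  show cont: "cont y" by (rule helmholtz_continuous[OF assms])
  fix \<phi> assume \<phi>: "test_fun D \<phi>"
  note int = helmholtz_integrable[OF assms \<phi>] integrable_times_test_fun[OF cont \<phi>]
    integrable_times_test_fun[OF cont test_fun_helmholtz[OF \<phi>, of \<mu>]]
  show "integrable lborel (\<lambda>x. (f x + (\<mu>' - \<mu>) * y x) * \<phi> x)" using int
    by (simp add: distrib_right mult.assoc)
  have "(LBINT x. y x * (\<mu>' * \<phi> x - lap \<phi> x)) = (LBINT x. y x * (\<mu> * \<phi> x - lap \<phi> x) + (\<mu>' - \<mu>) * (y x * \<phi> x))"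
    by (simp add: algebra_simps)
  then show "(LBINT x. y x * (\<mu>' * \<phi> x - lap \<phi> x)) = (LBINT x. (f x + (\<mu>' - \<mu>) * y x) * \<phi> x)"
    using int helmholtz_weak[OF assms \<phi>] by (simp add: distrib_right mult.assoc)
qed

lemma helmholtz_smooth:
  assumes "smooth \<psi>" shows "helmholtz \<mu> D (\<lambda>x. \<mu> * \<psi> x - lap \<psi> x) \<psi>"
  unfolding helmholtz_def
proof (intro conjI allI impI)
  note cont = smooth_continuous[OF assms] smooth_continuous[OF smooth_lap[OF assms]]
  show "cont \<psi>" by (rule cont)
  fix \<phi> assume \<phi>: "test_fun D \<phi>"
  note int = cont[THEN integrable_times_test_fun, OF \<phi>] integrable_times_test_fun[OF cont(1)
      test_fun_lap[OF \<phi>]]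
  show "integrable lborel (\<lambda>x. (\<mu> * \<psi> x - lap \<psi> x) * \<phi> x)" using int
    by (simp add: left_diff_distrib mult.assoc)
  have "(LBINT x. \<psi> x * (\<mu> * \<phi> x - lap \<phi> x)) = (LBINT x. \<mu> * (\<psi> x * \<phi> x) - \<psi> x * lap \<phi> x)"
    by (simp add: algebra_simps)
  then show "(LBINT x. \<psi> x * (\<mu> * \<phi> x - lap \<phi> x)) = (LBINT x. (\<mu> * \<psi> x - lap \<psi> x) * \<phi> x)"
    using int integral_lap_swap[OF assms \<phi>] by (simp add: left_diff_distrib mult.assoc)
qed

lemma smooth_const: "smooth (\<lambda>x::'a::euclidean_space. k)"
  by (rule elementary_smooth[OF elementary.const])

lemma lap_const: "lap (\<lambda>x::'a::euclidean_space. k) = (\<lambda>x. 0)"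
proof -
  have "pd (\<lambda>x::'a. k) b = (\<lambda>x. 0)" for b :: 'a and k :: real by (rule ext, rule pd_eq) simp
  then show ?thesis by (simp add: lap_def[abs_def])
qed

lemma helmholtz_add_const:
  assumes "helmholtz \<mu> D f y" shows "helmholtz \<mu> D (\<lambda>x. f x + \<mu> * c) (\<lambda>x. y x + c)"
  using helmholtz_lincomb[OF assms helmholtz_smooth[OF smooth_const], of 1 1 c] by (simp add: lap_const)

lemma helmholtz_comparison:
  assumes D: "open D" "bounded D" and \<mu>: "0 \<le> \<mu>" and y: "helmholtz \<mu> D f y" and z: "helmholtz \<mu> D g z"
    and boundary: "\<And>x. x \<in> frontier D \<Longrightarrow> y x \<le> z x"
    and le: "\<And>x. x \<in> D \<Longrightarrow> z x < y x \<Longrightarrow> f x \<le> g x" and x: "x \<in> D"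
  shows "y x \<le> z x"
proof -
  have diff: "helmholtz 0 D (\<lambda>x. f x - g x + (0 - \<mu>) * (y x - z x)) (\<lambda>x. y x - z x)"
    by (rule helmholtz_change_coefficient[OF helmholtz_diff[OF y z]])
  have "y x - z x \<le> 0"
  proof (rule maximum_principle[OF D helmholtz_continuous[OF diff] _ _ x])
    fix \<phi> assume \<phi>: "test_fun (D \<inter> {x. 0 < y x - z x}) \<phi>" "\<And>x. 0 \<le> \<phi> x"
    have sign: "(f x - g x + (0 - \<mu>) * (y x - z x)) * \<phi> x \<le> 0" for x
    proof (cases "x \<in> D \<and> z x < y x")
      case True
      have "0 \<le> \<mu> * (y x - z x)" using \<mu> True by simp
      then show ?thesis using le[of x] True \<phi>(2)[of x]
        by (intro mult_nonpos_nonneg) (simp_all add: algebra_simps)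
    qed (use test_fun_outside[OF \<phi>(1), of x] in simp)
    have "0 \<le> (LBINT x. - ((f x - g x + (0 - \<mu>) * (y x - z x)) * \<phi> x))"
      by (rule integral_nonneg_AE) (use sign in simp)
    then have "(LBINT x. (f x - g x + (0 - \<mu>) * (y x - z x)) * \<phi> x) \<le> 0" by simp
    then show "0 \<le> (LBINT x. (y x - z x) * lap \<phi> x)"
      using helmholtz_weak[OF diff test_fun_mono[OF \<phi>(1)]] by simp
  qed (use boundary in simp)
  then show ?thesis by simp
qed

lemma helmholtz_close:
  assumes D: "open D" "bounded D" and \<mu>: "0 \<le> \<mu>" and y: "helmholtz \<mu> D f y" and z: "helmholtz \<mu> D f z"
    and \<epsilon>: "0 \<le> \<epsilon>" and close: "\<And>x. x \<notin> D \<Longrightarrow> \<bar>y x - z x\<bar> \<le> \<epsilon>"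
  shows "\<bar>y x - z x\<bar> \<le> \<epsilon>"
proof (cases "x \<in> D")
  case True
  have frontier: "\<bar>y x - z x\<bar> \<le> \<epsilon>" if "x \<in> frontier D" for x
    using close that D(1) by (simp add: frontier_def interior_open)
  have "y x \<le> z x + \<epsilon>"
    by (rule helmholtz_comparison[OF D \<mu> y helmholtz_add_const[OF z] _ _ True])
      (use frontier \<mu> \<epsilon> in \<open>force simp: abs_le_iff\<close>)+
  moreover have "z x \<le> y x + \<epsilon>"
    by (rule helmholtz_comparison[OF D \<mu> z helmholtz_add_const[OF y] _ _ True])
      (use frontier \<mu> \<epsilon> in \<open>force simp: abs_le_iff\<close>)+
  ultimately show ?thesis by (simp add: abs_le_iff)
qed (rule close)

lemma uniform_limit_bound:
  fixes Y :: "nat \<Rightarrow> 'b \<Rightarrow> real"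
  assumes "\<And>k x. \<bar>Y k x - y x\<bar> \<le> a k" "a \<longlonglongrightarrow> 0" shows "uniform_limit UNIV Y y sequentially"
proof (rule uniform_limitI)
  fix e :: real assume "e > 0"
  with assms(2) have "\<forall>\<^sub>F k in sequentially. a k < e" by (rule order_tendstoD)
  then show "\<forall>\<^sub>F k in sequentially. \<forall>x\<in>UNIV. dist (Y k x) (y x) < e"
    by eventually_elim (auto simp: dist_real_def intro: le_less_trans[OF assms(1)])
qed

lemma integral_uniform_limit:
  fixes Y :: "nat \<Rightarrow> 'b \<Rightarrow> real"
  assumes w: "integrable M w" and Y: "\<And>k. integrable M (\<lambda>x. w x * Y k x)" "integrable M (\<lambda>x. w x * y x)"
    and lim: "uniform_limit UNIV Y y sequentially"
  shows "(\<lambda>k. \<integral>x. w x * Y k x \<partial>M) \<longlonglongrightarrow> (\<integral>x. w x * y x \<partial>M)"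
proof (rule tendstoI)
  define W where "W = (\<integral>x. \<bar>w x\<bar> \<partial>M)"
  have W: "0 \<le> W" by (simp add: W_def)
  fix e :: real assume e: "e > 0"
  then have "0 < e / (W + 1)" using W by simp
  with lim have "\<forall>\<^sub>F k in sequentially. \<forall>x\<in>UNIV. dist (Y k x) (y x) < e / (W + 1)" by (rule uniform_limitD)
  then show "\<forall>\<^sub>F k in sequentially. dist (\<integral>x. w x * Y k x \<partial>M) (\<integral>x. w x * y x \<partial>M) < e"
  proof eventually_elim
    case (elim k)
    have "\<bar>(\<integral>x. w x * Y k x \<partial>M) - (\<integral>x. w x * y x \<partial>M)\<bar> = \<bar>\<integral>x. w x * Y k x - w x * y x \<partial>M\<bar>" using Y by simp
    also have "\<dots> \<le> (\<integral>x. \<bar>w x\<bar> * (e / (W + 1)) \<partial>M)"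
    proof (rule order_trans[OF integral_abs_bound], rule integral_mono)
      show "\<bar>w x * Y k x - w x * y x\<bar> \<le> \<bar>w x\<bar> * (e / (W + 1))" for x
        unfolding right_diff_distrib[symmetric] abs_mult
        using elim by (intro mult_left_mono) (auto simp: dist_real_def intro: less_imp_le)
    qed (intro integrable_abs integrable_mult_left bochner_integrable_diff Y w)+
    also have "\<dots> = e * (W / (W + 1))" by (simp add: W_def)
    also have "\<dots> < e * 1" using e W by (intro mult_strict_left_mono) auto
    finally show ?case by (simp add: dist_real_def)
  qed
qed

lemma helmholtz_uniform_limit:
  assumes Y: "\<And>k. helmholtz \<mu> D (F k) (Y k)" and lim: "uniform_limit UNIV Y y sequentially"
    and f: "\<And>\<phi>. test_fun D \<phi> \<Longrightarrow> integrable lborel (\<lambda>x. f x * \<phi> x)"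
    and F: "\<And>\<phi>. test_fun D \<phi> \<Longrightarrow> (\<lambda>k. LBINT x. F k x * \<phi> x) \<longlonglongrightarrow> (LBINT x. f x * \<phi> x)"
  shows "helmholtz \<mu> D f y"
  unfolding helmholtz_def
proof (intro conjI allI impI)
  note contY = helmholtz_continuous[OF Y]
  show cont: "cont y" by (rule uniform_limit_theorem[OF _ lim]) (simp_all add: contY)
  fix \<phi> assume \<phi>: "test_fun D \<phi>"
  show "integrable lborel (\<lambda>x. f x * \<phi> x)" by (rule f[OF \<phi>])
  let ?w = "\<lambda>x. \<mu> * \<phi> x - lap \<phi> x"
  note w = test_fun_helmholtz[OF \<phi>, of \<mu>]
  have "(\<lambda>k. LBINT x. ?w x * Y k x) \<longlonglongrightarrow> (LBINT x. ?w x * y x)"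
    using integrable_times_test_fun[OF contY w] integrable_times_test_fun[OF cont w]
    by (intro integral_uniform_limit lim integrable_test_fun[OF w]) (simp_all add: mult.commute)
  moreover have "(LBINT x. ?w x * Y k x) = (LBINT x. F k x * \<phi> x)" for k
    using helmholtz_weak[OF Y \<phi>, of k] by (simp add: mult.commute)
  ultimately show "(LBINT x. y x * ?w x) = (LBINT x. f x * \<phi> x)"
    using LIMSEQ_unique[OF _ F[OF \<phi>]] by (simp add: mult.commute)
qed

definition has_exterior_ball :: "'a::real_normed_vector set \<Rightarrow> real \<Rightarrow> real \<Rightarrow> 'a \<Rightarrow> bool" where
  "has_exterior_ball \<Omega> \<sigma> \<tau> x \<longleftrightarrow> (\<exists>c. norm (c - x) = \<tau> \<and> ball c (\<sigma> * \<tau>) \<inter> \<Omega> = {})"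

(* This exterior condition is all that is used of the Lipschitz boundary. *)
definition corkscrew :: "'a::real_normed_vector set \<Rightarrow> bool" where
  "corkscrew \<Omega> \<longleftrightarrow> (\<exists>\<sigma> \<tau>0. 0 < \<sigma> \<and> \<sigma> \<le> 1 \<and> 0 < \<tau>0 \<and>
    (\<forall>x \<tau>. x \<notin> \<Omega> \<longrightarrow> 0 < \<tau> \<longrightarrow> \<tau> \<le> \<tau>0 \<longrightarrow> has_exterior_ball \<Omega> \<sigma> \<tau> x))"

locale corkscrew_domain =
  fixes \<Omega> :: "'a::euclidean_space set"
  assumes dim: "DIM('a) \<le> 3" and open_dom: "open \<Omega>" and bounded_dom: "bounded \<Omega>"
    and corkscrew_dom: "corkscrew \<Omega>"
begin

definition L2supp :: "('a \<Rightarrow> real) \<Rightarrow> bool" where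
  "L2supp f \<longleftrightarrow> square_integrable lborel f \<and> (\<forall>x. x \<notin> \<Omega> \<longrightarrow> f x = 0)"

lemma L2supp_square_integrable: "L2supp f \<Longrightarrow> square_integrable lborel f"
  by (simp add: L2supp_def)

lemma L2supp_measurable: "L2supp f \<Longrightarrow> f \<in> borel_measurable borel"
  by (simp add: L2supp_def square_integrable_def)

lemma L2supp_outside: "L2supp f \<Longrightarrow> x \<notin> \<Omega> \<Longrightarrow> f x = 0"
  by (simp add: L2supp_def)

lemma dom_measurable [measurable]: "\<Omega> \<in> sets borel"
  using open_dom by simp

lemma frontier_outside: "x \<in> frontier \<Omega> \<Longrightarrow> x \<notin> \<Omega>"
  using open_dom by (simp add: frontier_def interior_open)

definition vol :: real where "vol = measure lborel \<Omega>"

lemma indicator_dom_integrable: "integrable lborel (indicator \<Omega> :: 'a \<Rightarrow> real)"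
  by (rule integrable_indicator_bounded[OF bounded_dom]) measurable

lemma vol_nonneg: "0 \<le> vol" by (simp add: vol_def)

lemma L2supp_bounded:
  assumes [measurable]: "f \<in> borel_measurable borel" and outside: "\<And>x. x \<notin> \<Omega> \<Longrightarrow> f x = 0" and M: "\<And>x. \<bar>f x\<bar> \<le> M"
  shows "L2supp f" and "sqnorm f \<le> M\<^sup>2 * vol"
proof -
  have "(f x)\<^sup>2 \<le> M\<^sup>2 * indicator \<Omega> x" for x
    using outside[of x] power_mono[OF M[of x] abs_ge_zero, of 2] by (cases "x \<in> \<Omega>") auto
  then show "L2supp f" "sqnorm f \<le> M\<^sup>2 * vol"
    using square_integrable_bound[of f lborel "\<lambda>x. M\<^sup>2 * indicator \<Omega> x"] indicator_dom_integrable outside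
    by (auto simp: L2supp_def vol_def)
qed

lemma L2supp_indicator: "L2supp (indicator \<Omega>)"
  by (rule L2supp_bounded[where M = 1]) (auto simp: indicator_def)

lemma L2supp_integrable:
  assumes "L2supp f" shows "integrable lborel f"
proof -
  have "(\<lambda>x. indicator \<Omega> x * f x) = f" using L2supp_outside[OF assms] by (auto simp: indicator_def fun_eq_iff)
  then show ?thesis
    using square_integrable_imp_integrable_mult[OF L2supp_indicator[THEN L2supp_square_integrable]
        assms[THEN L2supp_square_integrable]]
    by simp
qed

lemma L2supp_lincomb: "L2supp f \<Longrightarrow> L2supp g \<Longrightarrow> L2supp (\<lambda>x. a * f x + b * g x)"
  by (simp add: L2supp_def square_integrable_lincomb)

lemma L2supp_diff: "L2supp f \<Longrightarrow> L2supp g \<Longrightarrow> L2supp (\<lambda>x. f x - g x)"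
  using L2supp_lincomb[of f g 1 "-1"] by simp

lemma L2supp_uminus: "L2supp f \<Longrightarrow> L2supp (\<lambda>x. - f x)"
  using L2supp_lincomb[of f f "-1" 0] by simp

lemma L2supp_abs: "L2supp f \<Longrightarrow> L2supp (\<lambda>x. \<bar>f x\<bar>)"
  by (auto simp: L2supp_def square_integrable_def)

lemma L2supp_indicator_times:
  assumes "cont y" "bounded (range y)" shows "L2supp (\<lambda>x. indicator \<Omega> x * y x)"
proof -
  obtain B where B: "\<And>x. \<bar>y x\<bar> \<le> B" using assms(2) by (auto simp: bounded_iff)
  have [measurable]: "y \<in> borel_measurable borel" by (rule borel_measurable_UNIV[OF assms(1)])
  show ?thesis
  proof (rule L2supp_bounded(1)[where M = "\<bar>B\<bar>"])
    show "\<bar>indicator \<Omega> x * y x\<bar> \<le> \<bar>B\<bar>" for x using B[of x] by (auto simp: indicator_def)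
  qed auto
qed

lemma L2supp_product_integrable: "L2supp f \<Longrightarrow> L2supp g \<Longrightarrow> integrable lborel (\<lambda>x. f x * g x)"
  by (intro square_integrable_imp_integrable_mult L2supp_square_integrable)

lemma integrable_L2supp_bounded:
  assumes "L2supp f" and [measurable]: "g \<in> borel_measurable borel" and C: "\<And>x. \<bar>g x\<bar> \<le> C"
  shows "integrable lborel (\<lambda>x. f x * g x)"
proof -
  note [measurable] = L2supp_measurable[OF assms(1)]
  show ?thesis
    by (rule bochner_integrable_bound[OF integrable_mult_left[OF L2supp_integrable[OF assms(1)], of C]])
      (use C order_trans[OF C abs_ge_self] in \<open>auto simp: abs_mult intro!: AE_I2 mult_left_mono\<close>)
qed

lemma integrable_L2supp_test: "L2supp f \<Longrightarrow> test_fun D \<phi> \<Longrightarrow> integrable lborel (\<lambda>x. f x * \<phi> x)"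
  using test_fun_bounded[of D \<phi>] borel_measurable_UNIV[OF test_fun_continuous[of D \<phi>]]
  by (blast intro: integrable_L2supp_bounded)

definition resolvent_norm :: "real \<Rightarrow> real" where
  "resolvent_norm \<mu> = sqrt (sqnorm (resolvent \<mu> :: 'a \<Rightarrow> real))"

lemma resolvent_norm_nonneg: "0 \<le> resolvent_norm \<mu>" by (simp add: resolvent_norm_def)

lemma resolvent_reflect:
  assumes "\<mu> > 0"
  shows "integrable lborel (\<lambda>z. resolvent \<mu> (x - z :: 'a))" "(LBINT z. resolvent \<mu> (x - z :: 'a)) = 1 / \<mu>"
    "square_integrable lborel (\<lambda>z. resolvent \<mu> (x - z :: 'a))" "sqnorm (\<lambda>z. resolvent \<mu> (x - z :: 'a)) =
        (resolvent_norm \<mu>)\<^sup>2"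
  using integrable_reflect[OF resolvent_integrable[OF assms]] lborel_integral_reflect[of "resolvent \<mu>" x]
    integrable_reflect[OF square_integrable_square[OF resolvent_square_integrable[OF assms dim]], of x]
    lborel_integral_reflect[of "\<lambda>z. (resolvent \<mu> (z::'a))\<^sup>2" x]
  by (simp_all add: resolvent_integral[OF assms] square_integrable_def L2_sqnorm_def resolvent_norm_def)

context
  fixes \<mu> :: real assumes \<mu>: "\<mu> > 0"
begin

lemma potential_integrable: "L2supp f \<Longrightarrow> integrable lborel (\<lambda>z. resolvent \<mu> (x - z) * f z)"
  by (intro square_integrable_imp_integrable_mult resolvent_reflect \<mu> L2supp_square_integrable)

lemma potential_L2_bound: "L2supp f \<Longrightarrow> \<bar>potential \<mu> f x\<bar> \<le> resolvent_norm \<mu> * sqrt (sqnorm f)"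
  using Cauchy_Schwarz_L2[OF resolvent_reflect(3)[OF \<mu>, of x] L2supp_square_integrable]
  by (simp add: potential_def L2_inner_def resolvent_reflect[OF \<mu>] abs_of_nonneg[OF resolvent_norm_nonneg])

lemma potential_lincomb:
  assumes "L2supp f" "L2supp g"
  shows "potential \<mu> (\<lambda>z. a * f z + b * g z) x = a * potential \<mu> f x + b * potential \<mu> g x"
proof -
  have "potential \<mu> (\<lambda>z. a * f z + b * g z) x =
      (LBINT z. a * (resolvent \<mu> (x - z) * f z) + b * (resolvent \<mu> (x - z) * g z))"
    unfolding potential_def by (simp add: algebra_simps)
  then show ?thesis using assms by (simp add: potential_def potential_integrable)
qed

lemma potential_diff:
  "L2supp f \<Longrightarrow> L2supp g \<Longrightarrow> potential \<mu> (\<lambda>z. f z - g z) x = potential \<mu> f x - potential \<mu> g x"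
  using potential_lincomb[of f g 1 "-1" x] by simp

lemma potential_mono:
  assumes "L2supp f" "L2supp g" "\<And>z. f z \<le> g z" shows "potential \<mu> f x \<le> potential \<mu> g x"
  unfolding potential_def using assms
  by (intro integral_mono potential_integrable) (auto intro: mult_left_mono simp: resolvent_nonneg)

lemma potential_nonneg: "(\<And>z. 0 \<le> f z) \<Longrightarrow> 0 \<le> potential \<mu> f x"
  unfolding potential_def by (auto intro!: integral_nonneg_AE AE_I2 simp: resolvent_nonneg)

lemma potential_upper:
  assumes "L2supp f" "\<And>x. f x \<le> F" shows "potential \<mu> f x \<le> F / \<mu>"
proof -
  have "potential \<mu> f x \<le> (LBINT z. resolvent \<mu> (x - z) * F)" unfolding potential_def
    by (intro integral_mono potential_integrable assms integrable_mult_left resolvent_reflect(1) \<mu>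
        mult_left_mono resolvent_nonneg)
  then show ?thesis by (simp add: resolvent_reflect(2)[OF \<mu>])
qed

lemma potential_bound:
  assumes "L2supp f" "\<And>x. \<bar>f x\<bar> \<le> F" shows "\<bar>potential \<mu> f x\<bar> \<le> F / \<mu>"
  using potential_upper[OF assms(1), of F x] potential_upper[OF L2supp_uminus[OF assms(1)], of F x]
    potential_lincomb[OF assms(1) assms(1), of "-1" 0 x] assms(2) by (simp add: abs_le_iff)

lemma potential_continuous_bounded:
  assumes "L2supp f" "\<And>x. \<bar>f x\<bar> \<le> M" shows "cont (potential \<mu> f)"
proof -
  obtain L where L: "\<And>x y. \<bar>potential \<mu> f x - potential \<mu> f y\<bar> \<le> L * norm (x - y)"
    using potential_lipschitz[OF \<mu> L2supp_measurable[OF assms(1)] assms(2)] by blast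
  have "0 \<le> L" using order_trans[OF abs_ge_zero L[of "SOME b. b \<in> Basis" 0]] SOME_Basis by simp
  then have "L-lipschitz_on UNIV (potential \<mu> f)" using L by (auto simp: lipschitz_on_def dist_norm)
  then show ?thesis by (rule lipschitz_on_continuous_on)
qed

end

definition clip :: "nat \<Rightarrow> ('a \<Rightarrow> real) \<Rightarrow> 'a \<Rightarrow> real" where
  "clip n f x = max (- real n) (min (real n) (f x))"

lemma clip_le: "\<bar>clip n f x\<bar> \<le> real n" "\<bar>clip n f x\<bar> \<le> \<bar>f x\<bar>" "\<bar>f x - clip n f x\<bar> \<le> \<bar>f x\<bar>"
  by (auto simp: clip_def)

lemma clip_eventually_eq: "\<forall>\<^sub>F n in sequentially. clip n f x = f x"
proof -
  obtain N where "\<bar>f x\<bar> \<le> real N" using real_arch_simple by blast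
  then show ?thesis by (intro eventually_sequentiallyI[of N]) (auto simp: clip_def max_def min_def abs_le_iff)
qed

lemma clip_L2supp: assumes "L2supp f" shows "L2supp (clip n f)"
proof (rule L2supp_bounded[OF _ _ clip_le(1)])
  note [measurable] = L2supp_measurable[OF assms]
  show "clip n f \<in> borel_measurable borel" unfolding clip_def[abs_def] by measurable
qed (simp add: clip_def L2supp_outside[OF assms])

lemma clip_tendsto: assumes "L2supp f" shows "(\<lambda>n. sqnorm (\<lambda>x. f x - clip n f x)) \<longlonglongrightarrow> 0"
proof -
  note [measurable] = L2supp_measurable[OF assms] L2supp_measurable[OF clip_L2supp[OF assms]]
  have "(\<lambda>n. LBINT x. (f x - clip n f x)\<^sup>2) \<longlonglongrightarrow> (LBINT x::'a. 0)"
  proof (rule integral_dominated_convergence[where w = "\<lambda>x. (f x)\<^sup>2"])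
    show "AE x in lborel. (\<lambda>n. (f x - clip n f x)\<^sup>2) \<longlonglongrightarrow> 0"
    proof (intro AE_I2 tendsto_eventually)
      fix x show "\<forall>\<^sub>F n in sequentially. (f x - clip n f x)\<^sup>2 = 0" using clip_eventually_eq[of f x]
        by eventually_elim simp
    qed
    show "AE x in lborel. norm ((f x - clip n f x)\<^sup>2) \<le> (f x)\<^sup>2" for n
      using power_mono[OF clip_le(3) abs_ge_zero, of f _ n 2] by (intro AE_I2) simp
  qed (use square_integrable_square[OF L2supp_square_integrable[OF assms]] in measurable)
  then show ?thesis by (simp add: L2_sqnorm_def)
qed

context
  fixes \<mu> :: real assumes \<mu>: "\<mu> > 0"
begin

lemma potential_continuous:
  assumes f: "L2supp f" shows "cont (potential \<mu> f)"
proof (rule uniform_limit_theorem[where F = sequentially and f = "\<lambda>n. potential \<mu> (clip n f)"])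
  show "\<forall>\<^sub>F n in sequentially. cont (potential \<mu> (clip n f))"
    by (intro always_eventually allI potential_continuous_bounded[OF \<mu> clip_L2supp[OF f] clip_le(1)])
  have bound: "\<bar>potential \<mu> (clip n f) x - potential \<mu> f x\<bar> \<le>
      resolvent_norm \<mu> * sqrt (sqnorm (\<lambda>x. f x - clip n f x))" for n x
    using potential_L2_bound[OF \<mu> L2supp_diff[OF f clip_L2supp[OF f]], of n x]
        potential_diff[OF \<mu> f clip_L2supp[OF f]]
    by (simp add: abs_minus_commute)
  have "(\<lambda>n. resolvent_norm \<mu> * sqrt (sqnorm (\<lambda>x. f x - clip n f x))) \<longlonglongrightarrow> resolvent_norm \<mu> * sqrt 0"
    by (intro tendsto_intros clip_tendsto f)
  then show "uniform_limit UNIV (\<lambda>n. potential \<mu> (clip n f)) (potential \<mu> f) sequentially"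
    by (intro uniform_limit_bound[OF bound]) simp
qed simp

lemma potential_fubini:
  assumes f: "L2supp f" and [measurable]: "g \<in> borel_measurable borel"
    and g: "\<And>z. integrable lborel (\<lambda>x. resolvent \<mu> (z - x) * g x)" "\<And>z. potential \<mu> (\<lambda>x. \<bar>g x\<bar>) z \<le> C"
  shows "(LBINT x. potential \<mu> f x * g x) = (LBINT z. f z * potential \<mu> g z)"
proof -
  note [measurable] = L2supp_measurable[OF f]
  let ?k = "\<lambda>(z, x). f z * (resolvent \<mu> (z - x) * g x)"
  have "integrable (lborel \<Otimes>\<^sub>M lborel) ?k"
  proof (rule lborel_pair.Fubini_integrable)
    show "AE z in lborel. integrable lborel (\<lambda>x. ?k (z, x))" using g(1) by simp
    show "integrable lborel (\<lambda>z. \<integral>x. norm (?k (z, x)) \<partial>lborel)"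
    proof (rule bochner_integrable_bound[OF integrable_mult_left[OF L2supp_integrable[OF f], of C]])
      have "(LBINT x. norm (?k (z, x))) = \<bar>f z\<bar> * potential \<mu> (\<lambda>x. \<bar>g x\<bar>) z" for z
        by (simp add: abs_mult potential_def abs_of_nonneg[OF resolvent_nonneg])
      moreover have "\<bar>f z\<bar> * potential \<mu> (\<lambda>x. \<bar>g x\<bar>) z \<le> \<bar>f z * C\<bar>" for z
        using order_trans[OF g(2) abs_ge_self, of z] by (simp add: abs_mult mult_left_mono)
      ultimately show "AE z in lborel. norm (LBINT x. norm (?k (z, x))) \<le> norm (f z * C)"
        using potential_nonneg[OF \<mu>, of "\<lambda>x. \<bar>g x\<bar>"] by (intro AE_I2) (simp add: abs_of_nonneg)
    qed measurable
  qed measurable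
  note pair = this
  have over_z: "(LBINT z. f z * (resolvent \<mu> (z - x) * g x)) = potential \<mu> f x * g x" for x
    unfolding potential_def resolvent_minus_commute[of \<mu> x]
    by (subst Bochner_Integration.integral_mult_left_zero[symmetric]) (simp only: mult_ac)
  have over_x: "(LBINT x. f z * (resolvent \<mu> (z - x) * g x)) = f z * potential \<mu> g z" for z
    by (simp add: potential_def)
  show ?thesis
    by (rule trans[OF lborel_pair.integral_snd[OF pair, unfolded over_z] lborel_pair.integral_fst[OF pair,
        unfolded over_x, symmetric]])
qed

lemma potential_symmetric:
  assumes f: "L2supp f" and g: "L2supp g"
  shows "ip (potential \<mu> f) g = ip f (potential \<mu> g)"
  unfolding L2_inner_def
proof (rule potential_fubini[OF f L2supp_measurable[OF g]])
  show "integrable lborel (\<lambda>x. resolvent \<mu> (z - x) * g x)" for z by (rule potential_integrable[OF \<mu> g])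
  show "potential \<mu> (\<lambda>x. \<bar>g x\<bar>) z \<le> resolvent_norm \<mu> * sqrt (sqnorm (\<lambda>x. \<bar>g x\<bar>))" for z
    by (rule order_trans[OF abs_ge_self potential_L2_bound[OF \<mu> L2supp_abs[OF g]]])
qed

lemma potential_helmholtz_test_fun:
  assumes \<phi>: "test_fun UNIV \<phi>" shows "potential \<mu> (\<lambda>x. \<mu> * \<phi> x - lap \<phi> x) (z::'a) = \<phi> z"
proof -
  have "test_fun UNIV (\<lambda>x. 1 * \<phi> (1 *\<^sub>R x + z))" by (rule test_fun_affine[OF \<phi>]) simp
  from resolvent_fundamental_solution[OF \<mu> this]
  have "(LBINT x. resolvent \<mu> x * (\<mu> * \<phi> (x + z) - lap \<phi> (x + z))) = \<phi> z"
    unfolding lap_affine[OF test_fun_smooth[OF \<phi>]] by simp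
  moreover have "(\<lambda>x. \<mu> * \<phi> x - lap \<phi> x) \<in> borel_measurable borel"
    by (rule borel_measurable_UNIV[OF test_fun_continuous[OF test_fun_helmholtz[OF \<phi>]]])
  ultimately show ?thesis
    unfolding potential_def resolvent_minus_commute[of \<mu> z]
    using lborel_integral_shift[of "\<lambda>x. resolvent \<mu> (x - z) * (\<mu> * \<phi> x - lap \<phi> x)" z] by simp
qed

lemma potential_helmholtz:
  assumes f: "L2supp f" shows "helmholtz \<mu> D f (potential \<mu> f)"
  unfolding helmholtz_def
proof (intro conjI allI impI)
  show "cont (potential \<mu> f)" by (rule potential_continuous[OF f])
  fix \<phi> :: "'a \<Rightarrow> real" assume D: "test_fun D \<phi>"
  show "integrable lborel (\<lambda>x. f x * \<phi> x)" by (rule integrable_L2supp_test[OF f D])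
  have \<phi>: "test_fun UNIV \<phi>" using D by (rule test_fun_mono) simp
  define g where "g x = \<mu> * \<phi> x - lap \<phi> x" for x
  have g: "test_fun UNIV g" unfolding g_def[abs_def] by (rule test_fun_helmholtz[OF \<phi>])
  then obtain C where C: "\<And>x. \<bar>g x\<bar> \<le> C" using test_fun_bounded by blast
  have [measurable]: "g \<in> borel_measurable borel"
    by (rule borel_measurable_UNIV[OF test_fun_continuous[OF g]])
  have int: "integrable lborel (\<lambda>x. resolvent \<mu> (z - x) * g x)" for z
    using square_integrable_imp_integrable_mult[OF resolvent_reflect(3)[OF \<mu>]]
      integrable_times_test_fun[OF test_fun_continuous[OF g] g]
        by (simp add: square_integrable_def power2_eq_square)
  have "potential \<mu> (\<lambda>x. \<bar>g x\<bar>) z \<le> (LBINT x. resolvent \<mu> (z - x) * C)" for z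
    unfolding potential_def using integrable_abs[OF int[of z]] C resolvent_reflect(1)[OF \<mu>, of z]
    by (intro integral_mono) (auto simp: abs_mult abs_of_nonneg[OF resolvent_nonneg] intro!: mult_left_mono
        resolvent_nonneg)
  then have "potential \<mu> (\<lambda>x. \<bar>g x\<bar>) z \<le> C / \<mu>" for z by (simp add: resolvent_reflect(2)[OF \<mu>])
  from potential_fubini[OF f borel_measurable_UNIV[OF test_fun_continuous[OF g]] int this]
  show "(LBINT x. potential \<mu> f x * (\<mu> * \<phi> x - lap \<phi> x)) = (LBINT x. f x * \<phi> x)"
    using potential_helmholtz_test_fun[OF \<phi>] by (simp add: g_def[abs_def])
qed

end

end

section \<open>Penalised problems and their boundary behaviour\<close>

lemma sup_contraction_fixpoint:
  fixes T :: "('a::metric_space \<Rightarrow> real) \<Rightarrow> 'a \<Rightarrow> real"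
  assumes T: "\<And>y. cont y \<Longrightarrow> bounded (range y) \<Longrightarrow> cont (T y) \<and> bounded (range (T y))"
    and q: "0 \<le> q" "q < 1"
    and contraction: "\<And>y y' d x. cont y \<Longrightarrow> bounded (range y) \<Longrightarrow> cont y' \<Longrightarrow> bounded (range y')
        \<Longrightarrow> (\<And>x. \<bar>y x - y' x\<bar> \<le> d) \<Longrightarrow> \<bar>T y x - T y' x\<bar> \<le> q * d"
  shows "\<exists>y. cont y \<and> bounded (range y) \<and> T y = y"
proof -
  define S :: "('a \<Rightarrow>\<^sub>C real) \<Rightarrow> ('a \<Rightarrow>\<^sub>C real)" where "S y = Bcontfun (T (apply_bcontfun y))" for y
  have continuous_bounded: "cont (apply_bcontfun y)" "bounded (range (apply_bcontfun y))"
    for y :: "'a \<Rightarrow>\<^sub>C real"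
    using apply_bcontfun[of y] by (auto simp: bcontfun_def)
  have S: "apply_bcontfun (S y) = T (apply_bcontfun y)" for y
    unfolding S_def by (rule Bcontfun_inverse) (use T[OF continuous_bounded[of y]] in
        \<open>auto simp: bcontfun_def\<close>)
  have "\<exists>!y. S y = y"
  proof (rule banach_fix_type[OF q])
    show "\<forall>y y'. dist (S y) (S y') \<le> q * dist y y'"
    proof (intro allI dist_bound)
      fix y y' x
      show "dist (apply_bcontfun (S y) x) (apply_bcontfun (S y') x) \<le> q * dist y y'"
        unfolding S dist_real_def using dist_bounded[of y _ y']
        by (intro contraction continuous_bounded) (simp add: dist_real_def)
    qed
  qed
  then obtain y where "S y = y" by blast
  then show ?thesis using S[of y] continuous_bounded[of y] by (intro exI[of _ "apply_bcontfun y"]) auto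
qed

context corkscrew_domain begin

(* (\<mu> - \<Delta>) y + n (1 - 1\<^sub>\<Omega>) y = f on the whole space, in resolvent form. *)
definition penalised :: "real \<Rightarrow> real \<Rightarrow> ('a \<Rightarrow> real) \<Rightarrow> ('a \<Rightarrow> real) \<Rightarrow> bool" where
  "penalised \<mu> n f y \<longleftrightarrow> cont y \<and> bounded (range y) \<and>
      y = potential (\<mu> + n) (\<lambda>x. f x + n * (indicator \<Omega> x * y x))"

lemma penalised_source_L2supp:
  "L2supp f \<Longrightarrow> cont y \<Longrightarrow> bounded (range y) \<Longrightarrow> L2supp (\<lambda>x. f x + n * (indicator \<Omega> x * y x))"
  using L2supp_lincomb[OF _ L2supp_indicator_times, of f y 1 n] by simp

lemma penalised_eq: "penalised \<mu> n f y \<Longrightarrow> y x = potential (\<mu> + n) (\<lambda>x. f x + n * (indicator \<Omega> x * y x)) x"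
  unfolding penalised_def by (elim conjE) (rule fun_cong)

context
  fixes \<mu> n :: real assumes \<mu>: "\<mu> > 0" and n: "n \<ge> 0"
begin

lemma penalised_exists:
  assumes f: "L2supp f" shows "\<exists>y. penalised \<mu> n f y"
proof -
  have \<mu>n: "\<mu> + n > 0" using \<mu> n by simp
  define g where "g y x = f x + n * (indicator \<Omega> x * y x)" for y :: "'a \<Rightarrow> real" and x
  have g: "L2supp (g y)" if "cont y" "bounded (range y)" for y
    unfolding g_def[abs_def] by (rule penalised_source_L2supp[OF f that])
  have "\<exists>y. cont y \<and> bounded (range y) \<and> potential (\<mu> + n) (g y) = y"
  proof (rule sup_contraction_fixpoint[where q = "n / (\<mu> + n)"])
    fix y :: "'a \<Rightarrow> real" assume y: "cont y" "bounded (range y)"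
    show "cont (potential (\<mu> + n) (g y)) \<and> bounded (range (potential (\<mu> + n) (g y)))"
      using potential_continuous[OF \<mu>n g[OF y]] potential_L2_bound[OF \<mu>n g[OF y]] by (auto simp: bounded_iff)
  next
    fix y y' :: "'a \<Rightarrow> real" and d x assume y: "cont y" "bounded (range y)"
      and y': "cont y'" "bounded (range y')"
      and d: "\<And>x. \<bar>y x - y' x\<bar> \<le> d"
    have "\<bar>potential (\<mu> + n) (\<lambda>x. g y x - g y' x) x\<bar> \<le> (n * d) / (\<mu> + n)"
    proof (rule potential_bound[OF \<mu>n L2supp_diff[OF g[OF y] g[OF y']]])
      fix x
      have "g y x - g y' x = n * (indicator \<Omega> x * (y x - y' x))" by (simp add: g_def algebra_simps)
      then show "\<bar>g y x - g y' x\<bar> \<le> n * d" using d[of x] n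
        by (auto simp: indicator_def abs_mult intro: mult_left_mono)
    qed
    then show "\<bar>potential (\<mu> + n) (g y) x - potential (\<mu> + n) (g y') x\<bar> \<le> n / (\<mu> + n) * d"
      using potential_diff[OF \<mu>n g[OF y] g[OF y']] by simp
  qed (use n \<mu> in auto)
  then show ?thesis unfolding penalised_def g_def[abs_def] by metis
qed

lemma penalised_uminus:
  assumes f: "L2supp f" and y: "penalised \<mu> n f y" shows "penalised \<mu> n (\<lambda>x. - f x) (\<lambda>x. - y x)"
proof -
  let ?g = "\<lambda>x. f x + n * (indicator \<Omega> x * y x)"
  have cont: "cont y" and bdd: "bounded (range y)" using y by (simp_all add: penalised_def)
  have "potential (\<mu> + n) (\<lambda>x. - f x + n * (indicator \<Omega> x * - y x)) x = - potential (\<mu> + n) ?g x" for x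
    using potential_lincomb[of "\<mu> + n" ?g ?g "-1" 0 x] penalised_source_L2supp[OF f cont bdd] \<mu> n by simp
  then have "(\<lambda>x. - y x) = potential (\<mu> + n) (\<lambda>x. - f x + n * (indicator \<Omega> x * - y x))"
    by (intro ext) (simp flip: penalised_eq[OF y])
  then show ?thesis using cont bdd unfolding penalised_def
    by (auto simp: bounded_iff intro: continuous_on_minus)
qed

lemma penalised_upper:
  assumes f: "L2supp f" "\<And>x. f x \<le> F" "0 \<le> F" and y: "penalised \<mu> n f y" shows "y x \<le> F / \<mu>"
proof -
  let ?g = "\<lambda>x. f x + n * (indicator \<Omega> x * y x)"
  have cont: "cont y" and bdd: "bounded (range y)" using y by (simp_all add: penalised_def)
  define S where "S = max 0 (SUP x. y x)"
  have "bdd_above (range y)" by (rule bounded_imp_bdd_above[OF bdd])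
  then have S: "0 \<le> S" "y x \<le> S" for x using cSUP_upper[of x UNIV y] by (auto simp: S_def)
  have "?g x \<le> F + n * S" for x
    using f(2)[of x] f(3) S n mult_left_mono[OF S(2)[of x] n]
    by (cases "x \<in> \<Omega>") (auto intro: add_mono add_increasing2)
  then have "y x \<le> (F + n * S) / (\<mu> + n)" for x
    using potential_upper[OF _ penalised_source_L2supp[OF f(1) cont bdd], where F = "F + n * S"] \<mu> n
    by (simp add: penalised_eq[OF y, of x])
  then have "S \<le> (F + n * S) / (\<mu> + n)"
    unfolding S_def using \<mu> n f(3) S(1) by (auto simp: S_def intro!: cSUP_least)
  then have "S \<le> F / \<mu>" using \<mu> n by (simp add: field_simps)
  then show ?thesis by (rule order_trans[OF S(2)])
qed

lemma penalised_bound: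
  assumes f: "L2supp f" "\<And>x. \<bar>f x\<bar> \<le> F" and y: "penalised \<mu> n f y" shows "\<bar>y x\<bar> \<le> F / \<mu>"
proof -
  have F: "0 \<le> F" by (rule order_trans[OF abs_ge_zero f(2)])
  have "y x \<le> F / \<mu>" by (rule penalised_upper[OF f(1) _ F y]) (use f(2) in \<open>auto simp: abs_le_iff\<close>)
  moreover have "- y x \<le> F / \<mu>"
    by (rule penalised_upper[OF L2supp_uminus[OF f(1)] _ F penalised_uminus[OF f(1) y]])
        (use f(2) in \<open>auto simp: abs_le_iff\<close>)
  ultimately show ?thesis by (simp add: abs_le_iff)
qed

lemma penalised_lipschitz:
  assumes f: "L2supp f" "\<And>x. \<bar>f x\<bar> \<le> F" and y: "penalised \<mu> n f y"
  shows "\<bar>y x - y x'\<bar> \<le> (F + n * (F / \<mu>)) * potential_lipschitz_const TYPE('a) (\<mu> + n) * norm (x - x')"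
proof -
  define A where "A x = f x + n * (indicator \<Omega> x * y x)" for x
  have F: "0 \<le> F / \<mu>" using order_trans[OF abs_ge_zero f(2)] \<mu> by simp
  have "\<bar>A x\<bar> \<le> F + n * (F / \<mu>)" for x
  proof -
    have "\<bar>indicator \<Omega> x * y x\<bar> \<le> F / \<mu>" using penalised_bound[OF f y, of x] F by (auto simp: indicator_def)
    then have "\<bar>n * (indicator \<Omega> x * y x)\<bar> \<le> n * (F / \<mu>)" unfolding abs_mult[of n] abs_of_nonneg[OF n] using n
      by (rule mult_left_mono)
    then show ?thesis using f(2)[of x] unfolding A_def by linarith
  qed
  moreover have "L2supp A" unfolding A_def[abs_def] using y
    by (intro penalised_source_L2supp f) (auto simp: penalised_def)
  ultimately have "\<bar>potential (\<mu> + n) A x - potential (\<mu> + n) A x'\<bar> \<le>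
      (F + n * (F / \<mu>)) * potential_lipschitz_const TYPE('a) (\<mu> + n) * norm (x - x')"
    using \<mu> n by (intro potential_lipschitz L2supp_measurable) auto
  then show ?thesis using penalised_eq[OF y, of x] penalised_eq[OF y, of x'] by (simp add: A_def[abs_def])
qed

lemma penalised_helmholtz:
  assumes f: "L2supp f" and y: "penalised \<mu> n f y"
  shows "helmholtz (\<mu> + n) UNIV (\<lambda>x. f x + n * (indicator \<Omega> x * y x)) y"
  using potential_helmholtz[of "\<mu> + n" "\<lambda>x. f x + n * (indicator \<Omega> x * y x)"] penalised_source_L2supp[OF f,
      of y n] y \<mu> n
  by (simp add: penalised_def)

lemma penalised_helmholtz_inside:
  assumes f: "L2supp f" and y: "penalised \<mu> n f y" shows "helmholtz \<mu> \<Omega> f y"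
  by (rule helmholtz_cong[OF helmholtz_change_coefficient[OF
      helmholtz_mono[OF penalised_helmholtz[OF f y]]]]) auto

lemma penalised_helmholtz_outside:
  assumes f: "L2supp f" and y: "penalised \<mu> n f y" and "D \<inter> \<Omega> = {}" shows "helmholtz (\<mu> + n) D (\<lambda>x. 0) y"
  by (rule helmholtz_cong[OF helmholtz_mono[OF penalised_helmholtz[OF f y]]])
    (use L2supp_outside[OF f] assms(3) in \<open>auto simp: indicator_def\<close>)

lemma penalised_subsolution:
  assumes f: "L2supp f" "\<And>x. f x \<le> F" and y: "penalised \<mu> n f y"
  obtains g where "helmholtz 0 UNIV g y" "\<And>x. 0 < y x \<Longrightarrow> g x \<le> F"
proof
  let ?g = "\<lambda>x. f x + n * (indicator \<Omega> x * y x) + (0 - (\<mu> + n)) * y x"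
  show "helmholtz 0 UNIV ?g y" by (rule helmholtz_change_coefficient[OF penalised_helmholtz[OF f(1) y]])
  show "?g x \<le> F" if "0 < y x" for x
  proof -
    have "n * (indicator \<Omega> x * y x) \<le> n * y x" using that n
      by (intro mult_left_mono) (auto simp: indicator_def)
    moreover have "0 \<le> \<mu> * y x" using \<mu> that by simp
    ultimately show ?thesis using f(2)[of x] by (simp add: algebra_simps)
  qed
qed

end

end

lemma smooth_sqdist: "smooth (\<lambda>x::'a::euclidean_space. (x - a) \<bullet> (x - a))"
  by (rule elementary_smooth[OF elementary_sqdist])

lemma smooth_gaussian: "smooth (\<lambda>x::'a::euclidean_space. exp (a * ((x - c) \<bullet> (x - c))))"
  by (intro elementary_smooth elementary.exp elementary.mult elementary.const elementary_sqdist)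

lemma lap_gaussian:
  "lap (\<lambda>x::'a::euclidean_space. exp (a * ((x - c) \<bullet> (x - c)))) x =
    (4 * a\<^sup>2 * ((x - c) \<bullet> (x - c)) + 2 * a * DIM('a)) * exp (a * ((x - c) \<bullet> (x - c)))"
proof -
  let ?g = "\<lambda>x::'a. exp (a * ((x - c) \<bullet> (x - c)))"
  have first: "(?g has_derivative (\<lambda>h. 2 * a * ((x - c) \<bullet> h) * ?g x)) (at x)" for x
    by (auto intro!: derivative_eq_intros simp: inner_commute algebra_simps)
  have pd: "pd ?g b = (\<lambda>x. 2 * a * ((x - c) \<bullet> b) * ?g x)" for b using pd_eq[OF first] by blast
  have second: "((\<lambda>x. 2 * a * ((x - c) \<bullet> b) * ?g x) has_derivative
      (\<lambda>h. 2 * a * ((x - c) \<bullet> b) * (2 * a * ((x - c) \<bullet> h) * ?g x) + 2 * a * (h \<bullet> b) * ?g x)) (at x)" for b x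
    by (rule has_derivative_mult[OF _ first]) (auto intro!: derivative_eq_intros)
  have "pd (pd ?g b) b x = (4 * a\<^sup>2 * (((x - c) \<bullet> b) * ((x - c) \<bullet> b)) + 2 * a) * ?g x" if "b \<in> Basis" for b
    unfolding pd pd_eq[OF second] using that by (simp add: power2_eq_square algebra_simps)
  then have "lap ?g x = (4 * a\<^sup>2 * (\<Sum>b\<in>Basis. ((x - c) \<bullet> b) * ((x - c) \<bullet> b)) + 2 * a * DIM('a)) * ?g x"
    by (simp add: lap_def sum_distrib_left sum.distrib flip: sum_distrib_right)
  then show ?thesis using euclidean_inner[of "x - c" "x - c"] by simp
qed

definition annulus_barrier :: "real \<Rightarrow> real \<Rightarrow> real \<Rightarrow> real \<Rightarrow> 'a::euclidean_space \<Rightarrow> 'a \<Rightarrow> real" where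
  "annulus_barrier a m F R c x =
    m * (1 - (exp (- a * (norm (x - c))\<^sup>2) - exp (- a * R\<^sup>2)) / 2) + F * (R\<^sup>2 - (norm (x - c))\<^sup>2) /
        (2 * DIM('a))"

lemma
  fixes c :: "'a::euclidean_space"
  shows smooth_annulus_barrier: "smooth (annulus_barrier a m F R c)" (is ?smooth)
    and lap_annulus_barrier: "lap (annulus_barrier a m F R c) x =
      - (m / 2 * ((4 * a\<^sup>2 * (norm (x - c))\<^sup>2 - 2 * a * DIM('a)) * exp (- a * (norm (x - c))\<^sup>2))) -
          F" (is ?lap)
proof -
  define k where "k = m + m * exp (- a * R\<^sup>2) / 2 + F * R\<^sup>2 / (2 * DIM('a))"
  have eq: "annulus_barrier a m F R c = (\<lambda>x. (- m / 2) * exp (- a * ((x - c) \<bullet> (x - c))) +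
      ((- F / (2 * DIM('a))) * ((x - c) \<bullet> (x - c)) + k))"
    by (auto simp: annulus_barrier_def k_def dot_square_norm field_simps)
  note smooth = smooth_cmult[OF smooth_gaussian] smooth_cmult[OF smooth_sqdist] smooth_const
  show ?smooth unfolding eq by (intro smooth_add smooth)
  show ?lap unfolding eq lap_add[OF smooth(1) smooth_add[OF smooth(2,3)]] lap_add[OF smooth(2,3)]
      lap_cmult[OF smooth_gaussian] lap_cmult[OF smooth_sqdist] lap_gaussian lap_sqdist lap_const
    by (simp add: dot_square_norm)
qed

lemma annulus_barrier_le:
  fixes c :: "'a::euclidean_space"
  assumes "0 \<le> a" "0 \<le> m" "0 \<le> F" "norm (x - c) \<le> r"
  shows "annulus_barrier a m F R c x \<le> m * (1 - (exp (- a * r\<^sup>2) - exp (- a * R\<^sup>2)) / 2) +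
      F * R\<^sup>2 / (2 * DIM('a))"
proof -
  have "a * (norm (x - c))\<^sup>2 \<le> a * r\<^sup>2" using assms by (intro mult_left_mono power_mono) auto
  then have "exp (- a * r\<^sup>2) \<le> exp (- a * (norm (x - c))\<^sup>2)" by simp
  then show ?thesis unfolding annulus_barrier_def
    using assms by (intro add_mono mult_left_mono divide_right_mono) auto
qed

lemma annulus_barrier_ge_half:
  assumes "0 \<le> a" "0 \<le> m" "0 \<le> F" "norm (x - c) \<le> R" shows "m / 2 \<le> annulus_barrier a m F R c x"
proof -
  have "exp (- a * (norm (x - c))\<^sup>2) \<le> 1" using assms by simp
  moreover have "0 < exp (- a * R\<^sup>2)" by simp
  ultimately have "1 / 2 \<le> 1 - (exp (- a * (norm (x - c))\<^sup>2) - exp (- a * R\<^sup>2)) / 2" by argo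
  then have "m * (1 / 2) \<le> m * (1 - (exp (- a * (norm (x - c))\<^sup>2) - exp (- a * R\<^sup>2)) / 2)"
    using assms(2) by (rule mult_left_mono)
  moreover have "(norm (x - c))\<^sup>2 \<le> R\<^sup>2" using assms(4) by (intro power_mono) auto
  ultimately show ?thesis using assms(3) by (simp add: annulus_barrier_def add_increasing2)
qed

lemma annulus_estimate:
  fixes c :: "'a::euclidean_space"
  assumes y: "helmholtz 0 UNIV g y" and g: "\<And>x. 0 < y x \<Longrightarrow> g x \<le> F" and F: "0 \<le> F" and m: "0 \<le> m"
    and r: "0 < r" "r < R"
    and outer: "\<And>x. norm (x - c) = R \<Longrightarrow> y x \<le> m" and inner: "\<And>x. norm (x - c) \<le> r \<Longrightarrow> y x \<le> m / 2"
    and x: "norm (x - c) < R"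
  shows "y x \<le> annulus_barrier (DIM('a) / (2 * r\<^sup>2)) m F R c x"
proof (cases "norm (x - c) \<le> r")
  case True
  have "m / 2 \<le> annulus_barrier (DIM('a) / (2 * r\<^sup>2)) m F R c x"
    by (rule annulus_barrier_ge_half) (use m F x in auto)
  then show ?thesis using inner[OF True] by linarith
next
  case False
  define a where "a = DIM('a) / (2 * r\<^sup>2)"
  have a: "0 < a" using r by (simp add: a_def)
  define D where "D = ball c R - cball c r"
  have D: "x \<in> D \<longleftrightarrow> r < norm (x - c) \<and> norm (x - c) < R" for x
    by (auto simp: D_def dist_norm norm_minus_commute)
  have half: "m / 2 \<le> annulus_barrier a m F R c x" if "norm (x - c) \<le> R" for x
    by (rule annulus_barrier_ge_half) (use a m F that in auto)
  have "y x \<le> annulus_barrier a m F R c x"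
  proof (rule helmholtz_comparison[where D = D and \<mu> = 0])
    show "helmholtz 0 D g y" by (rule helmholtz_mono[OF y]) simp
    show "helmholtz 0 D (\<lambda>x. 0 * annulus_barrier a m F R c x - lap (annulus_barrier a m F R c) x)
        (annulus_barrier a m F R c)"
      by (rule helmholtz_smooth[OF smooth_annulus_barrier])
  next
    fix x assume "x \<in> frontier D"
    then have "x \<in> frontier (ball c R) \<union> frontier (cball c r)"
      using frontier_Int_subset[of "ball c R" "- cball c r"] unfolding D_def Diff_eq by auto
    then consider "norm (x - c) = R" | "norm (x - c) = r" using r by (auto simp: dist_norm norm_minus_commute)
    then show "y x \<le> annulus_barrier a m F R c x"
    proof cases
      assume R: "norm (x - c) = R"
      show ?thesis using outer[OF R] by (simp add: annulus_barrier_def R)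
    qed (use inner[of x] half[of x] r in linarith)
  next
    fix x assume x: "x \<in> D" "annulus_barrier a m F R c x < y x"
    then have "g x \<le> F" using half[of x] m by (intro g) (simp add: D)
    also have "r\<^sup>2 \<le> (norm (x - c))\<^sup>2" using x(1) r by (intro power_mono) (auto simp: D)
    then have "2 * a * DIM('a) \<le> 2 * a * (2 * a * (norm (x - c))\<^sup>2)"
      using a r by (intro mult_left_mono) (simp_all add: a_def field_simps)
    then have "0 \<le> m / 2 * ((4 * a\<^sup>2 * (norm (x - c))\<^sup>2 - 2 * a * DIM('a)) * exp (- a * (norm (x - c))\<^sup>2))"
      using m by (intro mult_nonneg_nonneg) (auto simp: power2_eq_square mult_ac)
    then have "F \<le> - lap (annulus_barrier a m F R c) x" unfolding lap_annulus_barrier by simp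
    finally show "g x \<le> 0 * annulus_barrier a m F R c x - lap (annulus_barrier a m F R c) x" by simp
  qed (use x False in \<open>auto simp: D_def dist_norm norm_minus_commute\<close>)
  then show ?thesis by (simp add: a_def)
qed

(* Comparison with a quadratic barrier. *)
lemma helmholtz_centre_halving:
  fixes c :: "'a::euclidean_space"
  assumes y: "helmholtz \<mu> (ball c s) (\<lambda>x. 0) y" and s: "s > 0" and \<mu>: "8 * real DIM('a) \<le> \<mu> * s\<^sup>2"
    and m: "m \<ge> 0" "\<And>z. norm (z - c) = s \<Longrightarrow> y z \<le> m" and x: "norm (x - c) \<le> s / 2"
  shows "y x \<le> m / 2"
proof -
  have "0 < \<mu> * s\<^sup>2" by (rule less_le_trans[OF _ \<mu>]) simp
  then have \<mu>0: "\<mu> > 0" using s by (simp add: zero_less_mult_iff)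
  define k where "k = 2 * DIM('a) * m / (\<mu> * s\<^sup>2)"
  have k: "0 \<le> k" "k \<le> m / 4"
    using m(1) \<mu>0 s mult_right_mono[OF \<mu> m(1)] by (auto simp: k_def divide_le_eq field_simps)
  define \<psi> where "\<psi> x = (m / s\<^sup>2) * ((x - c) \<bullet> (x - c)) + k" for x
  note smooth = smooth_cmult[OF smooth_sqdist] smooth_const
  have smooth_\<psi>: "smooth \<psi>" unfolding \<psi>_def[abs_def] by (intro smooth_add smooth)
  have lap_\<psi>: "lap \<psi> x = (m / s\<^sup>2) * (2 * DIM('a))" for x
    unfolding \<psi>_def[abs_def] lap_add[OF smooth] lap_cmult[OF smooth_sqdist] lap_sqdist lap_const by simp
  have "y x \<le> \<psi> x"
  proof (rule helmholtz_comparison[OF _ _ less_imp_le[OF \<mu>0] y helmholtz_smooth[OF smooth_\<psi>]])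
    show "y x \<le> \<psi> x" if "x \<in> frontier (ball c s)" for x
    proof -
      have on_sphere: "norm (x - c) = s" using that s by (simp add: dist_norm norm_minus_commute)
      then have "\<psi> x = m + k" using s by (simp add: \<psi>_def dot_square_norm)
      then show ?thesis using m(2)[OF on_sphere] k by linarith
    qed
    show "0 \<le> \<mu> * \<psi> x - lap \<psi> x" for x
      using \<mu>0 s m(1) by (simp add: \<psi>_def lap_\<psi> k_def distrib_left)
  qed (use x s in \<open>auto simp: dist_norm norm_minus_commute\<close>)
  moreover have "(m / s\<^sup>2) * ((x - c) \<bullet> (x - c)) \<le> (m / s\<^sup>2) * (s / 2)\<^sup>2"
    unfolding dot_square_norm using x m by (intro mult_left_mono power_mono) auto
  then have "\<psi> x \<le> m / 4 + k" using s by (simp add: \<psi>_def power_divide)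
  then have "\<psi> x \<le> m / 2" using k(2) by linarith
  ultimately show ?thesis by linarith
qed

(* The fraction of the boundary values absorbed at one scale. *)
definition corkscrew_gain :: "'a::euclidean_space itself \<Rightarrow> real \<Rightarrow> real" where
  "corkscrew_gain _ \<sigma> = exp (- (9 * DIM('a) / (2 * \<sigma>\<^sup>2))) - exp (- (18 * DIM('a) / \<sigma>\<^sup>2))"

lemma corkscrew_gain_bounds:
  assumes "0 < \<sigma>" shows "0 < corkscrew_gain TYPE('a::euclidean_space) \<sigma>" "corkscrew_gain TYPE('a) \<sigma> < 1"
proof -
  have "- (18 * DIM('a) / \<sigma>\<^sup>2) < - (9 * DIM('a) / (2 * \<sigma>\<^sup>2))" using assms by (simp add: field_simps)
  then show "0 < corkscrew_gain TYPE('a) \<sigma>" by (simp add: corkscrew_gain_def)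
  have "exp (- (9 * DIM('a) / (2 * \<sigma>\<^sup>2))) \<le> 1" using assms by simp
  then show "corkscrew_gain TYPE('a) \<sigma> < 1"
    unfolding corkscrew_gain_def using exp_gt_zero[of "- (18 * DIM('a) / \<sigma>\<^sup>2)"] by linarith
qed

context corkscrew_domain begin

lemma penalised_decay:
  assumes \<mu>: "\<mu> > 0" and n: "n \<ge> 0" and f: "L2supp f" "\<And>x. f x \<le> F" and F: "0 \<le> F" and y: "penalised \<mu> n f y"
    and \<sigma>: "0 < \<sigma>" "\<sigma> \<le> 1" and \<tau>: "0 < \<tau>" and c: "norm (c - x) = \<tau>" "ball c (\<sigma> * \<tau>) \<inter> \<Omega> = {}"
    and large: "8 * real DIM('a) \<le> n * (\<sigma> * \<tau>)\<^sup>2" and m: "0 \<le> m" "\<And>z. norm (z - c) \<le> 3 * \<tau> \<Longrightarrow> y z \<le> m"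
    and z: "norm (z - x) \<le> \<tau> / 2"
  shows "y z \<le> m * (1 - corkscrew_gain TYPE('a) \<sigma> / 2) + F * (9 * \<tau>\<^sup>2) / (2 * DIM('a))"
proof -
  define s where "s = \<sigma> * \<tau>"
  have s: "0 < s" "s \<le> \<tau>" using \<sigma> \<tau> by (auto simp: s_def mult_left_le_one_le)
  have halving: "y z \<le> m / 2" if "norm (z - c) \<le> s / 2" for z
  proof (rule helmholtz_centre_halving[OF _ s(1) _ m(1) _ that])
    show "helmholtz (\<mu> + n) (ball c s) (\<lambda>x. 0) y"
      by (rule penalised_helmholtz_outside[OF \<mu> n f(1) y]) (use c in \<open>simp add: s_def\<close>)
    show "8 * real DIM('a) \<le> (\<mu> + n) * s\<^sup>2" using large \<mu> by (simp add: s_def distrib_right add_increasing)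
  qed (use m s in auto)
  obtain g where g: "helmholtz 0 UNIV g y" "\<And>x. 0 < y x \<Longrightarrow> g x \<le> F"
    using penalised_subsolution[OF \<mu> n f y] by blast
  have z_near_c: "norm (z - c) \<le> 3 * \<tau> / 2"
    using norm_triangle_ineq[of "z - x" "x - c"] z c by (simp add: norm_minus_commute)
  define a where "a = DIM('a) / (2 * (s / 2)\<^sup>2)"
  have "y z \<le> annulus_barrier a m F (3 * \<tau>) c z" unfolding a_def
    by (rule annulus_estimate[OF g F m(1)]) (use s m \<tau> z_near_c halving in auto)
  also have "\<dots> \<le> m * (1 - (exp (- a * (3 * \<tau> / 2)\<^sup>2) - exp (- a * (3 * \<tau>)\<^sup>2)) / 2) +
      F * (3 * \<tau>)\<^sup>2 / (2 * DIM('a))"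
    by (rule annulus_barrier_le[OF _ m(1) F z_near_c]) (simp add: a_def)
  also have "a * (3 * \<tau> / 2)\<^sup>2 = 9 * DIM('a) / (2 * \<sigma>\<^sup>2)" "a * (3 * \<tau>)\<^sup>2 = 18 * DIM('a) / \<sigma>\<^sup>2"
    using \<sigma> \<tau> by (simp_all add: a_def s_def power2_eq_square field_simps)
  then have "exp (- a * (3 * \<tau> / 2)\<^sup>2) - exp (- a * (3 * \<tau>)\<^sup>2) = corkscrew_gain TYPE('a) \<sigma>"
    by (simp add: corkscrew_gain_def)
  finally show ?thesis by (simp add: power_mult_distrib)
qed

lemma small_quadratic:
  fixes C e r :: real
  assumes e: "e > 0" and r: "r > 0" obtains t where "0 < t" "t < r" "C * t\<^sup>2 < e"
proof -
  have "((\<lambda>t. C * t\<^sup>2) \<longlongrightarrow> C * 0\<^sup>2) (at_right 0)" by (intro tendsto_intros)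
  then have "\<forall>\<^sub>F t in at_right 0. C * t\<^sup>2 < e" using e by (intro order_tendstoD(2)) auto
  then have "\<forall>\<^sub>F t in at_right 0. C * t\<^sup>2 < e \<and> t \<in> {0<..<r}"
    by (rule eventually_conj) (rule eventually_at_right_real[OF r])
  then have "\<exists>t. C * t\<^sup>2 < e \<and> t \<in> {0<..<r}" by (rule eventually_happens'[OF trivial_limit_at_right_real])
  then show ?thesis using that by auto
qed

definition boundary_bound :: "real \<Rightarrow> real \<Rightarrow> real \<Rightarrow> bool" where
  "boundary_bound \<mu> F m \<longleftrightarrow> (\<exists>\<rho>>0. \<exists>n0\<ge>0. \<forall>n\<ge>n0. \<forall>f y. L2supp f \<longrightarrow> (\<forall>x. \<bar>f x\<bar> \<le> F) \<longrightarrow> penalised \<mu> n f y \<longrightarrow>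
    (\<forall>x z. x \<notin> \<Omega> \<longrightarrow> norm (z - x) \<le> \<rho> \<longrightarrow> y z \<le> m))"

lemma boundary_bound_step:
  assumes \<mu>: "\<mu> > 0" and F: "F \<ge> 0"
  obtains \<theta> where "0 < \<theta>" "\<theta> < 1" "\<And>m. m > 0 \<Longrightarrow> boundary_bound \<mu> F m \<Longrightarrow> boundary_bound \<mu> F (\<theta> * m)"
proof -
  obtain \<sigma> \<tau>0 where \<sigma>: "\<sigma> > 0" "\<sigma> \<le> 1" "\<tau>0 > 0"
    and exterior: "\<And>x \<tau>. x \<notin> \<Omega> \<Longrightarrow> 0 < \<tau> \<Longrightarrow> \<tau> \<le> \<tau>0 \<Longrightarrow> has_exterior_ball \<Omega> \<sigma> \<tau> x"
    using corkscrew_dom unfolding corkscrew_def by blast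
  define \<delta> where "\<delta> = corkscrew_gain TYPE('a) \<sigma>"
  have \<delta>: "0 < \<delta>" "\<delta> < 1" using corkscrew_gain_bounds[OF \<sigma>(1), where 'a = 'a] by (auto simp: \<delta>_def)
  have "boundary_bound \<mu> F ((1 - \<delta> / 4) * m)" if m: "m > 0" and bound: "boundary_bound \<mu> F m" for m
  proof -
    obtain \<rho> n0 where \<rho>: "\<rho> > 0" "n0 \<ge> 0" and near: "\<And>n f y x z. n \<ge> n0 \<Longrightarrow> L2supp f \<Longrightarrow> (\<And>x. \<bar>f x\<bar> \<le> F) \<Longrightarrow>
        penalised \<mu> n f y \<Longrightarrow> x \<notin> \<Omega> \<Longrightarrow> norm (z - x) \<le> \<rho> \<Longrightarrow> y z \<le> m"
      using bound unfolding boundary_bound_def by blast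
    have "0 < m * \<delta> / 4" "0 < min \<tau>0 (\<rho> / 4)" using m \<delta> \<sigma> \<rho> by auto
    then obtain \<tau> where \<tau>: "0 < \<tau>" "\<tau> < min \<tau>0 (\<rho> / 4)" "(F * 9 / (2 * DIM('a))) * \<tau>\<^sup>2 < m * \<delta> / 4"
      by (rule small_quadratic)
    define n1 where "n1 = max n0 (8 * DIM('a) / (\<sigma> * \<tau>)\<^sup>2)"
    have "y z \<le> (1 - \<delta> / 4) * m"
      if n: "n \<ge> n1" and f: "L2supp f" "\<And>x. \<bar>f x\<bar> \<le> F" and y: "penalised \<mu> n f y"
        and x: "x \<notin> \<Omega>" "norm (z - x) \<le> \<tau> / 2" for n f y x z
    proof -
      have n': "n \<ge> n0" "n \<ge> 0" "8 * real DIM('a) \<le> n * (\<sigma> * \<tau>)\<^sup>2"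
        using n \<rho> \<sigma> \<tau> by (auto simp: n1_def pos_divide_le_eq)
      obtain c where c: "norm (c - x) = \<tau>" "ball c (\<sigma> * \<tau>) \<inter> \<Omega> = {}" using exterior[OF x(1) \<tau>(1)] \<tau>(2)
        unfolding has_exterior_ball_def by auto
      have "y z \<le> m" if "norm (z - c) \<le> 3 * \<tau>" for z
        by (rule near[OF n'(1) f y x(1)]) (use norm_triangle_ineq[of "z - c" "c - x"] that c \<tau> in simp)
      with n' c \<sigma> \<tau> m x f have "y z \<le> m * (1 - \<delta> / 2) + F * (9 * \<tau>\<^sup>2) / (2 * DIM('a))"
        unfolding \<delta>_def by (intro penalised_decay[OF \<mu> _ f(1) _ F y, where c = c and x = x])
            (auto simp: abs_le_iff)
      also have "\<dots> \<le> m * (1 - \<delta> / 2) + m * \<delta> / 4" using \<tau>(3) by simp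
      finally show ?thesis by (simp add: algebra_simps)
    qed
    moreover have "n1 \<ge> 0" using \<rho> by (simp add: n1_def)
    ultimately show ?thesis unfolding boundary_bound_def using \<tau>(1)
      by (intro exI[of _ "\<tau> / 2"] conjI exI[of _ n1]) auto
  qed
  then show ?thesis using \<delta> by (intro that[of "1 - \<delta> / 4"]) auto
qed

lemma boundary_bound_small:
  assumes \<mu>: "\<mu> > 0" and F: "F \<ge> 0" and \<epsilon>: "\<epsilon> > 0" shows "boundary_bound \<mu> F \<epsilon>"
proof -
  obtain \<theta> where \<theta>: "0 < \<theta>" "\<theta> < 1" "\<And>m. m > 0 \<Longrightarrow> boundary_bound \<mu> F m \<Longrightarrow> boundary_bound \<mu> F (\<theta> * m)"
    using boundary_bound_step[OF \<mu> F] by blast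
  define M where "M = F / \<mu> + 1"
  have M: "M > 0" using F \<mu> by (simp add: M_def add_nonneg_pos)
  have iterate: "boundary_bound \<mu> F (\<theta> ^ k * M)" for k
  proof (induction k)
    case 0
    have "y z \<le> M" if "n \<ge> 0" "L2supp f" "\<And>x. \<bar>f x\<bar> \<le> F" "penalised \<mu> n f y" for n f y z
      using penalised_bound[OF \<mu> that, of z] by (simp add: M_def abs_le_iff)
    then show ?case unfolding boundary_bound_def by (intro exI[of _ 1] conjI exI[of _ 0]) auto
  next
    case (Suc k)
    then show ?case using \<theta>(3)[OF _ Suc] \<theta> M by (simp add: mult.assoc)
  qed
  have "(\<lambda>k. \<theta> ^ k * M) \<longlonglongrightarrow> 0 * M" using \<theta> by (intro tendsto_intros LIMSEQ_realpow_zero) auto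
  then have "\<forall>\<^sub>F k in sequentially. \<theta> ^ k * M < \<epsilon>" using \<epsilon> by (auto intro: order_tendstoD)
  then obtain k where "\<theta> ^ k * M < \<epsilon>" by (auto simp: eventually_sequentially)
  then show ?thesis using iterate[of k] unfolding boundary_bound_def by (meson less_imp_le order_trans)
qed

lemma penalised_small_outside:
  assumes \<mu>: "\<mu> > 0" and F: "F \<ge> 0" and \<epsilon>: "\<epsilon> > 0"
  obtains n0 where "n0 \<ge> 0" "\<And>n f y x. n \<ge> n0 \<Longrightarrow> L2supp f \<Longrightarrow> (\<And>x. \<bar>f x\<bar> \<le> F) \<Longrightarrow> penalised \<mu> n f y \<Longrightarrow> x \<notin> \<Omega> \<Longrightarrow>
      \<bar>y x\<bar> \<le> \<epsilon>"
proof -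
  obtain \<rho> n0 where \<rho>: "\<rho> > 0" "n0 \<ge> 0" and upper: "\<And>n f y x z. n \<ge> n0 \<Longrightarrow> L2supp f \<Longrightarrow> (\<And>x. \<bar>f x\<bar> \<le> F) \<Longrightarrow>
      penalised \<mu> n f y \<Longrightarrow> x \<notin> \<Omega> \<Longrightarrow> norm (z - x) \<le> \<rho> \<Longrightarrow> y z \<le> \<epsilon>"
    using boundary_bound_small[OF \<mu> F \<epsilon>] unfolding boundary_bound_def by blast
  have "\<bar>y x\<bar> \<le> \<epsilon>" if n: "n \<ge> n0" and f: "L2supp f" "\<And>x. \<bar>f x\<bar> \<le> F" and y: "penalised \<mu> n f y" and x: "x \<notin> \<Omega>"
    for n f y x
  proof -
    have "penalised \<mu> n (\<lambda>x. - f x) (\<lambda>x. - y x)" by (rule penalised_uminus[OF \<mu> _ f(1) y]) (use n \<rho> in simp)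
    then have "- y x \<le> \<epsilon>" using upper[OF n L2supp_uminus[OF f(1)], of "\<lambda>x. - y x" x x] f(2) x \<rho>(1) by simp
    moreover have "y x \<le> \<epsilon>" using upper[OF n f y x, of x] \<rho>(1) by simp
    ultimately show ?thesis by (simp add: abs_le_iff)
  qed
  then show ?thesis using \<rho>(2) by (rule that[rotated])
qed

end

section \<open>The Dirichlet problem\<close>

lemma uniformly_Cauchy_limit:
  fixes Y :: "nat \<Rightarrow> 'b \<Rightarrow> real"
  assumes "\<And>e. e > 0 \<Longrightarrow> \<exists>N. \<forall>j\<ge>N. \<forall>k\<ge>N. \<forall>x. \<bar>Y j x - Y k x\<bar> \<le> e"
  obtains y where "uniform_limit UNIV Y y sequentially"
proof -
  have "uniformly_Cauchy_on UNIV Y"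
    unfolding uniformly_Cauchy_on_def
  proof (intro allI impI)
    fix e :: real assume e: "e > 0"
    obtain N where N: "\<forall>j\<ge>N. \<forall>k\<ge>N. \<forall>x. \<bar>Y j x - Y k x\<bar> \<le> e / 2" using assms[of "e / 2"] e by auto
    show "\<exists>M. \<forall>x\<in>UNIV. \<forall>m\<ge>M. \<forall>n\<ge>M. dist (Y m x) (Y n x) < e"
    proof (intro exI[of _ N] ballI allI impI)
      fix x m n assume "N \<le> m" "N \<le> n"
      then have "\<bar>Y m x - Y n x\<bar> \<le> e / 2" using N by blast
      then show "dist (Y m x) (Y n x) < e" using e by (simp add: dist_real_def)
    qed
  qed
  then show ?thesis using Cauchy_uniformly_convergent that unfolding uniformly_convergent_on_def by blast
qed

context corkscrew_domain begin

definition C0dom :: "('a \<Rightarrow> real) \<Rightarrow> bool" where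
  "C0dom y \<longleftrightarrow> cont y \<and> (\<forall>x. x \<notin> \<Omega> \<longrightarrow> y x = 0)"

lemma C0dom_continuous: "C0dom y \<Longrightarrow> cont y" by (simp add: C0dom_def)
lemma C0dom_outside: "C0dom y \<Longrightarrow> x \<notin> \<Omega> \<Longrightarrow> y x = 0" by (simp add: C0dom_def)

lemma C0dom_bounded: assumes "C0dom y" shows "bounded (range y)"
proof -
  have "compact (closure \<Omega>)" using bounded_dom by (simp add: compact_closure)
  moreover have "y x = 0" if "x \<notin> closure \<Omega>" for x using C0dom_outside[OF assms] that closure_subset[of \<Omega>]
    by auto
  ultimately obtain C where "\<And>x. \<bar>y x\<bar> \<le> C" using compact_support_bounded[OF C0dom_continuous[OF assms]]
    by blast
  then show ?thesis by (auto simp: bounded_iff)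
qed

lemma C0dom_L2supp: assumes "C0dom y" shows "L2supp y"
proof -
  have "(\<lambda>x. indicator \<Omega> x * y x) = y" using C0dom_outside[OF assms] by (auto simp: indicator_def fun_eq_iff)
  then show ?thesis using L2supp_indicator_times[OF C0dom_continuous[OF assms] C0dom_bounded[OF assms]]
    by simp
qed

definition dirichlet :: "real \<Rightarrow> ('a \<Rightarrow> real) \<Rightarrow> ('a \<Rightarrow> real) \<Rightarrow> bool" where
  "dirichlet \<mu> f y \<longleftrightarrow> helmholtz \<mu> \<Omega> f y \<and> (\<forall>x. x \<notin> \<Omega> \<longrightarrow> y x = 0)"

lemma dirichlet_helmholtz: "dirichlet \<mu> f y \<Longrightarrow> helmholtz \<mu> \<Omega> f y" by (simp add: dirichlet_def)
lemma dirichlet_outside: "dirichlet \<mu> f y \<Longrightarrow> x \<notin> \<Omega> \<Longrightarrow> y x = 0" by (simp add: dirichlet_def)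
lemma dirichlet_C0dom: "dirichlet \<mu> f y \<Longrightarrow> C0dom y" by (simp add: dirichlet_def helmholtz_def C0dom_def)
lemma dirichlet_L2supp: "dirichlet \<mu> f y \<Longrightarrow> L2supp y" by (intro C0dom_L2supp dirichlet_C0dom)

lemma dirichlet_change_coefficient: "dirichlet \<mu> f y \<Longrightarrow> dirichlet \<mu>' (\<lambda>x. f x + (\<mu>' - \<mu>) * y x) y"
  by (simp add: dirichlet_def helmholtz_change_coefficient)

lemma dirichlet_diff: "dirichlet \<mu> f y \<Longrightarrow> dirichlet \<mu> g z \<Longrightarrow> dirichlet \<mu> (\<lambda>x. f x - g x) (\<lambda>x. y x - z x)"
  by (simp add: dirichlet_def helmholtz_diff)

lemma dirichlet_uminus: "dirichlet \<mu> f y \<Longrightarrow> dirichlet \<mu> (\<lambda>x. - f x) (\<lambda>x. - y x)"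
  by (simp add: dirichlet_def helmholtz_uminus)

lemma dirichlet_le_supersolution:
  assumes \<mu>: "0 \<le> \<mu>" and y: "dirichlet \<mu> g y" and \<psi>: "helmholtz \<mu> \<Omega> h \<psi>"
    and nonneg: "\<And>x. x \<in> closure \<Omega> \<Longrightarrow> 0 \<le> \<psi> x"
    and le: "\<And>x. x \<in> \<Omega> \<Longrightarrow> 0 < y x \<Longrightarrow> \<psi> x < y x \<Longrightarrow> g x \<le> h x" and x: "x \<in> \<Omega>"
  shows "y x \<le> \<psi> x"
proof (rule helmholtz_comparison[OF open_dom bounded_dom \<mu> dirichlet_helmholtz[OF y] \<psi> _ _ x])
  show "y x \<le> \<psi> x" if "x \<in> frontier \<Omega>" for x
    using nonneg[of x] that dirichlet_outside[OF y frontier_outside[OF that]] by (simp add: frontier_def)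
  show "g x \<le> h x" if "x \<in> \<Omega>" "\<psi> x < y x" for x
  proof -
    have "0 \<le> \<psi> x" using nonneg closure_subset that(1) by blast
    then show ?thesis using le[of x] that by simp
  qed
qed

context
  fixes \<mu> :: real assumes \<mu>: "\<mu> > 0"
begin

lemma dirichlet_le_potential:
  assumes y: "dirichlet \<mu> f y" and g: "L2supp g" "\<And>x. f x \<le> g x" "\<And>x. 0 \<le> g x"
  shows "y x \<le> potential \<mu> g x"
proof (cases "x \<in> \<Omega>")
  case True
  show ?thesis
    by (rule dirichlet_le_supersolution[OF less_imp_le[OF \<mu>] y potential_helmholtz[OF \<mu> g(1)] _ _ True])
      (use potential_nonneg[OF \<mu> g(3)] g(2) in auto)
qed (use dirichlet_outside[OF y] potential_nonneg[OF \<mu> g(3)] in simp)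

lemma dirichlet_abs_le_potential:
  assumes y: "dirichlet \<mu> f y" and f: "L2supp f" shows "\<bar>y x\<bar> \<le> potential \<mu> (\<lambda>x. \<bar>f x\<bar>) x"
  using dirichlet_le_potential[OF y L2supp_abs[OF f], of x] dirichlet_le_potential[OF dirichlet_uminus[OF y]
      L2supp_abs[OF f], of x]
  by (simp add: abs_le_iff)

lemma dirichlet_L2_bound:
  assumes y: "dirichlet \<mu> f y" and f: "L2supp f" shows "\<bar>y x\<bar> \<le> resolvent_norm \<mu> * sqrt (sqnorm f)"
  using order_trans[OF dirichlet_abs_le_potential[OF assms, of x] order_trans[OF abs_ge_self
      potential_L2_bound[OF \<mu> L2supp_abs[OF f]]]]
  by (simp add: L2_sqnorm_def)

lemma penalised_exists_sequence:
  assumes "L2supp f" obtains Y where "\<And>k. penalised \<mu> (real k) f (Y k)"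
proof -
  have "\<exists>y. penalised \<mu> (real k) f y" for k by (rule penalised_exists[OF \<mu> _ assms]) simp
  then show ?thesis using that by metis
qed

lemma dirichlet_exists_bounded:
  assumes f: "L2supp f" "\<And>x. \<bar>f x\<bar> \<le> F" shows "\<exists>y. dirichlet \<mu> f y"
proof -
  have F: "F \<ge> 0" by (rule order_trans[OF abs_ge_zero f(2)])
  obtain Y where Y: "\<And>k. penalised \<mu> (real k) f (Y k)" using penalised_exists_sequence[OF f(1)] by blast
  have helmholtz: "helmholtz \<mu> \<Omega> f (Y k)" for k by (rule penalised_helmholtz_inside[OF \<mu> _ f(1) Y]) simp
  have far: "\<exists>N. \<forall>k\<ge>N. \<forall>x. x \<notin> \<Omega> \<longrightarrow> \<bar>Y k x\<bar> \<le> e" if e: "e > 0" for e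
  proof -
    obtain n0 where "n0 \<ge> 0" and n0: "\<And>n f y x. n \<ge> n0 \<Longrightarrow> L2supp f \<Longrightarrow> (\<And>x. \<bar>f x\<bar> \<le> F) \<Longrightarrow>
        penalised \<mu> n f y \<Longrightarrow> x \<notin> \<Omega> \<Longrightarrow> \<bar>y x\<bar> \<le> e"
      using penalised_small_outside[OF \<mu> F e] by blast
    obtain N where "n0 \<le> real N" using real_arch_simple by blast
    then have "\<bar>Y k x\<bar> \<le> e" if "k \<ge> N" "x \<notin> \<Omega>" for k x using that by (intro n0[OF _ f Y]) auto
    then show ?thesis by blast
  qed
  have "\<exists>N. \<forall>j\<ge>N. \<forall>k\<ge>N. \<forall>x. \<bar>Y j x - Y k x\<bar> \<le> e" if e: "e > 0" for e
  proof -
    obtain N where N: "\<And>k x. k \<ge> N \<Longrightarrow> x \<notin> \<Omega> \<Longrightarrow> \<bar>Y k x\<bar> \<le> e / 2" using far[of "e / 2"] e by auto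
    have "\<bar>Y j x - Y k x\<bar> \<le> e" if "j \<ge> N" "k \<ge> N" for j k x
    proof (rule helmholtz_close[OF open_dom bounded_dom less_imp_le[OF \<mu>] helmholtz helmholtz
        less_imp_le[OF e]])
      show "\<bar>Y j x - Y k x\<bar> \<le> e" if "x \<notin> \<Omega>" for x
        using N[OF \<open>j \<ge> N\<close> that] N[OF \<open>k \<ge> N\<close> that] by linarith
    qed
    then show ?thesis by blast
  qed
  then obtain y where lim: "uniform_limit UNIV Y y sequentially" using uniformly_Cauchy_limit by blast
  have "\<bar>y x\<bar> \<le> 0 + e" if "x \<notin> \<Omega>" "e > 0" for x e
  proof (rule tendsto_upperbound)
    show "(\<lambda>k. \<bar>Y k x\<bar>) \<longlonglongrightarrow> \<bar>y x\<bar>" by (intro tendsto_rabs tendsto_uniform_limitI[OF lim]) simp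
    show "\<forall>\<^sub>F k in sequentially. \<bar>Y k x\<bar> \<le> 0 + e" using far[OF that(2)] that(1)
      by (auto simp: eventually_sequentially)
  qed simp
  then have "y x = 0" if "x \<notin> \<Omega>" for x using field_le_epsilon[of "\<bar>y x\<bar>" 0] that by simp
  moreover have "helmholtz \<mu> \<Omega> f y"
    by (rule helmholtz_uniform_limit[OF helmholtz lim integrable_L2supp_test[OF f(1)] tendsto_const])
  ultimately show ?thesis unfolding dirichlet_def by blast
qed

lemma clip_test_tendsto:
  assumes f: "L2supp f" and \<phi>: "test_fun D \<phi>"
  shows "(\<lambda>k. LBINT x. clip k f x * \<phi> x) \<longlonglongrightarrow> (LBINT x. f x * \<phi> x)"
proof (rule integral_dominated_convergence[where w = "\<lambda>x. \<bar>f x * \<phi> x\<bar>"])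
  show "AE x in lborel. (\<lambda>k. clip k f x * \<phi> x) \<longlonglongrightarrow> f x * \<phi> x"
  proof (intro AE_I2 tendsto_eventually)
    fix x show "\<forall>\<^sub>F k in sequentially. clip k f x * \<phi> x = f x * \<phi> x"
      using clip_eventually_eq[of f x] by eventually_elim simp
  qed
  show "AE x in lborel. norm (clip k f x * \<phi> x) \<le> \<bar>f x * \<phi> x\<bar>" for k
    using clip_le(2)[of k f] by (auto simp: abs_mult intro!: AE_I2 mult_right_mono)
qed (use integrable_L2supp_test[OF f \<phi>] integrable_L2supp_test[OF clip_L2supp[OF f] \<phi>] in auto)

lemma dirichlet_exists:
  assumes f: "L2supp f" shows "\<exists>y. dirichlet \<mu> f y"
proof -
  obtain Y where Y: "\<And>k. dirichlet \<mu> (clip k f) (Y k)"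
    using dirichlet_exists_bounded[OF clip_L2supp[OF f] clip_le(1)] by metis
  define a where "a k = resolvent_norm \<mu> * sqrt (sqnorm (\<lambda>x. f x - clip k f x))" for k
  have rest: "L2supp (\<lambda>x. \<bar>f x - clip k f x\<bar>)" for k by (intro L2supp_abs L2supp_diff f clip_L2supp)
  have a: "potential \<mu> (\<lambda>x. \<bar>f x - clip k f x\<bar>) x \<le> a k" for k x
    using order_trans[OF abs_ge_self potential_L2_bound[OF \<mu> rest]] by (simp add: a_def L2_sqnorm_def)
  have close: "\<bar>Y j x - Y k x\<bar> \<le> a j + a k" for j k x
  proof -
    have "\<bar>Y j x - Y k x\<bar> \<le> potential \<mu> (\<lambda>x. \<bar>clip j f x - clip k f x\<bar>) x"
      by (intro dirichlet_abs_le_potential dirichlet_diff Y L2supp_diff clip_L2supp f)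
    also have "\<dots> \<le> potential \<mu> (\<lambda>x. 1 * \<bar>f x - clip j f x\<bar> + 1 * \<bar>f x - clip k f x\<bar>) x"
      by (intro potential_mono[OF \<mu>] L2supp_abs L2supp_diff L2supp_lincomb clip_L2supp f) auto
    also have "\<dots> = potential \<mu> (\<lambda>x. \<bar>f x - clip j f x\<bar>) x + potential \<mu> (\<lambda>x. \<bar>f x - clip k f x\<bar>) x"
      using potential_lincomb[OF \<mu> rest rest, of 1 j 1 k x] by simp
    finally show ?thesis using a[of j x] a[of k x] by linarith
  qed
  have "a \<longlonglongrightarrow> resolvent_norm \<mu> * sqrt 0" unfolding a_def[abs_def] by (intro tendsto_intros clip_tendsto f)
  then have lim_a: "a \<longlonglongrightarrow> 0" by simp
  have "\<exists>N. \<forall>j\<ge>N. \<forall>k\<ge>N. \<forall>x. \<bar>Y j x - Y k x\<bar> \<le> e" if "e > 0" for e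
  proof -
    have "\<forall>\<^sub>F k in sequentially. a k < e / 2" using lim_a that by (intro order_tendstoD) auto
    then obtain N where N: "\<And>k. k \<ge> N \<Longrightarrow> a k < e / 2" by (auto simp: eventually_sequentially)
    have "\<bar>Y j x - Y k x\<bar> \<le> e" if "j \<ge> N" "k \<ge> N" for j k x
      using close[of j x k] N[OF that(1)] N[OF that(2)] by simp
    then show ?thesis by blast
  qed
  then obtain y where lim: "uniform_limit UNIV Y y sequentially" using uniformly_Cauchy_limit by blast
  have "y x = 0" if "x \<notin> \<Omega>" for x
    using LIMSEQ_unique[OF tendsto_uniform_limitI[OF lim, of x], of 0] dirichlet_outside[OF Y that] by simp
  moreover have "helmholtz \<mu> \<Omega> f y"
    by (rule helmholtz_uniform_limit[OF dirichlet_helmholtz[OF Y] lim integrable_L2supp_test[OF f]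
        clip_test_tendsto[OF f]])
  ultimately show ?thesis unfolding dirichlet_def by blast
qed

lemma penalised_close:
  assumes F: "F \<ge> 0" and \<epsilon>: "\<epsilon> > 0"
  obtains n0 where "n0 \<ge> 0" "\<And>n f y Y x. n \<ge> n0 \<Longrightarrow> L2supp f \<Longrightarrow> (\<And>x. \<bar>f x\<bar> \<le> F) \<Longrightarrow>
    penalised \<mu> n f Y \<Longrightarrow> dirichlet \<mu> f y \<Longrightarrow> \<bar>Y x - y x\<bar> \<le> \<epsilon>"
proof -
  obtain n0 where n0: "n0 \<ge> 0" "\<And>n f y x. n \<ge> n0 \<Longrightarrow> L2supp f \<Longrightarrow> (\<And>x. \<bar>f x\<bar> \<le> F) \<Longrightarrow>
      penalised \<mu> n f y \<Longrightarrow> x \<notin> \<Omega> \<Longrightarrow> \<bar>y x\<bar> \<le> \<epsilon>"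
    using penalised_small_outside[OF \<mu> F \<epsilon>] by blast
  have "\<bar>Y x - y x\<bar> \<le> \<epsilon>"
    if n: "n \<ge> n0" and f: "L2supp f" "\<And>x. \<bar>f x\<bar> \<le> F" and Y: "penalised \<mu> n f Y" and y: "dirichlet \<mu> f y"
      for n f y Y x
  proof (rule helmholtz_close[OF open_dom bounded_dom less_imp_le[OF \<mu>] _ dirichlet_helmholtz[OF y]
      less_imp_le[OF \<epsilon>]])
    show "helmholtz \<mu> \<Omega> f Y" by (rule penalised_helmholtz_inside[OF \<mu> _ f(1) Y]) (use n n0(1) in simp)
    show "\<bar>Y x - y x\<bar> \<le> \<epsilon>" if "x \<notin> \<Omega>" for x using n0(2)[OF n f Y that] dirichlet_outside[OF y that] by simp
  qed
  then show ?thesis using n0(1) by (rule that[rotated])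
qed

lemma penalised_uniform_limit:
  assumes f: "L2supp f" "\<And>x. \<bar>f x\<bar> \<le> F" and Y: "\<And>k. penalised \<mu> (real k) f (Y k)" and y: "dirichlet \<mu> f y"
  shows "uniform_limit UNIV Y y sequentially"
proof (rule uniform_limitI)
  fix e :: real assume e: "e > 0"
  then have "e / 2 > 0" by simp
  then obtain n0 where "n0 \<ge> 0" and n0: "\<And>n f y Y x. n \<ge> n0 \<Longrightarrow> L2supp f \<Longrightarrow> (\<And>x. \<bar>f x\<bar> \<le> F) \<Longrightarrow>
      penalised \<mu> n f Y \<Longrightarrow> dirichlet \<mu> f y \<Longrightarrow> \<bar>Y x - y x\<bar> \<le> e / 2"
    using penalised_close[OF order_trans[OF abs_ge_zero f(2)], of "e / 2"] by blast
  obtain N where "n0 \<le> real N" using real_arch_simple by blast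
  then have half: "\<bar>Y k x - y x\<bar> \<le> e / 2" if "k \<ge> N" for k x using that by (intro n0[OF _ f Y y]) simp
  have "\<bar>Y k x - y x\<bar> < e" if "k \<ge> N" for k x using half[OF that, of x] e by linarith
  then show "\<forall>\<^sub>F k in sequentially. \<forall>x\<in>UNIV. dist (Y k x) (y x) < e"
    by (intro eventually_sequentiallyI[of N]) (simp add: dist_real_def)
qed

lemma penalised_symmetric:
  assumes n: "n \<ge> 0" and f: "L2supp f" and g: "L2supp g" and Y: "penalised \<mu> n f Y" and Z: "penalised \<mu> n g Z"
  shows "ip f Z = ip g Y"
proof -
  define A where "A x = f x + n * (indicator \<Omega> x * Y x)" for x
  define B where "B x = g x + n * (indicator \<Omega> x * Z x)" for x
  have cont: "cont Y" "cont Z" and bdd: "bounded (range Y)" "bounded (range Z)"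
    and eq: "Y = potential (\<mu> + n) A" "Z = potential (\<mu> + n) B"
    using Y Z unfolding penalised_def A_def[abs_def] B_def[abs_def] by blast+
  obtain C C' where C: "\<And>x. \<bar>Y x\<bar> \<le> C" "\<And>x. \<bar>Z x\<bar> \<le> C'" using bdd by (auto simp: bounded_iff)
  have int: "integrable lborel (\<lambda>x. h x * Y x)" "integrable lborel (\<lambda>x. h x * Z x)" if "L2supp h" for h
    using integrable_L2supp_bounded[OF that borel_measurable_UNIV] cont C by blast+
  note ind = L2supp_indicator_times[OF cont(1) bdd(1)] L2supp_indicator_times[OF cont(2) bdd(2)]
  have A: "L2supp A" and B: "L2supp B" unfolding A_def[abs_def] B_def[abs_def]
    by (intro penalised_source_L2supp f g cont bdd)+
  have "ip Y B = ip A Z" using potential_symmetric[OF _ A B, of "\<mu> + n"] \<mu> n eq by simp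
  moreover have "ip Y B = ip g Y + n * (LBINT x. indicator \<Omega> x * Y x * Z x)"
    using int(1)[OF g] int(2)[OF ind(1)] by (simp add: L2_inner_def B_def distrib_left mult_ac)
  moreover have "ip A Z = ip f Z + n * (LBINT x. indicator \<Omega> x * Y x * Z x)"
    using int(2)[OF f] int(2)[OF ind(1)] by (simp add: L2_inner_def A_def distrib_right mult.assoc)
  ultimately show ?thesis by simp
qed

lemma dirichlet_symmetric_bounded:
  assumes f: "L2supp f" "\<And>x. \<bar>f x\<bar> \<le> F" and g: "L2supp g" "\<And>x. \<bar>g x\<bar> \<le> F"
    and y: "dirichlet \<mu> f y" and z: "dirichlet \<mu> g z"
  shows "ip f z = ip g y"
proof -
  obtain Y where Y: "\<And>k. penalised \<mu> (real k) f (Y k)" using penalised_exists_sequence[OF f(1)] by blast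
  obtain Z where Z: "\<And>k. penalised \<mu> (real k) g (Z k)" using penalised_exists_sequence[OF g(1)] by blast
  have lim: "(\<lambda>k. ip h (W k)) \<longlonglongrightarrow> ip h w"
    if h: "L2supp h" and W: "\<And>k. penalised \<mu> (real k) k' (W k)" and w: "dirichlet \<mu> k' w"
      and k': "L2supp k'" "\<And>x. \<bar>k' x\<bar> \<le> F" for h k' W w
    unfolding L2_inner_def
  proof (rule integral_uniform_limit[OF L2supp_integrable[OF h] _ L2supp_product_integrable[OF h
      dirichlet_L2supp[OF w]]])
    show "integrable lborel (\<lambda>x. h x * W k x)" for k
      by (rule integrable_L2supp_bounded[OF h _ penalised_bound[OF \<mu> _ k' W]])
        (use W in \<open>auto simp: penalised_def intro: borel_measurable_UNIV\<close>)
    show "uniform_limit UNIV W w sequentially" by (rule penalised_uniform_limit[OF k' W w])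
  qed
  have "ip f (Z k) = ip g (Y k)" for k by (rule penalised_symmetric[OF _ f(1) g(1) Y Z]) simp
  then show ?thesis using LIMSEQ_unique[OF lim[OF f(1) Z z g]] lim[OF g(1) Y y f] by simp
qed

lemma dirichlet_symmetric:
  assumes f: "L2supp f" and g: "L2supp g" and y: "dirichlet \<mu> f y" and z: "dirichlet \<mu> g z"
  shows "ip f z = ip g y"
proof -
  obtain Y where Y: "\<And>k. dirichlet \<mu> (clip k f) (Y k)" using dirichlet_exists[OF clip_L2supp[OF f]] by metis
  obtain Z where Z: "\<And>k. dirichlet \<mu> (clip k g) (Z k)" using dirichlet_exists[OF clip_L2supp[OF g]] by metis
  have lim: "(\<lambda>k. ip (clip k h) (W k)) \<longlonglongrightarrow> ip h w"
    if h: "L2supp h" and r: "L2supp r" and W: "\<And>k. dirichlet \<mu> (clip k r) (W k)" and w: "dirichlet \<mu> r w"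
      for h r W w
  proof (rule L2_inner_tendsto)
    show "(\<lambda>k. sqnorm (\<lambda>x. clip k h x - h x)) \<longlonglongrightarrow> 0"
      using clip_tendsto[OF h] by (simp add: L2_sqnorm_minus_commute[of _ "clip _ h"])
    show "(\<lambda>k. sqnorm (\<lambda>x. W k x - w x)) \<longlonglongrightarrow> 0"
    proof (rule real_tendsto_sandwich[OF _ _ tendsto_const])
      have diff: "dirichlet \<mu> (\<lambda>x. clip k r x - r x) (\<lambda>x. W k x - w x)" for k by (rule dirichlet_diff[OF W w])
      have "sqnorm (\<lambda>x. W k x - w x) \<le> (resolvent_norm \<mu> * sqrt (sqnorm (\<lambda>x. clip k r x - r x)))\<^sup>2 *
          vol" for k
        by (rule L2supp_bounded[OF L2supp_measurable[OF dirichlet_L2supp[OF diff]] dirichlet_outside[OF diff]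
            dirichlet_L2_bound[OF diff L2supp_diff[OF clip_L2supp[OF r] r]]])
      then show "\<forall>\<^sub>F k in sequentially. sqnorm (\<lambda>x. W k x - w x) \<le>
          (resolvent_norm \<mu>)\<^sup>2 * sqnorm (\<lambda>x. r x - clip k r x) * vol"
        by (simp add: power_mult_distrib L2_sqnorm_minus_commute[of _ "clip _ r"])
      have "(\<lambda>k. (resolvent_norm \<mu>)\<^sup>2 * sqnorm (\<lambda>x. r x - clip k r x) * vol) \<longlonglongrightarrow> (resolvent_norm \<mu>)\<^sup>2 * 0 * vol"
        by (intro tendsto_intros clip_tendsto r)
      then show "(\<lambda>k. (resolvent_norm \<mu>)\<^sup>2 * sqnorm (\<lambda>x. r x - clip k r x) * vol) \<longlonglongrightarrow> 0" by simp
    qed simp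
  qed (intro L2supp_square_integrable clip_L2supp h dirichlet_L2supp[OF W] dirichlet_L2supp[OF w])+
  have "ip (clip k f) (Z k) = ip (clip k g) (Y k)" for k
    by (rule dirichlet_symmetric_bounded[OF clip_L2supp[OF f] clip_le(1) clip_L2supp[OF g] clip_le(1) Y Z])
  then show ?thesis using LIMSEQ_unique[OF lim[OF f g Z z]] lim[OF g f Y y] by simp
qed

end

definition rad :: real where "rad = (SOME R. R > 0 \<and> (\<forall>x\<in>closure \<Omega>. norm x \<le> R))"

lemma rad: "rad > 0" "x \<in> closure \<Omega> \<Longrightarrow> norm x \<le> rad"
proof -
  have "\<exists>R. R > 0 \<and> (\<forall>x\<in>closure \<Omega>. norm x \<le> R)"
    using bounded_closure[OF bounded_dom] by (auto simp: bounded_pos)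
  from someI_ex[OF this, folded rad_def] show "rad > 0" "x \<in> closure \<Omega> \<Longrightarrow> norm x \<le> rad" by auto
qed

definition green_bound :: real where "green_bound = rad\<^sup>2 / (2 * DIM('a))"

lemma green_bound_nonneg: "0 \<le> green_bound" by (simp add: green_bound_def)

definition paraboloid :: "real \<Rightarrow> 'a \<Rightarrow> real" where
  "paraboloid S x = S * (rad\<^sup>2 - (norm x)\<^sup>2) / (2 * DIM('a))"

lemma paraboloid_helmholtz: "helmholtz 0 D (\<lambda>x. S) (paraboloid S)"
proof -
  have eq: "paraboloid S = (\<lambda>x. (- S / (2 * DIM('a))) * ((x - 0) \<bullet> (x - 0)) + S * rad\<^sup>2 / (2 * DIM('a)))"
    by (auto simp: paraboloid_def dot_square_norm field_simps)
  note smooth = smooth_cmult[OF smooth_sqdist] smooth_const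
  have "lap (paraboloid S) = (\<lambda>x. - S)"
    unfolding eq lap_add[OF smooth] lap_cmult[OF smooth_sqdist] lap_sqdist lap_const by simp
  moreover have "smooth (paraboloid S)" unfolding eq by (intro smooth_add smooth)
  ultimately show ?thesis using helmholtz_smooth[of "paraboloid S" 0 D] by simp
qed

lemma paraboloid_bounds:
  assumes "S \<ge> 0" shows "x \<in> closure \<Omega> \<Longrightarrow> 0 \<le> paraboloid S x" and "paraboloid S x \<le> S * green_bound"
  using assms power_mono[OF rad(2) norm_ge_zero, of x 2]
  by (auto simp: paraboloid_def green_bound_def divide_right_mono mult_left_mono)

lemma dirichlet_upper:
  assumes y: "dirichlet 0 g y" and F: "F \<ge> 0" and le: "\<And>x. x \<in> \<Omega> \<Longrightarrow> 0 < y x \<Longrightarrow> g x \<le> F"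
  shows "y x \<le> F * green_bound"
proof (cases "x \<in> \<Omega>")
  case True
  have "y x \<le> paraboloid F x"
    by (rule dirichlet_le_supersolution[OF _ y paraboloid_helmholtz paraboloid_bounds(1)[OF F] le True]) auto
  then show ?thesis using paraboloid_bounds(2)[OF F, of x] by simp
qed (use dirichlet_outside[OF y] F green_bound_nonneg in simp)

lemma dirichlet_abs_upper:
  assumes y: "dirichlet 0 g y" and F: "F \<ge> 0"
    and le: "\<And>x. x \<in> \<Omega> \<Longrightarrow> 0 < y x \<Longrightarrow> g x \<le> F" "\<And>x. x \<in> \<Omega> \<Longrightarrow> y x < 0 \<Longrightarrow> - F \<le> g x"
  shows "\<bar>y x\<bar> \<le> F * green_bound"
proof -
  have "y x \<le> F * green_bound" by (rule dirichlet_upper[OF y F le(1)])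
  moreover have "- y x \<le> F * green_bound"
    by (rule dirichlet_upper[OF dirichlet_uminus[OF y] F]) (use le(2) in force)
  ultimately show ?thesis by (simp add: abs_le_iff)
qed

definition green_L2_bound :: real where "green_L2_bound = resolvent_norm 1 * (1 + green_bound)"

lemma dirichlet_L2_upper:
  assumes y: "dirichlet 0 g y" and h: "L2supp h" "\<And>x. 0 \<le> h x"
    and le: "\<And>x. x \<in> \<Omega> \<Longrightarrow> 0 < y x \<Longrightarrow> g x \<le> h x"
  shows "y x \<le> green_L2_bound * sqrt (sqnorm h)"
proof -
  define S where "S = resolvent_norm 1 * sqrt (sqnorm h)"
  have S: "0 \<le> S" using resolvent_norm_nonneg by (simp add: S_def)
  have E: "0 \<le> potential 1 h x" "potential 1 h x \<le> S" for x
    using potential_nonneg[of 1 h x] h(2) potential_L2_bound[OF _ h(1), of 1 x]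
    by (auto simp: S_def abs_le_iff)
  have total: "green_L2_bound * sqrt (sqnorm h) = S + S * green_bound"
    by (simp add: green_L2_bound_def S_def algebra_simps)
  show ?thesis
  proof (cases "x \<in> \<Omega>")
    case True
    have "helmholtz 0 \<Omega> (\<lambda>x. h x + (0 - 1) * potential 1 h x) (potential 1 h)"
      by (rule helmholtz_change_coefficient[OF potential_helmholtz[OF _ h(1)]]) simp
    from helmholtz_lincomb[OF this paraboloid_helmholtz, of 1 1 S]
    have super: "helmholtz 0 \<Omega> (\<lambda>x. h x - potential 1 h x + S) (\<lambda>x. potential 1 h x + paraboloid S x)" by simp
    have "y x \<le> potential 1 h x + paraboloid S x"
    proof (rule dirichlet_le_supersolution[OF _ y super _ _ True])
      show "0 \<le> potential 1 h x + paraboloid S x" if "x \<in> closure \<Omega>" for x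
        using E(1)[of x] paraboloid_bounds(1)[OF S that] by simp
      show "g x \<le> h x - potential 1 h x + S" if "x \<in> \<Omega>" "0 < y x" for x using le[OF that] E(2)[of x] by simp
    qed simp
    then show ?thesis unfolding total using E(2)[of x] paraboloid_bounds(2)[OF S, of x] by linarith
  qed (use total dirichlet_outside[OF y] S green_bound_nonneg in simp)
qed

(* Interpolation between the sup norm and the L2 norm; \<mu> is at our disposal. *)
lemma dirichlet_interpolation:
  assumes y: "dirichlet 0 g y" and \<mu>: "\<mu> > 0" and M: "M \<ge> 0" and le: "\<And>x. x \<in> \<Omega> \<Longrightarrow> 0 < y x \<Longrightarrow> g x \<le> M"
  shows "y x \<le> M / \<mu> + \<mu> * (resolvent_norm \<mu> * sqrt (sqnorm y))"
proof -
  note Ly = dirichlet_L2supp[OF y]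
  note [measurable] = L2supp_measurable[OF Ly]
  define p where "p x = max 0 (y x)" for x
  have [measurable]: "p \<in> borel_measurable borel" unfolding p_def[abs_def] by measurable
  have "square_integrable lborel p" "sqnorm p \<le> sqnorm y" unfolding L2_sqnorm_def[of _ y]
    by (rule square_integrable_bound[of p lborel "\<lambda>x. (y x)\<^sup>2"],
        use square_integrable_square[OF L2supp_square_integrable[OF Ly]] in \<open>auto simp: p_def max_def\<close>)+
  then have p: "L2supp p" "sqnorm p \<le> sqnorm y" using dirichlet_outside[OF y] by (auto simp: L2supp_def p_def)
  note const = L2supp_lincomb[OF L2supp_indicator L2supp_indicator, of M 0, simplified]
  define h where "h x = 1 * (M * indicator \<Omega> x) + \<mu> * p x" for x
  have h: "L2supp h" unfolding h_def[abs_def] by (intro L2supp_lincomb const p)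
  have nonneg: "0 \<le> potential \<mu> h x" for x using M \<mu> by (intro potential_nonneg) (simp_all add: h_def p_def)
  have bound: "potential \<mu> h x \<le> M / \<mu> + \<mu> * (resolvent_norm \<mu> * sqrt (sqnorm y))"
  proof -
    have "potential \<mu> h x = 1 * potential \<mu> (\<lambda>x. M * indicator \<Omega> x) x + \<mu> * potential \<mu> p x"
      unfolding h_def[abs_def] by (rule potential_lincomb[OF \<mu> const p(1)])
    moreover have "potential \<mu> (\<lambda>x. M * indicator \<Omega> x) x \<le> M / \<mu>"
      by (rule potential_upper[OF \<mu> const]) (use M in \<open>auto simp: indicator_def\<close>)
    moreover have "resolvent_norm \<mu> * sqrt (sqnorm p) \<le> resolvent_norm \<mu> * sqrt (sqnorm y)"
      using p(2) resolvent_norm_nonneg by (intro mult_left_mono) auto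
    then have "\<mu> * potential \<mu> p x \<le> \<mu> * (resolvent_norm \<mu> * sqrt (sqnorm y))"
      using potential_L2_bound[OF \<mu> p(1), of x] \<mu> by (intro mult_left_mono) auto
    ultimately show ?thesis by simp
  qed
  show ?thesis
  proof (cases "x \<in> \<Omega>")
    case True
    have "y x \<le> potential \<mu> h x"
      by (rule dirichlet_le_supersolution[OF less_imp_le[OF \<mu>] dirichlet_change_coefficient[OF y]
          potential_helmholtz[OF \<mu> h] nonneg _ True])
        (use le in \<open>simp add: h_def p_def\<close>)
    then show ?thesis using bound by simp
  qed (use dirichlet_outside[OF y] M \<mu> resolvent_norm_nonneg[of \<mu>] in simp)
qed

(* The barrier 1 - exp (a (|x|^2 - rad^2)) is a supersolution for the source \<mu> = 2 a DIM. *)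
lemma dirichlet_exp_barrier:
  fixes a \<mu> :: real
  assumes a: "0 < a" and \<mu>: "\<mu> = 2 * a * DIM('a)" and y: "dirichlet \<mu> f y" and f: "\<And>x. \<bar>f x\<bar> \<le> M"
  shows "y x \<le> (1 - exp (- a * rad\<^sup>2)) * (M / \<mu>)"
proof -
  define c where "c = exp (- a * rad\<^sup>2)"
  define e where "e x = exp (a * ((x - 0) \<bullet> (x - 0)))" for x :: 'a
  define \<psi> where "\<psi> x = (M / \<mu>) * (1 + (- c) * e x)" for x
  have \<mu>_pos: "0 < \<mu>" using a by (simp add: \<mu>)
  have c: "0 < c" "c < 1" using a rad(1) by (auto simp: c_def)
  have M: "0 \<le> M / \<mu>" using order_trans[OF abs_ge_zero f] \<mu>_pos by simp
  have e: "c * e x \<le> 1" "1 \<le> e x" if "x \<in> closure \<Omega>" for x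
  proof -
    have "a * (norm x)\<^sup>2 \<le> a * rad\<^sup>2" using a rad that by (intro mult_left_mono power_mono) auto
    then show "c * e x \<le> 1" by (simp add: c_def e_def dot_square_norm flip: exp_add)
    show "1 \<le> e x" using a by (simp add: e_def)
  qed
  have smooth_e: "smooth e" unfolding e_def[abs_def] by (rule smooth_gaussian)
  note smooth = smooth_const smooth_cmult[OF smooth_e]
  have lap_e: "\<mu> * e x \<le> lap e x" for x
    unfolding e_def[abs_def] lap_gaussian \<mu> using a by (intro mult_right_mono) auto
  have smooth_\<psi>: "smooth \<psi>" unfolding \<psi>_def[abs_def] by (intro smooth_cmult smooth_add smooth)
  have lap_\<psi>: "lap \<psi> x = - (M / \<mu>) * c * lap e x" for x
    unfolding \<psi>_def[abs_def] lap_cmult[OF smooth_add[OF smooth]] lap_add[OF smooth] lap_cmult[OF smooth_e]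
        lap_const by simp
  have super: "f x \<le> \<mu> * \<psi> x - lap \<psi> x" for x
  proof -
    have "0 \<le> (M / \<mu>) * c * (lap e x - \<mu> * e x)" using lap_e[of x] M c by (intro mult_nonneg_nonneg) auto
    then show ?thesis unfolding lap_\<psi> \<psi>_def using f[of x] \<mu>_pos by (simp add: abs_le_iff algebra_simps)
  qed
  have "y x \<le> (1 - c) * (M / \<mu>)"
  proof (cases "x \<in> \<Omega>")
    case True
    have "y x \<le> \<psi> x"
      by (rule dirichlet_le_supersolution[OF less_imp_le[OF \<mu>_pos] y helmholtz_smooth[OF smooth_\<psi>] _ super
          True])
        (use mult_nonneg_nonneg[OF M] e(1) in \<open>force simp: \<psi>_def\<close>)
    also have "\<psi> x \<le> (M / \<mu>) * (1 - c)"
      using e(2)[of x] closure_subset[of \<Omega>] True c M unfolding \<psi>_def by (intro mult_left_mono) auto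
    finally show ?thesis by (simp add: mult.commute)
  qed (use dirichlet_outside[OF y] mult_nonneg_nonneg[OF _ M, of "1 - c"] c in simp)
  then show ?thesis by (simp add: c_def)
qed

lemma dirichlet_contraction:
  assumes \<mu>: "\<mu> > 0"
  obtains q where "0 \<le> q" "q < 1" "\<And>f y M x. dirichlet \<mu> f y \<Longrightarrow> (\<And>x. \<bar>f x\<bar> \<le> M) \<Longrightarrow> \<bar>y x\<bar> \<le> q * (M / \<mu>)"
proof -
  define a where "a = \<mu> / (2 * DIM('a))"
  have a: "0 < a" "\<mu> = 2 * a * DIM('a)" using \<mu> by (auto simp: a_def)
  define q where "q = 1 - exp (- a * rad\<^sup>2)"
  have q: "0 \<le> q" "q < 1" using a(1) by (auto simp: q_def)
  have "\<bar>y x\<bar> \<le> q * (M / \<mu>)" if y: "dirichlet \<mu> f y" and f: "\<And>x. \<bar>f x\<bar> \<le> M" for f y M x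
    using dirichlet_exp_barrier[OF a y f, of x] dirichlet_exp_barrier[OF a dirichlet_uminus[OF y], of M x] f
    by (simp add: abs_le_iff q_def)
  then show ?thesis using q by (rule that[rotated 2])
qed

end

lemma monotone_lipschitz_residual:
  fixes N :: "real \<Rightarrow> real"
  assumes "\<And>s t. s \<le> t \<Longrightarrow> 0 \<le> N t - N s" "\<And>s t. s \<le> t \<Longrightarrow> N t - N s \<le> \<Lambda> * (t - s)"
  shows "\<bar>(\<Lambda> * t - N t) - (\<Lambda> * s - N s)\<bar> \<le> \<Lambda> * \<bar>t - s\<bar>"
  using assms[of s t] assms[of t s] by (cases "s \<le> t") (auto simp: algebra_simps abs_le_iff)

context corkscrew_domain begin

lemma L2supp_indicator_dominated:
  assumes y: "bounded (range y)" and [measurable]: "h \<in> borel_measurable borel" and h: "\<And>x. \<bar>h x\<bar> \<le> \<Lambda> * \<bar>y x\<bar>"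
    and \<Lambda>: "\<Lambda> \<ge> 0"
  shows "L2supp (\<lambda>x. indicator \<Omega> x * h x)"
proof -
  obtain B where B: "\<And>x. \<bar>y x\<bar> \<le> B" using y by (auto simp: bounded_iff)
  have "\<bar>h x\<bar> \<le> \<Lambda> * B" for x using h[of x] mult_left_mono[OF B \<Lambda>, of x] by linarith
  then show ?thesis
    using order_trans[OF abs_ge_zero B] \<Lambda>
    by (intro L2supp_bounded(1)[where M = "\<Lambda> * B"]) (auto simp: indicator_def)
qed

lemma dirichlet_absorb_nonlinearity:
  assumes y: "dirichlet \<Lambda> (\<lambda>x. f x + indicator \<Omega> x * (\<Lambda> * y x - h x)) y" and f: "L2supp f"
    and h: "\<And>x. y x = 0 \<Longrightarrow> h x = 0"
  shows "dirichlet 0 (\<lambda>x. f x - h x) y"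
proof -
  have source: "f x + indicator \<Omega> x * (\<Lambda> * y x - h x) + (0 - \<Lambda>) * y x = f x - h x" for x
    using dirichlet_outside[OF y, of x] L2supp_outside[OF f, of x] h[of x] by (cases "x \<in> \<Omega>") auto
  show ?thesis using dirichlet_change_coefficient[OF y, of 0] unfolding source .
qed

lemma semilinear_exists:
  assumes f: "L2supp f" and \<Lambda>: "\<Lambda> > 0"
    and mono: "\<And>x s t. s \<le> t \<Longrightarrow> 0 \<le> N x t - N x s" and lip: "\<And>x s t. s \<le> t \<Longrightarrow> N x t - N x s \<le> \<Lambda> * (t - s)"
    and zero: "\<And>x. N x 0 = 0" and meas: "\<And>y. cont y \<Longrightarrow> (\<lambda>x. N x (y x)) \<in> borel_measurable borel"
  shows "\<exists>y. dirichlet 0 (\<lambda>x. f x - N x (y x)) y"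
proof -
  have residual: "\<bar>(\<Lambda> * t - N x t) - (\<Lambda> * s - N x s)\<bar> \<le> \<Lambda> * \<bar>t - s\<bar>" for x t s
    by (rule monotone_lipschitz_residual[OF mono lip])
  obtain q where q: "q \<ge> 0" "q < 1" "\<And>f y M x. dirichlet \<Lambda> f y \<Longrightarrow> (\<And>x. \<bar>f x\<bar> \<le> M) \<Longrightarrow> \<bar>y x\<bar> \<le> q * (M / \<Lambda>)"
    using dirichlet_contraction[OF \<Lambda>] by blast
  define r where "r y x = indicator \<Omega> x * (\<Lambda> * y x - N x (y x))" for y :: "'a \<Rightarrow> real" and x
  define g where "g y x = 1 * f x + 1 * r y x" for y x
  have r: "L2supp (r y)" if y: "cont y" "bounded (range y)" for y
  proof -
    note [measurable] = borel_measurable_UNIV[OF y(1)] meas[OF y(1)]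
    show ?thesis unfolding r_def[abs_def]
    proof (rule L2supp_indicator_dominated[OF y(2), where \<Lambda> = \<Lambda>])
      show "\<bar>\<Lambda> * y x - N x (y x)\<bar> \<le> \<Lambda> * \<bar>y x\<bar>" for x using residual[of "y x" x 0] zero by simp
    qed (use \<Lambda> in auto)
  qed
  have "\<forall>y. \<exists>z. cont y \<and> bounded (range y) \<longrightarrow> dirichlet \<Lambda> (g y) z"
    using dirichlet_exists[OF \<Lambda> L2supp_lincomb[OF f r]] unfolding g_def[abs_def] by blast
  then obtain T where T: "\<And>y. cont y \<Longrightarrow> bounded (range y) \<Longrightarrow> dirichlet \<Lambda> (g y) (T y)" by metis
  have "\<exists>y. cont y \<and> bounded (range y) \<and> T y = y"
  proof (rule sup_contraction_fixpoint[OF _ q(1,2)])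
    show "cont (T y) \<and> bounded (range (T y))" if "cont y" "bounded (range y)" for y
      using T[OF that] by (blast intro: dirichlet_C0dom C0dom_continuous C0dom_bounded)
  next
    fix y y' :: "'a \<Rightarrow> real" and d x assume y: "cont y" "bounded (range y)"
      and y': "cont y'" "bounded (range y')"
      and d: "\<And>x. \<bar>y x - y' x\<bar> \<le> d"
    have "\<bar>T y x - T y' x\<bar> \<le> q * (\<Lambda> * d / \<Lambda>)"
    proof (rule q(3)[OF dirichlet_diff[OF T[OF y] T[OF y']]])
      fix x
      have "g y x - g y' x = indicator \<Omega> x * ((\<Lambda> * y x - N x (y x)) - (\<Lambda> * y' x - N x (y' x)))"
        by (simp add: g_def r_def right_diff_distrib)
      moreover have "\<bar>(\<Lambda> * y x - N x (y x)) - (\<Lambda> * y' x - N x (y' x))\<bar> \<le> \<Lambda> * d"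
        using residual[of "y x" x "y' x"] mult_left_mono[OF d[of x], of \<Lambda>] \<Lambda> by linarith
      ultimately show "\<bar>g y x - g y' x\<bar> \<le> \<Lambda> * d"
        using order_trans[OF abs_ge_zero d] \<Lambda> by (auto simp: indicator_def)
    qed
    then show "\<bar>T y x - T y' x\<bar> \<le> q * d" using \<Lambda> by simp
  qed
  then obtain y where y: "cont y" "bounded (range y)" "T y = y" by blast
  have "dirichlet \<Lambda> (\<lambda>x. f x + indicator \<Omega> x * (\<Lambda> * y x - N x (y x))) y"
    using T[OF y(1,2)] unfolding y(3) by (simp add: g_def[abs_def] r_def)
  then have "dirichlet 0 (\<lambda>x. f x - N x (y x)) y" by (rule dirichlet_absorb_nonlinearity[OF _ f])
      (simp add: zero)
  then show ?thesis by blast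
qed

lemma semilinear_unique:
  assumes y: "dirichlet 0 (\<lambda>x. f x - N x (y x)) y" and z: "dirichlet 0 (\<lambda>x. f x - N x (z x)) z"
    and mono: "\<And>x s t. x \<in> \<Omega> \<Longrightarrow> s \<le> t \<Longrightarrow> N x s \<le> N x t"
  shows "y = z"
proof
  fix x
  have "\<bar>y x - z x\<bar> \<le> 0 * green_bound"
  proof (rule dirichlet_abs_upper[OF dirichlet_diff[OF y z]])
    show "f x - N x (y x) - (f x - N x (z x)) \<le> 0" if "x \<in> \<Omega>" "0 < y x - z x" for x
      using mono[of x "z x" "y x"] that by simp
    show "- 0 \<le> f x - N x (y x) - (f x - N x (z x))" if "x \<in> \<Omega>" "y x - z x < 0" for x
      using mono[of x "y x" "z x"] that by simp
  qed simp
  then show "y x = z x" by simp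
qed

lemma dirichlet_equicontinuous:
  assumes M: "M \<ge> 0" and \<eta>: "\<eta> > 0"
  obtains \<delta> where "\<delta> > 0" "\<And>g y x x'. dirichlet 0 g y \<Longrightarrow> L2supp g \<Longrightarrow> (\<And>x. \<bar>g x\<bar> \<le> M) \<Longrightarrow>
    norm (x - x') < \<delta> \<Longrightarrow> \<bar>y x - y x'\<bar> \<le> \<eta>"
proof -
  define F where "F = M + M * green_bound"
  have F: "F \<ge> 0" using M green_bound_nonneg by (simp add: F_def)
  have "\<eta> / 4 > 0" using \<eta> by simp
  then obtain n where n: "n \<ge> 0" and close: "\<And>m f y Y x. m \<ge> n \<Longrightarrow> L2supp f \<Longrightarrow> (\<And>x. \<bar>f x\<bar> \<le> F) \<Longrightarrow>
      penalised 1 m f Y \<Longrightarrow> dirichlet 1 f y \<Longrightarrow> \<bar>Y x - y x\<bar> \<le> \<eta> / 4"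
    using penalised_close[OF zero_less_one F, of "\<eta> / 4"] by blast
  note near = close[OF order_refl]
  define L where "L = (F + n * F) * potential_lipschitz_const TYPE('a) (1 + n)"
  define \<delta> where "\<delta> = \<eta> / (2 * (\<bar>L\<bar> + 1))"
  have \<delta>: "\<delta> > 0" using \<eta> by (simp add: \<delta>_def)
  have "\<bar>y x - y x'\<bar> \<le> \<eta>" if y: "dirichlet 0 g y" and g: "L2supp g" "\<And>x. \<bar>g x\<bar> \<le> M"
    and dist: "norm (x - x') < \<delta>" for g y x x'
  proof -
    have y_le: "\<bar>y x\<bar> \<le> M * green_bound" for x
      by (rule dirichlet_abs_upper[OF y M]) (use g(2) in \<open>auto simp: abs_le_iff minus_le_iff\<close>)
    define f where "f x = g x + (1 - 0) * y x" for x
    have f: "dirichlet 1 f y" "L2supp f"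
      unfolding f_def[abs_def] using dirichlet_change_coefficient[OF y, of 1]
          L2supp_lincomb[OF g(1) dirichlet_L2supp[OF y], of 1 1] by auto
    have f_le: "\<bar>f x\<bar> \<le> F" for x using g(2)[of x] y_le[of x] by (simp add: f_def F_def)
    obtain Y where Y: "penalised 1 n f Y" using penalised_exists[OF _ n f(2), of 1] by auto
    have "\<bar>Y x - Y x'\<bar> \<le> L * norm (x - x')" unfolding L_def using penalised_lipschitz[OF _ n f(2) f_le Y]
      by simp
    also have "\<dots> \<le> (\<bar>L\<bar> + 1) * \<delta>" using dist by (intro mult_mono) auto
    also have "\<dots> = \<eta> / 2" by (simp add: \<delta>_def add_pos_nonneg field_simps)
    finally show ?thesis using near[OF f(2) f_le Y f(1), of x] near[OF f(2) f_le Y f(1), of x'] by linarith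
  qed
  then show ?thesis using \<delta> by (rule that[rotated])
qed

end

section \<open>Weak derivatives of solutions\<close>

lemma DERIV_pos_part_square:
  "((\<lambda>t::real. (max (t - k) 0)\<^sup>2) has_real_derivative 2 * max (t - k) 0) (at t)"
proof -
  consider "t > k" | "t < k" | "t = k" by linarith
  then show ?thesis
  proof cases
    assume t: "t > k"
    have "((\<lambda>t. (t - k)\<^sup>2) has_real_derivative 2 * max (t - k) 0) (at t)"
      using t by (auto intro!: derivative_eq_intros)
    then show ?thesis by (rule has_field_derivative_transform_within_open[where S = "{k<..}"]) (use t in auto)
  next
    assume t: "t < k"
    have "((\<lambda>t. 0) has_real_derivative 2 * max (t - k) 0) (at t)" using t by simp
    then show ?thesis by (rule has_field_derivative_transform_within_open[where S = "{..<k}"]) (use t in auto)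
  next
    assume t: "t = k"
    have "((\<lambda>h. (max h 0)\<^sup>2 / h) \<longlongrightarrow> 0) (at (0::real))"
    proof (rule Lim_null_comparison)
      show "\<forall>\<^sub>F h in at (0::real). norm ((max h 0)\<^sup>2 / h) \<le> \<bar>h\<bar>"
        by (rule always_eventually) (auto simp: max_def power2_eq_square)
      show "((\<lambda>h::real. \<bar>h\<bar>) \<longlongrightarrow> 0) (at 0)" by (rule tendsto_rabs_zero) (rule tendsto_ident_at)
    qed
    then show ?thesis by (simp add: DERIV_def t)
  qed
qed

definition shrink_pos :: "real \<Rightarrow> real \<Rightarrow> real" where
  "shrink_pos k t = sqrt ((max (t - k) 0)\<^sup>2 + k\<^sup>2) - k"

definition shrink_pos_deriv :: "real \<Rightarrow> real \<Rightarrow> real" where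
  "shrink_pos_deriv k t = max (t - k) 0 / sqrt ((max (t - k) 0)\<^sup>2 + k\<^sup>2)"

(* An odd C1 function with slopes in [0, 1] that vanishes on [-k, k] and is 2 k-close to the identity. *)
definition shrink :: "real \<Rightarrow> real \<Rightarrow> real" where
  "shrink k t = shrink_pos k t - shrink_pos k (- t)"

definition shrink_deriv :: "real \<Rightarrow> real \<Rightarrow> real" where
  "shrink_deriv k t = shrink_pos_deriv k t + shrink_pos_deriv k (- t)"

context
  fixes k :: real assumes k: "k > 0"
begin

lemma shrink_pos_radicand: "0 < (max (t - k) 0)\<^sup>2 + k\<^sup>2"
  using k by (simp add: add_nonneg_pos)

lemma DERIV_shrink_pos: "(shrink_pos k has_real_derivative shrink_pos_deriv k t) (at t)"
proof -
  have radicand: "((\<lambda>t. (max (t - k) 0)\<^sup>2 + k\<^sup>2) has_real_derivative 2 * max (t - k) 0) (at t)"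
    using DERIV_add[OF DERIV_pos_part_square DERIV_const] by simp
  from DERIV_diff[OF DERIV_chain2[OF DERIV_real_sqrt[OF shrink_pos_radicand] radicand] DERIV_const[of k]]
  show ?thesis unfolding shrink_pos_def[abs_def] shrink_pos_deriv_def
    by (rule DERIV_cong) (simp add: field_simps)
qed

lemma shrink_pos_bounds: "max (t - k) 0 - k \<le> shrink_pos k t" "0 \<le> shrink_pos k t"
  "shrink_pos k t \<le> max (t - k) 0"
proof -
  have "max (t - k) 0 \<le> sqrt ((max (t - k) 0)\<^sup>2 + k\<^sup>2)" "k \<le> sqrt ((max (t - k) 0)\<^sup>2 + k\<^sup>2)"
    by (rule real_le_rsqrt; simp)+
  then show "max (t - k) 0 - k \<le> shrink_pos k t" "0 \<le> shrink_pos k t" by (simp_all add: shrink_pos_def)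
  have "sqrt ((max (t - k) 0)\<^sup>2 + k\<^sup>2) \<le> max (t - k) 0 + k"
    using k by (intro real_le_lsqrt) (auto simp: power2_sum)
  then show "shrink_pos k t \<le> max (t - k) 0" by (simp add: shrink_pos_def)
qed

lemma shrink_pos_deriv_bounds: "0 \<le> shrink_pos_deriv k t" "shrink_pos_deriv k t \<le> 1"
  "t \<le> k \<Longrightarrow> shrink_pos_deriv k t = 0"
proof -
  have "max (t - k) 0 \<le> sqrt ((max (t - k) 0)\<^sup>2 + k\<^sup>2)" by (rule real_le_rsqrt) simp
  then show "shrink_pos_deriv k t \<le> 1"
    unfolding shrink_pos_deriv_def using shrink_pos_radicand[of t] by (simp add: divide_le_eq)
  show "0 \<le> shrink_pos_deriv k t" "t \<le> k \<Longrightarrow> shrink_pos_deriv k t = 0" by (simp_all add: shrink_pos_deriv_def)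
qed

lemma DERIV_shrink: "(shrink k has_real_derivative shrink_deriv k t) (at t)"
  using DERIV_diff[OF DERIV_shrink_pos[of t] DERIV_chain2[OF DERIV_shrink_pos DERIV_minus[OF DERIV_ident],
      of t]]
  by (simp add: shrink_def[abs_def] shrink_deriv_def)

lemma shrink_deriv_bounds: "0 \<le> shrink_deriv k t" "shrink_deriv k t \<le> 1"
  using shrink_pos_deriv_bounds[of t] shrink_pos_deriv_bounds[of "- t"] k
  by (cases "t \<le> 0"; simp add: shrink_deriv_def)+

lemma continuous_shrink_deriv: "cont (shrink_deriv k)"
proof -
  have "cont (shrink_pos_deriv k)" unfolding shrink_pos_deriv_def[abs_def]
    by (intro continuous_intros) (use shrink_pos_radicand in \<open>metis less_irrefl real_sqrt_gt_0_iff\<close>)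
  then show ?thesis unfolding shrink_deriv_def[abs_def]
    by (intro continuous_on_add continuous_on_compose2[of UNIV "shrink_pos_deriv k" UNIV uminus]
        continuous_intros) auto
qed

lemma shrink_eq_0: "\<bar>t\<bar> \<le> k \<Longrightarrow> shrink k t = 0"
  by (simp add: shrink_def shrink_pos_def abs_le_iff)

lemma shrink_close: "\<bar>shrink k t - t\<bar> \<le> 2 * k"
  using shrink_pos_bounds[of t] shrink_pos_bounds[of "- t"] k unfolding shrink_def
  by (auto simp: max_def abs_le_iff split: if_splits)

lemma shrink_abs_le: "\<bar>shrink k t\<bar> \<le> \<bar>t\<bar>"
  using shrink_pos_bounds[of t] shrink_pos_bounds[of "- t"] k unfolding shrink_def
  by (auto simp: max_def abs_le_iff split: if_splits)

end

lemma pd_compose: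
  assumes "(S has_real_derivative s) (at (f x))" "f differentiable (at x)"
  shows "pd (\<lambda>x. S (f x)) b x = s * pd f b x" and "(\<lambda>x. S (f x)) differentiable (at x)"
proof -
  from has_derivative_compose[OF differentiable_has_derivative_pd[OF assms(2)]
      assms(1)[unfolded has_field_derivative_def]]
  have "((\<lambda>x. S (f x)) has_derivative (\<lambda>h. s * pd f h x)) (at x)" .
  then show "pd (\<lambda>x. S (f x)) b x = s * pd f b x" "(\<lambda>x. S (f x)) differentiable (at x)"
    by (auto intro: pd_eq simp: differentiable_def)
qed

lemma shrink_energy:
  fixes w :: "'a::euclidean_space \<Rightarrow> real"
  assumes k: "k > 0" and w: "smooth w" and K: "compact K" "\<And>x. x \<notin> K \<Longrightarrow> \<bar>w x\<bar> \<le> k" and b: "b \<in> Basis"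
  defines "s x \<equiv> shrink k (w x)"
  shows "s differentiable (at x)" and "cont (pd s h)" and "square_integrable lborel (pd s b)"
    and "sqnorm (pd s b) \<le> (LBINT x. - (s x * lap w x))"
proof -
  note pd_s = pd_compose[OF DERIV_shrink[OF k] smooth_differentiable[OF w]]
  show diff: "s differentiable (at x)" for x unfolding s_def[abs_def] by (rule pd_s(2))
  have pd: "pd s h = (\<lambda>x. shrink_deriv k (w x) * pd w h x)" for h unfolding s_def[abs_def]
    by (rule ext) (rule pd_s(1))
  have cont_deriv: "cont (\<lambda>x. shrink_deriv k (w x))"
    by (rule continuous_on_compose2[OF continuous_shrink_deriv[OF k] smooth_continuous[OF w]]) auto
  show cont: "cont (pd s h)" for h
    unfolding pd by (intro continuous_on_mult cont_deriv smooth_continuous smooth_pd w)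
  have zero: "s x = 0" if "x \<notin> K" for x using shrink_eq_0[OF k K(2)[OF that]] by (simp add: s_def)
  note parts = integration_by_parts[OF diff cont smooth_differentiable[OF smooth_pd[OF w]]
      smooth_continuous[OF smooth_pd[OF smooth_pd[OF w]]] K(1)]
  have parts: "(LBINT x. s x * pd (pd w b) b x) = - (LBINT x. pd s b x * pd w b x)"
    "integrable lborel (\<lambda>x. s x * pd (pd w b) b x)" "integrable lborel (\<lambda>x. pd s b x * pd w b x)" for b
    by (rule parts(1) parts(2) parts(3); use zero in blast)+
  have nonneg: "0 \<le> pd s b x * pd w b x" for b x
    using shrink_deriv_bounds(1)[OF k, of "w x"] by (simp add: pd mult.assoc)
  have "(pd s b x)\<^sup>2 \<le> pd s b x * pd w b x" for x
  proof -
    have "(shrink_deriv k (w x))\<^sup>2 \<le> shrink_deriv k (w x)"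
      using shrink_deriv_bounds[OF k, of "w x"] by (simp add: power2_eq_square mult_left_le)
    then have "(shrink_deriv k (w x))\<^sup>2 * (pd w b x)\<^sup>2 \<le> shrink_deriv k (w x) * (pd w b x)\<^sup>2"
      by (rule mult_right_mono) simp
    then show ?thesis unfolding pd power2_eq_square by (simp only: mult_ac)
  qed
  note square = square_integrable_bound[OF _ parts(3) this]
  show "square_integrable lborel (pd s b)" using borel_measurable_UNIV[OF cont] by (intro square) simp
  have "sqnorm (pd s b) \<le> (LBINT x. pd s b x * pd w b x)" using borel_measurable_UNIV[OF cont]
    by (intro square) simp
  also have "\<dots> \<le> (\<Sum>b\<in>Basis. LBINT x. pd s b x * pd w b x)"
    by (rule member_le_sum[OF b]) (auto intro!: integral_nonneg_AE AE_I2 nonneg)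
  also have "\<dots> = - (\<Sum>b\<in>Basis. LBINT x. s x * pd (pd w b) b x)" by (simp add: parts(1) sum_negf)
  also have "\<dots> = (LBINT x. - (s x * lap w x))"
    unfolding lap_def sum_distrib_left using parts(2) by (simp add: bochner_integral_sum)
  finally show "sqnorm (pd s b) \<le> (LBINT x. - (s x * lap w x))" .
qed

lemma square_integrable_test_fun: "test_fun D \<phi> \<Longrightarrow> square_integrable lborel \<phi>"
  using integrable_times_test_fun[OF test_fun_continuous, of D \<phi> D \<phi>] borel_measurable_UNIV[OF
      test_fun_continuous, of D \<phi>]
  by (simp add: square_integrable_def power2_eq_square)

lemma conv_L1:
  fixes f :: "'a::euclidean_space \<Rightarrow> real"
  assumes f: "integrable lborel f" and \<rho>: "test_fun UNIV \<rho>" "\<And>x. 0 \<le> \<rho> x" "(LBINT x. \<rho> x) = 1"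
  shows "integrable lborel (conv f \<rho>)" and "(LBINT x. \<bar>conv f \<rho> x\<bar>) \<le> (LBINT x. \<bar>f x\<bar>)"
proof -
  note [measurable] = borel_measurable_UNIV[OF test_fun_continuous[OF \<rho>(1)]]
  have int: "integrable lborel (\<lambda>x. \<rho> (x - z))" for z
    using integrable_shift[OF integrable_test_fun[OF \<rho>(1)], of "- z"] by simp
  have mass: "(LBINT x. \<rho> (x - z)) = 1" for z using lborel_integral_shift[of \<rho> "- z"] \<rho>(3) by simp
  have pair: "integrable (lborel \<Otimes>\<^sub>M lborel) (\<lambda>(z, x). h z * \<rho> (x - z))" if h: "integrable lborel h" for h
  proof (rule lborel_pair.Fubini_integrable)
    note [measurable] = borel_measurable_integrable[OF h]
    show "(\<lambda>(z, x). h z * \<rho> (x - z)) \<in> borel_measurable (lborel \<Otimes>\<^sub>M lborel)" by measurable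
    show "AE z in lborel. integrable lborel (\<lambda>x. case (z, x) of (z, x) \<Rightarrow> h z * \<rho> (x - z))" using int by simp
    have "(LBINT x. norm (case (z, x) of (z, x) \<Rightarrow> h z * \<rho> (x - z))) = \<bar>h z\<bar>" for z
      using mass[of z] by (simp add: abs_mult abs_of_nonneg[OF \<rho>(2)])
    then show "integrable lborel (\<lambda>z. \<integral>x. norm (case (z, x) of (z, x) \<Rightarrow> h z * \<rho> (x - z)) \<partial>lborel)" using h
      by simp
  qed
  show conv: "integrable lborel (conv f \<rho>)"
    unfolding conv_def[abs_def] by (rule lborel_pair.integrable_snd[OF pair[OF f]])
  note abs_pair = pair[OF integrable_abs[OF f]]
  have "(LBINT x. \<bar>conv f \<rho> x\<bar>) \<le> (LBINT x. (LBINT z. \<bar>f z\<bar> * \<rho> (x - z)))"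
  proof (rule integral_mono[OF integrable_abs[OF conv] lborel_pair.integrable_snd[OF abs_pair]])
    show "\<bar>conv f \<rho> x\<bar> \<le> (LBINT z. \<bar>f z\<bar> * \<rho> (x - z))" for x
      using integral_abs_bound[of lborel "\<lambda>z. f z * \<rho> (x - z)"]
      by (simp add: conv_def abs_mult abs_of_nonneg[OF \<rho>(2)])
  qed
  also have "\<dots> = (LBINT z. (LBINT x. \<bar>f z\<bar> * \<rho> (x - z)))"
    by (rule trans[OF lborel_pair.integral_snd[OF abs_pair] lborel_pair.integral_fst[OF abs_pair, symmetric]])
  also have "\<dots> = (LBINT x. \<bar>f x\<bar>)" by (simp add: mass)
  finally show "(LBINT x. \<bar>conv f \<rho> x\<bar>) \<le> (LBINT x. \<bar>f x\<bar>)" .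
qed

lemma conv_mollifier_abs_le:
  fixes y :: "'a::euclidean_space \<Rightarrow> real"
  assumes "cont y" "\<epsilon> > 0" "\<And>x. \<bar>y x\<bar> \<le> Y" shows "\<bar>conv y (mollifier \<epsilon>) x\<bar> \<le> Y"
  using conv_mollifier_close[of y \<epsilon> x 0 Y] assms by simp

lemma product_le_if_eq_uminus:
  fixes s l g Y :: real
  assumes Y: "\<bar>s\<bar> \<le> Y" and l: "s \<noteq> 0 \<Longrightarrow> l = - g" shows "- (s * l) \<le> Y * \<bar>g\<bar>"
proof (cases "s = 0")
  case False
  then have "- (s * l) \<le> \<bar>s\<bar> * \<bar>g\<bar>" using l by (simp flip: abs_mult)
  also have "\<dots> \<le> Y * \<bar>g\<bar>" using Y by (intro mult_right_mono) auto
  finally show ?thesis .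
qed (use Y in simp)

context corkscrew_domain begin

lemma C0dom_uniformly_continuous:
  assumes y: "C0dom y" and e: "e > 0"
  obtains d where "d > 0" "\<And>x z. norm (x - z) < d \<Longrightarrow> \<bar>y x - y z\<bar> < e"
proof -
  obtain d where d: "d > 0" "\<And>x z. x \<in> cball 0 (rad + 1) \<Longrightarrow> norm (x - z) < d \<Longrightarrow> \<bar>y x - y z\<bar> < e"
    using uniformly_continuous_near_bounded[OF C0dom_continuous[OF y] bounded_cball e] by metis
  have far: "y x = 0" if "norm x > rad" for x
    using C0dom_outside[OF y, of x] rad(2)[of x] closure_subset[of \<Omega>] that by force
  have "\<bar>y x - y z\<bar> < e" if close: "norm (x - z) < min d 1" for x z
  proof (cases "norm x \<le> rad + 1")
    case False
    have "norm z > rad" using norm_triangle_ineq2[of x z] close False by simp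
    then show ?thesis using far False e by simp
  qed (use d(2)[of x z] close in simp)
  then show ?thesis using d(1) by (intro that[of "min d 1"]) auto
qed

lemma mollified_dirichlet:
  assumes y: "dirichlet 0 f y" and k: "k > 0"
  obtains \<epsilon> where "\<epsilon> > 0" "\<And>x. \<bar>conv y (mollifier \<epsilon>) x - y x\<bar> \<le> k"
    "\<And>x. k < \<bar>conv y (mollifier \<epsilon>) x\<bar> \<Longrightarrow> x \<in> \<Omega> \<and> lap (conv y (mollifier \<epsilon>)) x = - conv f (mollifier \<epsilon>) x"
proof -
  have cont: "cont y" by (rule C0dom_continuous[OF dirichlet_C0dom[OF y]])
  obtain d where d: "d > 0" "\<And>x z. norm (x - z) < d \<Longrightarrow> \<bar>y x - y z\<bar> < k"
    using C0dom_uniformly_continuous[OF dirichlet_C0dom[OF y] k] by blast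
  define \<epsilon> where "\<epsilon> = d / 3"
  have \<epsilon>: "\<epsilon> > 0" "2 * \<epsilon> < d" using d by (auto simp: \<epsilon>_def)
  have near: "\<bar>y z - y x\<bar> \<le> k" if "norm (x - z) \<le> 2 * \<epsilon>" for x z
    using d(2)[of x z] that \<epsilon> by (simp add: abs_minus_commute)
  have inside: "cball x \<epsilon> \<subseteq> \<Omega>" if large: "k < \<bar>conv y (mollifier \<epsilon>) x\<bar>" for x
  proof (rule ccontr)
    assume "\<not> cball x \<epsilon> \<subseteq> \<Omega>"
    then obtain z where "z \<in> cball x \<epsilon>" "z \<notin> \<Omega>" by blast
    then have z: "norm (x - z) \<le> \<epsilon>" "y z = 0" using dirichlet_outside[OF y] by (auto simp: dist_norm)
    have "\<bar>conv y (mollifier \<epsilon>) x - 0\<bar> \<le> k"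
    proof (rule conv_mollifier_close[OF cont \<epsilon>(1)])
      show "\<bar>y z' - 0\<bar> \<le> k" if "norm (x - z') \<le> \<epsilon>" for z'
        using near[of z z'] norm_triangle_ineq4[of "x - z'" "x - z"] z that by simp
    qed
    with large show False by simp
  qed
  have lap: "lap (conv y (mollifier \<epsilon>)) x = - conv f (mollifier \<epsilon>) x" if "k < \<bar>conv y (mollifier \<epsilon>) x\<bar>" for x
    using helmholtz_weak[OF dirichlet_helmholtz[OF y] test_fun_mollifier[OF \<epsilon>(1) inside[OF that]]]
    unfolding lap_conv[OF cont test_fun_mollifier_UNIV[OF \<epsilon>(1)]] lap_reflect[OF mollifier_smooth[OF \<epsilon>(1)]]
    by (simp add: conv_def)
  have "\<bar>conv y (mollifier \<epsilon>) x - y x\<bar> \<le> k" for x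
    by (rule conv_mollifier_close[OF cont \<epsilon>(1)]) (use near \<epsilon>(1) in simp)
  moreover have "x \<in> \<Omega>" if "k < \<bar>conv y (mollifier \<epsilon>) x\<bar>" for x using subsetD[OF inside[OF that], of x] \<epsilon>(1)
    by simp
  ultimately show ?thesis using that[OF \<epsilon>(1)] lap by blast
qed

(* Testing the mollified equation with a truncation s of the mollified solution bounds the gradient of s. *)
lemma mollified_truncation:
  assumes y: "dirichlet 0 f y" and f: "integrable lborel f" and Y: "\<And>x. \<bar>y x\<bar> \<le> Y" and b: "b \<in> Basis"
    and k: "k > 0"
  obtains s where "\<And>x. s differentiable (at x)" "cont (pd s b)" "square_integrable lborel (pd s b)"
    "sqnorm (pd s b) \<le> Y * (LBINT x. \<bar>f x\<bar>)" "\<And>x. \<bar>y x - s x\<bar> \<le> 3 * k"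
proof -
  have cont: "cont y" by (rule C0dom_continuous[OF dirichlet_C0dom[OF y]])
  obtain \<epsilon> where \<epsilon>: "\<epsilon> > 0" and close: "\<And>x. \<bar>conv y (mollifier \<epsilon>) x - y x\<bar> \<le> k"
    and lap: "\<And>x. k < \<bar>conv y (mollifier \<epsilon>) x\<bar> \<Longrightarrow> x \<in> \<Omega> \<and> lap (conv y (mollifier \<epsilon>)) x =
        - conv f (mollifier \<epsilon>) x"
    using mollified_dirichlet[OF y k] by blast
  define w where "w = conv y (mollifier \<epsilon>)"
  define s where "s x = shrink k (w x)" for x
  note test = test_fun_mollifier_UNIV[OF \<epsilon>, where 'a = 'a]
  have w: "smooth w" unfolding w_def by (rule smooth_conv[OF cont test])
  have K: "compact (closure \<Omega>)" using bounded_dom by (simp add: compact_closure)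
  have small: "\<bar>w x\<bar> \<le> k" if "x \<notin> closure \<Omega>" for x
    using lap[of x] that closure_subset[of \<Omega>] unfolding w_def by (meson not_less subsetD)
  note energy = shrink_energy[OF k w K small, folded s_def]
  have s: "s differentiable (at x)" "cont (pd s b)" "square_integrable lborel (pd s b)"
    "sqnorm (pd s b) \<le> (LBINT x. - (s x * lap w x))" for x
    using energy[OF _ b] by (simp_all add: s_def[abs_def])
  have s_Y: "\<bar>s x\<bar> \<le> Y" for x
    using order_trans[OF shrink_abs_le[OF k] conv_mollifier_abs_le[OF cont \<epsilon> Y]] by (simp add: s_def w_def)
  note L1 = conv_L1[OF f test mollifier_nonneg[OF \<epsilon>] mollifier_integral[OF \<epsilon>]]
  have "(LBINT x. - (s x * lap w x)) \<le> (LBINT x. Y * \<bar>conv f (mollifier \<epsilon>) x\<bar>)"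
  proof (rule integral_mono)
    show "integrable lborel (\<lambda>x. - (s x * lap w x))"
      by (intro integrable_minus integrable_compact_support[OF _ K] continuous_on_mult
          differentiable_imp_cont s(1)
          smooth_continuous smooth_lap w)
        (simp add: s_def shrink_eq_0[OF k small])
    show "- (s x * lap w x) \<le> Y * \<bar>conv f (mollifier \<epsilon>) x\<bar>" for x
    proof (rule product_le_if_eq_uminus[OF s_Y])
      show "lap w x = - conv f (mollifier \<epsilon>) x" if "s x \<noteq> 0"
        using that lap[of x] shrink_eq_0[OF k, of "w x"] by (force simp: s_def w_def)
    qed
  qed (intro integrable_mult_right integrable_abs L1)
  also have "\<dots> \<le> Y * (LBINT x. \<bar>f x\<bar>)" using L1(2) order_trans[OF abs_ge_zero Y] by (simp add: mult_left_mono)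
  finally have "sqnorm (pd s b) \<le> Y * (LBINT x. \<bar>f x\<bar>)" using s(4) by linarith
  moreover have "\<bar>y x - s x\<bar> \<le> 3 * k" for x
    using close[of x] shrink_close[OF k, of "w x"] by (simp add: s_def w_def)
  ultimately show ?thesis by (rule that[OF s(1-3)])
qed

lemma gradient_bound_approx:
  assumes y: "dirichlet 0 f y" and f: "integrable lborel f" and Y: "\<And>x. \<bar>y x\<bar> \<le> Y" and \<phi>: "test_fun \<Omega> \<phi>"
    and b: "b \<in> Basis" and k: "k > 0"
  shows "\<bar>LBINT x. y x * pd \<phi> b x\<bar> \<le> sqrt (Y * (LBINT x. \<bar>f x\<bar>)) * sqrt (sqnorm \<phi>) +
      3 * k * (LBINT x. \<bar>pd \<phi> b x\<bar>)"
proof -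
  obtain s where s: "\<And>x. s differentiable (at x)" "cont (pd s b)" "square_integrable lborel (pd s b)"
    and E: "sqnorm (pd s b) \<le> Y * (LBINT x. \<bar>f x\<bar>)" and close: "\<And>x. \<bar>y x - s x\<bar> \<le> 3 * k"
    using mollified_truncation[OF y f Y b k] by blast
  note cont = C0dom_continuous[OF dirichlet_C0dom[OF y]] differentiable_imp_cont[OF s(1)]
  note \<phi>_int = integrable_times_test_fun[OF _ test_fun_pd[OF \<phi>, of b]]
  obtain K\<phi> where K\<phi>: "compact K\<phi>" "\<And>x. x \<notin> K\<phi> \<Longrightarrow> \<phi> x = 0" using test_fun_support[OF \<phi>] by blast
  have "(LBINT x. s x * pd \<phi> b x) = - (LBINT x. pd s b x * \<phi> x)"
    using K\<phi> by (intro integration_by_parts(1)[OF s(1,2) smooth_differentiable[OF test_fun_smooth[OF \<phi>]]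
        test_fun_continuous[OF test_fun_pd[OF \<phi>]]]) auto
  moreover have "\<bar>ip (pd s b) \<phi>\<bar> \<le> sqrt (sqnorm (pd s b)) * sqrt (sqnorm \<phi>)"
    by (rule Cauchy_Schwarz_L2[OF s(3) square_integrable_test_fun[OF \<phi>]])
  moreover have "\<dots> \<le> sqrt (Y * (LBINT x. \<bar>f x\<bar>)) * sqrt (sqnorm \<phi>)" using E by (intro mult_right_mono) auto
  ultimately have truncated: "\<bar>LBINT x. s x * pd \<phi> b x\<bar> \<le> sqrt (Y * (LBINT x. \<bar>f x\<bar>)) * sqrt (sqnorm \<phi>)"
    by (simp add: L2_inner_def)
  have "\<bar>LBINT x. y x * pd \<phi> b x - s x * pd \<phi> b x\<bar> \<le> (LBINT x. 3 * k * \<bar>pd \<phi> b x\<bar>)"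
  proof (rule order_trans[OF integral_abs_bound], rule integral_mono)
    show "\<bar>y x * pd \<phi> b x - s x * pd \<phi> b x\<bar> \<le> 3 * k * \<bar>pd \<phi> b x\<bar>" for x
      unfolding left_diff_distrib[symmetric] abs_mult using close[of x] by (intro mult_right_mono) auto
  qed (intro integrable_abs integrable_mult_right bochner_integrable_diff \<phi>_int cont
      integrable_test_fun[OF test_fun_pd[OF \<phi>]])+
  then have "\<bar>(LBINT x. y x * pd \<phi> b x) - (LBINT x. s x * pd \<phi> b x)\<bar> \<le> 3 * k * (LBINT x. \<bar>pd \<phi> b x\<bar>)"
    using \<phi>_int[OF cont(1)] \<phi>_int[OF cont(2)] by simp
  then show ?thesis using truncated by linarith
qed

lemma gradient_bound:
  assumes y: "dirichlet 0 f y" and f: "integrable lborel f" and Y: "\<And>x. \<bar>y x\<bar> \<le> Y" and \<phi>: "test_fun \<Omega> \<phi>"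
    and b: "b \<in> Basis"
  shows "\<bar>LBINT x. y x * pd \<phi> b x\<bar> \<le> sqrt (Y * (LBINT x. \<bar>f x\<bar>)) * sqrt (sqnorm \<phi>)"
proof (rule tendsto_lowerbound)
  let ?B = "sqrt (Y * (LBINT x. \<bar>f x\<bar>)) * sqrt (sqnorm \<phi>)"
  have "((\<lambda>k. ?B + 3 * k * (LBINT x. \<bar>pd \<phi> b x\<bar>)) \<longlongrightarrow> ?B + 3 * 0 * (LBINT x. \<bar>pd \<phi> b x\<bar>)) (at_right 0)"
    by (intro tendsto_intros)
  then show "((\<lambda>k. ?B + 3 * k * (LBINT x. \<bar>pd \<phi> b x\<bar>)) \<longlongrightarrow> ?B) (at_right 0)" by simp
  show "\<forall>\<^sub>F k in at_right 0. \<bar>LBINT x. y x * pd \<phi> b x\<bar> \<le> ?B + 3 * k * (LBINT x. \<bar>pd \<phi> b x\<bar>)"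
    using gradient_bound_approx[OF y f Y \<phi> b] by (auto intro: eventually_at_rightI[of 0 1])
qed simp

lemma weak_derivative_exists:
  assumes y: "dirichlet 0 f y" and f: "integrable lborel f" and b: "b \<in> Basis"
  shows "\<exists>g. square_integrable lborel g \<and> (\<forall>\<phi>. test_fun \<Omega> \<phi> \<longrightarrow> (LBINT x. g x * \<phi> x) =
      - (LBINT x. y x * pd \<phi> b x))"
proof -
  obtain Y where Y: "\<And>x. \<bar>y x\<bar> \<le> Y" using C0dom_bounded[OF dirichlet_C0dom[OF y]] by (auto simp: bounded_iff)
  note int = integrable_times_test_fun[OF C0dom_continuous[OF dirichlet_C0dom[OF y]] test_fun_pd]
  have "\<exists>g. square_integrable lborel g \<and> (\<forall>\<phi>\<in>{\<phi>. test_fun \<Omega> \<phi>}. ip g \<phi> = - (LBINT x. y x * pd \<phi> b x))"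
  proof (rule riesz_representation_L2[where C = "sqrt (Y * (LBINT x. \<bar>f x\<bar>))"]; clarify)
    fix \<phi> assume \<phi>: "test_fun \<Omega> \<phi>"
    show "square_integrable lborel \<phi>" by (rule square_integrable_test_fun[OF \<phi>])
    show "\<bar>- (LBINT x. y x * pd \<phi> b x)\<bar> \<le> sqrt (Y * (LBINT x. \<bar>f x\<bar>)) * sqrt (sqnorm \<phi>)"
      using gradient_bound[OF y f Y \<phi> b] by simp
    fix \<psi> a c assume \<psi>: "test_fun \<Omega> \<psi>"
    show "test_fun \<Omega> (\<lambda>x. a * \<phi> x + c * \<psi> x)" by (intro test_fun_add test_fun_cmult \<phi> \<psi>)
    have "pd (\<lambda>x. a * \<phi> x + c * \<psi> x) b = (\<lambda>x. a * pd \<phi> b x + c * pd \<psi> b x)"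
      using test_fun_smooth[OF \<phi>] test_fun_smooth[OF \<psi>] by (simp add: pd_add pd_cmult smooth_cmult)
    then have "(LBINT x. y x * pd (\<lambda>x. a * \<phi> x + c * \<psi> x) b x) =
        (LBINT x. a * (y x * pd \<phi> b x) + c * (y x * pd \<psi> b x))"
      by (simp add: algebra_simps)
    then show "- (LBINT x. y x * pd (\<lambda>x. a * \<phi> x + c * \<psi> x) b x) =
        a * - (LBINT x. y x * pd \<phi> b x) + c * - (LBINT x. y x * pd \<psi> b x)"
      using int[OF \<phi>] int[OF \<psi>] by simp
  qed
  then show ?thesis by (auto simp: L2_inner_def)
qed

end

section \<open>States on Lipschitz domains\<close>

lemma borel_measurable_completion_AE:
  fixes k :: "'b \<Rightarrow> real"
  assumes h: "h \<in> borel_measurable M" and ae: "AE x in M. k x = h x"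
  shows "k \<in> borel_measurable (completion M)"
proof (rule measurableI)
  fix A :: "real set" assume A: "A \<in> sets borel"
  show "k -` A \<inter> space (completion M) \<in> sets (completion M)"
  proof (rule completion.in_sets_AE)
    show "h -` A \<inter> space (completion M) \<in> sets (completion M)"
      using measurable_sets[OF measurable_completion[OF h] A] .
    show "AE x in completion M. (x \<in> h -` A \<inter> space (completion M)) = (x \<in> k -` A \<inter> space (completion M))"
      using AE_completion[OF ae] by eventually_elim simp
  qed auto
qed auto

context corkscrew_domain begin

lemma
  fixes h k :: "'a \<Rightarrow> real"
  assumes h: "h \<in> borel_measurable borel" "\<And>x. x \<notin> \<Omega> \<Longrightarrow> h x = 0" and ae: "AE x in lborel. x \<in> \<Omega> \<longrightarrow> k x = h x"
  shows lebesgue_integral_dom: "(LINT x:\<Omega>|lebesgue. k x) = (LBINT x. h x)"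
    and set_integrable_lebesgue_dom: "set_integrable lebesgue \<Omega> k \<longleftrightarrow> integrable lborel h"
proof -
  have h': "h \<in> borel_measurable lborel" using h by simp
  have eq: "AE x in lborel. indicator \<Omega> x *\<^sub>R k x = h x" using ae
    by eventually_elim (use h(2) in \<open>auto simp: indicator_def\<close>)
  note eq' = AE_completion[OF eq]
  have meas: "(\<lambda>x. indicator \<Omega> x *\<^sub>R k x) \<in> borel_measurable lebesgue" "h \<in> borel_measurable lebesgue"
    by (rule borel_measurable_completion_AE[OF h' eq]) (rule measurable_completion[OF h'])
  show "(LINT x:\<Omega>|lebesgue. k x) = (LBINT x. h x)"
    unfolding set_lebesgue_integral_def integral_cong_AE[OF meas eq'] by (rule integral_completion[OF h'])
  show "set_integrable lebesgue \<Omega> k \<longleftrightarrow> integrable lborel h"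
    unfolding set_integrable_def integrable_cong_AE[OF meas eq'] by (rule integrable_completion[OF h'])
qed

definition represented_by :: "('a \<Rightarrow> real) \<Rightarrow> ('a \<Rightarrow> real) \<Rightarrow> bool" where
  "represented_by f f' \<longleftrightarrow> L2supp f' \<and> (AE x in lborel. x \<in> \<Omega> \<longrightarrow> f x = f' x)"

lemma represented_by_self: "L2supp f \<Longrightarrow> represented_by f f" by (simp add: represented_by_def)

lemma represented_by_L2supp: "represented_by f f' \<Longrightarrow> L2supp f'" by (simp add: represented_by_def)

lemma represented_by_lincomb:
  "represented_by f f' \<Longrightarrow> represented_by g g' \<Longrightarrow>
      represented_by (\<lambda>x. a * f x + b * g x) (\<lambda>x. a * f' x + b * g' x)"
  unfolding represented_by_def by (auto simp: L2supp_lincomb elim: eventually_elim2)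

lemma represented_by_diff:
  "represented_by f f' \<Longrightarrow> represented_by g g' \<Longrightarrow> represented_by (\<lambda>x. f x - g x) (\<lambda>x. f' x - g' x)"
  using represented_by_lincomb[of f f' g g' 1 "-1"] by simp

lemma represented_by_integral_mult:
  assumes f: "represented_by f f'" and [measurable]: "h \<in> borel_measurable borel"
  shows "(LINT x:\<Omega>|lebesgue. f x * h x) = (LBINT x. f' x * h x)"
proof (rule lebesgue_integral_dom)
  note [measurable] = L2supp_measurable[OF represented_by_L2supp[OF f]]
  show "(\<lambda>x. f' x * h x) \<in> borel_measurable borel" by measurable
  show "f' x * h x = 0" if "x \<notin> \<Omega>" for x using L2supp_outside[OF represented_by_L2supp[OF f] that] by simp
  show "AE x in lborel. x \<in> \<Omega> \<longrightarrow> f x * h x = f' x * h x" using f unfolding represented_by_def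
    by (auto elim: eventually_mono)
qed

lemma represented_by_square:
  assumes f: "represented_by f f'" shows "(LINT x:\<Omega>|lebesgue. (f x)\<^sup>2) = sqnorm f'"
  unfolding L2_sqnorm_def
proof (rule lebesgue_integral_dom)
  note [measurable] = L2supp_measurable[OF represented_by_L2supp[OF f]]
  show "(\<lambda>x. (f' x)\<^sup>2) \<in> borel_measurable borel" by measurable
  show "(f' x)\<^sup>2 = 0" if "x \<notin> \<Omega>" for x using L2supp_outside[OF represented_by_L2supp[OF f] that] by simp
  show "AE x in lborel. x \<in> \<Omega> \<longrightarrow> (f x)\<^sup>2 = (f' x)\<^sup>2" using f unfolding represented_by_def
    by (auto elim: eventually_mono)
qed

lemma represented_by_L2norm: "represented_by f f' \<Longrightarrow> L2norm \<Omega> f = sqrt (sqnorm f')"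
  by (simp add: L2norm_def represented_by_square)

lemma L2fun_represented_by: assumes "L2fun \<Omega> f" obtains f' where "represented_by f f'"
proof -
  obtain g where g: "g \<in> borel_measurable lborel" "AE x in lborel. f x = g x"
    using completion_ex_borel_measurable_real[of f lborel] assms by (auto simp: L2fun_def)
  note [measurable] = g(1)
  define f' where "f' x = indicator \<Omega> x * g x" for x
  have [measurable]: "f' \<in> borel_measurable borel" unfolding f'_def by measurable
  have ae: "AE x in lborel. x \<in> \<Omega> \<longrightarrow> f x = f' x" using g(2) by eventually_elim (simp add: f'_def)
  have "integrable lborel (\<lambda>x. (f' x)\<^sup>2)"
  proof (rule set_integrable_lebesgue_dom[THEN iffD1])
    show "AE x in lborel. x \<in> \<Omega> \<longrightarrow> (f x)\<^sup>2 = (f' x)\<^sup>2" using ae by eventually_elim simp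
    show "set_integrable lebesgue \<Omega> (\<lambda>x. (f x)\<^sup>2)" using assms by (simp add: L2fun_def)
  qed (simp_all add: f'_def)
  then have "represented_by f f'" using ae
    by (auto simp: represented_by_def L2supp_def square_integrable_def f'_def)
  then show ?thesis by (rule that)
qed

lemma L2supp_imp_L2fun: assumes "L2supp f" shows "L2fun \<Omega> f"
proof -
  note [measurable] = L2supp_measurable[OF assms]
  have "f \<in> borel_measurable lebesgue" by (intro measurable_completion) simp
  moreover have "set_integrable lebesgue \<Omega> (\<lambda>x. (f x)\<^sup>2)"
    by (rule set_integrable_lebesgue_dom[THEN iffD2])
      (use L2supp_outside[OF assms] square_integrable_square[OF L2supp_square_integrable[OF assms]] in
          simp_all)
  ultimately show ?thesis by (simp add: L2fun_def)
qed

lemma weak_grad_integral: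
  assumes y: "C0dom y" and \<phi>: "test_fun \<Omega> \<phi>" and G [measurable]: "G \<in> borel_measurable lebesgue"
    and sq: "set_integrable lebesgue \<Omega> (\<lambda>x. (norm (G x))\<^sup>2)" and grad: "weak_grad \<Omega> y G"
  shows "set_integrable lebesgue \<Omega> (\<lambda>x. \<Sum>b\<in>Basis. (G x \<bullet> b) * pd \<phi> b x)"
    and "(LINT x:\<Omega>|lebesgue. \<Sum>b\<in>Basis. (G x \<bullet> b) * pd \<phi> b x) = - (LBINT x. y x * lap \<phi> x)"
proof -
  have [measurable]: "\<Omega> \<in> sets lebesgue" by simp
  have int: "set_integrable lebesgue \<Omega> (\<lambda>x. (G x \<bullet> b) * pd \<phi> b x)" if b: "b \<in> Basis" for b
  proof -
    have bound: "(indicator \<Omega> x * (G x \<bullet> b))\<^sup>2 \<le> indicator \<Omega> x *\<^sub>R (norm (G x))\<^sup>2" for x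
      using power_mono[OF Basis_le_norm[OF b, of "G x"] abs_ge_zero, of 2] by (simp add: indicator_def)
    have "square_integrable lebesgue (\<lambda>x. indicator \<Omega> x * (G x \<bullet> b))"
      by (rule square_integrable_bound[OF _ sq[unfolded set_integrable_def] bound]) measurable
    moreover have "square_integrable lebesgue (pd \<phi> b)"
      using square_integrable_test_fun[OF test_fun_pd[OF \<phi>, of b]] unfolding square_integrable_def
      by (auto simp: integrable_completion intro: measurable_completion)
    ultimately have "integrable lebesgue (\<lambda>x. indicator \<Omega> x * (G x \<bullet> b) * pd \<phi> b x)"
      by (rule square_integrable_imp_integrable_mult)
    then show ?thesis by (simp add: set_integrable_def mult.assoc)
  qed
  then show "set_integrable lebesgue \<Omega> (\<lambda>x. \<Sum>b\<in>Basis. (G x \<bullet> b) * pd \<phi> b x)"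
    unfolding set_integrable_def scaleR_sum_right by (intro bochner_integrable_sum)
  have deriv: "(LINT x:\<Omega>|lebesgue. (G x \<bullet> b) * pd \<phi> b x) = - (LBINT x. y x * pd (pd \<phi> b) b x)"
    if b: "b \<in> Basis" for b
  proof -
    have "(LINT x:\<Omega>|lebesgue. y x * pd (pd \<phi> b) b x) = (LBINT x. y x * pd (pd \<phi> b) b x)"
      by (intro represented_by_integral_mult represented_by_self C0dom_L2supp y borel_measurable_UNIV
          test_fun_continuous[OF test_fun_pd[OF test_fun_pd[OF \<phi>]]])
    then show ?thesis using grad test_fun_pd[OF \<phi>, of b] b unfolding weak_grad_def by auto
  qed
  have "(LINT x:\<Omega>|lebesgue. \<Sum>b\<in>Basis. (G x \<bullet> b) * pd \<phi> b x) =
      (\<Sum>b\<in>Basis. LINT x:\<Omega>|lebesgue. (G x \<bullet> b) * pd \<phi> b x)"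
    unfolding set_lebesgue_integral_def scaleR_sum_right
    using int by (intro bochner_integral_sum) (simp add: set_integrable_def)
  also have "\<dots> = - (\<Sum>b\<in>Basis. LBINT x. y x * pd (pd \<phi> b) b x)" by (simp add: deriv sum_negf)
  also have "\<dots> = - (LBINT x. y x * lap \<phi> x)"
    unfolding lap_def sum_distrib_left
    using integrable_times_test_fun[OF C0dom_continuous[OF y] test_fun_pd[OF test_fun_pd[OF \<phi>]]]
    by (simp add: bochner_integral_sum)
  finally show "(LINT x:\<Omega>|lebesgue. \<Sum>b\<in>Basis. (G x \<bullet> b) * pd \<phi> b x) = - (LBINT x. y x * lap \<phi> x)" .
qed

lemma weak_grad_exists:
  assumes y: "dirichlet 0 f y" and f: "L2supp f"
  obtains G where "G \<in> borel_measurable lebesgue" "set_integrable lebesgue \<Omega> (\<lambda>x. (norm (G x))\<^sup>2)"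
    "weak_grad \<Omega> y G"
proof -
  have "\<forall>b. \<exists>g. b \<in> Basis \<longrightarrow> square_integrable lborel g \<and>
      (\<forall>\<phi>. test_fun \<Omega> \<phi> \<longrightarrow> (LBINT x. g x * \<phi> x) = - (LBINT x. y x * pd \<phi> b x))"
    using weak_derivative_exists[OF y L2supp_integrable[OF f]] by blast
  then obtain g where g: "\<And>b. b \<in> Basis \<Longrightarrow> square_integrable lborel (g b)"
    "\<And>b \<phi>. b \<in> Basis \<Longrightarrow> test_fun \<Omega> \<phi> \<Longrightarrow> (LBINT x. g b x * \<phi> x) = - (LBINT x. y x * pd \<phi> b x)"
    by metis
  define G where "G x = (\<Sum>b\<in>Basis. g b x *\<^sub>R b)" for x
  have G_inner: "G x \<bullet> b = g b x" if "b \<in> Basis" for x b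
    using that by (simp add: G_def inner_sum_left inner_Basis if_distrib cong: if_cong)
  have norm: "(norm (G x))\<^sup>2 = (\<Sum>b\<in>Basis. (g b x)\<^sup>2)" for x
    by (subst power2_norm_eq_inner, subst euclidean_inner) (simp add: G_inner power2_eq_square)
  have meas: "G \<in> borel_measurable lborel"
    unfolding G_def using square_integrable_measurable[OF g(1)]
    by (intro borel_measurable_sum borel_measurable_scaleR) auto
  show ?thesis
  proof
    show "G \<in> borel_measurable lebesgue" using meas by (rule measurable_completion)
    have "integrable lborel (\<lambda>x. (norm (G x))\<^sup>2)"
      unfolding norm using square_integrable_square[OF g(1)] by (intro bochner_integrable_sum)
    then have "integrable lebesgue (\<lambda>x. (norm (G x))\<^sup>2)" using meas by (subst integrable_completion) auto
    then show "set_integrable lebesgue \<Omega> (\<lambda>x. (norm (G x))\<^sup>2)" unfolding set_integrable_def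
      by (rule integrable_mult_indicator[rotated]) simp
    show "weak_grad \<Omega> y G" unfolding weak_grad_def
    proof (intro allI impI ballI)
      fix \<phi> and b :: 'a assume \<phi>: "test_fun \<Omega> \<phi>" and b: "b \<in> Basis"
      note [measurable] = borel_measurable_UNIV[OF test_fun_continuous[OF \<phi>]] square_integrable_measurable[OF
          g(1)[OF b]]
      have "(LINT x:\<Omega>|lebesgue. y x * pd \<phi> b x) = (LBINT x. y x * pd \<phi> b x)"
        by (intro represented_by_integral_mult represented_by_self C0dom_L2supp dirichlet_C0dom[OF y]
            borel_measurable_UNIV
            test_fun_continuous[OF test_fun_pd[OF \<phi>]])
      moreover have "(LINT x:\<Omega>|lebesgue. (G x \<bullet> b) * \<phi> x) = (LBINT x. g b x * \<phi> x)"
        by (rule lebesgue_integral_dom) (use test_fun_outside[OF \<phi>] in \<open>auto simp: G_inner[OF b]\<close>)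
      ultimately show "(LINT x:\<Omega>|lebesgue. y x * pd \<phi> b x) = - (LINT x:\<Omega>|lebesgue. (G x \<bullet> b) * \<phi> x)"
        using g(2)[OF b \<phi>] by simp
    qed
  qed
qed

lemma weak_formulation_iff:
  assumes f: "represented_by f f'" and y: "C0dom y" and N: "C0dom (\<lambda>x. N x (y x))" and \<phi>: "test_fun \<Omega> \<phi>"
    and G: "G \<in> borel_measurable lebesgue" "set_integrable lebesgue \<Omega> (\<lambda>x. (norm (G x))\<^sup>2)" "weak_grad \<Omega> y G"
  shows "(LINT x:\<Omega>|lebesgue. (\<Sum>b\<in>Basis. (G x \<bullet> b) * pd \<phi> b x) + N x (y x) * \<phi> x) =
      (LINT x:\<Omega>|lebesgue. f x * \<phi> x) \<longleftrightarrow>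
    (LBINT x. y x * (0 * \<phi> x - lap \<phi> x)) = (LBINT x. (f' x - N x (y x)) * \<phi> x)"
proof -
  note grad = weak_grad_integral[OF y \<phi> G]
  note meas = borel_measurable_UNIV[OF test_fun_continuous[OF \<phi>]]
  note int = integrable_L2supp_test[OF represented_by_L2supp[OF f] \<phi>] integrable_L2supp_test[OF
      C0dom_L2supp[OF N] \<phi>]
  have "set_integrable lebesgue \<Omega> (\<lambda>x. N x (y x) * \<phi> x)"
    by (rule set_integrable_lebesgue_dom[THEN iffD2, OF borel_measurable_integrable[OF int(2), simplified]])
      (use int(2) test_fun_outside[OF \<phi>] in auto)
  then have "(LINT x:\<Omega>|lebesgue. (\<Sum>b\<in>Basis. (G x \<bullet> b) * pd \<phi> b x) + N x (y x) * \<phi> x) =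
      - (LBINT x. y x * lap \<phi> x) + (LBINT x. N x (y x) * \<phi> x)"
    using represented_by_integral_mult[OF represented_by_self[OF C0dom_L2supp[OF N]] meas] grad(2)
    by (simp add: set_integral_add(2)[OF grad(1)])
  then show ?thesis
    using represented_by_integral_mult[OF f meas] int by (simp add: left_diff_distrib) linarith
qed

lemma weak_dirichlet_iff:
  assumes f: "represented_by f f'" and N: "\<And>y. C0dom y \<Longrightarrow> C0dom (\<lambda>x. N x (y x))"
  shows "weak_dirichlet \<Omega> N f y \<longleftrightarrow> dirichlet 0 (\<lambda>x. f' x - N x (y x)) y"
proof
  assume w: "weak_dirichlet \<Omega> N f y"
  then have y: "C0dom y" by (simp add: weak_dirichlet_def C0dom_def)
  have L2: "L2supp (\<lambda>x. f' x - N x (y x))" by (intro L2supp_diff represented_by_L2supp[OF f] C0dom_L2supp N y)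
  show "dirichlet 0 (\<lambda>x. f' x - N x (y x)) y"
    using w weak_formulation_iff[where N = N and y = y, OF f y N[OF y]] integrable_L2supp_test[OF L2]
        C0dom_continuous[OF y] C0dom_outside[OF y]
    unfolding weak_dirichlet_def dirichlet_def helmholtz_def by blast
next
  assume d: "dirichlet 0 (\<lambda>x. f' x - N x (y x)) y"
  then have y: "C0dom y" by (rule dirichlet_C0dom)
  have L2: "L2supp (\<lambda>x. f' x - N x (y x))" by (intro L2supp_diff represented_by_L2supp[OF f] C0dom_L2supp N y)
  obtain G where "G \<in> borel_measurable lebesgue" "set_integrable lebesgue \<Omega> (\<lambda>x. (norm (G x))\<^sup>2)"
    "weak_grad \<Omega> y G"
    using weak_grad_exists[OF d L2] by blast
  then show "weak_dirichlet \<Omega> N f y"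
    using weak_formulation_iff[where N = N and y = y, OF f y N[OF y]]
        helmholtz_weak[OF dirichlet_helmholtz[OF d]] y
    unfolding weak_dirichlet_def C0dom_def by blast
qed

lemma sol_eqI:
  assumes f: "represented_by f f'" and N: "\<And>y. C0dom y \<Longrightarrow> C0dom (\<lambda>x. N x (y x))"
    and mono: "\<And>x s t. s \<le> t \<Longrightarrow> N x s \<le> N x t" and y: "dirichlet 0 (\<lambda>x. f' x - N x (y x)) y"
  shows "sol \<Omega> N f = y"
  unfolding sol_def
proof (rule the_equality)
  show "weak_dirichlet \<Omega> N f y" using weak_dirichlet_iff[where N = N, OF f N] y by blast
  show "z = y" if "weak_dirichlet \<Omega> N f z" for z
    using weak_dirichlet_iff[where N = N, OF f N] that semilinear_unique[where N = N, OF _ y mono] by blast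
qed

lemma linearised_exists:
  assumes q: "C0dom q" and f: "L2supp f"
  shows "\<exists>z. dirichlet 0 (\<lambda>x. f x - 3 * (q x)\<^sup>2 * z x) z"
proof -
  obtain Y where Y: "\<And>x. \<bar>q x\<bar> \<le> Y" using C0dom_bounded[OF q] by (auto simp: bounded_iff)
  show ?thesis
  proof (rule semilinear_exists[where N = "\<lambda>x t. 3 * (q x)\<^sup>2 * t" and \<Lambda> = "3 * Y\<^sup>2 + 1", OF f])
    show "0 \<le> 3 * (q x)\<^sup>2 * t - 3 * (q x)\<^sup>2 * s" if "s \<le> t" for x s t using that by (simp add: mult_left_mono)
    show "3 * (q x)\<^sup>2 * t - 3 * (q x)\<^sup>2 * s \<le> (3 * Y\<^sup>2 + 1) * (t - s)" if "s \<le> t" for x s t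
    proof -
      have "3 * (q x)\<^sup>2 * (t - s) \<le> (3 * Y\<^sup>2 + 1) * (t - s)"
        using that power_mono[OF Y[of x] abs_ge_zero, of 2] by (intro mult_right_mono) auto
      then show ?thesis by (simp add: algebra_simps)
    qed
    show "(\<lambda>x. 3 * (q x)\<^sup>2 * y x) \<in> borel_measurable borel" if "cont y" for y
      using C0dom_continuous[OF q] that by (intro borel_measurable_UNIV continuous_intros)
  qed (auto simp: add_nonneg_pos)
qed

lemma linearised_sol_eqI:
  assumes q: "C0dom q" and f: "represented_by f f'" and z: "dirichlet 0 (\<lambda>x. f' x - 3 * (q x)\<^sup>2 * z x) z"
  shows "sol \<Omega> (\<lambda>x t. 3 * (q x)\<^sup>2 * t) f = z"
proof (rule sol_eqI[where N = "\<lambda>x t. 3 * (q x)\<^sup>2 * t", OF f _ _ z])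
  show "C0dom (\<lambda>x. 3 * (q x)\<^sup>2 * y x)" if "C0dom y" for y
    using q that by (auto simp: C0dom_def intro!: continuous_intros)
qed (simp add: mult_left_mono)

lemma semilinear_bound:
  assumes y: "dirichlet 0 (\<lambda>x. u x - N x (y x)) y" and u: "\<And>x. \<bar>u x\<bar> \<le> F"
    and sign: "\<And>x. 0 < y x \<Longrightarrow> 0 \<le> N x (y x)" "\<And>x. y x < 0 \<Longrightarrow> N x (y x) \<le> 0"
  shows "\<bar>y x\<bar> \<le> F * green_bound"
proof (rule dirichlet_abs_upper[OF y order_trans[OF abs_ge_zero u]])
  show "u x - N x (y x) \<le> F" if "0 < y x" for x using u[of x] sign(1)[OF that] by linarith
  show "- F \<le> u x - N x (y x)" if "y x < 0" for x using u[of x] sign(2)[OF that] by linarith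
qed

definition cubic_state :: "('a \<Rightarrow> real) \<Rightarrow> ('a \<Rightarrow> real) \<Rightarrow> bool" where
  "cubic_state u y \<longleftrightarrow> dirichlet 0 (\<lambda>x. u x - (y x) ^ 3) y"

lemma C0dom_cube: "C0dom y \<Longrightarrow> C0dom (\<lambda>x. (y x) ^ 3)"
  by (auto simp: C0dom_def intro!: continuous_intros)

lemma cubic_state_C0dom: "cubic_state u y \<Longrightarrow> C0dom y" by (simp add: cubic_state_def dirichlet_C0dom)

lemma cubic_state_L2supp: "cubic_state u y \<Longrightarrow> L2supp y" by (intro C0dom_L2supp cubic_state_C0dom)

lemma cubic_state_source_L2supp: "cubic_state u y \<Longrightarrow> L2supp u \<Longrightarrow> L2supp (\<lambda>x. u x - (y x) ^ 3)"
  by (rule L2supp_diff[OF _ C0dom_L2supp[OF C0dom_cube[OF cubic_state_C0dom]]])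

lemma cubic_state_bound: "cubic_state u y \<Longrightarrow> (\<And>x. \<bar>u x\<bar> \<le> F) \<Longrightarrow> \<bar>y x\<bar> \<le> F * green_bound"
  unfolding cubic_state_def by (rule semilinear_bound[where N = "\<lambda>x t. t ^ 3"]) (auto simp: power_less_zero_eq
      less_imp_le)

lemma cubic_state_unique: "cubic_state u y \<Longrightarrow> cubic_state u z \<Longrightarrow> y = z"
  unfolding cubic_state_def by (rule semilinear_unique[where N = "\<lambda>x t. t ^ 3"]) (auto intro: power_mono_odd)

end

lemma cube_diff: "b ^ 3 - a ^ 3 = (b - a) * (b\<^sup>2 + a * b + a\<^sup>2)" for a b :: real
  by (simp add: power2_eq_square power3_eq_cube algebra_simps)

lemma
  fixes a b :: real
  shows cube_factor_nonneg: "0 \<le> b\<^sup>2 + a * b + a\<^sup>2"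
    and cube_factor_le: "\<bar>a\<bar> \<le> M \<Longrightarrow> \<bar>b\<bar> \<le> M \<Longrightarrow> b\<^sup>2 + a * b + a\<^sup>2 \<le> 3 * M\<^sup>2"
proof -
  have "b\<^sup>2 + a * b + a\<^sup>2 = (b + a / 2)\<^sup>2 + 3 / 4 * a\<^sup>2" by (simp add: power2_eq_square algebra_simps)
  then show "0 \<le> b\<^sup>2 + a * b + a\<^sup>2" by simp
  assume M: "\<bar>a\<bar> \<le> M" "\<bar>b\<bar> \<le> M"
  have "a * b \<le> \<bar>a\<bar> * \<bar>b\<bar>" by (simp flip: abs_mult)
  also have "\<dots> \<le> M * M" using M by (intro mult_mono) auto
  finally show "b\<^sup>2 + a * b + a\<^sup>2 \<le> 3 * M\<^sup>2"
    using power_mono[OF M(1) abs_ge_zero, of 2] power_mono[OF M(2) abs_ge_zero, of 2]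
    by (simp add: power2_eq_square)
qed

context corkscrew_domain begin

lemma cubic_state_exists:
  assumes u: "L2supp u" "\<And>x. \<bar>u x\<bar> \<le> F" shows "\<exists>y. cubic_state u y"
proof -
  have F: "0 \<le> F" by (rule order_trans[OF abs_ge_zero u(2)])
  define M where "M = F * green_bound + 1"
  have M: "M > 0" using F green_bound_nonneg by (simp add: M_def add_nonneg_pos)
  define T where "T t = max (- M) (min M t)" for t
  have T: "T s \<le> T t" "T t - T s \<le> t - s" if "s \<le> t" for s t using that by (auto simp: T_def)
  have T_le: "\<bar>T t\<bar> \<le> M" for t using M by (auto simp: T_def)
  have "\<exists>y. dirichlet 0 (\<lambda>x. u x - (T (y x)) ^ 3) y"
  proof (rule semilinear_exists[where N = "\<lambda>x t. (T t) ^ 3" and \<Lambda> = "3 * M\<^sup>2", OF u(1)])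
    show "0 \<le> (T t) ^ 3 - (T s) ^ 3" if "s \<le> t" for s t using power_mono_odd[OF _ T(1)[OF that], of 3] by simp
    show "(T t) ^ 3 - (T s) ^ 3 \<le> 3 * M\<^sup>2 * (t - s)" if "s \<le> t" for s t
    proof -
      have "(T t - T s) * ((T t)\<^sup>2 + T s * T t + (T s)\<^sup>2) \<le> (t - s) * (3 * M\<^sup>2)"
        using T[OF that] that by (intro mult_mono cube_factor_le cube_factor_nonneg T_le) auto
      then show ?thesis unfolding cube_diff by (simp add: mult.commute)
    qed
    show "(\<lambda>x. (T (y x)) ^ 3) \<in> borel_measurable borel" if "cont y" for y :: "'a \<Rightarrow> real"
      unfolding T_def using that by (intro borel_measurable_UNIV continuous_intros)
  qed (use M in \<open>auto simp: T_def\<close>)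
  then obtain y where y: "dirichlet 0 (\<lambda>x. u x - (T (y x)) ^ 3) y" by blast
  have "\<bar>y x\<bar> \<le> F * green_bound" for x
  proof (rule semilinear_bound[where N = "\<lambda>x t. T t ^ 3", OF y u(2)])
    show "0 \<le> T (y x) ^ 3" if "0 < y x" for x using that M by (auto simp: T_def)
    show "T (y x) ^ 3 \<le> 0" if "y x < 0" for x using that M by (auto simp: T_def power_le_zero_eq)
  qed
  then have "T (y x) = y x" for x using abs_le_D1[of "y x"] abs_le_D2[of "y x"] by (force simp: T_def M_def)
  then show ?thesis using y by (auto simp: cubic_state_def)
qed

lemma state_eqI: assumes "represented_by u u'" "cubic_state u' y" shows "state \<Omega> u = y"
  unfolding state_def
  by (rule sol_eqI[where N = "\<lambda>x t. t ^ 3", OF assms(1) _ _ assms(2)[unfolded cubic_state_def]])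
    (auto intro: C0dom_cube power_mono_odd)

lemma cubic_state_cong_AE:
  assumes y: "cubic_state u y" and u: "L2supp u" "L2supp u'" and ae: "AE x in lborel. x \<in> \<Omega> \<longrightarrow> u x = u' x"
  shows "cubic_state u' y"
proof -
  have "represented_by u u" "represented_by u u'" using u ae by (auto simp: represented_by_def)
  from weak_dirichlet_iff[OF this(1), of "\<lambda>x t. t ^ 3" y] weak_dirichlet_iff[OF this(2), of "\<lambda>x t. t ^ 3" y]
  show ?thesis using y unfolding cubic_state_def by (simp add: C0dom_cube)
qed

end

(* Above the graph the complement contains a cone with axis e. *)
lemma has_exterior_ball_above_graph:
  fixes \<gamma> :: "'a::euclidean_space \<Rightarrow> real"
  assumes e: "norm e = 1" and L: "L-lipschitz_on {q. q \<bullet> e = 0} \<gamma>"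
    and graph: "\<Omega> \<inter> ball x0 r = {p \<in> ball x0 r. p \<bullet> e < \<gamma> (p - (p \<bullet> e) *\<^sub>R e)}"
    and x: "x \<in> ball x0 (r / 2)" "x \<notin> \<Omega>" and \<tau>: "0 < \<tau>" "\<tau> \<le> r / 4"
  shows "has_exterior_ball \<Omega> (1 / (1 + L)) \<tau> x"
  unfolding has_exterior_ball_def
proof (intro exI[of _ "x + \<tau> *\<^sub>R e"] conjI)
  have L0: "L \<ge> 0" using L by (rule lipschitz_on_nonneg)
  have e_unit: "e \<bullet> e = 1" using e by (simp add: norm_eq_1)
  show "norm (x + \<tau> *\<^sub>R e - x) = \<tau>" using \<tau> e by simp
  have "x \<in> ball x0 r" using x(1) \<tau> by auto
  then have above: "\<gamma> (x - (x \<bullet> e) *\<^sub>R e) \<le> x \<bullet> e" using graph x(2)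
    by (auto simp: set_eq_iff not_less[symmetric])
  have "p \<notin> \<Omega>" if p: "p \<in> ball (x + \<tau> *\<^sub>R e) (1 / (1 + L) * \<tau>)" for p
  proof
    assume p_dom: "p \<in> \<Omega>"
    define h where "h = p - (x + \<tau> *\<^sub>R e)"
    have p_eq: "p = x + \<tau> *\<^sub>R e + h" by (simp add: h_def)
    have h: "(1 + L) * norm h < \<tau>"
      using p L0 by (simp add: h_def dist_norm norm_minus_commute pos_less_divide_eq mult.commute)
    then have "norm h < \<tau>" using mult_nonneg_nonneg[OF L0 norm_ge_zero[of h]] by (simp add: distrib_right)
    then have "dist x p < r / 4 + r / 4"
      unfolding p_eq dist_commute[of x] using norm_triangle_ineq[of "\<tau> *\<^sub>R e" h] \<tau> e
      by (simp add: dist_norm add.assoc)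
    then have "p \<in> ball x0 r" using x(1) dist_triangle[of x0 p x] by simp
    then have below: "p \<bullet> e < \<gamma> (p - (p \<bullet> e) *\<^sub>R e)" using graph p_dom by blast
    have "dist (\<gamma> (p - (p \<bullet> e) *\<^sub>R e)) (\<gamma> (x - (x \<bullet> e) *\<^sub>R e)) \<le>
        L * dist (p - (p \<bullet> e) *\<^sub>R e) (x - (x \<bullet> e) *\<^sub>R e)"
      by (rule lipschitz_onD[OF L]) (simp_all add: inner_diff_left e_unit)
    also have "dist (p - (p \<bullet> e) *\<^sub>R e) (x - (x \<bullet> e) *\<^sub>R e) = norm (h - (h \<bullet> e) *\<^sub>R e)"
      unfolding p_eq dist_norm by (rule arg_cong[of _ _ norm]) (simp add: inner_add_left e_unit algebra_simps)
    also have "norm (h - (h \<bullet> e) *\<^sub>R e) \<le> norm h"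
    proof -
      have "(norm (h - (h \<bullet> e) *\<^sub>R e))\<^sup>2 = (norm h)\<^sup>2 - (h \<bullet> e)\<^sup>2"
        unfolding power2_norm_eq_inner
        by (simp add: inner_diff_left inner_diff_right e_unit inner_commute power2_eq_square)
      then show ?thesis by (intro power2_le_imp_le[of "norm (h - (h \<bullet> e) *\<^sub>R e)" "norm h"]) auto
    qed
    finally have "\<gamma> (p - (p \<bullet> e) *\<^sub>R e) \<le> \<gamma> (x - (x \<bullet> e) *\<^sub>R e) + L * norm h"
      using L0 by (simp add: dist_real_def abs_le_iff mult_left_mono)
    moreover have "p \<bullet> e = x \<bullet> e + \<tau> + h \<bullet> e" by (simp add: p_eq inner_add_left e_unit)
    moreover have "- norm h \<le> h \<bullet> e" using Cauchy_Schwarz_ineq2[of h e] e by simp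
    ultimately have "\<tau> < (1 + L) * norm h" using below above by (simp add: algebra_simps)
    then show False using h by simp
  qed
  then show "ball (x + \<tau> *\<^sub>R e) (1 / (1 + L) * \<tau>) \<inter> \<Omega> = {}" by blast
qed

lemma has_exterior_ball_mono:
  "has_exterior_ball \<Omega> \<sigma> \<tau> x \<Longrightarrow> \<sigma>' \<le> \<sigma> \<Longrightarrow> 0 < \<tau> \<Longrightarrow> has_exterior_ball \<Omega> \<sigma>' \<tau> x"
  unfolding has_exterior_ball_def using subset_ball[of "\<sigma>' * \<tau>" "\<sigma> * \<tau>"] by (simp add: mult_right_mono) blast

lemma lipschitz_domain_locally_corkscrew:
  assumes dom: "lipschitz_domain \<Omega>" and x0: "x0 \<in> frontier \<Omega>"
  obtains \<rho> where "0 < \<rho>" "\<And>x \<tau>. x \<in> ball x0 \<rho> \<Longrightarrow> x \<notin> \<Omega> \<Longrightarrow> 0 < \<tau> \<Longrightarrow> \<tau> \<le> \<rho> \<Longrightarrow> has_exterior_ball \<Omega> \<rho> \<tau> x"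
proof -
  obtain r and e :: 'a and \<gamma> L where r: "r > 0" and e: "norm e = 1" and L: "L-lipschitz_on {q. q \<bullet> e = 0} \<gamma>"
    and graph: "\<Omega> \<inter> ball x0 r = {p \<in> ball x0 r. p \<bullet> e < \<gamma> (p - (p \<bullet> e) *\<^sub>R e)}"
    using dom x0 unfolding lipschitz_domain_def by blast
  define \<rho> where "\<rho> = min (r / 4) (1 / (1 + L))"
  have "0 < \<rho>" using r lipschitz_on_nonneg[OF L] by (simp add: \<rho>_def)
  moreover have "has_exterior_ball \<Omega> \<rho> \<tau> x" if "x \<in> ball x0 \<rho>" "x \<notin> \<Omega>" "0 < \<tau>" "\<tau> \<le> \<rho>" for x \<tau>
  proof (rule has_exterior_ball_mono[OF has_exterior_ball_above_graph[OF e L graph _ that(2,3)] _ that(3)])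
    show "x \<in> ball x0 (r / 2)" "\<tau> \<le> r / 4" "\<rho> \<le> 1 / (1 + L)" using that r by (auto simp: \<rho>_def)
  qed
  ultimately show ?thesis by (rule that)
qed

lemma has_exterior_ball_far:
  fixes x :: "'a::euclidean_space"
  assumes x: "x \<notin> \<Omega>" and far: "\<And>z. z \<in> frontier \<Omega> \<Longrightarrow> 2 * \<tau> < dist x z" and \<tau>: "0 < \<tau>" and \<sigma>: "\<sigma> \<le> 1"
  shows "has_exterior_ball \<Omega> \<sigma> \<tau> x"
proof -
  obtain b :: 'a where b: "norm b = 1" using vector_choose_size[of 1] by auto
  have "p \<notin> \<Omega>" if p: "dist (x + \<tau> *\<^sub>R b) p < \<sigma> * \<tau>" for p
  proof
    assume "p \<in> \<Omega>"
    then have "closed_segment x p \<inter> frontier \<Omega> \<noteq> {}"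
      by (intro connected_Int_frontier[OF connected_segment(1)]) (use x in auto)
    then obtain z where z: "z \<in> closed_segment x p" "z \<in> frontier \<Omega>" by blast
    have "dist x z \<le> dist x p" using segment_bound1[OF z(1)] by (simp add: dist_norm norm_minus_commute)
    also have "\<dots> \<le> dist x (x + \<tau> *\<^sub>R b) + dist (x + \<tau> *\<^sub>R b) p" by (rule dist_triangle)
    also have "dist x (x + \<tau> *\<^sub>R b) = \<tau>" using \<tau> b by (simp add: dist_norm)
    also have "\<tau> + dist (x + \<tau> *\<^sub>R b) p \<le> 2 * \<tau>" using p mult_right_mono[OF \<sigma>, of \<tau>] \<tau> by linarith
    finally show False using far[OF z(2)] by simp
  qed
  then have "ball (x + \<tau> *\<^sub>R b) (\<sigma> * \<tau>) \<inter> \<Omega> = {}" by auto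
  then show ?thesis unfolding has_exterior_ball_def using b \<tau> by (intro exI[of _ "x + \<tau> *\<^sub>R b"]) simp
qed

lemma lipschitz_domain_corkscrew:
  fixes \<Omega> :: "'a::euclidean_space set"
  assumes dom: "lipschitz_domain \<Omega>" shows "corkscrew \<Omega>"
proof -
  have "\<forall>x0\<in>frontier \<Omega>. \<exists>\<rho>>0. \<forall>x \<tau>. x \<in> ball x0 \<rho> \<longrightarrow> x \<notin> \<Omega> \<longrightarrow> 0 < \<tau> \<longrightarrow> \<tau> \<le> \<rho> \<longrightarrow> has_exterior_ball \<Omega> \<rho> \<tau> x"
    using lipschitz_domain_locally_corkscrew[OF dom] by metis
  then obtain \<rho> where \<rho>: "\<And>x0. x0 \<in> frontier \<Omega> \<Longrightarrow> 0 < \<rho> x0" "\<And>x0 x \<tau>. x0 \<in> frontier \<Omega> \<Longrightarrow> x \<in> ball x0 (\<rho> x0) \<Longrightarrow>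
      x \<notin> \<Omega> \<Longrightarrow> 0 < \<tau> \<Longrightarrow> \<tau> \<le> \<rho> x0 \<Longrightarrow> has_exterior_ball \<Omega> (\<rho> x0) \<tau> x" by metis
  have "compact (frontier \<Omega>)" using dom by (simp add: lipschitz_domain_def compact_frontier_bounded)
  moreover have "frontier \<Omega> \<subseteq> (\<Union>x0\<in>frontier \<Omega>. ball x0 (\<rho> x0 / 2))" using \<rho>(1) by fastforce
  ultimately obtain T where T: "T \<subseteq> frontier \<Omega>" "finite T" "frontier \<Omega> \<subseteq> (\<Union>x0\<in>T. ball x0 (\<rho> x0 / 2))"
    by (rule compactE_image[OF _ open_ball])
  define \<sigma> where "\<sigma> = Min (insert 1 (\<rho> ` T))"
  have \<sigma>: "0 < \<sigma>" "\<sigma> \<le> 1" unfolding \<sigma>_def using T \<rho>(1) by (auto simp: Min_gr_iff)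
  have \<sigma>_le: "\<sigma> \<le> \<rho> x0" if "x0 \<in> T" for x0 unfolding \<sigma>_def using T(2) that by (intro Min_le) auto
  have "has_exterior_ball \<Omega> \<sigma> \<tau> x" if x: "x \<notin> \<Omega>" and \<tau>: "0 < \<tau>" "\<tau> \<le> \<sigma> / 4" for x \<tau>
  proof (cases "\<exists>z\<in>frontier \<Omega>. dist x z \<le> 2 * \<tau>")
    case True
    then obtain z where z: "z \<in> frontier \<Omega>" "dist x z \<le> 2 * \<tau>" by blast
    then obtain x0 where x0: "x0 \<in> T" "dist x0 z < \<rho> x0 / 2" using T(3) by auto
    have "x \<in> ball x0 (\<rho> x0)" using dist_triangle[of x0 x z] x0(2) z(2) \<tau>(2) \<sigma>_le[OF x0(1)]
      by (simp add: dist_commute)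
    then have "has_exterior_ball \<Omega> (\<rho> x0) \<tau> x"
      using \<rho>(2) x0(1) T(1) x \<tau> \<sigma>_le[OF x0(1)] \<sigma>(1) by (auto intro: order_trans[of _ "\<sigma> / 4"])
    then show ?thesis by (rule has_exterior_ball_mono[OF _ \<sigma>_le[OF x0(1)] \<tau>(1)])
  next
    case False
    then show ?thesis by (intro has_exterior_ball_far[OF x _ \<tau>(1) \<sigma>(2)]) force
  qed
  then show ?thesis unfolding corkscrew_def using \<sigma> by (intro exI[of _ \<sigma>] exI[of _ "\<sigma> / 4"]) auto
qed

section \<open>Optimal controls\<close>

context corkscrew_domain begin

lemma C0dom_mult: "C0dom f \<Longrightarrow> cont g \<Longrightarrow> C0dom (\<lambda>x. g x * f x)"
  by (auto simp: C0dom_def intro!: continuous_on_mult)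

lemma C0dom_diff: "C0dom f \<Longrightarrow> C0dom g \<Longrightarrow> C0dom (\<lambda>x. f x - g x)"
  by (auto simp: C0dom_def intro!: continuous_on_diff)

lemma C0dom_cube_uniform_limit:
  assumes y: "C0dom y" and lim: "uniform_limit UNIV Y y sequentially"
  shows "uniform_limit UNIV (\<lambda>n x. (Y n x) ^ 3) (\<lambda>x. (y x) ^ 3) sequentially"
  unfolding power3_eq_cube
  by (intro uniform_lim_mult lim C0dom_bounded y C0dom_mult C0dom_continuous)

lemma L2supp_uniform_limit:
  assumes Y: "\<And>n. L2supp (Y n)" "L2supp y" and lim: "uniform_limit UNIV Y y sequentially"
  shows "(\<lambda>n. sqnorm (\<lambda>x. Y n x - y x)) \<longlonglongrightarrow> 0"
proof (rule tendstoI)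
  fix e :: real assume e: "e > 0"
  define s where "s = sqrt (e / (vol + 1))"
  have s: "s > 0" "s\<^sup>2 = e / (vol + 1)" using e vol_nonneg by (simp_all add: s_def)
  have "e * (vol / (vol + 1)) < e * 1" using e vol_nonneg by (intro mult_strict_left_mono) auto
  then have s_vol: "s\<^sup>2 * vol < e" by (simp add: s(2))
  have "\<forall>\<^sub>F n in sequentially. \<forall>x\<in>UNIV. dist (Y n x) (y x) < s" using lim s(1) by (rule uniform_limitD)
  then show "\<forall>\<^sub>F n in sequentially. dist (sqnorm (\<lambda>x. Y n x - y x)) 0 < e"
  proof eventually_elim
    case (elim n)
    note diff = L2supp_diff[OF Y(1)[of n] Y(2)]
    have "sqnorm (\<lambda>x. Y n x - y x) \<le> s\<^sup>2 * vol"
      by (rule L2supp_bounded(2)[OF L2supp_measurable[OF diff] L2supp_outside[OF diff]])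
        (use elim in \<open>auto simp: dist_real_def intro: less_imp_le\<close>)
    then show ?case using s_vol by simp
  qed
qed

lemma sqnorm_diff_tendsto:
  assumes Y: "\<And>n. L2supp (Y n)" "L2supp y" "(\<lambda>n. sqnorm (\<lambda>x. Y n x - y x)) \<longlonglongrightarrow> 0" and q: "L2supp q"
  shows "(\<lambda>n. sqnorm (\<lambda>x. Y n x - q x)) \<longlonglongrightarrow> sqnorm (\<lambda>x. y x - q x)"
  unfolding L2_inner_self[symmetric]
  by (intro L2_inner_tendsto) (use Y in \<open>auto intro!: L2supp_square_integrable L2supp_diff q\<close>)

end

locale control_problem = corkscrew_domain +
  fixes \<alpha> \<beta> :: real
  assumes bounds_less: "\<alpha> < \<beta>"
begin

definition admissible :: "('a \<Rightarrow> real) \<Rightarrow> bool" where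
  "admissible u \<longleftrightarrow> u \<in> borel_measurable borel \<and> (\<forall>x\<in>\<Omega>. \<alpha> \<le> u x \<and> u x \<le> \<beta>) \<and> (\<forall>x. x \<notin> \<Omega> \<longrightarrow> u x = 0)"

definition feasible :: "('a \<Rightarrow> real) \<Rightarrow> ('a \<Rightarrow> real) \<Rightarrow> bool" where
  "feasible u y \<longleftrightarrow> admissible u \<and> cubic_state u y"

definition control_bound :: real where "control_bound = \<bar>\<alpha>\<bar> + \<bar>\<beta>\<bar>"

definition state_bound :: real where "state_bound = control_bound * green_bound"

lemma control_bound_nonneg: "0 \<le> control_bound" by (simp add: control_bound_def)

lemma state_bound_nonneg: "0 \<le> state_bound"
  using control_bound_nonneg green_bound_nonneg by (simp add: state_bound_def)

lemma admissible_bound: assumes "admissible u" shows "\<bar>u x\<bar> \<le> control_bound"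
proof (cases "x \<in> \<Omega>")
  case True
  then have "\<alpha> \<le> u x" "u x \<le> \<beta>" using assms by (auto simp: admissible_def)
  then show ?thesis by (auto simp: control_bound_def)
qed (use assms control_bound_nonneg in \<open>auto simp: admissible_def\<close>)

lemma admissible_L2supp: assumes "admissible u" shows "L2supp u"
  by (rule L2supp_bounded[OF _ _ admissible_bound[OF assms]]) (use assms in \<open>auto simp: admissible_def\<close>)

lemma feasible_admissible: "feasible u y \<Longrightarrow> admissible u" by (simp add: feasible_def)
lemma feasible_state: "feasible u y \<Longrightarrow> cubic_state u y" by (simp add: feasible_def)
lemma feasible_C0dom: "feasible u y \<Longrightarrow> C0dom y" by (intro cubic_state_C0dom feasible_state)
lemma feasible_L2supp: "feasible u y \<Longrightarrow> L2supp y" by (intro C0dom_L2supp feasible_C0dom)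

lemma feasible_exists: assumes "admissible u" obtains y where "feasible u y"
  using cubic_state_exists[OF admissible_L2supp[OF assms] admissible_bound[OF assms]] assms
  by (auto simp: feasible_def)

lemma feasible_bound: "feasible u y \<Longrightarrow> \<bar>y x\<bar> \<le> state_bound"
  unfolding state_bound_def
  by (rule cubic_state_bound[OF feasible_state admissible_bound[OF feasible_admissible]])

lemma clamp_admissible:
  assumes [measurable]: "g \<in> borel_measurable borel"
    shows "admissible (\<lambda>x. if x \<in> \<Omega> then max \<alpha> (min \<beta> (g x)) else 0)"
  using bounds_less by (auto simp: admissible_def)

lemma feasible_ex: "\<exists>u y. feasible u y"
proof -
  have "admissible (\<lambda>x. if x \<in> \<Omega> then max \<alpha> (min \<beta> \<alpha>) else 0)" by (rule clamp_admissible) simp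
  then show ?thesis using feasible_exists by blast
qed

lemma states_equicontinuous:
  assumes e: "e > 0"
  obtains d where "d > 0" "\<And>u y x x'. feasible u y \<Longrightarrow> norm (x - x') < d \<Longrightarrow> \<bar>y x - y x'\<bar> \<le> e"
proof -
  define M where "M = control_bound + state_bound ^ 3"
  have M: "0 \<le> M" using control_bound_nonneg state_bound_nonneg by (simp add: M_def)
  obtain d where d: "d > 0" "\<And>g y x x'. dirichlet 0 g y \<Longrightarrow> L2supp g \<Longrightarrow> (\<And>x. \<bar>g x\<bar> \<le> M) \<Longrightarrow> norm (x - x') < d \<Longrightarrow>
      \<bar>y x - y x'\<bar> \<le> e"
    using dirichlet_equicontinuous[OF M e] by blast
  have "\<bar>y x - y x'\<bar> \<le> e" if u: "feasible u y" and x: "norm (x - x') < d" for u y x x'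
  proof (rule d(2)[OF feasible_state[OF u, unfolded cubic_state_def] _ _ x])
    show "L2supp (\<lambda>x. u x - (y x) ^ 3)"
      by (rule cubic_state_source_L2supp[OF feasible_state[OF u]
          admissible_L2supp[OF feasible_admissible[OF u]]])
    show "\<bar>u x - (y x) ^ 3\<bar> \<le> M" for x
      using power_mono[OF feasible_bound[OF u, of x] abs_ge_zero, of 3]
          admissible_bound[OF feasible_admissible[OF u], of x]
        abs_triangle_ineq4[of "u x" "(y x) ^ 3"] by (simp add: M_def power_abs)
  qed
  then show ?thesis by (rule that[OF d(1)])
qed

lemma states_uniform_limit:
  assumes UY: "\<And>n. feasible (U n) (Y n)"
  obtains k y where "strict_mono (k :: nat \<Rightarrow> nat)" "C0dom y" "uniform_limit UNIV (\<lambda>n. Y (k n)) y sequentially"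
proof -
  have equicont: "\<exists>d>0. \<forall>n z. z \<in> closure \<Omega> \<and> norm (x - z) < d \<longrightarrow> norm (Y n x - Y n z) < e" if e: "e > 0"
    for e x
  proof -
    have "e / 2 > 0" using e by simp
    then obtain d where "d > 0" "\<And>u y x x'. feasible u y \<Longrightarrow> norm (x - x') < d \<Longrightarrow> \<bar>y x - y x'\<bar> \<le> e / 2"
      using states_equicontinuous by blast
    then show ?thesis using UY e by (intro exI[of _ d]) (force intro: le_less_trans[of _ "e / 2"])
  qed
  have "compact (closure \<Omega>)" using bounded_dom by (simp add: compact_closure)
  then obtain h and k :: "nat \<Rightarrow> nat" where k: "strict_mono k"
    and lim: "\<And>e. 0 < e \<Longrightarrow> \<exists>N. \<forall>n x. n \<ge> N \<and> x \<in> closure \<Omega> \<longrightarrow> norm (Y (k n) x - h x) < e"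
  proof (rule Arzela_Ascoli[of "closure \<Omega>" Y state_bound])
    show "norm (Y n x) \<le> state_bound" for n x using feasible_bound[OF UY] by simp
  qed (use equicont in blast)+
  define y where "y x = (if x \<in> closure \<Omega> then h x else 0)" for x
  have zero: "Y n x = 0" if "x \<notin> \<Omega>" for n x by (rule C0dom_outside[OF feasible_C0dom[OF UY] that])
  have unif: "uniform_limit UNIV (\<lambda>n. Y (k n)) y sequentially"
  proof (rule uniform_limitI)
    fix e :: real assume "e > 0"
    then obtain N where "\<And>n x. n \<ge> N \<Longrightarrow> x \<in> closure \<Omega> \<Longrightarrow> norm (Y (k n) x - h x) < e" using lim by blast
    then show "\<forall>\<^sub>F n in sequentially. \<forall>x\<in>UNIV. dist (Y (k n) x) (y x) < e"
      using zero[OF contra_subsetD[OF closure_subset]] \<open>e > 0\<close>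
      by (intro eventually_sequentiallyI[of N]) (auto simp: y_def dist_real_def)
  qed
  have "C0dom y" unfolding C0dom_def
  proof (intro conjI allI impI)
    show "cont y" by (rule uniform_limit_theorem[OF _ unif])
        (simp_all add: C0dom_continuous[OF feasible_C0dom[OF UY]])
    show "y x = 0" if "x \<notin> \<Omega>" for x
      using LIMSEQ_unique[OF tendsto_uniform_limitI[OF unif, of x], of 0] zero[OF that] by simp
  qed
  then show ?thesis by (rule that[OF k _ unif])
qed

lemma admissible_L2_limit:
  assumes v: "\<And>n. admissible (v n)" and Cauchy: "L2_Cauchy lborel v"
  obtains u where "admissible u" "(\<lambda>n. sqnorm (\<lambda>x. v n x - u x)) \<longlonglongrightarrow> 0"
proof -
  obtain g r where g: "square_integrable lborel g" "(\<lambda>n. sqnorm (\<lambda>x. v n x - g x)) \<longlonglongrightarrow> 0"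
    "AE x in lborel. (\<lambda>n. v (r n) x) \<longlonglongrightarrow> g x"
    using L2_complete[OF L2supp_square_integrable[OF admissible_L2supp[OF v]] Cauchy] by blast
  note [measurable] = square_integrable_measurable[OF g(1)] L2supp_measurable[OF admissible_L2supp[OF v]]
  define u where "u x = (if x \<in> \<Omega> then max \<alpha> (min \<beta> (g x)) else 0)" for x
  have u: "admissible u" unfolding u_def by (rule clamp_admissible) simp
  note [measurable] = L2supp_measurable[OF admissible_L2supp[OF u]]
  have ae: "AE x in lborel. g x = u x" using g(3)
  proof eventually_elim
    fix x assume lim: "(\<lambda>n. v (r n) x) \<longlonglongrightarrow> g x"
    show "g x = u x"
    proof (cases "x \<in> \<Omega>")
      case True
      then have "\<alpha> \<le> v n x" "v n x \<le> \<beta>" for n using v[of n] by (auto simp: admissible_def)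
      then have "\<alpha> \<le> g x" "g x \<le> \<beta>" using LIMSEQ_le_const[OF lim] LIMSEQ_le_const2[OF lim] by blast+
      then show ?thesis using True by (simp add: u_def)
    next
      case False
      then have "v n x = 0" for n using v[of n] by (simp add: admissible_def)
      then show ?thesis using lim False LIMSEQ_unique[OF _ tendsto_const] by (simp add: u_def)
    qed
  qed
  have "sqnorm (\<lambda>x. v n x - g x) = sqnorm (\<lambda>x. v n x - u x)" for n
    unfolding L2_sqnorm_def by (rule integral_cong_AE) (measurable, use ae in \<open>auto elim: eventually_mono\<close>)
  then show ?thesis using that[OF u] g(2) by simp
qed

lemma admissible_midpoint: "admissible u \<Longrightarrow> admissible w \<Longrightarrow> admissible (\<lambda>x. 1/2 * u x + 1/2 * w x)"
  by (fastforce simp: admissible_def)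

definition tail_controls :: "(nat \<Rightarrow> 'a \<Rightarrow> real) \<Rightarrow> (('a \<Rightarrow> real) \<Rightarrow> real) \<Rightarrow> nat \<Rightarrow> ('a \<Rightarrow> real) set" where
  "tail_controls U l n =
    {v. admissible v \<and> (\<forall>\<phi> e. test_fun \<Omega> \<phi> \<longrightarrow> (\<forall>m\<ge>n. \<bar>ip (U m) \<phi> - l \<phi>\<bar> \<le> e) \<longrightarrow> \<bar>ip v \<phi> - l \<phi>\<bar> \<le> e)}"

lemma tail_controls_admissible: "v \<in> tail_controls U l n \<Longrightarrow> admissible v" by (simp add: tail_controls_def)

lemma tail_controls_close:
  "v \<in> tail_controls U l n \<Longrightarrow> test_fun \<Omega> \<phi> \<Longrightarrow> (\<And>m. m \<ge> n \<Longrightarrow> \<bar>ip (U m) \<phi> - l \<phi>\<bar> \<le> e) \<Longrightarrow> \<bar>ip v \<phi> - l \<phi>\<bar> \<le> e"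
  by (simp add: tail_controls_def)

lemma tail_controls_midpoint:
  assumes u: "u \<in> tail_controls U l n" and w: "w \<in> tail_controls U l n"
  shows "(\<lambda>x. 1/2 * u x + 1/2 * w x) \<in> tail_controls U l n"
proof -
  note admissible = u[THEN tail_controls_admissible] w[THEN tail_controls_admissible]
  have "\<bar>ip (\<lambda>x. 1/2 * u x + 1/2 * w x) \<phi> - l \<phi>\<bar> \<le> e"
    if \<phi>: "test_fun \<Omega> \<phi>" and e: "\<forall>m\<ge>n. \<bar>ip (U m) \<phi> - l \<phi>\<bar> \<le> e" for \<phi> e
  proof -
    have "ip (\<lambda>x. 1/2 * u x + 1/2 * w x) \<phi> = 1/2 * ip u \<phi> + 1/2 * ip w \<phi>"
      unfolding L2_inner_commute[of _ _ \<phi>]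
      by (intro L2_inner_lincomb_right square_integrable_test_fun[OF \<phi>] L2supp_square_integrable
          admissible_L2supp admissible)
    then show ?thesis using tail_controls_close[OF u \<phi>, of e] tail_controls_close[OF w \<phi>, of e] e
      by (simp add: abs_le_iff)
  qed
  then show ?thesis using admissible_midpoint[OF admissible] by (simp add: tail_controls_def)
qed

(* A weak limit of controls, obtained as the limit of almost minimal elements of a decreasing
      sequence of convex sets, without weak compactness. *)
lemma admissible_weak_limit:
  assumes U: "\<And>n. admissible (U n)" and l: "\<And>\<phi>. test_fun \<Omega> \<phi> \<Longrightarrow> (\<lambda>n. ip (U n) \<phi>) \<longlonglongrightarrow> l \<phi>"
  obtains u where "admissible u" "\<And>\<phi>. test_fun \<Omega> \<phi> \<Longrightarrow> ip u \<phi> = l \<phi>"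
proof -
  obtain v where v: "\<And>n. v n \<in> tail_controls U l n" and Cauchy: "L2_Cauchy lborel v"
  proof (rule almost_minimal_L2_Cauchy[of "tail_controls U l" lborel "control_bound\<^sup>2 * vol"])
    show "square_integrable lborel u" if "u \<in> tail_controls U l n" for n u
      by (rule L2supp_square_integrable[OF admissible_L2supp[OF tail_controls_admissible[OF that]]])
    show "tail_controls U l (Suc n) \<subseteq> tail_controls U l n" for n unfolding tail_controls_def
      by (blast intro: Suc_leD)
    show "\<exists>u\<in>tail_controls U l n. sqnorm u \<le> control_bound\<^sup>2 * vol" for n
    proof
      show "U n \<in> tail_controls U l n" using U by (simp add: tail_controls_def)
      show "sqnorm (U n) \<le> control_bound\<^sup>2 * vol"
        by (rule L2supp_bounded(2)[OF _ _ admissible_bound[OF U]]) (use U in \<open>auto simp: admissible_def\<close>)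
    qed
  qed (rule tail_controls_midpoint that; assumption)+
  have v_adm: "admissible (v n)" for n by (rule tail_controls_admissible[OF v])
  obtain u where u: "admissible u" "(\<lambda>n. sqnorm (\<lambda>x. v n x - u x)) \<longlonglongrightarrow> 0"
    using admissible_L2_limit[OF v_adm Cauchy] .
  have "ip u \<phi> = l \<phi>" if \<phi>: "test_fun \<Omega> \<phi>" for \<phi>
  proof (rule LIMSEQ_unique)
    show "(\<lambda>n. ip (v n) \<phi>) \<longlonglongrightarrow> ip u \<phi>"
      by (intro L2_inner_tendsto u square_integrable_test_fun[OF \<phi>] L2supp_square_integrable admissible_L2supp
          v_adm)
        (simp add: L2_sqnorm_def)
    show "(\<lambda>n. ip (v n) \<phi>) \<longlonglongrightarrow> l \<phi>"
    proof (rule LIMSEQ_I)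
      fix e :: real assume e: "e > 0"
      then obtain N where N: "\<And>n. n \<ge> N \<Longrightarrow> \<bar>ip (U n) \<phi> - l \<phi>\<bar> \<le> e / 2"
        using LIMSEQ_D[OF l[OF \<phi>], of "e / 2"] by (auto intro: less_imp_le)
      have "norm (ip (v n) \<phi> - l \<phi>) < e" if "n \<ge> N" for n
        using tail_controls_close[OF v \<phi>, of n "e / 2"] N that e by simp
      then show "\<exists>N. \<forall>n\<ge>N. norm (ip (v n) \<phi> - l \<phi>) < e" by blast
    qed
  qed
  then show ?thesis by (rule that[OF u(1)])
qed

lemma feasible_limit:
  assumes UY: "\<And>n. feasible (U n) (Y n)" and y: "C0dom y" and lim: "uniform_limit UNIV Y y sequentially"
  obtains u where "feasible u y"
proof -
  define l where "l \<phi> = (LBINT x. (0 * \<phi> x - lap \<phi> x) * y x) + (LBINT x. \<phi> x * (y x) ^ 3)" for \<phi>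
  note Y = feasible_C0dom[OF UY]
  have l: "(\<lambda>n. ip (U n) \<phi>) \<longlonglongrightarrow> l \<phi>" if \<phi>: "test_fun \<Omega> \<phi>" for \<phi>
  proof -
    note w = test_fun_helmholtz[OF \<phi>, of 0]
    have int: "integrable lborel (\<lambda>x. \<psi> x * z x)" if "test_fun \<Omega> \<psi>" "C0dom z" for \<psi> z
      using integrable_times_test_fun[OF C0dom_continuous[OF that(2)] that(1)] by (simp add: mult.commute)
    have "ip (U n) \<phi> = (LBINT x. (0 * \<phi> x - lap \<phi> x) * Y n x) + (LBINT x. \<phi> x * (Y n x) ^ 3)" for n
      using helmholtz_weak[OF dirichlet_helmholtz[OF feasible_state[OF UY, unfolded cubic_state_def]] \<phi>, of n]
        integrable_L2supp_test[OF admissible_L2supp[OF feasible_admissible[OF UY]] \<phi>, of n]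
            int[OF \<phi> C0dom_cube[OF Y], of n]
      by (simp add: L2_inner_def right_diff_distrib mult.commute)
    moreover have "(\<lambda>n. (LBINT x. (0 * \<phi> x - lap \<phi> x) * Y n x) + (LBINT x. \<phi> x * (Y n x) ^ 3)) \<longlonglongrightarrow> l \<phi>"
      unfolding l_def
      by (intro tendsto_add integral_uniform_limit lim C0dom_cube_uniform_limit y int w \<phi> C0dom_cube Y
          integrable_test_fun[OF w]
          integrable_test_fun[OF \<phi>])
    ultimately show ?thesis by simp
  qed
  obtain u where u: "admissible u" and u_eq: "\<And>\<phi>. test_fun \<Omega> \<phi> \<Longrightarrow> ip u \<phi> = l \<phi>"
    by (rule admissible_weak_limit[of U l, OF feasible_admissible[OF UY]]) (erule l, rule that)
  have "cubic_state u y" unfolding cubic_state_def dirichlet_def helmholtz_def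
  proof (intro conjI allI impI)
    fix \<phi> assume \<phi>: "test_fun \<Omega> \<phi>"
    note int = integrable_L2supp_test[OF admissible_L2supp[OF u] \<phi>] integrable_L2supp_test[OF
        C0dom_L2supp[OF C0dom_cube[OF y]] \<phi>]
    show "integrable lborel (\<lambda>x. (u x - y x ^ 3) * \<phi> x)" using int by (simp add: left_diff_distrib)
    show "(LBINT x. y x * (0 * \<phi> x - lap \<phi> x)) = (LBINT x. (u x - y x ^ 3) * \<phi> x)"
      using u_eq[OF \<phi>] int by (simp add: l_def L2_inner_def right_diff_distrib mult.commute)
  qed (use y in \<open>auto simp: C0dom_def\<close>)
  then show ?thesis using u that by (simp add: feasible_def)
qed

lemma minimising_sequence_limit:
  assumes UY: "\<And>n. feasible (U n) (Y n)" and q: "L2supp q"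
    and le: "\<And>n. sqnorm (\<lambda>x. Y n x - q x) \<le> c + 1 / real (Suc n)"
  obtains u y k where "feasible u y" "sqnorm (\<lambda>x. y x - q x) \<le> c" "(\<lambda>n. sqnorm (\<lambda>x. Y (k n) x - y x)) \<longlonglongrightarrow> 0"
proof -
  obtain k y where k: "strict_mono (k :: nat \<Rightarrow> nat)" and y: "C0dom y"
    and unif: "uniform_limit UNIV (\<lambda>n. Y (k n)) y sequentially"
    using states_uniform_limit[OF UY] .
  obtain u where u: "feasible u y" using feasible_limit[of "\<lambda>n. U (k n)" "\<lambda>n. Y (k n)", OF UY y unif] .
  have lim: "(\<lambda>n. sqnorm (\<lambda>x. Y (k n) x - y x)) \<longlonglongrightarrow> 0"
    by (rule L2supp_uniform_limit[OF feasible_L2supp[OF UY] feasible_L2supp[OF u] unif])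
  have "sqnorm (\<lambda>x. y x - q x) \<le> c + 0"
  proof (rule LIMSEQ_le)
    show "(\<lambda>n. sqnorm (\<lambda>x. Y (k n) x - q x)) \<longlonglongrightarrow> sqnorm (\<lambda>x. y x - q x)"
      by (rule sqnorm_diff_tendsto[OF feasible_L2supp[OF UY] feasible_L2supp[OF u] lim q])
    show "(\<lambda>n. c + 1 / real (Suc n)) \<longlonglongrightarrow> c + 0" by (intro tendsto_intros LIMSEQ_Suc lim_1_over_n)
    have "sqnorm (\<lambda>x. Y (k n) x - q x) \<le> c + 1 / real (Suc n)" for n
    proof -
      have "1 / real (Suc (k n)) \<le> 1 / real (Suc n)" using seq_suble[OF k, of n] by (simp add: frac_le)
      then show ?thesis using le[of "k n"] by linarith
    qed
    then show "\<exists>N. \<forall>n\<ge>N. sqnorm (\<lambda>x. Y (k n) x - q x) \<le> c + 1 / real (Suc n)" by blast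
  qed
  then show ?thesis using that[OF u _ lim] by simp
qed

lemma minimiser_exists:
  assumes q: "L2supp q"
  obtains u y where "feasible u y" "\<And>u' y'. feasible u' y' \<Longrightarrow> sqnorm (\<lambda>x. y x - q x) \<le> sqnorm (\<lambda>x. y' x - q x)"
proof -
  define V where "V = {sqnorm (\<lambda>x. y x - q x) | u y. feasible u y}"
  have V: "V \<noteq> {}" "bdd_below V" using feasible_ex by (auto simp: V_def intro!: bdd_belowI[of _ 0])
  have "\<exists>u y. feasible u y \<and> sqnorm (\<lambda>x. y x - q x) \<le> Inf V + 1 / real (Suc n)" for n
  proof -
    obtain a where "a \<in> V" "a < Inf V + 1 / real (Suc n)"
      using cInf_lessD[OF V(1), of "Inf V + 1 / real (Suc n)"] by auto
    then show ?thesis by (auto simp: V_def intro: less_imp_le)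
  qed
  then obtain U Y where UY: "\<And>n. feasible (U n) (Y n)"
    "\<And>n. sqnorm (\<lambda>x. Y n x - q x) \<le> Inf V + 1 / real (Suc n)" by metis
  obtain u y where uy: "feasible u y" "sqnorm (\<lambda>x. y x - q x) \<le> Inf V"
    by (rule minimising_sequence_limit[OF UY(1) q UY(2)])
  have "Inf V \<le> sqnorm (\<lambda>x. y' x - q x)" if "feasible u' y'" for u' y'
    by (rule cInf_lower[OF _ V(2)]) (use that in \<open>auto simp: V_def\<close>)
  then show ?thesis using that[OF uy(1)] uy(2) order_trans by blast
qed

end

context corkscrew_domain begin

lemma poisson_symmetric:
  assumes f: "L2supp f" and g: "L2supp g" and y: "dirichlet 0 f y" and z: "dirichlet 0 g z"
  shows "ip f z = ip g y"
proof -
  note L2 = f g dirichlet_L2supp[OF y] dirichlet_L2supp[OF z]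
  have "ip (\<lambda>x. f x + (1 - 0) * y x) z = ip (\<lambda>x. g x + (1 - 0) * z x) y"
    using L2supp_lincomb[OF L2(1,3), of 1 1] L2supp_lincomb[OF L2(2,4), of 1 1]
    by (intro dirichlet_symmetric[OF zero_less_one _ _ dirichlet_change_coefficient[OF y]
        dirichlet_change_coefficient[OF z]]) simp_all
  then show ?thesis
    using L2_inner_lincomb_right[OF L2(4,1,3)[THEN L2supp_square_integrable], of 1 1]
      L2_inner_lincomb_right[OF L2(3,2,4)[THEN L2supp_square_integrable], of 1 1]
    by (simp add: L2_inner_commute)
qed

(* A lower-order term of good sign does not affect the estimate of the sup norm by the L2 norm. *)
lemma poisson_L2_abs:
  assumes y: "dirichlet 0 g y" and h: "L2supp h" "\<And>x. 0 \<le> h x"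
    and le: "\<And>x. 0 < y x \<Longrightarrow> g x \<le> h x" "\<And>x. y x < 0 \<Longrightarrow> - h x \<le> g x"
  shows "\<bar>y x\<bar> \<le> green_L2_bound * sqrt (sqnorm h)"
proof -
  have "y x \<le> green_L2_bound * sqrt (sqnorm h)" by (rule dirichlet_L2_upper[OF y h le(1)])
  moreover have "- y x \<le> green_L2_bound * sqrt (sqnorm h)"
    by (rule dirichlet_L2_upper[OF dirichlet_uminus[OF y] h]) (use le(2) in force)
  ultimately show ?thesis by (simp add: abs_le_iff)
qed

lemma L2_small_imp_sup_small:
  assumes M: "M \<ge> 0" and s: "s > 0"
  obtains e where "e > 0" "\<And>g y x. dirichlet 0 g y \<Longrightarrow> (\<And>x. 0 < y x \<Longrightarrow> g x \<le> M) \<Longrightarrow> (\<And>x. y x < 0 \<Longrightarrow> - M \<le> g x) \<Longrightarrow>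
    sqnorm y \<le> e \<Longrightarrow> \<bar>y x\<bar> \<le> s"
proof -
  define \<mu> where "\<mu> = 2 * M / s + 1"
  have \<mu>: "\<mu> > 0" using M s by (simp add: \<mu>_def add_nonneg_pos)
  have "M \<le> s / 2 * \<mu>" using s by (simp add: \<mu>_def field_simps)
  then have M_le: "M / \<mu> \<le> s / 2" using \<mu> by (simp add: pos_divide_le_eq)
  define k where "k = \<mu> * resolvent_norm \<mu>"
  have k: "0 \<le> k" using \<mu> resolvent_norm_nonneg by (simp add: k_def)
  define t where "t = s / (2 * (k + 1))"
  have t: "t > 0" "(k + 1) * t = s / 2" using s k by (auto simp: t_def field_simps)
  have "\<bar>y x\<bar> \<le> s"
    if y: "dirichlet 0 g y" and le: "\<And>x. 0 < y x \<Longrightarrow> g x \<le> M" "\<And>x. y x < 0 \<Longrightarrow> - M \<le> g x" and n: "sqnorm y \<le> t\<^sup>2"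
      for g y x
  proof -
    have "sqrt (sqnorm y) \<le> t" using real_sqrt_le_mono[OF n] t by simp
    then have "k * sqrt (sqnorm y) \<le> k * t" using k by (rule mult_left_mono)
    then have small: "\<mu> * (resolvent_norm \<mu> * sqrt (sqnorm y)) \<le> s / 2" using t
      by (simp add: k_def algebra_simps)
    have "y x \<le> M / \<mu> + \<mu> * (resolvent_norm \<mu> * sqrt (sqnorm y))"
      by (rule dirichlet_interpolation[OF y \<mu> M le(1)])
    moreover have "- y x \<le> M / \<mu> + \<mu> * (resolvent_norm \<mu> * sqrt (sqnorm (\<lambda>x. - y x)))"
      by (rule dirichlet_interpolation[OF dirichlet_uminus[OF y] \<mu> M]) (use le(2) in force)
    then have "- y x \<le> M / \<mu> + \<mu> * (resolvent_norm \<mu> * sqrt (sqnorm y))" by (simp add: L2_sqnorm_def)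
    ultimately show ?thesis using M_le small unfolding abs_le_iff by linarith
  qed
  then show ?thesis using t by (intro that[of "t\<^sup>2"]) auto
qed

end

section \<open>Second-order condition, growth and stability\<close>

lemma quadratic_model_error_pointwise:
  fixes A P b d p s w :: real
  assumes s: "0 < s" "\<bar>w\<bar> \<le> s" and P: "\<bar>p\<bar> \<le> P" and A: "\<bar>1/2 - 3 * b * p\<bar> \<le> A"
  shows "\<bar>(1/2 * w\<^sup>2 - (3 * b * w\<^sup>2 + w ^ 3) * p) - 1/2 * ((1 - 6 * b * p) * (w - d)\<^sup>2)\<bar> \<le>
    (A + P) * s * w\<^sup>2 + A * (1 / s + 1) * d\<^sup>2"
proof -
  have nonneg: "0 \<le> A" "0 \<le> P" using A P by linarith+
  have "0 \<le> (s * w - d)\<^sup>2 / s" "0 \<le> (s * w + d)\<^sup>2 / s" using s by auto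
  moreover have "(s * w - d)\<^sup>2 / s = s * w\<^sup>2 - 2 * (d * w) + d\<^sup>2 / s"
    "(s * w + d)\<^sup>2 / s = s * w\<^sup>2 + 2 * (d * w) + d\<^sup>2 / s"
    using s by (simp_all add: power2_eq_square field_simps)
  ultimately have "\<bar>2 * (d * w)\<bar> \<le> s * w\<^sup>2 + d\<^sup>2 / s" by (simp add: abs_le_iff)
  then have mixed: "\<bar>2 * (d * w) - d\<^sup>2\<bar> \<le> s * w\<^sup>2 + d\<^sup>2 / s + d\<^sup>2"
    using abs_triangle_ineq4[of "2 * (d * w)" "d\<^sup>2"] by simp
  have "(1/2 * w\<^sup>2 - (3 * b * w\<^sup>2 + w ^ 3) * p) - 1/2 * ((1 - 6 * b * p) * (w - d)\<^sup>2) =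
      (1/2 - 3 * b * p) * (2 * (d * w) - d\<^sup>2) - p * (w * w\<^sup>2)"
    by (simp add: power2_eq_square power3_eq_cube algebra_simps)
  also have "\<bar>\<dots>\<bar> \<le> \<bar>1/2 - 3 * b * p\<bar> * \<bar>2 * (d * w) - d\<^sup>2\<bar> + \<bar>p\<bar> * (\<bar>w\<bar> * w\<^sup>2)"
    by (rule order_trans[OF abs_triangle_ineq4]) (simp add: abs_mult)
  also have "\<dots> \<le> A * (s * w\<^sup>2 + d\<^sup>2 / s + d\<^sup>2) + P * (s * w\<^sup>2)"
    by (intro add_mono mult_mono mixed) (use A P s nonneg in auto)
  also have "\<dots> = (A + P) * s * w\<^sup>2 + A * (1 / s + 1) * d\<^sup>2" by (simp add: algebra_simps)
  finally show ?thesis .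
qed

lemma square_damping_sign:
  fixes b t :: real
  shows "0 < t \<Longrightarrow> 0 \<le> 3 * b\<^sup>2 * t" and "t < 0 \<Longrightarrow> 3 * b\<^sup>2 * t \<le> 0"
  by (simp_all add: mult_nonneg_nonpos)

(* yd is the desired state; ub, yb and p are the optimal control, its state and its adjoint state. *)
locale optimal_control = control_problem +
  fixes yd ub yb p :: "'a \<Rightarrow> real"
  assumes yd: "L2supp yd" and optimal_feasible: "feasible ub yb"
    and adjoint_state: "dirichlet 0 (\<lambda>x. (yb x - yd x) - 3 * (yb x)\<^sup>2 * p x) p"
    and strictly_optimal: "\<And>u y. feasible u y \<Longrightarrow> \<not> (AE x in lborel. x \<in> \<Omega> \<longrightarrow> u x = ub x) \<Longrightarrow>
      sqnorm (\<lambda>x. yb x - yd x) < sqnorm (\<lambda>x. y x - yd x)"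
begin

definition linearised :: "('a \<Rightarrow> real) \<Rightarrow> ('a \<Rightarrow> real) \<Rightarrow> bool" where
  "linearised u z \<longleftrightarrow> dirichlet 0 (\<lambda>x. (u x - ub x) - 3 * (yb x)\<^sup>2 * z x) z"

definition excess :: "('a \<Rightarrow> real) \<Rightarrow> real" where
  "excess y = 1/2 * sqnorm (\<lambda>x. y x - yd x) - 1/2 * sqnorm (\<lambda>x. yb x - yd x)"

definition quadratic_model :: "('a \<Rightarrow> real) \<Rightarrow> ('a \<Rightarrow> real) \<Rightarrow> real" where
  "quadratic_model u z = ip p (\<lambda>x. u x - ub x) + 1/2 * (LBINT x. (1 - 6 * yb x * p x) * (z x)\<^sup>2)"

definition remainder :: "('a \<Rightarrow> real) \<Rightarrow> 'a \<Rightarrow> real" where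
  "remainder y x = 3 * yb x * (y x - yb x)\<^sup>2 + (y x - yb x) ^ 3"

definition growth :: "real \<Rightarrow> bool" where
  "growth c \<longleftrightarrow> (\<forall>u y. feasible u y \<longrightarrow> c * sqnorm (\<lambda>x. y x - yb x) \<le> excess y)"

definition second_order :: "real \<Rightarrow> real \<Rightarrow> bool" where
  "second_order \<delta> c \<longleftrightarrow>
    (\<forall>u z. admissible u \<longrightarrow> linearised u z \<longrightarrow> sqrt (sqnorm z) \<le> \<delta> \<longrightarrow> c * sqnorm z \<le> quadratic_model u z)"

definition stable :: "real \<Rightarrow> bool" where
  "stable \<kappa> \<longleftrightarrow> (\<forall>\<eta> u y. L2supp \<eta> \<longrightarrow> feasible u y \<longrightarrow>
    (\<forall>u' y'. feasible u' y' \<longrightarrow> sqnorm (\<lambda>x. y x - (yd x + \<eta> x)) \<le> sqnorm (\<lambda>x. y' x - (yd x + \<eta> x))) \<longrightarrow>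
    sqrt (sqnorm (\<lambda>x. y x - yb x)) \<le> \<kappa> * sqrt (sqnorm \<eta>))"

lemmas optimal_admissible = feasible_admissible[OF optimal_feasible]
lemmas optimal_C0dom = feasible_C0dom[OF optimal_feasible]
lemmas optimal_L2supp = feasible_L2supp[OF optimal_feasible]
lemmas optimal_bound = feasible_bound[OF optimal_feasible]
lemmas adjoint_C0dom = dirichlet_C0dom[OF adjoint_state]

lemma linearised_C0dom: "linearised u z \<Longrightarrow> C0dom z" by (simp add: linearised_def dirichlet_C0dom)
lemma linearised_L2supp: "linearised u z \<Longrightarrow> L2supp z" by (intro C0dom_L2supp linearised_C0dom)

lemma linearised_ex: "admissible u \<Longrightarrow> \<exists>z. linearised u z"
  unfolding linearised_def
  by (intro linearised_exists optimal_C0dom L2supp_diff admissible_L2supp optimal_admissible)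

lemma control_difference_L2supp: "admissible u \<Longrightarrow> L2supp (\<lambda>x. u x - ub x)"
  by (intro L2supp_diff admissible_L2supp optimal_admissible)

lemma deviation_C0dom: "feasible u y \<Longrightarrow> C0dom (\<lambda>x. y x - yb x)"
  by (intro C0dom_diff feasible_C0dom[of u] optimal_C0dom)

lemma deviation_L2supp: "feasible u y \<Longrightarrow> L2supp (\<lambda>x. y x - yb x)"
  by (intro C0dom_L2supp deviation_C0dom)

lemma deviation_dirichlet:
  assumes "feasible u y" shows "dirichlet 0 (\<lambda>x. (u x - y x ^ 3) - (ub x - yb x ^ 3)) (\<lambda>x. y x - yb x)"
  by (intro dirichlet_diff feasible_state[OF assms, unfolded cubic_state_def]
      feasible_state[OF optimal_feasible, unfolded cubic_state_def])

lemma linearisation_error_dirichlet: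
  assumes u: "feasible u y" and z: "linearised u z"
  shows "dirichlet 0 (\<lambda>x. 3 * (yb x)\<^sup>2 * z x - (y x ^ 3 - yb x ^ 3)) (\<lambda>x. (y x - yb x) - z x)"
  using dirichlet_diff[OF deviation_dirichlet[OF u] z[unfolded linearised_def]] by (simp add: algebra_simps)

lemma optimal_unique:
  assumes u: "feasible u y" and le: "sqnorm (\<lambda>x. y x - yd x) \<le> sqnorm (\<lambda>x. yb x - yd x)"
  shows "y = yb"
proof -
  have "AE x in lborel. x \<in> \<Omega> \<longrightarrow> u x = ub x" using strictly_optimal[OF u] le by force
  then have "cubic_state ub y"
    by (rule cubic_state_cong_AE[OF feasible_state[OF u] admissible_L2supp[OF feasible_admissible[OF u]]
        admissible_L2supp[OF optimal_admissible]])
  then show ?thesis by (rule cubic_state_unique[OF _ feasible_state[OF optimal_feasible]])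
qed

lemma excess_nonneg: assumes "feasible u y" shows "0 \<le> excess y"
proof (cases "sqnorm (\<lambda>x. y x - yd x) \<le> sqnorm (\<lambda>x. yb x - yd x)")
  case True
  then show ?thesis using optimal_unique[OF assms] by (simp add: excess_def)
qed (simp add: excess_def)

lemma excess_gap:
  assumes e: "e > 0"
  obtains m where "m > 0" "\<And>u y. feasible u y \<Longrightarrow> e \<le> sqnorm (\<lambda>x. y x - yb x) \<Longrightarrow> m \<le> excess y"
proof (rule ccontr)
  assume neg: "\<not> thesis"
  have "\<exists>u y. feasible u y \<and> e \<le> sqnorm (\<lambda>x. y x - yb x) \<and> excess y < 1/2 * (1 / real (Suc n))" for n
    using that[of "1/2 * (1 / real (Suc n))"] neg by force
  then obtain U Y where UY: "\<And>n. feasible (U n) (Y n)" and far: "\<And>n. e \<le> sqnorm (\<lambda>x. Y n x - yb x)"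
    and small: "\<And>n. excess (Y n) < 1/2 * (1 / real (Suc n))" by metis
  have le: "sqnorm (\<lambda>x. Y n x - yd x) \<le> sqnorm (\<lambda>x. yb x - yd x) + 1 / real (Suc n)" for n
    using small[of n] unfolding excess_def by linarith
  obtain u y k where u: "feasible u y" "sqnorm (\<lambda>x. y x - yd x) \<le> sqnorm (\<lambda>x. yb x - yd x)"
    and lim: "(\<lambda>n. sqnorm (\<lambda>x. Y (k n) x - y x)) \<longlonglongrightarrow> 0"
    by (rule minimising_sequence_limit[OF UY yd le])
  have "e \<le> 0" by (rule LIMSEQ_le_const[OF lim]) (use far optimal_unique[OF u] in auto)
  then show False using e by simp
qed

lemma remainder_C0dom: assumes "feasible u y" shows "C0dom (remainder y)"
  using deviation_C0dom[OF assms] C0dom_continuous[OF optimal_C0dom]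
  by (auto simp: C0dom_def remainder_def intro!: continuous_intros)

lemma cube_deviation: "y x ^ 3 - yb x ^ 3 = 3 * (yb x)\<^sup>2 * (y x - yb x) + remainder y x"
  unfolding remainder_def by (simp add: power2_eq_square power3_eq_cube algebra_simps)

lemma remainder_le:
  assumes s: "\<bar>y x - yb x\<bar> \<le> s" "s \<le> 1"
  shows "\<bar>remainder y x\<bar> \<le> (3 * state_bound + 1) * s * \<bar>y x - yb x\<bar>"
proof -
  have "remainder y x = (3 * yb x + (y x - yb x)) * (y x - yb x) * (y x - yb x)"
    unfolding remainder_def by (simp add: power2_eq_square power3_eq_cube algebra_simps)
  then have "\<bar>remainder y x\<bar> = \<bar>3 * yb x + (y x - yb x)\<bar> * \<bar>y x - yb x\<bar> * \<bar>y x - yb x\<bar>"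
    by (simp add: abs_mult)
  also have "\<dots> \<le> (3 * state_bound + 1) * s * \<bar>y x - yb x\<bar>"
  proof (intro mult_mono)
    show "\<bar>3 * yb x + (y x - yb x)\<bar> \<le> 3 * state_bound + 1" using optimal_bound[of x] s by linarith
  qed (use s state_bound_nonneg in auto)
  finally show ?thesis .
qed

lemma remainder_L2:
  assumes u: "feasible u y" and s: "\<And>x. \<bar>y x - yb x\<bar> \<le> s" "s \<le> 1"
  shows "sqnorm (remainder y) \<le> ((3 * state_bound + 1) * s)\<^sup>2 * sqnorm (\<lambda>x. y x - yb x)"
proof -
  have "sqnorm (remainder y) \<le> (LBINT x. ((3 * state_bound + 1) * s)\<^sup>2 * (y x - yb x)\<^sup>2)"
  proof (rule square_integrable_bound(2))
    show "remainder y \<in> borel_measurable lborel"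
      using L2supp_measurable[OF C0dom_L2supp[OF remainder_C0dom[OF u]]] by simp
    show "(remainder y x)\<^sup>2 \<le> ((3 * state_bound + 1) * s)\<^sup>2 * (y x - yb x)\<^sup>2" for x
      using power_mono[OF remainder_le[of y x, OF s] abs_ge_zero, of 2] by (simp add: power_mult_distrib)
  qed (intro integrable_mult_right square_integrable_square L2supp_square_integrable deviation_L2supp[OF u])
  then show ?thesis by (simp add: L2_sqnorm_def)
qed

(* The adjoint equation, tested against the deviation of the states, eliminates the term linear in y - yb. *)
lemma excess_expansion:
  assumes u: "feasible u y"
  shows "excess y = 1/2 * sqnorm (\<lambda>x. y x - yb x) + ip p (\<lambda>x. u x - ub x) - ip (remainder y) p"
proof -
  define w where "w x = y x - yb x" for x
  define v where "v x = u x - ub x" for x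
  define r where "r x = yb x - yd x" for x
  define N where "N f x = 3 * (yb x)\<^sup>2 * f x" for f :: "'a \<Rightarrow> real" and x
  have N: "C0dom (N f)" if "C0dom f" for f
    unfolding N_def[abs_def] by (intro C0dom_mult that continuous_intros C0dom_continuous optimal_C0dom)
  have wC: "C0dom w" unfolding w_def by (rule deviation_C0dom[OF u])
  note L2 = wC[THEN C0dom_L2supp] N[OF wC, THEN C0dom_L2supp] N[OF adjoint_C0dom, THEN C0dom_L2supp]
    adjoint_C0dom[THEN C0dom_L2supp] remainder_C0dom[OF u, THEN C0dom_L2supp]
  have v: "L2supp v" and r: "L2supp r" unfolding v_def r_def
    by (rule control_difference_L2supp[OF feasible_admissible[OF u]]) (intro L2supp_diff optimal_L2supp yd)
  have source: "(v x - N w x) - remainder y x = (u x - y x ^ 3) - (ub x - yb x ^ 3)" for x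
    using cube_deviation[of y x] by (simp add: v_def w_def N_def)
  have "dirichlet 0 (\<lambda>x. r x - N p x) p" using adjoint_state by (simp add: r_def N_def)
  moreover have "dirichlet 0 (\<lambda>x. (v x - N w x) - remainder y x) w"
    unfolding source using deviation_dirichlet[OF u] by (simp add: w_def[abs_def])
  ultimately have "ip (\<lambda>x. (v x - N w x) - remainder y x) p = ip (\<lambda>x. r x - N p x) w"
    using L2 v r by (intro poisson_symmetric L2supp_diff)
  moreover have "ip (N w) p = ip (N p) w" unfolding L2_inner_def N_def by (simp add: ac_simps)
  ultimately have first_order: "ip r w = ip v p - ip (remainder y) p"
    using L2 v r by (simp add: L2_inner_diff_left L2supp_square_integrable L2supp_diff)
  have "sqnorm (\<lambda>x. 1 * w x + 1 * r x) = sqnorm w + 2 * ip w r + sqnorm r"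
    by (subst L2_sqnorm_lincomb) (simp_all add: L2(1) r L2supp_square_integrable)
  then have "excess y = 1/2 * sqnorm w + ip r w"
    by (simp add: excess_def w_def r_def[abs_def] L2_inner_commute add_divide_distrib)
  then show ?thesis unfolding first_order using L2_inner_commute[of lborel v p]
    by (simp add: w_def[abs_def] v_def[abs_def])
qed

definition linearisation_const :: real where
  "linearisation_const = green_L2_bound\<^sup>2 * (3 * state_bound + 1)\<^sup>2 * vol"

lemma linearisation_const_nonneg: "0 \<le> linearisation_const" using vol_nonneg
  by (simp add: linearisation_const_def)

lemma linearisation_error_L2:
  assumes u: "feasible u y" and z: "linearised u z" and s: "\<And>x. \<bar>y x - yb x\<bar> \<le> s" "s \<le> 1"
  shows "sqnorm (\<lambda>x. (y x - yb x) - z x) \<le> linearisation_const * s\<^sup>2 * sqnorm (\<lambda>x. y x - yb x)"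
proof -
  define d where "d x = (y x - yb x) - z x" for x
  note R = C0dom_L2supp[OF remainder_C0dom[OF u]]
  have d: "dirichlet 0 (\<lambda>x. - remainder y x - 3 * (yb x)\<^sup>2 * d x) d"
    using linearisation_error_dirichlet[OF u z] cube_deviation[of y]
    by (simp add: d_def[abs_def] algebra_simps)
  have "\<bar>d x\<bar> \<le> green_L2_bound * sqrt (sqnorm (\<lambda>x. \<bar>remainder y x\<bar>))" for x
  proof (rule poisson_L2_abs[OF d L2supp_abs[OF R]])
    show "- remainder y x - 3 * (yb x)\<^sup>2 * d x \<le> \<bar>remainder y x\<bar>" if "0 < d x" for x
      using square_damping_sign(1)[OF that, of "yb x"] by linarith
    show "- \<bar>remainder y x\<bar> \<le> - remainder y x - 3 * (yb x)\<^sup>2 * d x" if "d x < 0" for x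
      using square_damping_sign(2)[OF that, of "yb x"] by linarith
  qed simp
  then have "sqnorm d \<le> (green_L2_bound * sqrt (sqnorm (remainder y)))\<^sup>2 * vol"
    by (intro L2supp_bounded L2supp_measurable[OF dirichlet_L2supp[OF d]] dirichlet_outside[OF d])
        (simp_all add: L2_sqnorm_def)
  then have "sqnorm d \<le> green_L2_bound\<^sup>2 * vol * sqnorm (remainder y)"
    by (simp add: power_mult_distrib ac_simps)
  also have "\<dots> \<le> green_L2_bound\<^sup>2 * vol * (((3 * state_bound + 1) * s)\<^sup>2 * sqnorm (\<lambda>x. y x - yb x))"
    by (intro mult_left_mono remainder_L2[OF u s]) (simp add: vol_nonneg)
  finally show ?thesis unfolding d_def linearisation_const_def by (simp add: power_mult_distrib ac_simps)
qed

lemma deviation_comparable: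
  obtains s where "s > 0" "\<And>u y z. feasible u y \<Longrightarrow> linearised u z \<Longrightarrow> (\<And>x. \<bar>y x - yb x\<bar> \<le> s) \<Longrightarrow>
    sqnorm (\<lambda>x. y x - yb x) \<le> 4 * sqnorm z \<and> sqnorm z \<le> 4 * sqnorm (\<lambda>x. y x - yb x)"
proof -
  define s where "s = 1 / (2 * linearisation_const + 2)"
  have s: "0 < s" "s \<le> 1" "linearisation_const * s \<le> 1/2" "s \<le> 1/2"
    using linearisation_const_nonneg by (auto simp: s_def field_simps)
  then have "(linearisation_const * s) * s \<le> 1/2 * (1/2)" by (intro mult_mono) auto
  then have small: "linearisation_const * s\<^sup>2 \<le> 1/4" by (simp add: power2_eq_square mult.assoc)
  have "sqnorm (\<lambda>x. y x - yb x) \<le> 4 * sqnorm z \<and> sqnorm z \<le> 4 * sqnorm (\<lambda>x. y x - yb x)"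
    if u: "feasible u y" and z: "linearised u z" and w: "\<And>x. \<bar>y x - yb x\<bar> \<le> s" for u y z
  proof -
    define w where "w x = y x - yb x" for x
    define d where "d x = w x - z x" for x
    have L2: "L2supp w" "L2supp z" "L2supp d" unfolding d_def w_def
      by (intro L2supp_diff[OF deviation_L2supp[OF u]] deviation_L2supp[OF u] linearised_L2supp[OF z])+
    have "sqnorm d \<le> linearisation_const * s\<^sup>2 * sqnorm w"
      unfolding d_def w_def by (rule linearisation_error_L2[OF u z w s(2)])
    also have "\<dots> \<le> 1/4 * sqnorm w" by (rule mult_right_mono[OF small]) simp
    finally have "sqnorm d \<le> 1/4 * sqnorm w" .
    moreover have "sqnorm w \<le> 2 * sqnorm z + 2 * sqnorm d" "sqnorm z \<le> 2 * sqnorm w + 2 * sqnorm d"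
      using L2_sqnorm_sum_le[OF L2(2,3)[THEN L2supp_square_integrable]]
        L2_sqnorm_sum_le[OF L2(1)[THEN L2supp_square_integrable] L2supp_square_integrable[OF
            L2supp_uminus[OF L2(3)]]]
      by (simp_all add: d_def L2_sqnorm_def power2_commute)
    ultimately show ?thesis unfolding w_def[abs_def] using L2_sqnorm_nonneg[of lborel w] by linarith
  qed
  then show ?thesis using that[OF s(1)] by blast
qed

definition model_error :: "('a \<Rightarrow> real) \<Rightarrow> ('a \<Rightarrow> real) \<Rightarrow> 'a \<Rightarrow> real" where
  "model_error y z x = (1/2 * (y x - yb x)\<^sup>2 - remainder y x * p x) - 1/2 * ((1 - 6 * yb x * p x) * (z x)\<^sup>2)"

lemma
  assumes u: "feasible u y" and z: "linearised u z"
  shows model_error_integrable: "integrable lborel (model_error y z)"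
    and excess_minus_model: "excess y - quadratic_model u z = (LBINT x. model_error y z x)"
proof -
  have "C0dom (\<lambda>x. 1/2 * ((1 - 6 * yb x * p x) * (z x)\<^sup>2))"
    using linearised_C0dom[OF z] C0dom_continuous[OF optimal_C0dom] C0dom_continuous[OF adjoint_C0dom]
    by (auto simp: C0dom_def intro!: continuous_intros)
  then have model: "integrable lborel (\<lambda>x. 1/2 * ((1 - 6 * yb x * p x) * (z x)\<^sup>2))"
    by (intro L2supp_integrable C0dom_L2supp)
  have square: "integrable lborel (\<lambda>x. 1/2 * (y x - yb x)\<^sup>2)"
    using square_integrable_square[OF L2supp_square_integrable[OF deviation_L2supp[OF u]]] by simp
  have cubic: "integrable lborel (\<lambda>x. remainder y x * p x)"
    by (intro L2supp_product_integrable C0dom_L2supp remainder_C0dom[OF u] adjoint_C0dom)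
  show "integrable lborel (model_error y z)"
    unfolding model_error_def[abs_def] by (intro bochner_integrable_diff square cubic model)
  show "excess y - quadratic_model u z = (LBINT x. model_error y z x)"
    unfolding excess_expansion[OF u] quadratic_model_def model_error_def
    using square cubic model by (simp add: L2_sqnorm_def L2_inner_def)
qed

lemma adjoint_bounds:
  obtains P A where "0 \<le> P" "0 \<le> A" "\<And>x. \<bar>p x\<bar> \<le> P" "\<And>x. \<bar>1/2 - 3 * yb x * p x\<bar> \<le> A"
proof -
  have "C0dom (\<lambda>x. (3 * yb x) * p x)"
    by (intro C0dom_mult adjoint_C0dom continuous_intros C0dom_continuous optimal_C0dom)
  then obtain P B where P: "\<And>x. \<bar>p x\<bar> \<le> P" and B: "\<And>x. \<bar>3 * yb x * p x\<bar> \<le> B"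
    using C0dom_bounded[OF adjoint_C0dom] C0dom_bounded by (force simp: bounded_iff)
  have "\<bar>1/2 - 3 * yb x * p x\<bar> \<le> 1/2 + B" for x using B[of x] by linarith
  moreover have "0 \<le> P" "0 \<le> 1/2 + B" using order_trans[OF abs_ge_zero P] order_trans[OF abs_ge_zero B]
    by simp_all
  ultimately show ?thesis using that P by blast
qed

lemma excess_model_error:
  obtains E where "E \<ge> 0" "\<And>u y z s. feasible u y \<Longrightarrow> linearised u z \<Longrightarrow> 0 < s \<Longrightarrow> s \<le> 1 \<Longrightarrow> (\<And>x. \<bar>y x - yb x\<bar> \<le> s) \<Longrightarrow>
    \<bar>excess y - quadratic_model u z\<bar> \<le> E * s * sqnorm (\<lambda>x. y x - yb x)"
proof -
  obtain P A where P0: "0 \<le> P" and A0: "0 \<le> A" and P: "\<And>x. \<bar>p x\<bar> \<le> P" and A: "\<And>x. \<bar>1/2 - 3 * yb x * p x\<bar> \<le> A"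
    using adjoint_bounds by blast
  define D where "D = linearisation_const"
  have D0: "0 \<le> D" by (simp add: D_def linearisation_const_nonneg)
  have "\<bar>excess y - quadratic_model u z\<bar> \<le> (A + P + 2 * A * D) * s * sqnorm (\<lambda>x. y x - yb x)"
    if u: "feasible u y" and z: "linearised u z" and s: "0 < s" "s \<le> 1" and w: "\<And>x. \<bar>y x - yb x\<bar> \<le> s"
      for u y z s
  proof -
    define w where "w x = y x - yb x" for x
    define d where "d x = w x - z x" for x
    have L2: "L2supp w" "L2supp d" unfolding d_def w_def
      by (intro L2supp_diff[OF deviation_L2supp[OF u]] deviation_L2supp[OF u] linearised_L2supp[OF z])+
    note sq = L2[THEN L2supp_square_integrable, THEN square_integrable_square]
    have "\<bar>excess y - quadratic_model u z\<bar> \<le> (LBINT x. (A + P) * s * (w x)\<^sup>2 + A * (1 / s + 1) * (d x)\<^sup>2)"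
      unfolding excess_minus_model[OF u z]
    proof (rule order_trans[OF integral_abs_bound integral_mono])
      show "integrable lborel (\<lambda>x. \<bar>model_error y z x\<bar>)"
        by (intro integrable_abs model_error_integrable[OF u z])
      show "\<bar>model_error y z x\<bar> \<le> (A + P) * s * (w x)\<^sup>2 + A * (1 / s + 1) * (d x)\<^sup>2" for x
        using quadratic_model_error_pointwise[OF s(1) w[of x] P[of x] A[of x], of "d x"]
        by (simp add: model_error_def w_def d_def remainder_def)
    qed (use sq in simp)
    also have "\<dots> = (A + P) * s * sqnorm w + A * (1 / s + 1) * sqnorm d" using sq by (simp add: L2_sqnorm_def)
    also have "\<dots> \<le> (A + P) * s * sqnorm w + A * (1 / s + 1) * (D * s\<^sup>2 * sqnorm w)"
      using linearisation_error_L2[OF u z w s(2)] A0 s unfolding d_def w_def D_def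
      by (intro add_left_mono mult_left_mono) auto
    also have "\<dots> = ((A + P) * s + A * D * (s + s * s)) * sqnorm w" using s
      by (simp add: power2_eq_square field_simps)
    also have "\<dots> \<le> ((A + P) * s + A * D * (s + s)) * sqnorm w"
      using s A0 D0 by (intro mult_right_mono add_left_mono mult_left_mono) (auto simp: mult_left_le)
    finally show ?thesis by (simp add: w_def[abs_def] algebra_simps)
  qed
  moreover have "0 \<le> A + P + 2 * A * D" using A0 P0 D0 by simp
  ultimately show ?thesis using that by blast
qed

lemma second_order_expansion:
  assumes \<epsilon>: "\<epsilon> > 0"
  obtains s where "s > 0" "\<And>u y z. feasible u y \<Longrightarrow> linearised u z \<Longrightarrow> (\<And>x. \<bar>y x - yb x\<bar> \<le> s) \<Longrightarrow>
    \<bar>excess y - quadratic_model u z\<bar> \<le> \<epsilon> * sqnorm (\<lambda>x. y x - yb x)"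
proof -
  obtain E where E: "E \<ge> 0" "\<And>u y z s. feasible u y \<Longrightarrow> linearised u z \<Longrightarrow> 0 < s \<Longrightarrow> s \<le> 1 \<Longrightarrow>
      (\<And>x. \<bar>y x - yb x\<bar> \<le> s) \<Longrightarrow>
      \<bar>excess y - quadratic_model u z\<bar> \<le> E * s * sqnorm (\<lambda>x. y x - yb x)" using excess_model_error by blast
  define s where "s = min 1 (\<epsilon> / (E + 1))"
  have s: "0 < s" "s \<le> 1" using \<epsilon> E(1) by (auto simp: s_def)
  have "E * s \<le> (E + 1) * (\<epsilon> / (E + 1))" using E(1) s(1) by (intro mult_mono) (auto simp: s_def)
  then have Es: "E * s \<le> \<epsilon>" using E(1) by simp
  show ?thesis
  proof (rule that[OF s(1)])
    fix u y z assume "feasible u y" "linearised u z" "\<And>x. \<bar>y x - yb x\<bar> \<le> s"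
    then have "\<bar>excess y - quadratic_model u z\<bar> \<le> E * s * sqnorm (\<lambda>x. y x - yb x)" using E(2) s by blast
    also have "\<dots> \<le> \<epsilon> * sqnorm (\<lambda>x. y x - yb x)" by (rule mult_right_mono[OF Es]) simp
    finally show "\<bar>excess y - quadratic_model u z\<bar> \<le> \<epsilon> * sqnorm (\<lambda>x. y x - yb x)" .
  qed
qed

lemma control_difference_le: "admissible u \<Longrightarrow> \<bar>u x - ub x\<bar> \<le> 2 * control_bound"
  using admissible_bound[of u x] admissible_bound[OF optimal_admissible, of x] by linarith

lemma deviation_sup_small:
  assumes s: "s > 0"
  obtains e where "e > 0" "\<And>u y x. feasible u y \<Longrightarrow> sqnorm (\<lambda>x. y x - yb x) \<le> e \<Longrightarrow> \<bar>y x - yb x\<bar> \<le> s"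
proof -
  have M: "0 \<le> 2 * control_bound" using control_bound_nonneg by simp
  obtain e where e: "e > 0" "\<And>g y x. dirichlet 0 g y \<Longrightarrow> (\<And>x. 0 < y x \<Longrightarrow> g x \<le> 2 * control_bound) \<Longrightarrow>
      (\<And>x. y x < 0 \<Longrightarrow> - (2 * control_bound) \<le> g x) \<Longrightarrow> sqnorm y \<le> e \<Longrightarrow> \<bar>y x\<bar> \<le> s"
    using L2_small_imp_sup_small[OF M s] by blast
  have "\<bar>y x - yb x\<bar> \<le> s" if u: "feasible u y" and small: "sqnorm (\<lambda>x. y x - yb x) \<le> e" for u y x
  proof (rule e(2)[OF deviation_dirichlet[OF u] _ _ small])
    note le = control_difference_le[OF feasible_admissible[OF u]]
    show "(u x - y x ^ 3) - (ub x - yb x ^ 3) \<le> 2 * control_bound" if "0 < y x - yb x" for x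
      using power_mono_odd[of 3 "yb x" "y x"] that le[of x] by simp
    show "- (2 * control_bound) \<le> (u x - y x ^ 3) - (ub x - yb x ^ 3)" if "y x - yb x < 0" for x
      using power_mono_odd[of 3 "y x" "yb x"] that le[of x] by simp
  qed
  then show ?thesis by (rule that[OF e(1)])
qed

lemma linearised_sup_small:
  assumes s: "s > 0"
  obtains e where "e > 0" "\<And>u z x. admissible u \<Longrightarrow> linearised u z \<Longrightarrow> sqnorm z \<le> e \<Longrightarrow> \<bar>z x\<bar> \<le> s"
proof -
  have M: "0 \<le> 2 * control_bound" using control_bound_nonneg by simp
  obtain e where e: "e > 0" "\<And>g y x. dirichlet 0 g y \<Longrightarrow> (\<And>x. 0 < y x \<Longrightarrow> g x \<le> 2 * control_bound) \<Longrightarrow>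
      (\<And>x. y x < 0 \<Longrightarrow> - (2 * control_bound) \<le> g x) \<Longrightarrow> sqnorm y \<le> e \<Longrightarrow> \<bar>y x\<bar> \<le> s"
    using L2_small_imp_sup_small[OF M s] by blast
  have "\<bar>z x\<bar> \<le> s" if u: "admissible u" and z: "linearised u z" and small: "sqnorm z \<le> e" for u z x
  proof (rule e(2)[OF z[unfolded linearised_def] _ _ small])
    show "(u x - ub x) - 3 * (yb x)\<^sup>2 * z x \<le> 2 * control_bound" if "0 < z x" for x
      using square_damping_sign(1)[OF that, of "yb x"] control_difference_le[OF u, of x] by linarith
    show "- (2 * control_bound) \<le> (u x - ub x) - 3 * (yb x)\<^sup>2 * z x" if "z x < 0" for x
      using square_damping_sign(2)[OF that, of "yb x"] control_difference_le[OF u, of x] by linarith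
  qed
  then show ?thesis by (rule that[OF e(1)])
qed

lemma deviation_le_linearised:
  assumes u: "feasible u y" and z: "linearised u z" and t: "\<And>x. \<bar>z x\<bar> \<le> t"
  shows "\<bar>y x - yb x\<bar> \<le> (6 * state_bound\<^sup>2 * green_bound + 1) * t"
proof -
  define a where "a x = (y x)\<^sup>2 + yb x * y x + (yb x)\<^sup>2" for x
  define F where "F = 6 * state_bound\<^sup>2 * t"
  have t0: "0 \<le> t" by (rule order_trans[OF abs_ge_zero t])
  have a0: "0 \<le> a x" for x unfolding a_def by (rule cube_factor_nonneg)
  have "a x \<le> 3 * state_bound\<^sup>2" for x unfolding a_def
    by (intro cube_factor_le optimal_bound feasible_bound[OF u])
  moreover have "(yb x)\<^sup>2 \<le> state_bound\<^sup>2" for x using power_mono[OF optimal_bound[of x] abs_ge_zero, of 2]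
    by simp
  ultimately have "\<bar>3 * (yb x)\<^sup>2 - a x\<bar> \<le> 6 * state_bound\<^sup>2" for x
    using a0[of x] zero_le_power2[of "yb x"] unfolding abs_le_iff by (smt (verit))
  then have F: "\<bar>(3 * (yb x)\<^sup>2 - a x) * z x\<bar> \<le> F" for x unfolding abs_mult F_def by (intro mult_mono t) auto
  have source: "3 * (yb x)\<^sup>2 * z x - (y x ^ 3 - yb x ^ 3) =
      (3 * (yb x)\<^sup>2 - a x) * z x - a x * ((y x - yb x) - z x)" for x
    unfolding cube_diff a_def by (simp add: algebra_simps)
  have "\<bar>(y x - yb x) - z x\<bar> \<le> F * green_bound"
  proof (rule dirichlet_abs_upper[OF linearisation_error_dirichlet[OF u z]])
    show "0 \<le> F" using t0 by (simp add: F_def)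
    show "3 * (yb x)\<^sup>2 * z x - (y x ^ 3 - yb x ^ 3) \<le> F" if "0 < (y x - yb x) - z x" for x
      unfolding source using F[of x] mult_nonneg_nonneg[OF a0[of x] less_imp_le[OF that]] unfolding abs_le_iff
      by linarith
    show "- F \<le> 3 * (yb x)\<^sup>2 * z x - (y x ^ 3 - yb x ^ 3)" if "(y x - yb x) - z x < 0" for x
      unfolding source using F[of x] mult_nonneg_nonpos[OF a0[of x] less_imp_le[OF that]] unfolding abs_le_iff
      by linarith
  qed
  then have "\<bar>y x - yb x\<bar> \<le> F * green_bound + t" using t[of x] by linarith
  then show ?thesis by (simp add: F_def algebra_simps)
qed

lemma linearised_small_imp_deviation_sup_small:
  assumes s: "s > 0"
  obtains e where "e > 0" "\<And>u y z x. feasible u y \<Longrightarrow> linearised u z \<Longrightarrow> sqnorm z \<le> e \<Longrightarrow> \<bar>y x - yb x\<bar> \<le> s"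
proof -
  define C where "C = 6 * state_bound\<^sup>2 * green_bound + 1"
  have C: "C > 0" using green_bound_nonneg by (simp add: C_def add_nonneg_pos)
  then have "s / C > 0" using s by simp
  then obtain e where e: "e > 0" "\<And>u z x. admissible u \<Longrightarrow> linearised u z \<Longrightarrow> sqnorm z \<le> e \<Longrightarrow> \<bar>z x\<bar> \<le> s / C"
    using linearised_sup_small by blast
  have "\<bar>y x - yb x\<bar> \<le> s" if u: "feasible u y" and z: "linearised u z" and small: "sqnorm z \<le> e" for u y z x
    using deviation_le_linearised[OF u z e(2)[OF feasible_admissible[OF u] z small]] C
    by (simp add: C_def[symmetric])
  then show ?thesis by (rule that[OF e(1)])
qed

lemma growth_imp_second_order:
  assumes c: "c > 0" and growth: "growth c"
  obtains \<delta> where "\<delta> > 0" "second_order \<delta> (c / 8)"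
proof -
  obtain s where s: "s > 0" and expansion: "\<And>u y z. feasible u y \<Longrightarrow> linearised u z \<Longrightarrow> (\<And>x. \<bar>y x - yb x\<bar> \<le> s) \<Longrightarrow>
      \<bar>excess y - quadratic_model u z\<bar> \<le> c / 2 * sqnorm (\<lambda>x. y x - yb x)"
    using second_order_expansion[of "c / 2"] c by auto
  obtain t where t: "t > 0" and comparable: "\<And>u y z. feasible u y \<Longrightarrow> linearised u z \<Longrightarrow> (\<And>x. \<bar>y x - yb x\<bar> \<le> t) \<Longrightarrow>
      sqnorm (\<lambda>x. y x - yb x) \<le> 4 * sqnorm z \<and> sqnorm z \<le> 4 * sqnorm (\<lambda>x. y x - yb x)"
    using deviation_comparable by blast
  have "min s t > 0" using s t by simp
  then obtain e where e: "e > 0"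
    and small: "\<And>u y z x. feasible u y \<Longrightarrow> linearised u z \<Longrightarrow> sqnorm z \<le> e \<Longrightarrow> \<bar>y x - yb x\<bar> \<le> min s t"
    using linearised_small_imp_deviation_sup_small by blast
  have "c / 8 * sqnorm z \<le> quadratic_model u z"
    if u: "admissible u" and z: "linearised u z" and n: "sqrt (sqnorm z) \<le> sqrt e" for u z
  proof -
    obtain y where y: "feasible u y" using feasible_exists[OF u] .
    have w: "\<bar>y x - yb x\<bar> \<le> s" "\<bar>y x - yb x\<bar> \<le> t" for x using small[OF y z, of x] n by auto
    have "c * sqnorm (\<lambda>x. y x - yb x) \<le> excess y" using growth y by (simp add: growth_def)
    then have "c / 2 * sqnorm (\<lambda>x. y x - yb x) \<le> quadratic_model u z"
      using expansion[OF y z w(1)] by linarith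
    moreover have "c / 8 * sqnorm z \<le> c / 8 * (4 * sqnorm (\<lambda>x. y x - yb x))"
      using comparable[OF y z w(2)] c by (intro mult_left_mono) auto
    ultimately show ?thesis by simp
  qed
  then show ?thesis using e by (intro that[of "sqrt e"]) (simp_all add: second_order_def)
qed

lemma second_order_imp_local_growth:
  assumes \<delta>: "\<delta> > 0" and c: "c > 0" and second_order: "second_order \<delta> c"
  obtains e where "e > 0" "\<And>u y. feasible u y \<Longrightarrow> sqnorm (\<lambda>x. y x - yb x) \<le> e \<Longrightarrow>
      c / 8 * sqnorm (\<lambda>x. y x - yb x) \<le> excess y"
proof -
  obtain s where s: "s > 0" and expansion: "\<And>u y z. feasible u y \<Longrightarrow> linearised u z \<Longrightarrow> (\<And>x. \<bar>y x - yb x\<bar> \<le> s) \<Longrightarrow>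
      \<bar>excess y - quadratic_model u z\<bar> \<le> c / 8 * sqnorm (\<lambda>x. y x - yb x)"
    using second_order_expansion[of "c / 8"] c by auto
  obtain t where t: "t > 0" and comparable: "\<And>u y z. feasible u y \<Longrightarrow> linearised u z \<Longrightarrow> (\<And>x. \<bar>y x - yb x\<bar> \<le> t) \<Longrightarrow>
      sqnorm (\<lambda>x. y x - yb x) \<le> 4 * sqnorm z \<and> sqnorm z \<le> 4 * sqnorm (\<lambda>x. y x - yb x)"
    using deviation_comparable by blast
  have "min s t > 0" using s t by simp
  then obtain e where e: "e > 0" and small: "\<And>u y x. feasible u y \<Longrightarrow> sqnorm (\<lambda>x. y x - yb x) \<le> e \<Longrightarrow>
      \<bar>y x - yb x\<bar> \<le> min s t"
    using deviation_sup_small by blast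
  have "c / 8 * sqnorm (\<lambda>x. y x - yb x) \<le> excess y"
    if u: "feasible u y" and n: "sqnorm (\<lambda>x. y x - yb x) \<le> min e (\<delta>\<^sup>2 / 4)" for u y
  proof -
    obtain z where z: "linearised u z" using linearised_ex[OF feasible_admissible[OF u]] by blast
    have w: "\<bar>y x - yb x\<bar> \<le> s" "\<bar>y x - yb x\<bar> \<le> t" for x using small[OF u, of x] n by auto
    note comparable = comparable[OF u z w(2)]
    have "sqnorm z \<le> \<delta>\<^sup>2" using comparable n by auto
    then have "sqrt (sqnorm z) \<le> \<delta>" using real_sqrt_le_mono[of "sqnorm z" "\<delta>\<^sup>2"] \<delta> by simp
    then have "c * sqnorm z \<le> quadratic_model u z"
      using second_order z feasible_admissible[OF u] by (simp add: second_order_def)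
    moreover have "c / 4 * sqnorm (\<lambda>x. y x - yb x) \<le> c / 4 * (4 * sqnorm z)" using comparable c
      by (intro mult_left_mono) auto
    ultimately show ?thesis using expansion[OF u z w(1)] by linarith
  qed
  then show ?thesis using e \<delta> by (intro that[of "min e (\<delta>\<^sup>2 / 4)"]) auto
qed

lemma growth_away_from_optimum:
  assumes e: "e > 0"
  obtains k where "k > 0" "\<And>u y. feasible u y \<Longrightarrow> e \<le> sqnorm (\<lambda>x. y x - yb x) \<Longrightarrow> k * sqnorm (\<lambda>x. y x - yb x) \<le>
      excess y"
proof -
  obtain m where m: "m > 0" "\<And>u y. feasible u y \<Longrightarrow> e \<le> sqnorm (\<lambda>x. y x - yb x) \<Longrightarrow> m \<le> excess y"
    using excess_gap[OF e] by blast
  define W where "W = (2 * state_bound)\<^sup>2 * vol + 1"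
  have W: "W > 0" using vol_nonneg by (simp add: W_def add_nonneg_pos)
  have "m / W * sqnorm (\<lambda>x. y x - yb x) \<le> excess y" if u: "feasible u y"
    and far: "e \<le> sqnorm (\<lambda>x. y x - yb x)" for u y
  proof -
    have "\<bar>y x - yb x\<bar> \<le> 2 * state_bound" for x using feasible_bound[OF u, of x] optimal_bound[of x]
      by linarith
    then have "sqnorm (\<lambda>x. y x - yb x) \<le> (2 * state_bound)\<^sup>2 * vol"
      using deviation_L2supp[OF u] L2supp_measurable L2supp_outside by (intro L2supp_bounded) blast+
    then have "m / W * sqnorm (\<lambda>x. y x - yb x) \<le> m / W * W" using m(1) W
      by (intro mult_left_mono) (auto simp: W_def)
    also have "\<dots> \<le> excess y" using m(2)[OF u far] W by simp
    finally show ?thesis .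
  qed
  then show ?thesis using m(1) W by (intro that[of "m / W"]) auto
qed

lemma second_order_imp_growth:
  assumes \<delta>: "\<delta> > 0" and c: "c > 0" and second_order: "second_order \<delta> c"
  obtains k where "k > 0" "growth k"
proof -
  obtain e where e: "e > 0"
    and near: "\<And>u y. feasible u y \<Longrightarrow> sqnorm (\<lambda>x. y x - yb x) \<le> e \<Longrightarrow> c / 8 * sqnorm (\<lambda>x. y x - yb x) \<le> excess y"
    using second_order_imp_local_growth[OF \<delta> c second_order] by blast
  obtain k where k: "k > 0"
    and far: "\<And>u y. feasible u y \<Longrightarrow> e \<le> sqnorm (\<lambda>x. y x - yb x) \<Longrightarrow> k * sqnorm (\<lambda>x. y x - yb x) \<le> excess y"
    using growth_away_from_optimum[OF e] by blast
  have "min (c / 8) k * sqnorm (\<lambda>x. y x - yb x) \<le> excess y" if u: "feasible u y" for u y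
  proof (cases "sqnorm (\<lambda>x. y x - yb x) \<le> e")
    case True
    have "min (c / 8) k * sqnorm (\<lambda>x. y x - yb x) \<le> c / 8 * sqnorm (\<lambda>x. y x - yb x)"
      by (rule mult_right_mono) auto
    then show ?thesis using near[OF u True] by linarith
  next
    case False
    have "min (c / 8) k * sqnorm (\<lambda>x. y x - yb x) \<le> k * sqnorm (\<lambda>x. y x - yb x)"
      by (rule mult_right_mono) auto
    then show ?thesis using far[OF u] False by linarith
  qed
  then show ?thesis using c k by (intro that[of "min (c / 8) k"]) (auto simp: growth_def)
qed

lemma perturbed_expansion:
  assumes y: "L2supp y" and y': "L2supp y'" and \<eta>: "L2supp \<eta>"
  shows "sqnorm (\<lambda>x. y x - (yd x + \<eta> x)) - sqnorm (\<lambda>x. y' x - (yd x + \<eta> x)) =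
    2 * excess y - 2 * excess y' - 2 * ip (\<lambda>x. y x - y' x) \<eta>"
proof -
  have "sqnorm (\<lambda>x. q x - (yd x + \<eta> x)) = sqnorm (\<lambda>x. q x - yd x) - 2 * (ip q \<eta> - ip yd \<eta>) + sqnorm \<eta>"
    if "L2supp q" for q
  proof -
    have "sqnorm (\<lambda>x. (q x - yd x) - \<eta> x) = sqnorm (\<lambda>x. q x - yd x) - 2 * ip (\<lambda>x. q x - yd x) \<eta> + sqnorm \<eta>"
      by (intro L2_sqnorm_diff L2supp_square_integrable L2supp_diff that yd \<eta>)
    then show ?thesis by (simp add: diff_diff_eq L2_inner_diff_left L2supp_square_integrable that yd \<eta>)
  qed
  then show ?thesis by (simp add: excess_def L2_inner_diff_left L2supp_square_integrable y y' \<eta>)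
qed

lemma growth_imp_stable:
  assumes c: "c > 0" and growth: "growth c" shows "stable (1 / c)"
  unfolding stable_def
proof (intro allI impI)
  fix \<eta> u y assume \<eta>: "L2supp \<eta>" and u: "feasible u y"
    and min: "\<forall>u' y'. feasible u' y' \<longrightarrow> sqnorm (\<lambda>x. y x - (yd x + \<eta> x)) \<le> sqnorm (\<lambda>x. y' x - (yd x + \<eta> x))"
  define r where "r = sqrt (sqnorm (\<lambda>x. y x - yb x))"
  have r: "0 \<le> r" "r * r = sqnorm (\<lambda>x. y x - yb x)" by (simp_all add: r_def)
  have "sqnorm (\<lambda>x. y x - (yd x + \<eta> x)) \<le> sqnorm (\<lambda>x. yb x - (yd x + \<eta> x))" using min optimal_feasible
    by blast
  then have "excess y \<le> ip (\<lambda>x. y x - yb x) \<eta>"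
    using perturbed_expansion[OF feasible_L2supp[OF u] optimal_L2supp \<eta>] by (simp add: excess_def)
  also have "\<dots> \<le> r * sqrt (sqnorm \<eta>)"
    unfolding r_def using Cauchy_Schwarz_L2[OF deviation_L2supp[OF u, THEN L2supp_square_integrable]
        L2supp_square_integrable[OF \<eta>]]
    by (simp add: abs_le_iff)
  finally have "r * (c * r) \<le> r * sqrt (sqnorm \<eta>)" using growth u r(2)
    by (force simp: growth_def mult.left_commute)
  then have "r = 0 \<or> c * r \<le> sqrt (sqnorm \<eta>)" using r(1) by (auto simp: mult_le_cancel_left)
  then have "c * r \<le> sqrt (sqnorm \<eta>)" by auto
  then show "sqrt (sqnorm (\<lambda>x. y x - yb x)) \<le> 1 / c * sqrt (sqnorm \<eta>)"
    unfolding r_def[symmetric] using c by (simp add: field_simps)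
qed

(* Apply stability to the perturbation (y - yb) / (2 \<kappa>) and compare its minimiser with y. *)
lemma stable_imp_growth:
  assumes \<kappa>: "\<kappa> > 0" and stable: "stable \<kappa>" shows "growth (1 / (4 * \<kappa>))"
  unfolding growth_def
proof (intro allI impI)
  fix u y assume u: "feasible u y"
  define t where "t = 1 / (2 * \<kappa>)"
  define w where "w x = y x - yb x" for x
  define \<eta> where "\<eta> x = t * w x" for x
  have t: "t > 0" "\<kappa> * t = 1/2" using \<kappa> by (simp_all add: t_def)
  have w: "L2supp w" unfolding w_def by (rule deviation_L2supp[OF u])
  have \<eta>: "L2supp \<eta>" using L2supp_lincomb[OF w w, of t 0] by (simp add: \<eta>_def[abs_def])
  have "L2supp (\<lambda>x. yd x + \<eta> x)" using L2supp_lincomb[OF yd \<eta>, of 1 1] by simp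
  then obtain v q where v: "feasible v q"
    and min: "\<And>u' y'. feasible u' y' \<Longrightarrow> sqnorm (\<lambda>x. q x - (yd x + \<eta> x)) \<le> sqnorm (\<lambda>x. y' x - (yd x + \<eta> x))"
    using minimiser_exists by blast
  define h where "h x = q x - yb x" for x
  have h: "L2supp h" unfolding h_def by (rule deviation_L2supp[OF v])
  have "sqrt (sqnorm h) \<le> \<kappa> * sqrt (sqnorm \<eta>)" using stable \<eta> v min unfolding stable_def h_def by blast
  also have "\<dots> = (\<kappa> * t) * sqrt (sqnorm w)" using t(1)
    by (simp add: \<eta>_def[abs_def] L2_sqnorm_cmult real_sqrt_mult)
  finally have "sqrt (sqnorm h) * sqrt (sqnorm w) \<le> (1/2 * sqrt (sqnorm w)) * sqrt (sqnorm w)"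
    unfolding t(2) by (rule mult_right_mono) simp
  then have "ip h w \<le> 1/2 * sqnorm w"
    using Cauchy_Schwarz_L2[OF h[THEN L2supp_square_integrable] w[THEN L2supp_square_integrable]]
    by (simp add: abs_le_iff)
  then have "t * (ip h w - sqnorm w) \<le> t * (- (1/2 * sqnorm w))" using t(1) by (intro mult_left_mono) auto
  moreover have "ip (\<lambda>x. q x - y x) \<eta> = t * (ip h w - sqnorm w)"
  proof -
    have "ip \<eta> (\<lambda>x. h x - w x) = t * (ip w h - sqnorm w)"
      by (simp add: \<eta>_def[abs_def] L2_inner_cmult L2_inner_diff_right h w L2supp_square_integrable
          L2_inner_self)
    then show ?thesis by (simp add: h_def w_def L2_inner_commute)
  qed
  moreover have "excess q - ip (\<lambda>x. q x - y x) \<eta> \<le> excess y"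
    using perturbed_expansion[OF feasible_L2supp[OF v] feasible_L2supp[OF u] \<eta>] min[OF u] by simp
  moreover have "t * (- (1/2 * sqnorm w)) = - (1 / (4 * \<kappa>) * sqnorm w)" by (simp add: t_def)
  ultimately have "1 / (4 * \<kappa>) * sqnorm w \<le> excess y" using excess_nonneg[OF v] by linarith
  then show "1 / (4 * \<kappa>) * sqnorm (\<lambda>x. y x - yb x) \<le> excess y" unfolding w_def .
qed

theorem second_order_iff_stable: "(\<exists>\<delta>>0. \<exists>c>0. second_order \<delta> c) \<longleftrightarrow> (\<exists>\<kappa>>0. stable \<kappa>)"
proof
  assume "\<exists>\<delta>>0. \<exists>c>0. second_order \<delta> c"
  then obtain k where "k > 0" "growth k" using second_order_imp_growth by blast
  then show "\<exists>\<kappa>>0. stable \<kappa>" using growth_imp_stable by (intro exI[of _ "1 / k"]) simp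
next
  assume "\<exists>\<kappa>>0. stable \<kappa>"
  then obtain \<kappa> where \<kappa>: "\<kappa> > 0" "stable \<kappa>" by blast
  define c where "c = 1 / (4 * \<kappa>)"
  have c: "c > 0" "growth c" using \<kappa> stable_imp_growth by (simp_all add: c_def)
  obtain \<delta> where "\<delta> > 0" "second_order \<delta> (c / 8)" using growth_imp_second_order[OF c] .
  then show "\<exists>\<delta>>0. \<exists>c>0. second_order \<delta> c" using c(1) by (intro exI[of _ \<delta>] exI[of _ "c / 8"] conjI) auto
qed

end

section \<open>Almost everywhere representatives\<close>

context corkscrew_domain begin

lemma Jfun_eq:
  assumes u: "represented_by u u'" and y: "cubic_state u' y" and q: "represented_by q q'"
  shows "Jfun \<Omega> q u = 1/2 * sqnorm (\<lambda>x. y x - q' x)"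
  unfolding Jfun_def state_eqI[OF u y]
  by (simp add: represented_by_square[OF
      represented_by_diff[OF represented_by_self[OF cubic_state_L2supp[OF y]] q]])

end

context control_problem begin

lemma Uad_represented_by: assumes "u \<in> Uad \<Omega> \<alpha> \<beta>" obtains u' where "admissible u'" "represented_by u u'"
proof -
  obtain g where g: "g \<in> borel_measurable lborel" "AE x in lborel. u x = g x"
    using completion_ex_borel_measurable_real[of u lborel] assms by (auto simp: Uad_def)
  define u' where "u' x = (if x \<in> \<Omega> then max \<alpha> (min \<beta> (g x)) else 0)" for x
  have u': "admissible u'" unfolding u'_def by (rule clamp_admissible) (use g(1) in simp)
  have "AE x in lborel. x \<in> \<Omega> \<longrightarrow> u x \<in> {\<alpha>..\<beta>}" using assms by (simp add: Uad_def AE_completion_iff)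
  then have "AE x in lborel. x \<in> \<Omega> \<longrightarrow> u x = u' x" using g(2) by eventually_elim (auto simp: u'_def)
  then have "represented_by u u'" using admissible_L2supp[OF u'] by (simp add: represented_by_def)
  with u' show ?thesis by (rule that)
qed

lemma admissible_Uad: assumes u: "admissible u" shows "u \<in> Uad \<Omega> \<alpha> \<beta>"
proof -
  have meas: "u \<in> borel_measurable borel" using u by (simp add: admissible_def)
  then have "u \<in> borel_measurable lebesgue" by (intro measurable_completion) simp
  moreover have "set_integrable lebesgue \<Omega> u"
    by (rule set_integrable_lebesgue_dom[THEN iffD2, OF meas])
      (use u L2supp_integrable[OF admissible_L2supp[OF u]] in \<open>auto simp: admissible_def\<close>)
  ultimately show ?thesis using u by (auto simp: Uad_def admissible_def)
qed

lemma optimal_control_exists: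
  assumes q: "represented_by q yd" and ubar: "represented_by ubar ub" and ub: "feasible ub yb"
    and strict_min: "\<forall>u\<in>Uad \<Omega> \<alpha> \<beta>. \<not> (AE x in lebesgue. x \<in> \<Omega> \<longrightarrow> u x = ubar x) \<longrightarrow> Jfun \<Omega> q ubar < Jfun \<Omega> q u"
  obtains p where "optimal_control \<Omega> \<alpha> \<beta> yd ub yb p"
proof -
  have "L2supp (\<lambda>x. yb x - yd x)" by (intro L2supp_diff feasible_L2supp[OF ub] represented_by_L2supp[OF q])
  then obtain p where p: "dirichlet 0 (\<lambda>x. (yb x - yd x) - 3 * (yb x)\<^sup>2 * p x) p"
    using linearised_exists[OF feasible_C0dom[OF ub]] by blast
  have "optimal_control \<Omega> \<alpha> \<beta> yd ub yb p"
  proof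
    fix u y assume u: "feasible u y" and neq: "\<not> (AE x in lborel. x \<in> \<Omega> \<longrightarrow> u x = ub x)"
    have "AE x in lborel. x \<in> \<Omega> \<longrightarrow> u x = ub x" if "AE x in lborel. x \<in> \<Omega> \<longrightarrow> u x = ubar x"
      using that ubar unfolding represented_by_def by (auto elim: eventually_elim2)
    then have "Jfun \<Omega> q ubar < Jfun \<Omega> q u"
      using neq strict_min admissible_Uad[OF feasible_admissible[OF u]] by (auto simp: AE_completion_iff)
    then show "sqnorm (\<lambda>x. yb x - yd x) < sqnorm (\<lambda>x. y x - yd x)"
      using Jfun_eq[OF ubar feasible_state[OF ub] q]
        Jfun_eq[OF represented_by_self[OF admissible_L2supp[OF feasible_admissible[OF u]]]
            feasible_state[OF u] q] by simp
  qed (use represented_by_L2supp[OF q] ub p in auto)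
  then show ?thesis by (rule that)
qed

end

context optimal_control begin

lemmas optimal_state = feasible_state[OF optimal_feasible]

lemma admissible_represented_by: "admissible u \<Longrightarrow> represented_by u u"
  by (intro represented_by_self admissible_L2supp)

lemma lin_state_eq:
  assumes ubar: "represented_by ubar ub" and u: "represented_by u u'" and z: "linearised u' z"
  shows "lin_state \<Omega> ubar (\<lambda>x. u x - ubar x) = z"
  unfolding lin_state_def state_eqI[OF ubar optimal_state]
  by (rule linearised_sol_eqI[OF optimal_C0dom represented_by_diff[OF u ubar] z[unfolded linearised_def]])

lemma adjoint_eq:
  assumes ubar: "represented_by ubar ub" and q: "represented_by q yd"
  shows "adjoint \<Omega> q ubar = p"
  unfolding adjoint_def state_eqI[OF ubar optimal_state]
  by (rule linearised_sol_eqI[OF optimal_C0dom represented_by_diff[OF represented_by_self[OF optimal_L2supp]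
      q] adjoint_state])

lemma L2norm_lin_state:
  assumes "represented_by ubar ub" "represented_by u u'" "linearised u' z"
  shows "L2norm \<Omega> (lin_state \<Omega> ubar (\<lambda>x. u x - ubar x)) = sqrt (sqnorm z)"
  unfolding lin_state_eq[OF assms]
  by (rule represented_by_L2norm[OF represented_by_self[OF linearised_L2supp[OF assms(3)]]])

lemma L2norm_state_difference:
  assumes ubar: "represented_by ubar ub" and u: "represented_by u u'" and y: "feasible u' y"
  shows "L2norm \<Omega> (\<lambda>x. state \<Omega> u x - state \<Omega> ubar x) = sqrt (sqnorm (\<lambda>x. y x - yb x))"
  unfolding state_eqI[OF ubar optimal_state] state_eqI[OF u feasible_state[OF y]]
  by (rule represented_by_L2norm[OF represented_by_self[OF deviation_L2supp[OF y]]])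

lemma quadratic_model_eq:
  assumes ubar: "represented_by ubar ub" and q: "represented_by q yd" and u: "represented_by u u'"
    and z: "linearised u' z"
  shows "J1 \<Omega> q ubar (\<lambda>x. u x - ubar x) + 1/2 * J2 \<Omega> q ubar (\<lambda>x. u x - ubar x) = quadratic_model u' z"
proof -
  note cont = C0dom_continuous[OF optimal_C0dom] C0dom_continuous[OF adjoint_C0dom]
      C0dom_continuous[OF linearised_C0dom[OF z]]
  have "(LINT x:\<Omega>|lebesgue. p x * (u x - ubar x)) = ip p (\<lambda>x. u' x - ub x)"
    using represented_by_integral_mult[OF represented_by_diff[OF u ubar] borel_measurable_UNIV[OF cont(2)]]
    by (simp add: L2_inner_def mult.commute)
  moreover have "(LINT x:\<Omega>|lebesgue. (1 - 6 * yb x * p x) * (z x)\<^sup>2) =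
      (LBINT x. (1 - 6 * yb x * p x) * (z x)\<^sup>2)"
  proof (rule lebesgue_integral_dom)
    show "(\<lambda>x. (1 - 6 * yb x * p x) * (z x)\<^sup>2) \<in> borel_measurable borel"
      by (intro borel_measurable_UNIV continuous_intros cont)
  qed (simp_all add: C0dom_outside[OF linearised_C0dom[OF z]])
  ultimately show ?thesis
    unfolding J1_def J2_def adjoint_eq[OF ubar q] lin_state_eq[OF ubar u z] state_eqI[OF ubar optimal_state]
        quadratic_model_def by simp
qed

lemma perturbed_Jfun_eq:
  assumes q: "represented_by q yd" and \<eta>: "represented_by \<eta> \<eta>'" and u: "represented_by u u'"
    and y: "feasible u' y"
  shows "Jfun \<Omega> (\<lambda>x. q x + \<eta> x) u = 1/2 * sqnorm (\<lambda>x. y x - (yd x + \<eta>' x))"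
  using Jfun_eq[OF u feasible_state[OF y] represented_by_lincomb[OF q \<eta>, of 1 1]] by simp

lemma second_order_condition_iff:
  assumes ubar: "represented_by ubar ub" and q: "represented_by q yd"
  shows "(\<forall>u\<in>Uad \<Omega> \<alpha> \<beta>. L2norm \<Omega> (lin_state \<Omega> ubar (\<lambda>x. u x - ubar x)) \<le> \<delta> \<longrightarrow>
      J1 \<Omega> q ubar (\<lambda>x. u x - ubar x) + 1/2 * J2 \<Omega> q ubar (\<lambda>x. u x - ubar x)
        \<ge> c * (L2norm \<Omega> (lin_state \<Omega> ubar (\<lambda>x. u x - ubar x)))\<^sup>2) \<longleftrightarrow> second_order \<delta> c"
    (is "(\<forall>u\<in>_. ?condition u) \<longleftrightarrow> _")
proof -
  have iff: "?condition u \<longleftrightarrow> (sqrt (sqnorm z) \<le> \<delta> \<longrightarrow> c * sqnorm z \<le> quadratic_model u' z)"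
    if u: "represented_by u u'" and z: "linearised u' z" for u u' z
    unfolding L2norm_lin_state[OF ubar u z] quadratic_model_eq[OF ubar q u z] by simp
  show ?thesis
  proof
    assume "\<forall>u\<in>Uad \<Omega> \<alpha> \<beta>. ?condition u"
    then show "second_order \<delta> c"
      unfolding second_order_def using iff[OF admissible_represented_by] admissible_Uad by blast
  next
    assume second_order: "second_order \<delta> c"
    show "\<forall>u\<in>Uad \<Omega> \<alpha> \<beta>. ?condition u"
    proof
      fix u assume "u \<in> Uad \<Omega> \<alpha> \<beta>"
      then obtain u' where u': "admissible u'" "represented_by u u'" by (rule Uad_represented_by)
      obtain z where z: "linearised u' z" using linearised_ex[OF u'(1)] by blast
      show "?condition u" unfolding iff[OF u'(2) z] using second_order u'(1) z by (simp add: second_order_def)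
    qed
  qed
qed

lemma perturbed_minimiser_iff:
  assumes q: "represented_by q yd" and \<eta>: "represented_by \<eta> \<eta>'" and u: "represented_by u u'"
    and y: "feasible u' y"
  shows "(\<forall>w\<in>Uad \<Omega> \<alpha> \<beta>. Jfun \<Omega> (\<lambda>x. q x + \<eta> x) u \<le> Jfun \<Omega> (\<lambda>x. q x + \<eta> x) w) \<longleftrightarrow>
    (\<forall>w z. feasible w z \<longrightarrow> sqnorm (\<lambda>x. y x - (yd x + \<eta>' x)) \<le> sqnorm (\<lambda>x. z x - (yd x + \<eta>' x)))"
    (is "?minimiser \<longleftrightarrow> ?closest")
proof
  assume min: ?minimiser
  show ?closest
  proof (intro allI impI)
    fix w z assume w: "feasible w z"
    note adm = feasible_admissible[OF w]
    show "sqnorm (\<lambda>x. y x - (yd x + \<eta>' x)) \<le> sqnorm (\<lambda>x. z x - (yd x + \<eta>' x))"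
      using min[rule_format, OF admissible_Uad[OF adm]]
      unfolding perturbed_Jfun_eq[OF q \<eta> u y] perturbed_Jfun_eq[OF q \<eta> admissible_represented_by[OF adm] w]
      by simp
  qed
next
  assume closest: ?closest
  show ?minimiser
  proof
    fix w assume "w \<in> Uad \<Omega> \<alpha> \<beta>"
    then obtain w' where w': "admissible w'" "represented_by w w'" by (rule Uad_represented_by)
    obtain z where z: "feasible w' z" using feasible_exists[OF w'(1)] .
    show "Jfun \<Omega> (\<lambda>x. q x + \<eta> x) u \<le> Jfun \<Omega> (\<lambda>x. q x + \<eta> x) w"
      unfolding perturbed_Jfun_eq[OF q \<eta> u y] perturbed_Jfun_eq[OF q \<eta> w'(2) z] using closest z by simp
  qed
qed

lemma stability_iff:
  assumes ubar: "represented_by ubar ub" and q: "represented_by q yd"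
  shows "(\<forall>\<eta>. L2fun \<Omega> \<eta> \<longrightarrow> (\<forall>u\<eta>\<in>Uad \<Omega> \<alpha> \<beta>.
      (\<forall>u\<in>Uad \<Omega> \<alpha> \<beta>. Jfun \<Omega> (\<lambda>x. q x + \<eta> x) u\<eta> \<le> Jfun \<Omega> (\<lambda>x. q x + \<eta> x) u) \<longrightarrow>
      L2norm \<Omega> (\<lambda>x. state \<Omega> u\<eta> x - state \<Omega> ubar x) \<le> \<kappa> * L2norm \<Omega> \<eta>)) \<longleftrightarrow> stable \<kappa>"
    (is "(\<forall>\<eta>. _ \<longrightarrow> (\<forall>u\<in>_. ?condition \<eta> u)) \<longleftrightarrow> _")
proof -
  have iff: "?condition \<eta> u \<longleftrightarrow>
      ((\<forall>w z. feasible w z \<longrightarrow> sqnorm (\<lambda>x. y x - (yd x + \<eta>' x)) \<le> sqnorm (\<lambda>x. z x - (yd x + \<eta>' x))) \<longrightarrow>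
        sqrt (sqnorm (\<lambda>x. y x - yb x)) \<le> \<kappa> * sqrt (sqnorm \<eta>'))"
    if "represented_by \<eta> \<eta>'" "represented_by u u'" "feasible u' y" for \<eta> \<eta>' u u' y
    unfolding perturbed_minimiser_iff[OF q that] L2norm_state_difference[OF ubar that(2,3)]
        represented_by_L2norm[OF that(1)] ..
  show ?thesis
  proof
    assume "\<forall>\<eta>. L2fun \<Omega> \<eta> \<longrightarrow> (\<forall>u\<in>Uad \<Omega> \<alpha> \<beta>. ?condition \<eta> u)"
    then show "stable \<kappa>" unfolding stable_def
      using iff[OF represented_by_self admissible_represented_by[OF feasible_admissible]]
        L2supp_imp_L2fun admissible_Uad[OF feasible_admissible] by blast
  next
    assume stable: "stable \<kappa>"
    show "\<forall>\<eta>. L2fun \<Omega> \<eta> \<longrightarrow> (\<forall>u\<in>Uad \<Omega> \<alpha> \<beta>. ?condition \<eta> u)"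
    proof (rule allI, rule impI, rule ballI)
      fix \<eta> u assume "L2fun \<Omega> \<eta>" "u \<in> Uad \<Omega> \<alpha> \<beta>"
      then obtain \<eta>' u' where \<eta>': "represented_by \<eta> \<eta>'" and u': "admissible u'" "represented_by u u'"
        using L2fun_represented_by Uad_represented_by by metis
      obtain y where y: "feasible u' y" using feasible_exists[OF u'(1)] .
      show "?condition \<eta> u" unfolding iff[OF \<eta>' u'(2) y] using stable represented_by_L2supp[OF \<eta>'] y
        by (simp add: stable_def)
    qed
  qed
qed

end

theorem theorem5p3:
  fixes \<Omega> :: "'a::euclidean_space set" and \<alpha> \<beta> :: real and yd ubar :: "'a \<Rightarrow> real"
  assumes dim: "DIM('a) \<in> {2, 3}"
    and dom: "lipschitz_domain \<Omega>"
    and ab: "\<alpha> < \<beta>"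
    and yd: "L2fun \<Omega> yd"
    and ubar: "ubar \<in> Uad \<Omega> \<alpha> \<beta>"
    and strict_min: "\<forall>u\<in>Uad \<Omega> \<alpha> \<beta>. \<not> (AE x in lebesgue. x \<in> \<Omega> \<longrightarrow> u x = ubar x) \<longrightarrow>
                        Jfun \<Omega> yd ubar < Jfun \<Omega> yd u"
  shows "(\<exists>\<delta>>0. \<exists>c>0. \<forall>u\<in>Uad \<Omega> \<alpha> \<beta>.
            L2norm \<Omega> (lin_state \<Omega> ubar (\<lambda>x. u x - ubar x)) \<le> \<delta> \<longrightarrow>
            J1 \<Omega> yd ubar (\<lambda>x. u x - ubar x) + 1/2 * J2 \<Omega> yd ubar (\<lambda>x. u x - ubar x)
              \<ge> c * (L2norm \<Omega> (lin_state \<Omega> ubar (\<lambda>x. u x - ubar x)))\<^sup>2)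
         \<longleftrightarrow>
         (\<exists>\<kappa>>0. \<forall>\<eta>. L2fun \<Omega> \<eta> \<longrightarrow>
            (\<forall>u\<eta>\<in>Uad \<Omega> \<alpha> \<beta>.
               (\<forall>u\<in>Uad \<Omega> \<alpha> \<beta>. Jfun \<Omega> (\<lambda>x. yd x + \<eta> x) u\<eta> \<le> Jfun \<Omega> (\<lambda>x. yd x + \<eta> x) u) \<longrightarrow>
               L2norm \<Omega> (\<lambda>x. state \<Omega> u\<eta> x - state \<Omega> ubar x) \<le> \<kappa> * L2norm \<Omega> \<eta>))"
proof -
  interpret control_problem \<Omega> \<alpha> \<beta>
  proof
    show "open \<Omega>" "bounded \<Omega>" using dom by (auto simp: lipschitz_domain_def)
  qed (use dim ab lipschitz_domain_corkscrew[OF dom] in auto)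
  obtain yd' where yd': "represented_by yd yd'" using L2fun_represented_by[OF yd] .
  obtain ub where ub: "admissible ub" "represented_by ubar ub" using Uad_represented_by[OF ubar] .
  obtain yb where yb: "feasible ub yb" using feasible_exists[OF ub(1)] .
  obtain p where "optimal_control \<Omega> \<alpha> \<beta> yd' ub yb p"
    using optimal_control_exists[OF yd' ub(2) yb strict_min] .
  then interpret optimal_control \<Omega> \<alpha> \<beta> yd' ub yb p .
  show ?thesis
    unfolding second_order_condition_iff[OF ub(2) yd'] stability_iff[OF ub(2) yd']
    by (rule second_order_iff_stable)
qed

end
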